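(* Let $\mathfrak n=T^3$. Then the cuspidal divisor group $\mathcal C(\mathfrak n)$ is contained in $J_0(\mathfrak n)(F)$ and equals the torsion subgroup $\mathcal T(\mathfrak n)=J_0(\mathfrak n)(F)_{\mathrm{tor}}$; moreover $\mathcal T(\mathfrak n)=\mathcal C(\mathfrak n)\cong\mathbb Z/q^2\mathbb Z$.
   Context: $q$ is a power of a prime $p$, $A=\mathbb F_q[T]$, $F=\mathbb F_q(T)$. $X_0(\mathfrak n)$ is the Drinfeld modular curve over $F$ for $\Gamma_0(\mathfrak n)=\{\begin{pmatrix}a&b\\c&d\end{pmatrix}\in\mathrm{GL}_2(A):c\in\mathfrak n\}$ (smooth projective model of the coarse moduli curve of rank-2 Drinfeld $A$-modules with $\mathfrak n$-cyclic subgroup), and $J_0(\mathfrak n)$ its Jacobian. The cusps of $X_0(\mathfrak n)$ correspond to $\Gamma_0(\mathfrak n)\backslash\mathbb P^1(F)$, and $\mathcal C(\mathfrak n)$ is the subgroup of $J_0(\mathfrak n)$ generated by the classes $[c]-[c']$ of differences of cusps. *)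

theory Defs
  imports
    "HOL-Algebra.Algebra"
    "HOL-Algebra.Algebraic_Closure_Type"
    "HOL-Algebra.Free_Abelian_Groups"
    "HOL-Library.Cardinality"
begin

section \<open>The ambient field\<close>

text \<open>
  The finite field is a type \<open>'q\<close>, so that \<open>q = CARD('q)\<close>, \<open>A = 'q poly\<close> and
  \<open>F = 'q poly fract\<close>. All fields below are subfields of an algebraic closure of the rational
  function field \<open>F(j)\<close> of the \<open>j\<close>-line.
\<close>

type_synonym 'q ratfun = "'q poly fract"
type_synonym 'q ambient = "'q ratfun poly fract alg_closure"

definition amb :: "'q::{finite,field} ambient ring" where
  "amb = ring_of_type_algebra"

definition of_F :: "'q::{finite,field} ratfun \<Rightarrow> 'q ambient" where
  "of_F f = to_ac (to_fract [:f:])"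

definition of_A :: "'q::{finite,field} poly \<Rightarrow> 'q ambient" where
  "of_A a = of_F (to_fract a)"

definition j_gen :: "'q::{finite,field} ambient" where
  "j_gen = to_ac (to_fract [:0, 1:])"

definition field_F :: "'q::{finite,field} ambient set" where
  "field_F = range of_F"

definition field_Fj :: "'q::{finite,field} ambient set" where
  "field_Fj = range to_ac"

text \<open>
  As the ambient field is algebraically closed, \<^const>\<open>rsquarefree\<close> says that the polynomial is
  separable. The field \<open>F\<close> is not perfect, so separable and algebraic closure differ.
\<close>

definition sep_closure :: "'q::{finite,field} ambient set \<Rightarrow> 'q ambient set" where
  "sep_closure k = {x. \<exists>p. (\<forall>i. Polynomial.coeff p i \<in> k) \<and> rsquarefree p \<and> Polynomial.poly p x = 0}"

definition auts :: "'q::{finite,field} ambient set \<Rightarrow> ('q ambient \<Rightarrow> 'q ambient) set" where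
  "auts k = {\<sigma> \<in> ring_iso amb amb. \<forall>x\<in>k. \<sigma> x = x}"


section \<open>Drinfeld modules with a cyclic subgroup\<close>

text \<open>
  The twisted polynomial ring over the ambient field is represented by \<open>q\<close>-polynomials
  \<open>\<Sum> c\<^sub>m X^(q^m)\<close> with composition as multiplication. The linear coefficient of the image
  of \<open>a\<close> is \<open>a\<close> itself, i.e. the characteristic is generic.
\<close>

definition drinfeld_module :: "nat \<Rightarrow> ('q::{finite,field} poly \<Rightarrow> 'q ambient poly) \<Rightarrow> bool" where
  "drinfeld_module r \<phi> \<longleftrightarrow>
     (\<forall>a i. Polynomial.coeff (\<phi> a) i \<noteq> 0 \<longrightarrow> (\<exists>m. i = CARD('q) ^ m)) \<and>
     (\<forall>c. \<phi> [:c:] = [:0, of_A [:c:]:]) \<and>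
     (\<forall>a b. \<phi> (a + b) = \<phi> a + \<phi> b) \<and>
     (\<forall>a b. \<phi> (a * b) = pcompose (\<phi> a) (\<phi> b)) \<and>
     (\<forall>a. Polynomial.coeff (\<phi> a) 1 = of_A a) \<and>
     (\<forall>a. a \<noteq> 0 \<longrightarrow> Polynomial.degree (\<phi> a) = CARD('q) ^ (r * Polynomial.degree a))"

text \<open>For \<open>\<phi>\<^sub>T = T X + g X^q + \<Delta> X^(q^2)\<close> the \<open>j\<close>-invariant is \<open>g^(q+1) / \<Delta>\<close>.\<close>

definition j_invariant :: "('q::{finite,field} poly \<Rightarrow> 'q ambient poly) \<Rightarrow> 'q ambient" where
  "j_invariant \<phi> =
     Polynomial.coeff (\<phi> [:0, 1:]) (CARD('q)) ^ (CARD('q) + 1) /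
     Polynomial.coeff (\<phi> [:0, 1:]) (CARD('q) ^ 2)"

text \<open>
  An \<open>A\<close>-submodule isomorphic to \<open>A/n\<close>: the submodule generated by a point with annihilator \<open>(n)\<close>.
\<close>

definition cyclic_subgroup ::
    "('q::{finite,field} poly \<Rightarrow> 'q ambient poly) \<Rightarrow> 'q poly \<Rightarrow> 'q ambient set \<Rightarrow> bool" where
  "cyclic_subgroup \<phi> n C \<longleftrightarrow>
     (\<exists>x. (\<forall>a. Polynomial.poly (\<phi> a) x = 0 \<longleftrightarrow> n dvd a) \<and> C = range (\<lambda>a. Polynomial.poly (\<phi> a) x))"

definition pair_iso ::
    "('q::{finite,field} poly \<Rightarrow> 'q ambient poly) \<Rightarrow> 'q ambient set \<Rightarrow>
     ('q poly \<Rightarrow> 'q ambient poly) \<Rightarrow> 'q ambient set \<Rightarrow> bool" where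
  "pair_iso \<phi> C \<psi> D \<longleftrightarrow>
     (\<exists>u. u \<noteq> 0 \<and> (\<forall>a. Polynomial.smult u (\<phi> a) = pcompose (\<psi> a) [:0, u:]) \<and> (\<lambda>x. u * x) ` C = D)"


section \<open>The modular curve\<close>

text \<open>
  A geometric generic point of the coarse moduli curve \<open>Y\<^sub>0(n)\<close>: as \<open>Y\<^sub>0(n)\<close> is finite over the
  \<open>j\<close>-line, this is a pair whose \<open>j\<close>-invariant is generic.
\<close>

definition generic_pair ::
    "'q::{finite,field} poly \<Rightarrow> ('q poly \<Rightarrow> 'q ambient poly) \<Rightarrow> 'q ambient set \<Rightarrow> bool" where
  "generic_pair n \<phi> C \<longleftrightarrow> drinfeld_module 2 \<phi> \<and> j_invariant \<phi> = j_gen \<and> cyclic_subgroup \<phi> n C"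

text \<open>
  The function field of \<open>X\<^sub>0(n)\<close> is the residue field of \<open>Y\<^sub>0(n)\<close> at its generic point. Since
  \<open>Y\<^sub>0(n)\<close> is generically etale over the \<open>j\<close>-line and its geometric points are the isomorphism
  classes of pairs, this is the field of moduli of a generic pair. The curve \<open>X\<^sub>0(n)\<close> is
  irreducible, i.e. generic pairs are conjugate up to isomorphism, so the choice of the pair only
  changes the field by an isomorphism over \<open>F(j)\<close>.
\<close>

definition X0_field ::
    "('q::{finite,field} poly \<Rightarrow> 'q ambient poly) \<Rightarrow> 'q ambient set \<Rightarrow> 'q ambient set" where
  "X0_field \<phi> C = {x \<in> sep_closure field_Fj.
     \<forall>\<sigma> \<in> auts field_Fj. pair_iso \<phi> C (\<lambda>a. map_poly \<sigma> (\<phi> a)) (\<sigma> ` C) \<longrightarrow> \<sigma> x = x}"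

text \<open>The function field of the base change of \<open>X\<^sub>0(n)\<close> to the separable closure of \<open>F\<close>.\<close>

definition X0_sep_field ::
    "('q::{finite,field} poly \<Rightarrow> 'q ambient poly) \<Rightarrow> 'q ambient set \<Rightarrow> 'q ambient set" where
  "X0_sep_field \<phi> C = generate_field amb (X0_field \<phi> C \<union> sep_closure field_F)"


section \<open>The divisor class group of a function field\<close>

text \<open>
  \<open>M\<close> is a function field in one variable over \<open>k\<close>. The closed points of its smooth projective
  model are the valuation rings of \<open>M\<close> containing \<open>k\<close> and different from \<open>M\<close>.
\<close>

definition places :: "'q::{finite,field} ambient set \<Rightarrow> 'q ambient set \<Rightarrow> 'q ambient set set" where
  "places k M = {P. subring P amb \<and> k \<subseteq> P \<and> P \<subset> M \<and> (\<forall>x\<in>M. x \<in> P \<or> inverse x \<in> P)}"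

definition max_ideal :: "'q::{finite,field} ambient set \<Rightarrow> 'q ambient set" where
  "max_ideal P = {x \<in> P. x = 0 \<or> inverse x \<notin> P}"

definition residue_field :: "'q::{finite,field} ambient set \<Rightarrow> 'q ambient set ring" where
  "residue_field P = (amb\<lparr>carrier := P\<rparr>) Quot (max_ideal P)"

definition place_degree :: "'q::{finite,field} ambient set \<Rightarrow> 'q ambient set \<Rightarrow> nat" where
  "place_degree k P =
     ring.dim (residue_field P) ((\<lambda>x. max_ideal P +>\<^bsub>amb\<^esub> x) ` k) (carrier (residue_field P))"

definition ord_at :: "'q::{finite,field} ambient set \<Rightarrow> 'q ambient \<Rightarrow> int" where
  "ord_at P f = (THE n. \<exists>t u. max_ideal P = (\<lambda>x. t * x) ` P \<and> u \<in> P - max_ideal P \<and> f = t powi n * u)"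

type_synonym 'q divisor = "'q ambient set \<Rightarrow>\<^sub>0 int"

definition div_degree :: "'q::{finite,field} ambient set \<Rightarrow> 'q divisor \<Rightarrow> int" where
  "div_degree k D =
     (\<Sum>P \<in> Poly_Mapping.keys D. Poly_Mapping.lookup D P * int (place_degree k P))"

definition div0_group ::
    "'q::{finite,field} ambient set \<Rightarrow> 'q ambient set \<Rightarrow> 'q divisor monoid" where
  "div0_group k M = (free_Abelian_group (places k M))
     \<lparr>carrier := {D \<in> carrier (free_Abelian_group (places k M)). div_degree k D = 0}\<rparr>"

definition princ_div ::
    "'q::{finite,field} ambient set \<Rightarrow> 'q ambient set \<Rightarrow> 'q ambient \<Rightarrow> 'q divisor" where
  "princ_div k M f = Abs_poly_mapping (\<lambda>P. if P \<in> places k M then ord_at P f else 0)"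

definition princ_divs :: "'q::{finite,field} ambient set \<Rightarrow> 'q ambient set \<Rightarrow> 'q divisor set" where
  "princ_divs k M = princ_div k M ` (M - {0})"

definition pic0 ::
    "'q::{finite,field} ambient set \<Rightarrow> 'q ambient set \<Rightarrow> 'q divisor set monoid" where
  "pic0 k M = div0_group k M Mod princ_divs k M"

definition div_class ::
    "'q::{finite,field} ambient set \<Rightarrow> 'q ambient set \<Rightarrow> 'q divisor \<Rightarrow> 'q divisor set" where
  "div_class k M D = princ_divs k M #>\<^bsub>div0_group k M\<^esub> D"


section \<open>The Jacobian and the cuspidal divisor class group\<close>

text \<open>The group of points of \<open>J\<^sub>0(n)\<close> over the separable closure of \<open>F\<close>.\<close>

definition J0_sep ::
    "('q::{finite,field} poly \<Rightarrow> 'q ambient poly) \<Rightarrow> 'q ambient set \<Rightarrow> 'q divisor set monoid" where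
  "J0_sep \<phi> C = pic0 (sep_closure field_F) (X0_sep_field \<phi> C)"

text \<open>
  The \<open>F\<close>-rational points are the Galois invariants. With \<open>Fsep = sep_closure field_F\<close>, the Galois group of \<open>Fsep/F\<close> acts on
  \<open>Fsep(X\<^sub>0(n))\<close> through the constants, i.e. by automorphisms fixing \<open>F(X\<^sub>0(n))\<close>; each of these
  extends to the ambient field, and conversely an automorphism of the ambient field over
  \<open>F(X\<^sub>0(n))\<close> restricts to one of \<open>Fsep(X\<^sub>0(n))\<close>.
\<close>

definition galois_div ::
    "('q::{finite,field} ambient \<Rightarrow> 'q ambient) \<Rightarrow> 'q divisor \<Rightarrow> 'q divisor" where
  "galois_div \<sigma> = frag_extend (\<lambda>P. frag_of (\<sigma> ` P))"

definition J0_rational ::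
    "('q::{finite,field} poly \<Rightarrow> 'q ambient poly) \<Rightarrow> 'q ambient set \<Rightarrow> 'q divisor set set" where
  "J0_rational \<phi> C =
     {c \<in> carrier (J0_sep \<phi> C). \<forall>\<sigma> \<in> auts (X0_field \<phi> C). galois_div \<sigma> ` c = c}"

definition J0_torsion ::
    "('q::{finite,field} poly \<Rightarrow> 'q ambient poly) \<Rightarrow> 'q ambient set \<Rightarrow> 'q divisor set set" where
  "J0_torsion \<phi> C =
     {c \<in> J0_rational \<phi> C. \<exists>m::nat. m > 0 \<and> c [^]\<^bsub>J0_sep \<phi> C\<^esub> m = \<one>\<^bsub>J0_sep \<phi> C\<^esub>}"

text \<open>
  The cusps are the geometric points of \<open>X\<^sub>0(n)\<close> outside \<open>Y\<^sub>0(n)\<close>, which lie over \<open>j = \<infinity>\<close>.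
\<close>

definition cusps ::
    "('q::{finite,field} poly \<Rightarrow> 'q ambient poly) \<Rightarrow> 'q ambient set \<Rightarrow> 'q ambient set set" where
  "cusps \<phi> C = {P \<in> places (sep_closure field_F) (X0_sep_field \<phi> C). j_gen \<notin> P}"

definition cuspidal_group ::
    "('q::{finite,field} poly \<Rightarrow> 'q ambient poly) \<Rightarrow> 'q ambient set \<Rightarrow> 'q divisor set set" where
  "cuspidal_group \<phi> C = generate (J0_sep \<phi> C)
     {div_class (sep_closure field_F) (X0_sep_field \<phi> C) (frag_of P - frag_of P') | P P'.
        P \<in> cusps \<phi> C \<and> P' \<in> cusps \<phi> C}"

end

theory Submission
  imports Defs
begin

text \<open>
  Normalising a generic pair so that \<open>\<phi>\<^bsub>T\<^sup>2\<^esub>\<close> sends the generator \<open>x\<close> of \<open>C\<close> to 1, and writing \<open>\<theta> = T\<close>, one finds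
  invariants \<open>r, s\<close> of the pair with \<open>\<theta> s\<^sup>2 + (1 + \<theta> (r^q - r)) s = r\<close>, and the function field of
  \<open>X\<^sub>0(T\<^sup>3)\<close> is \<open>F(r, s)\<close>. With \<open>z = s + r^q - r\<close> one has \<open>\<theta> = (r - s) / (s z)\<close>, so this field is the
  rational function field in \<open>r, s\<close> over the finite field. The divisors of \<open>r\<close>, \<open>s\<close> and \<open>z\<close> are
  supported on the four cusps \<open>P\<^sub>1, P\<^sub>2, Q\<^sub>1, Q\<^sub>2\<close>, every cuspidal divisor of degree 0 is equivalent to a
  multiple of \<open>\<delta> = Q\<^sub>2 - Q\<^sub>1\<close>, and \<open>s^q / z\<close> has divisor \<open>q\<^sup>2 \<delta>\<close>. If \<open>(q\<^sup>2/p) \<delta>\<close> were principal, \<open>s^q / z\<close>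
  would be a \<open>p\<close>-th power up to a constant, and then so would \<open>s\<close> be a combination of \<open>p\<close>-th
  powers, which contradicts its simple zero at \<open>P\<^sub>1\<close>.

  Every rational class, torsion or not, is cuspidal: it contains, up to a multiple of \<open>Q\<^sub>1\<close>, a
  Galois-invariant effective divisor, which by Galois descent is locally given by functions in
  \<open>F(r, s)\<close>, and away from the cusps a single function of \<open>r, s\<close> works for all points at
  once, by division with remainder over the finite field.
\<close>

text \<open>The constant field is the separable closure \<open>K\<close> of F; it is imperfect and
  not algebraically closed. So places may have degree greater than one, and a constant need not be a
  p-th power: the function field theory keeps track of residue degrees, and p-th powers are replaced
  by the compositum K M^p (\<open>pspan\<close>), where M is the function field over K. Why every
  rational class is cuspidal: as theta is a rational function of r and s over the finite field, the
  coordinate ring over F of the curve without its cusps is a localisation of a polynomial ring in r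
  and s over the finite field. That ring is factorial, so divisors over F on this open curve are
  principal. Finding one function for all noncuspidal points makes factoriality explicit: first the
  primes that meet the polynomials in r trivially, then those generated by an irreducible polynomial
  in r. Origin of r and s: another generator of C changes the normalised data by combinations over
  the finite field, and r, s are built from expressions u^q - u, which absorb such changes.\<close>

locale subrng =
 fixes R :: "'a::field set"
 assumes zero_mem [simp]: "0 : R" and one_mem [simp]: "1 : R"
  and add_mem: "x : R ==> y : R ==> x + y : R"
  and minus_mem: "x : R ==> - x : R"
  and mult_mem: "x : R ==> y : R ==> x * y : R"
begin

lemma diff_mem: "x : R ==> y : R ==> x - y : R"
 using add_mem[of x "- y"] minus_mem[of y] by simp

lemma power_mem: "x : R ==> x ^ n : R"
 by (induction n) (auto intro: mult_mem)

lemma sum_mem: "(!!i. i : I ==> f i : R) ==> sum f I : R"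
 by (induction I rule: infinite_finite_induct) (auto intro: add_mem)

lemma of_nat_mem: "of_nat n : R"
 by (induction n) (auto intro: add_mem)

lemma prod_mem: "(!!i. i : I ==> f i : R) ==> prod f I : R"
 by (induction I rule: infinite_finite_induct) (auto intro: mult_mem)

lemmas mems = add_mem minus_mem mult_mem diff_mem power_mem sum_mem prod_mem

end

locale subfld = subrng k for k :: "'a::field set" +
 assumes inverse_mem: "x : k ==> inverse x : k"
begin

lemma divide_mem: "x : k ==> y : k ==> x / y : k"
 by (simp add: divide_inverse inverse_mem mult_mem)

lemma powi_mem: "x : k ==> x powi n : k"
 by (cases "n >= 0") (auto simp: power_int_def intro: power_mem inverse_mem)

lemma mult_cancel_mem: "x : k ==> x ~= 0 ==> x * y : k ==> y : k"
 using mult_mem[of "inverse x" "x * y"] inverse_mem by (simp add: field_simps)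

lemmas fmems = mems inverse_mem divide_mem

end

section \<open>The ambient field as a ring with carrier\<close>

lemma ring_amb: "ring amb" and cring_amb: "cring amb" and field_amb: "field amb"
 unfolding amb_def by (rule ring_from_type_algebra cring_from_type_algebra field_from_type_algebra)+

lemma amb_simps [simp]:
 "carrier amb = UNIV" "x \<otimes>\<^bsub>amb\<^esub> y = x * y" "x \<oplus>\<^bsub>amb\<^esub> y = x + y" "\<one>\<^bsub>amb\<^esub> = 1" "\<zero>\<^bsub>amb\<^esub> = 0"
 by (simp_all add: amb_def ring_of_type_algebra_def)

lemma a_inv_amb [simp]: "\<ominus>\<^bsub>amb\<^esub> x = - x"
 using ring.ring_simprules(9)[OF ring_amb, of x]
  abelian_group.minus_equality[OF ring.is_abelian_group[OF ring_amb], of "- x" x] by simp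

lemma subring_amb: "subring P amb \<longleftrightarrow> subrng P"
proof
 show "subrng P" if "subring P amb"
  using subringE[OF that] by unfold_locales auto
 show "subring P amb" if "subrng P"
  using ring.subringI[OF ring_amb, of P] subrng.one_mem[OF that] subrng.minus_mem[OF that]
   subrng.add_mem[OF that] subrng.mult_mem[OF that] by simp
qed

subsection \<open>Linear algebra over a subfield\<close>

definition vsub :: "'a::field set => 'a set => bool" where
 "vsub k W \<longleftrightarrow> 0 : W & (ALL x:W. ALL y:W. x + y : W) & (ALL c:k. ALL x:W. c * x : W)"

text \<open>Independence, spanning and dimension are all taken modulo \<open>W\<close>. In this way
  \<open>mdim k V W n\<close> speaks of the dimension of V/W without forming a quotient; residue
  fields and quotients of Riemann-Roch spaces are handled like this throughout.\<close>

definition indep :: "'a::field set => 'a set => 'a set => bool" where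
 "indep k W U \<longleftrightarrow> finite U &
  (ALL c. (ALL u:U. c u : k) --> (\<Sum>u\<in>U. c u * u) : W --> (ALL u:U. c u = 0))"

definition spans :: "'a::field set => 'a set => 'a set => 'a set => bool" where
 "spans k W U V \<longleftrightarrow> finite U &
  (ALL v:V. EX c. (ALL u:U. c u : k) & v - (\<Sum>u\<in>U. c u * u) : W)"

definition mdim :: "'a::field set => 'a set => 'a set => nat => bool" where
 "mdim k V W n \<longleftrightarrow> (EX U. indep k W U & spans k W U V & U \<subseteq> V & card U = n)"

lemma indepD:
 "indep k W U ==> (!!u. u : U ==> c u : k) ==> (\<Sum>u\<in>U. c u * u) : W ==> u : U ==> c u = 0"
 unfolding indep_def by blast

lemma indep_antimono: "indep k W U ==> Z \<subseteq> W ==> indep k Z U"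
 unfolding indep_def by blast

lemma vsubD:
 assumes "vsub k W"
 shows "0 : W" "x : W ==> y : W ==> x + y : W" "c : k ==> x : W ==> c * x : W"
 using assms by (auto simp: vsub_def)

lemma vsub_sum: "vsub k W ==> (!!i. i : I ==> f i : W) ==> sum f I : W"
 by (induction I rule: infinite_finite_induct) (auto simp: vsub_def)

lemma (in subrng) vsub_diff: "vsub R W ==> x : W ==> y : W ==> x - y : W"
 using vsubD(2)[of R W x "- 1 * y"] vsubD(3)[of R W "- 1" y] minus_mem[OF one_mem] by simp

lemma vsub_zero [simp]: "vsub k {0}"
 by (auto simp: vsub_def)

lemma (in subrng) vsub_self: "vsub R R"
 by (auto simp: vsub_def mems)

context subfld
begin

text \<open>Gaussian elimination, by induction on the set of equations: an equation with a nonzero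
  coefficient removes one unknown and one equation, an equation that vanishes identically is
  dropped.\<close>

lemma homogeneous_system:
 assumes "finite I" "finite J" "card J < card I" "!!i j. i : I ==> j : J ==> a i j : k"
 shows "EX c. (ALL i. c i : k) & (EX i:I. c i ~= 0) & (ALL j:J. (\<Sum>i\<in>I. c i * a i j) = 0)"
 using assms(2,1,3,4)
proof (induction J arbitrary: I a rule: finite_induct)
 case empty
 then obtain i where "i : I" by (metis card.empty card_gt_0_iff ex_in_conv)
 thus ?case by (intro exI[of _ "%_. 1"]) auto
next
 case (insert j J)
 show ?case
 proof (cases "ALL i:I. a i j = 0")
  case True
  have "card J < card I" using insert by simp
  from insert.IH[OF insert.prems(1) this, of a] insert.prems(3)
  show ?thesis using True by auto
 next
  case False
  then obtain i0 where i0: "i0 : I" "a i0 j ~= 0" by auto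
  define I' where "I' = I - {i0}"
  define b where "b i l = a i l - a i j / a i0 j * a i0 l" for i l
  have c: "card J < card I'" "finite I'" using insert i0 by (auto simp: I'_def)
  have bk: "b i l : k" if "i : I'" "l : J" for i l
   using that insert.prems(3) i0 unfolding b_def I'_def by (auto intro!: fmems)
  from insert.IH[OF c(2,1), of b] bk obtain c where
   c': "ALL i. c i : k" "EX i:I'. c i ~= 0" "ALL l:J. (\<Sum>i\<in>I'. c i * b i l) = 0" by blast
  \<comment> \<open>The value that equation \<open>j\<close> forces on the eliminated unknown
    \<open>i0\<close>; the other equations were freed of \<open>i0\<close> in
    \<open>b\<close>.\<close>
  define s where "s = - (\<Sum>i\<in>I'. c i * a i j) / a i0 j"
  have s: "s : k" unfolding s_def I'_def using c'(1) insert.prems(3) i0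
   by (auto intro!: fmems)
  have sum: "(\<Sum>i\<in>I. (c(i0 := s)) i * a i l) = s * a i0 l + (\<Sum>i\<in>I'. c i * a i l)" for l
   using i0(1) insert.prems(1) unfolding I'_def
   by (simp add: sum.remove[of I i0])
  show ?thesis
  proof (intro exI[of _ "c(i0 := s)"] conjI ballI)
   show "ALL i. (c(i0 := s)) i : k" using c' s by auto
   show "EX i:I. (c(i0 := s)) i ~= 0" using c'(2) by (auto simp: I'_def)
   fix l assume l: "l : insert j J"
   show "(\<Sum>i\<in>I. (c(i0 := s)) i * a i l) = 0"
   proof (cases "l = j")
    case True
    have "s * a i0 j = - (\<Sum>i\<in>I'. c i * a i j)" using i0(2) by (simp add: s_def)
    thus ?thesis unfolding sum True by simp
   next
    case False
    hence "(\<Sum>i\<in>I'. c i * b i l) = 0" using c'(3) l by auto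
    moreover have "(\<Sum>i\<in>I'. c i * b i l) = (\<Sum>i\<in>I'. c i * a i l) - (\<Sum>i\<in>I'. c i * a i j) / a i0 j * a i0 l"
     unfolding b_def
     by (simp add: right_diff_distrib sum_subtractf sum_distrib_right sum_divide_distrib mult.assoc)
    ultimately show ?thesis unfolding sum by (simp add: s_def)
   qed
  qed
 qed
qed

text \<open>The source of every dimension count below. It is stated for an indexed family instead of
  a set, so that coinciding vectors are still counted separately.\<close>

lemma spanned_relation:
 assumes W: "vsub k W" and S: "spans k W S V" and I: "finite I" "card S < card I"
  and v: "!!i. i : I ==> v i : V"
 shows "EX c. (ALL i. c i : k) & (EX i:I. c i ~= 0) & (\<Sum>i\<in>I. c i * v i) : W"
proof -
 have "EX a. ALL i:I. (ALL s:S. a i s : k) & v i - (\<Sum>s\<in>S. a i s * s) : W"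
  using S v unfolding spans_def by (intro bchoice) blast
 then obtain a where a: "!!i s. i : I ==> s : S ==> a i s : k"
  "!!i. i : I ==> v i - (\<Sum>s\<in>S. a i s * s) : W" by blast
 from homogeneous_system[OF I(1) _ I(2), of a] a S obtain c where
  c: "ALL i. c i : k" "EX i:I. c i ~= 0" "ALL s:S. (\<Sum>i\<in>I. c i * a i s) = 0"
  unfolding spans_def by blast
 have "(\<Sum>i\<in>I. c i * (\<Sum>s\<in>S. a i s * s)) = (\<Sum>i\<in>I. \<Sum>s\<in>S. c i * a i s * s)"
  by (simp add: sum_distrib_left mult.assoc)
 also have "... = (\<Sum>s\<in>S. \<Sum>i\<in>I. c i * a i s * s)" by (rule sum.swap)
 also have "... = (\<Sum>s\<in>S. (\<Sum>i\<in>I. c i * a i s) * s)" by (simp add: sum_distrib_right)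
 also have "... = 0" using c(3) by simp
 finally have "(\<Sum>i\<in>I. c i * v i) = (\<Sum>i\<in>I. c i * (v i - (\<Sum>s\<in>S. a i s * s)))"
  by (simp add: right_diff_distrib sum_subtractf)
 also have "... : W" using a(2) c(1) W by (intro vsub_sum) (auto simp: vsub_def)
 finally show ?thesis using c by blast
qed

lemma indep_card_le:
 assumes "vsub k W" "spans k W S V" "indep k W U" "U \<subseteq> V"
 shows "card U <= card S"
proof (rule ccontr)
 assume "~ ?thesis"
 then obtain c where "ALL i. c i : k" "EX i:U. c i ~= 0" "(\<Sum>i\<in>U. c i * i) : W"
  using spanned_relation[OF assms(1,2), of U "%u. u"] assms(3,4) unfolding indep_def by force
 with assms(3) show False unfolding indep_def by blast
qed

lemma mdim_indep_le: "vsub k W ==> mdim k V W n ==> indep k W U ==> U \<subseteq> V ==> card U <= n"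
 using indep_card_le unfolding mdim_def by blast

lemma mdim_unique: "vsub k W ==> mdim k V W m ==> mdim k V W n ==> m = n"
 using mdim_indep_le unfolding mdim_def by (metis le_antisym)

lemma indep_insert:
 assumes W: "vsub k W" and U: "indep k W U"
  and v: "!!c. (ALL u:U. c u : k) ==> v - (\<Sum>u\<in>U. c u * u) ~: W"
 shows "v ~: U" "indep k W (insert v U)"
proof -
 have fin: "finite U" using U by (simp add: indep_def)
 show vU: "v ~: U"
 proof
  assume "v : U"
  moreover have "(\<Sum>u\<in>U. (if u = v then 1 else 0) * u) = v"
   using fin \<open>v : U\<close> by (simp add: if_distrib[of "%x. x * _"] cong: if_cong)
  moreover have "ALL u:U. (if u = v then 1 else 0) : k" by simp
  ultimately show False using v[of "%u. if u = v then 1 else 0"] vsubD(1)[OF W] by simp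
 qed
 show "indep k W (insert v U)" unfolding indep_def
 proof (intro conjI allI impI)
  show "finite (insert v U)" using fin by simp
  fix c assume c: "ALL u:insert v U. c u : k" "(\<Sum>u\<in>insert v U. c u * u) : W"
  have eq: "(\<Sum>u\<in>insert v U. c u * u) = c v * v + (\<Sum>u\<in>U. c u * u)"
   using fin vU by simp
  have "c v = 0"
  proof (rule ccontr)
   assume cv: "c v ~= 0"
   have "inverse (c v) * (c v * v + (\<Sum>u\<in>U. c u * u)) : W"
    using vsubD(3)[OF W] c eq inverse_mem by auto
   also have "inverse (c v) * (c v * v + (\<Sum>u\<in>U. c u * u)) = v - (\<Sum>u\<in>U. - (c u / c v) * u)"
    using cv by (simp add: sum_negf sum_distrib_left field_simps sum_divide_distrib)
   finally show False using v[of "%u. - (c u / c v)"] c by (auto intro!: fmems)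
  qed
  with eq c U show "ALL u:insert v U. c u = 0" unfolding indep_def by auto
 qed
qed

text \<open>A uniform bound on the size of independent sets replaces finite dimension: an
  independent set of maximal size above \<open>U\<close> must span.\<close>

lemma indep_extend:
 assumes W: "vsub k W" and U: "indep k W U" "U \<subseteq> V"
  and bd: "!!U. U \<subseteq> V ==> indep k W U ==> card U <= N"
 shows "EX B. U \<subseteq> B & B \<subseteq> V & indep k W B & spans k W B V"
proof -
 define Q where "Q B \<longleftrightarrow> U \<subseteq> B & B \<subseteq> V & indep k W B" for B
 have "Q U" using U by (simp add: Q_def)
 moreover have "!!B. Q B ==> card B < Suc N" using bd by (auto simp: Q_def less_Suc_eq_le)
 ultimately obtain B where B: "Q B" "!!B'. Q B' ==> card B' <= card B"
  using ex_has_greatest_nat[of Q U card "Suc N"] by (metis less_le_not_le nat_le_linear)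
 have "spans k W B V" unfolding spans_def
 proof (intro conjI ballI)
  show "finite B" using B by (simp add: Q_def indep_def)
  fix v assume v: "v : V"
  show "EX c. (ALL u:B. c u : k) & v - (\<Sum>u\<in>B. c u * u) : W"
  proof (rule ccontr)
   assume n: "\<nexists>c. (ALL u:B. c u : k) & v - (\<Sum>u\<in>B. c u * u) : W"
   have "indep k W B" using B by (simp add: Q_def)
   with n have "v ~: B" "indep k W (insert v B)" using indep_insert[OF W, of B v] by blast+
   hence "Q (insert v B)" "card (insert v B) = Suc (card B)"
    using B v by (auto simp: Q_def indep_def)
   thus False using B(2) by fastforce
  qed
 qed
 thus ?thesis using B by (auto simp: Q_def)
qed

lemma indep_empty [simp]: "indep k W {}"
 by (simp add: indep_def)

lemma mdim_exists:
 assumes W: "vsub k W" and bd: "!!U. U \<subseteq> V ==> indep k W U ==> card U <= N"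
 shows "EX n<=N. mdim k V W n"
 using indep_extend[OF W indep_empty, of V N] bd unfolding mdim_def by blast

lemma mdim_add:
 assumes W: "vsub k W" and Z: "vsub k Z" and sub: "Z \<subseteq> W" "W \<subseteq> V"
  and m: "mdim k V W m" and n: "mdim k W Z n"
 shows "mdim k V Z (m + n)"
proof -
 from m obtain A where A: "indep k W A" "spans k W A V" "A \<subseteq> V" "card A = m" by (auto simp: mdim_def)
 from n obtain B where B: "indep k Z B" "spans k Z B W" "B \<subseteq> W" "card B = n" by (auto simp: mdim_def)
 have fin: "finite A" "finite B" using A B by (auto simp: indep_def)
 have comb: "(\<Sum>u\<in>B. c u * u) : W" if "ALL u:B. c u : k" for c
  using that B(3) W by (intro vsub_sum) (auto simp: vsub_def)
 have disj: "A \<inter> B = {}"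
 proof (rule ccontr)
  assume "A \<inter> B ~= {}"
  then obtain v where v: "v : A" "v : B" by auto
  have "(\<Sum>u\<in>A. (if u = v then 1 else 0) * u) = v"
   using fin v by (simp add: if_distrib[of "%x. x * _"] cong: if_cong)
  moreover have "ALL u:A. (if u = v then 1 else 0) : k" by simp
  moreover have "v : W" using B(3) v by auto
  ultimately show False
   using indepD[OF A(1), of "%u. if u = v then 1 else 0" v] v by simp
 qed
 have "indep k Z (A \<union> B)" unfolding indep_def
 proof (intro conjI allI impI)
  show "finite (A \<union> B)" using fin by simp
  fix c assume c: "ALL u:A \<union> B. c u : k" "(\<Sum>u\<in>A \<union> B. c u * u) : Z"
  have eq: "(\<Sum>u\<in>A \<union> B. c u * u) = (\<Sum>u\<in>A. c u * u) + (\<Sum>u\<in>B. c u * u)"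
   using fin disj by (simp add: sum.union_disjoint)
  have "(\<Sum>u\<in>A. c u * u) = (\<Sum>u\<in>A \<union> B. c u * u) - (\<Sum>u\<in>B. c u * u)" using eq by simp
  also have "... : W" using c sub comb by (intro vsub_diff[OF W]) auto
  finally have z: "ALL u:A. c u = 0" using A(1) c unfolding indep_def by auto
  hence "(\<Sum>u\<in>A. c u * u) = 0" by simp
  with eq c have "(\<Sum>u\<in>B. c u * u) : Z" by simp
  thus "ALL u:A \<union> B. c u = 0" using z B(1) c unfolding indep_def by auto
 qed
 moreover have "spans k Z (A \<union> B) V" unfolding spans_def
 proof (intro conjI ballI)
  show "finite (A \<union> B)" using fin by simp
  fix v assume "v : V"
  then obtain c where c: "ALL u:A. c u : k" "v - (\<Sum>u\<in>A. c u * u) : W"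
   using A(2) unfolding spans_def by blast
  then obtain d where d: "ALL u:B. d u : k" "v - (\<Sum>u\<in>A. c u * u) - (\<Sum>u\<in>B. d u * u) : Z"
   using B(2) unfolding spans_def by blast
  define e where "e u = (if u : A then c u else d u)" for u
  have "(\<Sum>u\<in>A \<union> B. e u * u) = (\<Sum>u\<in>A. e u * u) + (\<Sum>u\<in>B. e u * u)"
   using fin disj by (simp add: sum.union_disjoint)
  also have "(\<Sum>u\<in>A. e u * u) = (\<Sum>u\<in>A. c u * u)" by (simp add: e_def)
  also have "(\<Sum>u\<in>B. e u * u) = (\<Sum>u\<in>B. d u * u)"
   using disj by (intro sum.cong) (auto simp: e_def)
  finally have "v - (\<Sum>u\<in>A \<union> B. e u * u) : Z" using d by (simp add: algebra_simps)
  moreover have "ALL u:A \<union> B. e u : k" using c d by (auto simp: e_def)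
  ultimately show "EX c. (ALL u:A \<union> B. c u : k) & v - (\<Sum>u\<in>A \<union> B. c u * u) : Z" by blast
 qed
 moreover have "card (A \<union> B) = m + n" using A B fin disj by (simp add: card_Un_disjoint)
 ultimately show ?thesis using A B sub unfolding mdim_def by blast
qed

text \<open>Membership in \<open>W'\<close> is tested only on products of \<open>x\<close> with
  vectors of \<open>V\<close>. This fits subspaces given by valuation conditions, where
  multiplication by \<open>x\<close> shifts the condition.\<close>

lemma indep_scale:
 assumes "indep k W U" "U \<subseteq> V" "vsub k V" "x ~= 0" "!!v. v : V ==> x * v : W' ==> v : W"
 shows "indep k W' ((*) x ` U)" "card ((*) x ` U) = card U"
proof -
 have inj: "inj_on ((*) x) U" using assms(4) by (auto simp: inj_on_def)
 show "card ((*) x ` U) = card U" using inj by (rule card_image)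
 show "indep k W' ((*) x ` U)" unfolding indep_def
 proof (intro conjI allI impI)
  show "finite ((*) x ` U)" using assms(1) by (simp add: indep_def)
  fix c assume c: "ALL u:(*) x ` U. c u : k" "(\<Sum>u\<in>(*) x ` U. c u * u) : W'"
  have "(\<Sum>u\<in>(*) x ` U. c u * u) = x * (\<Sum>u\<in>U. c (x * u) * u)"
   by (subst sum.reindex[OF inj]) (simp add: sum_distrib_left mult_ac)
  moreover have "(\<Sum>u\<in>U. c (x * u) * u) : V"
   using c assms(2,3) by (intro vsub_sum) (auto simp: vsub_def)
  ultimately have "(\<Sum>u\<in>U. c (x * u) * u) : W" using c(2) assms(5) by auto
  moreover have "ALL u:U. c (x * u) : k" using c by auto
  ultimately have "ALL u:U. c (x * u) = 0"
   using indepD[OF assms(1), of "%u. c (x * u)"] by blast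
  thus "ALL u:(*) x ` U. c u = 0" by auto
 qed
qed

lemma mdim_scale:
 assumes V: "vsub k V" and x: "x ~= 0" and m: "mdim k V W n"
 shows "mdim k ((*) x ` V) ((*) x ` W) n"
proof -
 from m obtain U where U: "indep k W U" "spans k W U V" "U \<subseteq> V" "card U = n" by (auto simp: mdim_def)
 have inj: "inj_on ((*) x) U" using x by (auto simp: inj_on_def)
 have "v : W" if "x * v : (*) x ` W" for v using that x by auto
 hence "indep k ((*) x ` W) ((*) x ` U)" "card ((*) x ` U) = n"
  using indep_scale[OF U(1,3) V x, of "(*) x ` W"] U(4) by blast+
 moreover have "spans k ((*) x ` W) ((*) x ` U) ((*) x ` V)" unfolding spans_def
 proof (intro conjI ballI)
  show "finite ((*) x ` U)" using U by (simp add: indep_def)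
  fix v assume "v : (*) x ` V"
  then obtain v' where v': "v = x * v'" "v' : V" by auto
  then obtain c where c: "ALL u:U. c u : k" "v' - (\<Sum>u\<in>U. c u * u) : W"
   using U(2) unfolding spans_def by blast
  have "v - (\<Sum>u\<in>(*) x ` U. c (u / x) * u) = x * (v' - (\<Sum>u\<in>U. c u * u))"
   using x by (subst sum.reindex[OF inj]) (simp add: v' sum_distrib_left right_diff_distrib mult_ac)
  thus "EX c. (ALL u:(*) x ` U. c u : k) & v - (\<Sum>u\<in>(*) x ` U. c u * u) : (*) x ` W"
   using c x by (intro exI[of _ "%u. c (u / x)"]) auto
 qed
 ultimately show ?thesis using U(3) unfolding mdim_def by (intro exI[of _ "(*) x ` U"]) auto
qed

lemma mdim_refl: "vsub k W ==> V \<subseteq> W ==> mdim k V W 0"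
 unfolding mdim_def by (intro exI[of _ "{}"]) (auto simp: spans_def)

lemma mdim_0D: "mdim k V W 0 ==> V \<subseteq> W"
 unfolding mdim_def indep_def spans_def by force

lemma mdim_sub:
 assumes "vsub k Z" "mdim k V Z n" "W \<subseteq> V"
 shows "EX m<=n. mdim k W Z m"
 using mdim_exists[OF assms(1), of W n] mdim_indep_le[OF assms(1,2)] assms(3) by blast

lemma mdim_quot:
 assumes "vsub k Z" "vsub k W" "mdim k V Z n" "Z \<subseteq> W" "W \<subseteq> V"
 obtains a b where "mdim k V W a" "mdim k W Z b" "n = a + b"
proof -
 have "card U <= n" if "U \<subseteq> V" "indep k W U" for U
  using mdim_indep_le[OF assms(1,3) indep_antimono[OF that(2) assms(4)] that(1)] .
 then obtain a where a: "mdim k V W a" using mdim_exists[OF assms(2), of V n] by blast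
 obtain b where b: "mdim k W Z b" using mdim_sub[OF assms(1,3,5)] by blast
 show ?thesis
  using that[OF a b] mdim_unique[OF assms(1,3) mdim_add[OF assms(2,1,4,5) a b]] by blast
qed

end

subsection \<open>Polynomials over a subring\<close>

definition pover :: "'a::field set => 'a poly => bool" where
 "pover R p \<longleftrightarrow> (ALL i. coeff p i : R)"

lemma pover_mono: "pover R p ==> R \<subseteq> S ==> pover S p"
 by (auto simp: pover_def)

context subrng
begin

lemma pover_0 [simp]: "pover R 0" and pover_1 [simp]: "pover R 1"
 by (auto simp: pover_def coeff_1)

lemma pover_pCons [simp]: "pover R (pCons a p) \<longleftrightarrow> a : R & pover R p"
 unfolding pover_def by (metis coeff_pCons_0 coeff_pCons_Suc not0_implies_Suc)

lemma pover_monom: "c : R ==> pover R (monom c n)"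
 by (auto simp: pover_def)

lemma pover_add: "pover R p ==> pover R q ==> pover R (p + q)"
 and pover_diff: "pover R p ==> pover R q ==> pover R (p - q)"
 and pover_uminus: "pover R p ==> pover R (- p)"
 and pover_smult: "c : R ==> pover R p ==> pover R (smult c p)"
 and pover_mult: "pover R p ==> pover R q ==> pover R (p * q)"
 by (auto simp: pover_def coeff_mult intro!: mems)

lemma pover_power: "pover R p ==> pover R (p ^ n)"
 by (induction n) (auto intro: pover_mult)

lemma pover_prod: "(!!i. i : I ==> pover R (f i)) ==> pover R (prod f I)"
 by (induction I rule: infinite_finite_induct) (auto intro: pover_mult)

lemmas pover_intros = pover_add pover_diff pover_uminus pover_smult pover_mult pover_power pover_monom

lemma poly_mem: "pover R p ==> x : R ==> poly p x : R"
 unfolding poly_altdef by (auto simp: pover_def intro!: mems)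

end

lemma (in subfld) pover_divmod:
 assumes "pover k m" "m ~= 0" "pover k f"
 shows "EX h r. pover k h & pover k r & f = m * h + r & (r = 0 \<or> degree r < degree m)"
 using assms(3)
proof (induction "degree f" arbitrary: f rule: less_induct)
 case less
 show ?case
 proof (cases "f = 0 \<or> degree f < degree m")
  case True
  thus ?thesis using less.prems by (intro exI[of _ 0] exI[of _ f]) auto
 next
  case False
  define c where "c = lead_coeff f / lead_coeff m"
  define t where "t = monom c (degree f - degree m)"
  have c: "c : k" using less.prems assms(1) unfolding c_def pover_def by (intro divide_mem) auto
  have t: "pover k t" unfolding t_def using c by (rule pover_monom)
  have c0: "c ~= 0" using False assms(2) by (simp add: c_def)
  define g where "g = f - m * t"
  have g: "pover k g" unfolding g_def using less.prems assms(1) t by (intro pover_intros)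
  have deg: "degree (m * t) = degree f"
   using False assms(2) c0 by (simp add: t_def degree_mult_eq degree_monom_eq monom_eq_0_iff)
  have "lead_coeff t = c" using c0 by (simp add: t_def degree_monom_eq)
  hence lc: "coeff (m * t) (degree f) = lead_coeff f"
   using lead_coeff_mult[of m t] assms(2) unfolding deg by (simp add: c_def)
  have "g = 0 \<or> degree g < degree f"
  proof (cases "degree f = 0")
   case True
   hence "degree g = 0" using deg degree_diff_le[of f 0 "m * t"] by (simp add: g_def)
   moreover have "coeff g 0 = 0" using lc True by (simp add: g_def)
   ultimately show ?thesis using leading_coeff_0_iff[of g] by simp
  next
   case False
   have "degree g <= degree f" using deg degree_diff_le[of f "degree f" "m * t"] by (simp add: g_def)
   moreover have "coeff g (degree f) = 0" using lc by (simp add: g_def)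
   ultimately have "degree g ~= degree f \<or> g = 0" by (metis leading_coeff_0_iff)
   with \<open>degree g <= degree f\<close> show ?thesis by auto
  qed
  thus ?thesis
  proof
   assume "g = 0"
   thus ?thesis using t by (intro exI[of _ t] exI[of _ 0]) (auto simp: g_def)
  next
   assume "degree g < degree f"
   from less.hyps[OF this g] obtain h r where
    "pover k h" "pover k r" "g = m * h + r" "r = 0 \<or> degree r < degree m" by blast
   thus ?thesis using t
    by (intro exI[of _ "h + t"] exI[of _ r]) (auto simp: g_def algebra_simps intro: pover_add)
  qed
 qed
qed

subsection \<open>Algebraic elements\<close>

definition algel :: "'a::field set => 'a => bool" where
 "algel k x \<longleftrightarrow> (EX p. pover k p & p ~= 0 & poly p x = 0)"

definition is_minpoly :: "'a::field set => 'a => 'a poly => bool" where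
 "is_minpoly k x m \<longleftrightarrow> pover k m & lead_coeff m = 1 & poly m x = 0 &
  (ALL f. pover k f --> poly f x = 0 --> (EX h. pover k h & f = m * h))"

definition adj :: "'a::field set => 'a => 'a set" where
 "adj R x = {poly f x | f. pover R f}"

lemma is_minpolyD:
 assumes "is_minpoly k x m"
 shows "pover k m" "lead_coeff m = 1" "poly m x = 0" "m ~= 0"
 using assms unfolding is_minpoly_def by auto

lemma algel_mono: "algel k x ==> k \<subseteq> l ==> algel l x"
 unfolding algel_def using pover_mono by blast

context subfld
begin

lemma ex_minpoly:
 assumes "algel k x"
 obtains m where "is_minpoly k x m"
proof -
 obtain f where f: "pover k f" "f ~= 0" "poly f x = 0" using assms by (auto simp: algel_def)
 define P where "P f \<longleftrightarrow> pover k f & f ~= 0 & poly f x = 0" for f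
 obtain g where g: "P g" "!!h. P h ==> degree g <= degree h"
  using f ex_has_least_nat[of P f degree] unfolding P_def by blast
 define m where "m = smult (inverse (lead_coeff g)) g"
 have lg: "lead_coeff g : k" using g by (simp add: P_def pover_def)
 have m: "P m" "degree m = degree g" "lead_coeff m = 1"
  using g lg unfolding m_def P_def by (auto intro!: pover_smult inverse_mem)
 have "EX h. pover k h & f = m * h" if f: "pover k f" "poly f x = 0" for f
 proof -
  obtain h r where hr: "pover k h" "pover k r" "f = m * h + r" "r = 0 \<or> degree r < degree m"
   using pover_divmod[of m f] m f unfolding P_def by blast
  have r: "poly r x = 0" using hr(3) f(2) m(1) by (simp add: P_def)
  have "r = 0"
  proof (rule ccontr)
   assume "r ~= 0"
   hence "degree g <= degree r" using r hr(2) g(2) by (simp add: P_def)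
   thus False using hr(4) m(2) \<open>r ~= 0\<close> by simp
  qed
  with hr show ?thesis by auto
 qed
 thus ?thesis using m that unfolding is_minpoly_def P_def by blast
qed

lemma minpoly_degree_pos: "is_minpoly k x m ==> degree m > 0"
 unfolding is_minpoly_def by (metis degree_0_id gr0I lead_coeff_pCons(1) poly_1 one_pCons zero_neq_one)

lemma minpoly_degree_le:
 assumes "is_minpoly k x m" "pover k f" "f ~= 0" "poly f x = 0"
 shows "degree m <= degree f"
proof -
 obtain h where "f = m * h" using assms unfolding is_minpoly_def by blast
 thus ?thesis using assms(3) by (auto simp: degree_mult_eq)
qed

lemma algel_mem: "x : k ==> algel k x"
 unfolding algel_def by (intro exI[of _ "[:- x, 1:]"]) (auto intro: minus_mem)

text \<open>From a + y p(y) = 0 with a nonzero one reads off 1/y = - p(y)/a; if a = 0, the factor X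
  is cancelled, as y is nonzero.\<close>

lemma algel_inverse_poly:
 assumes "pover k p" "p ~= 0" "poly p y = 0" "y ~= 0"
 shows "EX g. pover k g & inverse y = poly g y"
 using assms(1-3)
proof (induction p)
 case (pCons a p)
 show ?case
 proof (cases "a = 0")
  case True
  with pCons assms(4) show ?thesis by auto
 next
  case False
  have "y * poly p y = - a" using pCons.prems(3) by (simp add: eq_neg_iff_add_eq_0 add.commute)
  moreover have "poly p y = inverse y * (y * poly p y)" using assms(4) by simp
  ultimately have "poly p y = inverse y * - a" by simp
  hence "inverse y = poly (smult (- inverse a) p) y" using False by simp
  moreover have "pover k (smult (- inverse a) p)"
   using pCons.prems(1) by (intro pover_smult minus_mem inverse_mem) auto
  ultimately show ?thesis by blast
 qed
qed auto

lemma subfld_algel: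
 assumes "subrng R" "k \<subseteq> R" "!!y. y : R ==> algel k y"
 shows "subfld R"
proof -
 interpret R: subrng R by fact
 show ?thesis
 proof
  fix y assume y: "y : R"
  show "inverse y : R"
  proof (cases "y = 0")
   case False
   then obtain g where "pover k g" "inverse y = poly g y"
    using algel_inverse_poly assms(3)[OF y] unfolding algel_def by blast
   thus ?thesis using R.poly_mem[OF pover_mono[OF _ assms(2)]] y by auto
  qed auto
 qed
qed

end

lemma (in subrng)
 shows adj_subrng: "subrng (adj R x)" and adj_incl: "R \<subseteq> adj R x" and adj_gen: "x : adj R x"
proof -
 show "subrng (adj R x)"
 proof
  show "0 : adj R x" unfolding adj_def by (auto intro!: exI[of _ 0])
  show "1 : adj R x" unfolding adj_def by (auto intro!: exI[of _ 1])
  fix y z assume "y : adj R x"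
  then obtain f where f: "pover R f" "y = poly f x" by (auto simp: adj_def)
  show "- y : adj R x" unfolding adj_def using f by (auto intro!: exI[of _ "- f"] pover_uminus)
  assume "z : adj R x"
  then obtain g where g: "pover R g" "z = poly g x" by (auto simp: adj_def)
  show "y + z : adj R x" unfolding adj_def using f g by (auto intro!: exI[of _ "f + g"] pover_add)
  show "y * z : adj R x" unfolding adj_def using f g by (auto intro!: exI[of _ "f * g"] pover_mult)
 qed
 show "R \<subseteq> adj R x"
 proof
  fix a assume "a : R"
  thus "a : adj R x" unfolding adj_def by (auto intro!: exI[of _ "[:a:]"])
 qed
 show "x : adj R x" unfolding adj_def by (auto intro!: exI[of _ "[:0, 1:]"])
qed

lemma adj_least: "subrng S ==> R \<subseteq> S ==> x : S ==> adj R x \<subseteq> S"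
 unfolding adj_def using subrng.poly_mem pover_mono by blast

subsection \<open>Finite extensions\<close>

definition fd :: "'a::field set => 'a set => bool" where
 "fd k R \<longleftrightarrow> subrng R & k \<subseteq> R & (EX S. spans k {0} S R)"

context subfld
begin

text \<open>Passage from families to sets: the coefficients of coinciding members are added
  up.\<close>

lemma spansI_family:
 assumes "finite I" "!!v. v : V ==> EX c. (ALL i:I. c i : k) & v - (\<Sum>i\<in>I. c i * w i) : W"
 shows "spans k W (w ` I) V"
 unfolding spans_def
proof (intro conjI ballI)
 show "finite (w ` I)" using assms(1) by simp
 fix v assume "v : V"
 then obtain c where c: "ALL i:I. c i : k" "v - (\<Sum>i\<in>I. c i * w i) : W" using assms(2) by blast
 define d where "d u = (\<Sum>i\<in>{i\<in>I. w i = u}. c i)" for u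
 have "(\<Sum>i\<in>I. c i * w i) = (\<Sum>u\<in>w ` I. \<Sum>i\<in>{i\<in>I. w i = u}. c i * w i)"
  using assms(1) by (rule sum.image_gen)
 also have "... = (\<Sum>u\<in>w ` I. d u * u)"
  by (intro sum.cong refl) (simp add: d_def sum_distrib_right)
 finally have "v - (\<Sum>u\<in>w ` I. d u * u) : W" using c(2) by simp
 moreover have "ALL u:w ` I. d u : k" using c(1) by (auto simp: d_def intro!: sum_mem)
 ultimately show "EX c. (ALL u:w ` I. c u : k) & v - (\<Sum>u\<in>w ` I. c u * u) : W" by blast
qed

lemma algel_relation:
 assumes "ALL i. c i : k" "i : {..N}" "c i ~= 0" "(\<Sum>i\<le>N. c i * y ^ i) = 0"
 shows "algel k y"
proof -
 define p where "p = (\<Sum>i\<le>N. monom (c i) i)"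
 have cp: "coeff p j = (if j <= N then c j else 0)" for j
  unfolding p_def by (simp add: coeff_sum if_distrib cong: if_cong)
 have "poly p y = 0" using assms(4) by (simp add: p_def poly_sum poly_monom)
 moreover have "pover k p" using assms(1) by (auto simp: pover_def cp)
 moreover have "p ~= 0" using cp[of i] assms(2,3) by auto
 ultimately show ?thesis unfolding algel_def by blast
qed

lemma fd_algel:
 assumes "fd k R" "y : R"
 shows "algel k y"
proof -
 interpret R: subrng R using assms by (simp add: fd_def)
 obtain S where S: "spans k {0} S R" using assms by (auto simp: fd_def)
 obtain c where "ALL i. c i : k" "EX i:{..card S}. c i ~= 0" "(\<Sum>i\<le>card S. c i * y ^ i) : {0}"
  using spanned_relation[OF vsub_zero S, of "{..card S}" "%i. y ^ i"] R.power_mem[OF assms(2)] by auto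
 thus ?thesis using algel_relation[of c _ "card S" y] by blast
qed

lemma fd_subfld: "fd k R ==> subfld R"
 using subfld_algel fd_algel unfolding fd_def by blast

lemma fd_self: "fd k k"
 unfolding fd_def
proof (intro conjI exI[of _ "{1}"])
 show "subrng k" by unfold_locales
 show "spans k {0} {1} k" unfolding spans_def by force
qed simp

lemma fd_adj:
 assumes "fd k R" "algel R x"
 shows "fd k (adj R x)"
proof -
 interpret R: subfld R using fd_subfld assms by blast
 obtain S where S: "spans k {0} S R" and kR: "k \<subseteq> R" using assms by (auto simp: fd_def)
 hence fS: "finite S" by (simp add: spans_def)
 obtain m where m: "is_minpoly R x m" using R.ex_minpoly assms by blast
 define d where "d = degree m"
 have "spans k {0} ((%(s, i). s * x ^ i) ` (S \<times> {..<d})) (adj R x)"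
 proof (rule spansI_family)
  show "finite (S \<times> {..<d})" using fS by simp
  fix v assume "v : adj R x"
  then obtain f where f: "pover R f" "v = poly f x" by (auto simp: adj_def)
  obtain h r where hr: "pover R h" "pover R r" "f = m * h + r" "r = 0 \<or> degree r < d"
   using R.pover_divmod[OF is_minpolyD(1,4)[OF m] f(1)] unfolding d_def by blast
  have v: "v = poly r x" using f hr m by (simp add: is_minpoly_def)
  have "v = (\<Sum>i<d. coeff r i * x ^ i)"
  proof (cases "r = 0")
   case False
   hence "degree r < d" using hr by auto
   hence "(\<Sum>i<d. coeff r i * x ^ i) = (\<Sum>i\<le>degree r. coeff r i * x ^ i)"
    by (intro sum.mono_neutral_right) (auto simp: coeff_eq_0)
   thus ?thesis using v by (simp add: poly_altdef)
  qed (use v in simp)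
  moreover have "EX c. ALL i. (ALL s:S. c i s : k) & coeff r i = (\<Sum>s\<in>S. c i s * s)"
  proof (rule choice, intro allI)
   fix i
   have "coeff r i : R" using hr(2) by (simp add: pover_def)
   thus "EX c. (ALL s:S. c s : k) & coeff r i = (\<Sum>s\<in>S. c s * s)"
    using S unfolding spans_def by fastforce
  qed
  then obtain c where c: "!!i s. s : S ==> c i s : k" "!!i. coeff r i = (\<Sum>s\<in>S. c i s * s)" by blast
  ultimately have "v = (\<Sum>i<d. \<Sum>s\<in>S. c i s * (s * x ^ i))"
   by (simp add: sum_distrib_right mult.assoc)
  also have "... = (\<Sum>s\<in>S. \<Sum>i<d. c i s * (s * x ^ i))" by (rule sum.swap)
  also have "... = (\<Sum>(s, i)\<in>S \<times> {..<d}. c i s * (s * x ^ i))" by (simp add: sum.cartesian_product)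
  also have "... = (\<Sum>p\<in>S \<times> {..<d}. (%(s, i). c i s) p * (case p of (s, i) => s * x ^ i))"
   by (intro sum.cong) auto
  finally show "EX c. (ALL i:S \<times> {..<d}. c i : k) &
     v - (\<Sum>i\<in>S \<times> {..<d}. c i * (case i of (s, i) => s * x ^ i)) : {0}"
   using c(1) by (intro exI[of _ "%(s, i). c i s"]) auto
 qed
 thus ?thesis unfolding fd_def using R.adj_subrng[of x] R.adj_incl[of x] kR by blast
qed

lemma subfld_adj: "algel k x ==> subfld (adj k x)"
 using fd_subfld[OF fd_adj[OF fd_self]] .

lemma fd_finite_set:
 assumes "finite A" "ALL a:A. algel k a"
 shows "EX R. fd k R & A \<subseteq> R"
 using assms
proof (induction A rule: finite_induct)
 case empty
 thus ?case using fd_self by auto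
next
 case (insert a A)
 then obtain R where R: "fd k R" "A \<subseteq> R" by auto
 then interpret R: subfld R using fd_subfld by blast
 have "algel R a" using insert R algel_mono unfolding fd_def by blast
 thus ?case using fd_adj[OF R(1)] R(2) R.adj_incl[of a] R.adj_gen[of a] by blast
qed

text \<open>The finitely many coefficients of an equation for \<open>x\<close> generate a finite
  extension \<open>R\<close> of \<open>k\<close>, and R[x] is again finite over
  \<open>k\<close>.\<close>

lemma algel_trans:
 assumes "algel l x" "!!y. y : l ==> algel k y"
 shows "algel k x"
proof -
 obtain p where p: "pover l p" "p ~= 0" "poly p x = 0" using assms by (auto simp: algel_def)
 obtain R where R: "fd k R" "coeff p ` {..degree p} \<subseteq> R"
  using fd_finite_set[of "coeff p ` {..degree p}"] p(1) assms(2) unfolding pover_def by blast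
 then interpret R: subfld R using fd_subfld by blast
 have "coeff p i : R" for i using R(2) by (cases "i <= degree p") (auto simp: coeff_eq_0)
 hence "algel R x" using p unfolding algel_def pover_def by blast
 thus ?thesis using fd_algel[OF fd_adj[OF R(1)]] R.adj_gen by blast
qed

end

subsection \<open>Separable elements\<close>

definition sepel :: "'a::field set => 'a => bool" where
 "sepel k x \<longleftrightarrow> (EX p. pover k p & rsquarefree p & poly p x = 0)"

lemma sepel_mono: "sepel k x ==> k \<subseteq> l ==> sepel l x"
 unfolding sepel_def using pover_mono by blast

lemma sepel_algel: "sepel k x ==> algel k x"
 unfolding sepel_def algel_def rsquarefree_def by blast

lemma rsquarefreeI:
 fixes p :: "'a::field poly"
 assumes "p ~= 0" "!!a. poly p a = 0 ==> poly (pderiv p) a ~= 0"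
 shows "rsquarefree p"
 unfolding rsquarefree_def
proof (intro conjI allI)
 fix a
 show "order a p = 0 \<or> order a p = 1"
 proof (rule ccontr)
  assume "~ ?thesis"
  hence "2 <= order a p" by simp
  hence "[:- a, 1:] ^ 2 dvd p" by (rule order_divides[THEN iffD2, OF disjI2])
  then obtain g where g: "p = [:- a, 1:] ^ 2 * g" by (elim dvdE)
  define q where "q = [:- a, 1:]"
  have "p = q * (q * g)" unfolding g q_def by (simp only: power2_eq_square mult.assoc)
  moreover have "poly q a = 0" by (simp add: q_def)
  ultimately have "poly p a = 0" "poly (pderiv p) a = 0" by (simp_all add: pderiv_mult)
  with assms(2) show False by blast
 qed
qed (use assms in blast)

lemma char_prime:
 assumes "CHAR('a::field) > 0"
 shows "normalization_semidom_class.prime CHAR('a)"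
 using prime_CHAR_semidom[where ?'a = 'a] assms by simp

text \<open>The polynomial (X - x)^p = X^p - x^p has coefficients in \<open>k\<close>, so the
  minimal polynomial of \<open>x\<close> divides it and is itself a power of X - x. Separability
  leaves only the first power.\<close>

lemma (in subfld) sepel_power_char_mem:
 assumes ch: "CHAR('a) > 0" and x: "x ^ CHAR('a) : k" "sepel k x"
 shows "x : k"
proof -
 let ?p = "CHAR('a)"
 obtain f where f: "pover k f" "rsquarefree f" "poly f x = 0" using x by (auto simp: sepel_def)
 hence f0: "f ~= 0" by (simp add: rsquarefree_def)
 obtain m where m: "is_minpoly k x m" using ex_minpoly sepel_algel x by blast
 have "CHAR('a poly) = ?p" by simp
 define g where "g = monom 1 ?p - [:x ^ ?p:]"
 have "[:0, 1:] ^ ?p = ([:- x, 1:] + [:x:]) ^ ?p" by simp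
 also have "... = [:- x, 1:] ^ ?p + [:x:] ^ ?p"
  by (rule freshmans_dream) (use char_prime[OF ch] in auto)
 finally have g: "g = [:- x, 1:] ^ ?p"
  by (simp add: g_def monom_altdef poly_const_pow)
 have "pover k g" unfolding g_def using x(1) by (intro pover_diff pover_monom) auto
 moreover have "poly g x = 0" by (simp add: g_def poly_monom)
 ultimately obtain h where h: "g = m * h" using m unfolding is_minpoly_def by blast
 have g0: "g ~= 0" by (simp add: g)
 hence mh: "m * h ~= 0" "m ~= 0" "h ~= 0" using h by auto
 have "order x g = ?p" by (simp add: g order_power_n_n)
 hence "order x m + order x h = ?p" using order_mult[OF mh(1), of x] h by simp
 moreover have "degree m + degree h = ?p" using h g mh degree_mult_eq[of m h] degree_linear_power[of "- x" ?p] by simp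
 moreover have "order x m <= degree m" "order x h <= degree h" using mh order_degree by auto
 ultimately have "order x m = degree m" by linarith
 moreover obtain h' where "f = m * h'" using m f unfolding is_minpoly_def by blast
 hence "order x m <= order x f" using f0 order_mult[of m h' x] by simp
 moreover have "order x f <= 1" using f(2) unfolding rsquarefree_def by (metis le_numeral_extra(4) zero_le_one)
 ultimately have "degree m = 1" using minpoly_degree_pos[OF m] by simp
 then obtain a b where ab: "m = [:a, b:]" by (metis degree1_coeffs)
 hence "b = 1" "a + x = 0" using m \<open>degree m = 1\<close> by (auto simp: is_minpoly_def split: if_splits)
 hence "x = - coeff m 0" using ab by (simp add: eq_neg_iff_add_eq_0 add.commute)
 thus ?thesis using m by (auto simp: is_minpoly_def pover_def intro: minus_mem)
qed

text \<open>The compositum k L^p in characteristic p. It serves twice: L = k L^p characterises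
  separable extensions, and a function in K M^p has expansions that involve only p-th powers of a
  local parameter, up to a shift.\<close>

inductive_set pspan :: "'a::field set => 'a set => 'a set" for k L where
 zero: "0 : pspan k L"
| step: "v : pspan k L ==> c : k ==> w : L ==> c * w ^ CHAR('a) + v : pspan k L"

lemma pspan_gen: "c : k ==> w : L ==> c * w ^ CHAR('a) : pspan k (L :: 'a::field set)"
 using pspan.step[OF pspan.zero] by fastforce

lemma pspan_add: "u : pspan k L ==> v : pspan k L ==> u + v : pspan k L"
 by (induction rule: pspan.induct) (auto simp: add.assoc intro: pspan.step)

lemma pspan_subfld:
 assumes k: "subfld k" and L: "subfld L" and kL: "k \<subseteq> L"
 shows "subfld (pspan k L)" "k \<subseteq> pspan k L" "pspan k L \<subseteq> L"
proof -
 interpret k: subfld k by fact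
 interpret L: subfld L by fact
 let ?N = "pspan k L" and ?p = "CHAR('a)"
 show kN: "k \<subseteq> ?N" using pspan_gen[of _ k 1 L] by force
 show NL: "?N \<subseteq> L"
 proof
  show "v : L" if "v : ?N" for v using that kL
   by (induction rule: pspan.induct) (auto intro!: L.mems)
 qed
 have sc: "c * w ^ ?p * v : ?N" if "v : ?N" "c : k" "w : L" for v c w
  using that
 proof (induction rule: pspan.induct)
  case (step v c' w')
  have "c * w ^ ?p * (c' * w' ^ ?p + v) = (c * c') * (w * w') ^ ?p + c * w ^ ?p * v"
   by (simp add: algebra_simps power_mult_distrib)
  thus ?case using step by (auto intro!: pspan.step k.mult_mem L.mult_mem)
 qed (simp add: pspan.zero)
 have mult: "u * v : ?N" if "u : ?N" "v : ?N" for u v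
  using that by (induction rule: pspan.induct) (auto simp: distrib_right pspan.zero intro!: pspan_add sc)
 have one: "1 : ?N" using kN by auto
 have pow: "v ^ n : ?N" if "v : ?N" for v n using that one mult by (induction n) auto
 show "subfld ?N"
 proof
  show "- x : ?N" if "x : ?N" for x
  proof -
   have "- 1 : ?N" using kN k.minus_mem[OF k.one_mem] by blast
   from mult[OF this that] show ?thesis by simp
  qed
  show "inverse x : ?N" if x: "x : ?N" for x
  proof (cases "?p = 0 \<or> x = 0")
   case True
   show ?thesis
   proof (cases "x = 0")
    case False
    \<comment> \<open>In characteristic 0 the exponent is 0, every w^0 is 1, and the span is
      \<open>k\<close> itself.\<close>
    with True have "?p = 0" by simp
    have N: "c : k" if "c : ?N" for c using that
     by (induction rule: pspan.induct) (auto simp: \<open>?p = 0\<close> intro: k.mems)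
    show ?thesis using kN k.inverse_mem[OF N[OF x]] by blast
   qed (use pspan.zero in auto)
  next
   case False
   have "1 * inverse x ^ ?p : ?N" using NL x by (intro pspan_gen L.inverse_mem) auto
   hence "x ^ (?p - 1) * (1 * inverse x ^ ?p) : ?N" using mult pow x by blast
   moreover have "x ^ ?p = x ^ (?p - 1) * x" using False by (metis neq0_conv power_minus_mult)
   hence "x ^ (?p - 1) * (1 * inverse x ^ ?p) = inverse x"
    using False by (simp add: power_inverse field_simps)
   ultimately show ?thesis by simp
  qed
 qed (use mult one pspan_add pspan.zero in auto)
qed

text \<open>Mac Lane's criterion: \<open>p\<close>-th powers of a basis of \<open>L\<close> form a basis again.\<close>

lemma (in subfld) indep_power_char:
 assumes ch: "CHAR('a) > 0" and L: "fd k L" "L \<subseteq> pspan k L"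
  and U: "indep k {0} U" "U \<subseteq> L"
 shows "indep k {0} ((%u. u ^ CHAR('a)) ` U)"
proof -
 let ?p = "CHAR('a)"
 note fr = freshmans_dream_sum[OF char_prime[OF ch] refl] freshmans_dream[OF char_prime[OF ch] refl]
 obtain S where S: "spans k {0} S L" using L by (auto simp: fd_def)
 obtain B where B: "U \<subseteq> B" "B \<subseteq> L" "indep k {0} B" "spans k {0} B L"
  using indep_extend[OF vsub_zero U, of "card S"] indep_card_le[OF vsub_zero S] by blast
 have fB: "finite B" using B by (simp add: indep_def)
 have span: "EX c. (ALL b:B. c b : k) & v = (\<Sum>b\<in>B. c b * b ^ ?p)" if "v : L" for v
 proof -
  have "v : pspan k L" using that L by blast
  thus ?thesis
  proof (induction rule: pspan.induct)
   case zero
   thus ?case by (intro exI[of _ "%_. 0"]) auto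
  next
   case (step v c w)
   then obtain d where d: "ALL b:B. d b : k" "v = (\<Sum>b\<in>B. d b * b ^ ?p)" by blast
   obtain e where e: "ALL b:B. e b : k" "w - (\<Sum>b\<in>B. e b * b) : {0}"
    using B(4) step unfolding spans_def by blast
   hence "w ^ ?p = (\<Sum>b\<in>B. e b ^ ?p * b ^ ?p)"
    using fr(1)[of "%b. e b * b" B] by (simp add: power_mult_distrib)
   hence "c * w ^ ?p + v = (\<Sum>b\<in>B. (c * e b ^ ?p + d b) * b ^ ?p)"
    using d by (simp add: sum_distrib_left sum.distrib algebra_simps)
   thus ?case using step(2) d(1) e(1)
    by (intro exI[of _ "%b. c * e b ^ ?p + d b"]) (auto intro!: mems)
  qed
 qed
 have inj: "inj_on (%u. u ^ ?p) A" for A :: "'a set"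
 proof (rule inj_onI)
  fix x y :: 'a assume "x ^ ?p = y ^ ?p"
  hence "(x - y) ^ ?p = 0" using fr(2)[of "x - y" y] by simp
  thus "x = y" by simp
 qed
 show ?thesis unfolding indep_def
 proof (intro conjI allI impI)
  show "finite ((%u. u ^ ?p) ` U)" using U by (simp add: indep_def)
  fix c assume c: "ALL u:(%u. u ^ ?p) ` U. c u : k" "(\<Sum>u\<in>(\<lambda>u. u ^ ?p) ` U. c u * u) : {0}"
  define d where "d u = (if u : U then c (u ^ ?p) else 0)" for u
  have dk: "d u : k" for u using c by (auto simp: d_def)
  have "(\<Sum>b\<in>B. d b * b ^ ?p) = (\<Sum>u\<in>U. d u * u ^ ?p)"
   using B(1) fB by (intro sum.mono_neutral_right) (auto simp: d_def)
  also have "... = 0" using c(2) by (subst (asm) sum.reindex[OF inj]) (simp add: d_def)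
  finally have rel: "(\<Sum>b\<in>B. d b * b ^ ?p) = 0" .
  have "d b = 0" if b: "b : B" for b
  proof (rule ccontr)
   assume db: "d b ~= 0"
   have bp: "b ^ ?p = (\<Sum>x\<in>B - {b}. - (d x / d b) * x ^ ?p)"
   proof -
    have "d b * b ^ ?p + (\<Sum>x\<in>B - {b}. d x * x ^ ?p) = 0" using rel fB b by (simp add: sum.remove)
    hence "b ^ ?p = - (\<Sum>x\<in>B - {b}. d x * x ^ ?p) / d b"
     using db by (simp add: field_simps) (simp add: eq_neg_iff_add_eq_0)
    thus ?thesis by (simp add: sum_negf sum_divide_distrib)
   qed
   have "spans k {0} ((%u. u ^ ?p) ` (B - {b})) L"
   proof (rule spansI_family)
    show "finite (B - {b})" using fB by simp
    fix v assume "v : L"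
    then obtain e where e: "ALL b:B. e b : k" "v = (\<Sum>b\<in>B. e b * b ^ ?p)" using span by blast
    have "v = e b * b ^ ?p + (\<Sum>x\<in>B - {b}. e x * x ^ ?p)" using e(2) fB b by (simp add: sum.remove)
    also have "... = (\<Sum>x\<in>B - {b}. (e x - e b * (d x / d b)) * x ^ ?p)"
     by (subst bp) (simp add: sum_distrib_left sum.distrib[symmetric] algebra_simps)
    finally show "EX c. (ALL i:B - {b}. c i : k) & v - (\<Sum>i\<in>B - {b}. c i * i ^ ?p) : {0}"
     using e(1) dk b by (intro exI[of _ "%x. e x - e b * (d x / d b)"]) (auto intro!: fmems)
   qed
   from indep_card_le[OF vsub_zero this B(3,2)]
   have "card B <= card (B - {b})" using card_image_le[of "B - {b}" "%u. u ^ ?p"] fB by simp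
   thus False using fB b by (metis card_Diff1_less leD)
  qed
  hence "c (u ^ ?p) = 0" if "u : U" for u using that B(1) by (metis d_def subsetD)
  thus "ALL u:(%u. u ^ ?p) ` U. c u = 0" by auto
 qed
qed


text \<open>If the minimal polynomial of \<open>w\<close> had a multiple root, it would be a
  polynomial in X^p. Its coefficients would then give a linear relation between the p-th powers of
  1, w, ..., w^(d-1), which are independent because the powers themselves are.\<close>

lemma (in subfld) fd_pspan_sepel:
 assumes ch: "CHAR('a) > 0" and L: "fd k L" "L \<subseteq> pspan k L" and w: "w : L"
 shows "sepel k w"
proof -
 let ?p = "CHAR('a)"
 interpret L: subfld L using fd_subfld L by blast
 obtain m where m: "is_minpoly k w m" using ex_minpoly fd_algel L w by blast
 define d where "d = degree m"
 have d: "d > 0" using minpoly_degree_pos[OF m] by (simp add: d_def)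
 have p1: "?p > 1" using char_prime[OF ch] prime_gt_1_nat by auto
 have low: "f = 0" if "pover k f" "poly f w = 0" "degree f < d" for f
  using minpoly_degree_le[OF m that(1) _ that(2)] that(3) by (auto simp: d_def)
 have ind_gen: "ALL i<d. c i = 0" if c: "ALL i<d. c i : k" "(\<Sum>i<d. c i * w ^ i) = 0" for c
 proof -
  define f where "f = (\<Sum>i<d. monom (c i) i)"
  have cf: "coeff f j = (if j < d then c j else 0)" for j
   unfolding f_def by (simp add: coeff_sum if_distrib cong: if_cong)
  have "f = 0"
  proof (rule low)
   show "pover k f" using c by (auto simp: pover_def cf)
   show "poly f w = 0" using c by (simp add: f_def poly_sum poly_monom)
   show "degree f < d" using d by (intro degree_lessI) (auto simp: cf)
  qed
  thus ?thesis using cf by (metis coeff_0)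
 qed
 have inj: "inj_on (%i. w ^ i) {..<d}"
 proof (rule ccontr)
  assume "~ ?thesis"
  then obtain i j where ij: "i < d" "j < d" "i ~= j" "w ^ i = w ^ j" by (auto simp: inj_on_def)
  have "(\<Sum>l<d. (if l = i then 1 else if l = j then - 1 else 0) * w ^ l) =
   (\<Sum>l<d. if l = i then w ^ l else 0) - (\<Sum>l<d. if l = j then w ^ l else 0)"
   unfolding sum_subtractf[symmetric] using ij by (intro sum.cong) auto
  also have "... = 0" using ij by simp
  finally have "ALL l<d. (if l = i then 1 else if l = j then - 1 else 0) = (0::'a)"
   by (intro ind_gen) (auto intro: minus_mem)
  thus False using ij by auto
 qed
 define U where "U = (%i. w ^ i) ` {..<d}"
 have U: "indep k {0} U" unfolding indep_def
 proof (intro conjI allI impI)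
  fix c assume c: "ALL u:U. c u : k" "(\<Sum>u\<in>U. c u * u) : {0}"
  have "(\<Sum>i<d. c (w ^ i) * w ^ i) = 0" using c(2) unfolding U_def sum.reindex[OF inj] by simp
  hence "ALL i<d. c (w ^ i) = 0" using c(1) by (intro ind_gen) (auto simp: U_def)
  thus "ALL u:U. c u = 0" by (auto simp: U_def)
 qed (simp add: U_def)
 have "U \<subseteq> L" using w by (auto simp: U_def intro: L.power_mem)
 from indep_power_char[OF ch L U this] have V: "indep k {0} ((%u. u ^ ?p) ` U)" .
 have injp: "inj_on (%u. u ^ ?p) U"
 proof (rule inj_onI)
  fix x y :: 'a assume "x ^ ?p = y ^ ?p"
  hence "(x - y) ^ ?p = 0"
   using freshmans_dream[OF char_prime[OF ch] refl, of "x - y" y] by simp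
  thus "x = y" by simp
 qed
 have "rsquarefree m"
 proof (rule rsquarefreeI)
  show "m ~= 0" using is_minpolyD[OF m] by simp
  fix a assume a: "poly m a = 0"
  show "poly (pderiv m) a ~= 0"
  proof
   assume a': "poly (pderiv m) a = 0"
   have pm: "pover k m" using is_minpolyD[OF m] by simp
   hence "algel k a" unfolding algel_def using a is_minpolyD[OF m] by blast
   \<comment> \<open>\<open>n\<close> divides \<open>m\<close>, and minimality of \<open>m\<close>
     for \<open>w\<close> makes the cofactor constant. So \<open>n\<close> has the degree of
     \<open>m\<close>, and \<open>pderiv m\<close>, which has smaller degree and vanishes at
     \<open>a\<close>, is zero.\<close>
   then obtain n where n: "is_minpoly k a n" using ex_minpoly by blast
   obtain h where h: "pover k h" "m = n * h" using n pm a unfolding is_minpoly_def by blast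
   have nz: "n ~= 0" "h ~= 0" using h \<open>m ~= 0\<close> by auto
   have deg: "degree m = degree n + degree h" using h nz by (simp add: degree_mult_eq)
   have "poly n w = 0 \<or> poly h w = 0" using is_minpolyD(3)[OF m] h by simp
   moreover have "poly h w ~= 0"
    using low[OF h(1)] nz deg minpoly_degree_pos[OF n] by (auto simp: d_def)
   ultimately have "degree m <= degree n"
    using minpoly_degree_le[OF m is_minpolyD(1)[OF n] nz(1)] by blast
   hence dn: "degree n = d" using deg by (simp add: d_def)
   have pm': "coeff (pderiv m) i : k" for i
    using pm unfolding coeff_pderiv pover_def by (intro mult_mem of_nat_mem) blast
   have "pderiv m = 0"
   proof (rule ccontr)
    assume z: "pderiv m ~= 0"
    hence "degree n <= degree (pderiv m)"
     using minpoly_degree_le[OF n _ z a'] pm' by (simp add: pover_def)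
    moreover have "degree (pderiv m) < degree m"
     using minpoly_degree_pos[OF m] by (intro degree_lessI) (auto simp: coeff_pderiv coeff_eq_0)
    ultimately show False using dn by (simp add: d_def)
   qed
   hence z: "coeff m (Suc i) = 0 \<or> ?p dvd Suc i" for i
   proof -
    have "of_nat (Suc i) * coeff m (Suc i) = 0"
     using coeff_pderiv[of m i] \<open>pderiv m = 0\<close> by (simp del: of_nat_Suc)
    thus ?thesis by (simp only: mult_eq_0_iff of_nat_eq_0_iff_char_dvd) blast
   qed
   hence zz: "coeff m j = 0" if "~ ?p dvd j" for j using that by (cases j) auto
   have pd: "?p dvd d" using zz[of d] is_minpolyD(2)[OF m] by (auto simp: d_def)
   then obtain e where e: "d = ?p * e" by blast
   hence ed: "e < d" using p1 d by auto
   have "0 = (\<Sum>j\<le>d. coeff m j * w ^ j)" using is_minpolyD(3)[OF m] by (simp add: poly_altdef d_def)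
   also have "... = (\<Sum>j\<in>(\<lambda>i. ?p * i) ` {..e}. coeff m j * w ^ j)"
   proof (rule sum.mono_neutral_right)
    show "ALL i:{..d} - (*) ?p ` {..e}. coeff m i * w ^ i = 0"
    proof
     fix i assume i: "i : {..d} - (*) ?p ` {..e}"
     have "~ ?p dvd i"
     proof
      assume "?p dvd i"
      then obtain l where "i = ?p * l" by blast
      with i e p1 show False by auto
     qed
     thus "coeff m i * w ^ i = 0" using zz by simp
    qed
   qed (auto simp: e)
   also have "... = (\<Sum>i\<le>e. coeff m (?p * i) * (w ^ i) ^ ?p)"
    using p1 by (subst sum.reindex) (auto simp: inj_on_def power_mult[symmetric] mult.commute)
   also have "... = (\<Sum>i<d. (if i <= e then coeff m (?p * i) else 0) * (w ^ i) ^ ?p)"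
    using ed by (intro sum.mono_neutral_cong_left) auto
   finally have rel: "(\<Sum>i<d. (if i <= e then coeff m (?p * i) else 0) * (w ^ i) ^ ?p) = 0" by simp
   have injc: "inj_on (%i. (w ^ i) ^ ?p) {..<d}"
    using comp_inj_on[OF inj] injp unfolding U_def o_def by blast
   define c where "c u = (let i = the_inv_into {..<d} (%i. (w ^ i) ^ ?p) u in if i <= e then coeff m (?p * i) else 0)" for u
   have cw: "c ((w ^ i) ^ ?p) = (if i <= e then coeff m (?p * i) else 0)" if "i < d" for i
    unfolding c_def using the_inv_into_f_f[OF injc, of i] that by simp
   have im: "(%u. u ^ ?p) ` U = (%i. (w ^ i) ^ ?p) ` {..<d}" by (auto simp: U_def)
   have "c ((w ^ e) ^ ?p) = 0"
   proof (rule indepD[OF V, where c = c])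
    show "(w ^ e) ^ ?p : (%u. u ^ ?p) ` U" using ed by (auto simp: U_def)
    show "c u : k" for u unfolding c_def Let_def using pm by (auto simp: pover_def)
    show "(\<Sum>u\<in>(\<lambda>u. u ^ ?p) ` U. c u * u) : {0}"
     unfolding im sum.reindex[OF injc] using rel by (simp add: cw)
   qed
   thus False using cw[OF ed] e is_minpolyD(2)[OF m] by (simp add: d_def)
  qed
 qed
 thus ?thesis unfolding sepel_def using is_minpolyD[OF m] by blast
qed

text \<open>Let L = k[x][y]. The p-th powers of \<open>x\<close> and \<open>y\<close> lie in k L^p;
  being separable, first \<open>x\<close> and then \<open>y\<close> lie in it too. Hence L = k L^p,
  and every element of L is separable.\<close>

lemma (in subfld) sepel_tower:
 assumes ch: "CHAR('a) > 0" and x: "sepel k x" and y: "sepel (adj k x) y"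
  and w: "w : adj (adj k x) y"
 shows "sepel k w"
proof -
 let ?L = "adj (adj k x) y"
 have fx: "fd k (adj k x)" by (rule fd_adj[OF fd_self sepel_algel[OF x]])
 interpret A: subfld "adj k x" using fd_subfld[OF fx] .
 have L: "fd k ?L" by (rule fd_adj[OF fx sepel_algel[OF y]])
 interpret L: subfld ?L using fd_subfld[OF L] .
 have kL: "k \<subseteq> ?L" using L by (simp add: fd_def)
 let ?N = "pspan k ?L"
 have N: "subfld ?N" "k \<subseteq> ?N" by (rule pspan_subfld[OF subfld_axioms L.subfld_axioms kL])+
 interpret N: subfld ?N by (rule N)
 have pow: "v ^ CHAR('a) : ?N" if "v : ?L" for v using pspan_gen[of 1 k v ?L] that by simp
 have xL: "x : ?L" "y : ?L" using A.adj_incl[of y] adj_gen[of x] A.adj_gen[of y] by auto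
 have "x : ?N" by (rule N.sepel_power_char_mem[OF ch pow[OF xL(1)] sepel_mono[OF x N(2)]])
 hence AN: "adj k x \<subseteq> ?N" using adj_least[OF N.subrng_axioms N(2)] by blast
 have "y : ?N" by (rule N.sepel_power_char_mem[OF ch pow[OF xL(2)] sepel_mono[OF y AN]])
 hence "?L \<subseteq> ?N" using adj_least[OF N.subrng_axioms AN] by blast
 thus ?thesis using fd_pspan_sepel[OF ch L _ w] by blast
qed

lemma (in subfld) sepel_mem: "x : k ==> sepel k x"
 unfolding sepel_def
proof (intro exI conjI)
 assume "x : k"
 thus "pover k [:- x, 1:]" by (auto intro: minus_mem)
 show "rsquarefree [:- x, 1:]" by (rule rsquarefreeI) (auto simp: pderiv_pCons)
qed simp

lemma (in subfld) sepel_subfld: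
 assumes ch: "CHAR('a) > 0"
 shows "subfld {x. sepel k x}"
proof -
 have *: "x + y : {x. sepel k x} & x * y : {x. sepel k x} & - x : {x. sepel k x} & inverse x : {x. sepel k x}"
  if "sepel k x" "sepel k y" for x y
 proof -
  let ?L = "adj (adj k x) y"
  have fx: "fd k (adj k x)" by (rule fd_adj[OF fd_self sepel_algel[OF that(1)]])
  interpret A: subfld "adj k x" using fd_subfld[OF fx] .
  have y: "sepel (adj k x) y" using sepel_mono[OF that(2) adj_incl] .
  have L: "fd k ?L" by (rule fd_adj[OF fx sepel_algel[OF y]])
  interpret L: subfld ?L using fd_subfld[OF L] .
  have xL: "x : ?L" "y : ?L" using A.adj_incl[of y] adj_gen[of x] A.adj_gen[of y] by auto
  show ?thesis using sepel_tower[OF ch that(1) y] xL by (auto intro: L.fmems)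
 qed
 show ?thesis
  by unfold_locales (use * sepel_mem[of 0] sepel_mem[of 1] in auto)
qed

subsection \<open>Extension of automorphisms\<close>

text \<open>Graphs of isomorphisms between subfields. As relations they can be united along a chain,
  and the conditions are symmetric under the converse, so that totality of a maximal one gives
  surjectivity as well.\<close>

definition pfiso :: "('a::field \<times> 'a) set => bool" where
 "pfiso R \<longleftrightarrow> (1, 1) : R &
  (ALL a b a' b'. (a, b) : R --> (a', b') : R --> (a + a', b + b') : R & (a * a', b * b') : R) &
  (ALL a b. (a, b) : R --> (- a, - b) : R & (inverse a, inverse b) : R & (a = 0 \<longleftrightarrow> b = 0))"

definition prel :: "('a::field \<times> 'a) set => 'a poly => 'a poly => bool" where
 "prel R f g \<longleftrightarrow> (ALL i. (coeff f i, coeff g i) : R)"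

lemma pfisoD:
 assumes "pfiso R"
 shows "(1, 1) : R" "(a, b) : R ==> (a', b') : R ==> (a + a', b + b') : R"
  "(a, b) : R ==> (a', b') : R ==> (a * a', b * b') : R"
  "(a, b) : R ==> (- a, - b) : R" "(a, b) : R ==> (inverse a, inverse b) : R"
  "(a, b) : R ==> a = 0 \<longleftrightarrow> b = 0"
 using assms unfolding pfiso_def by blast+

lemma pfiso_zero: "pfiso R ==> (0, 0) : R"
 using pfisoD(2)[of R 1 1 "- 1" "- 1"] pfisoD(1,4) by fastforce

lemma pfiso_unique: "pfiso R ==> (a, b) : R ==> (a, c) : R ==> b = c"
 using pfisoD(2)[of R a b "- a" "- c"] pfisoD(4)[of R a c] pfisoD(6)[of R "a + - a" "b + - c"] by simp

lemma pfiso_converse: "pfiso R ==> pfiso (R\<inverse>)"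
 unfolding pfiso_def converse_iff by (intro conjI allI impI) blast+

lemma pfiso_sum:
 assumes "pfiso R" "!!i. i : I ==> (f i, g i) : R"
 shows "(sum f I, sum g I) : R"
 using assms(2)
 by (induction I rule: infinite_finite_induct) (auto intro: pfisoD[OF assms(1)] pfiso_zero[OF assms(1)])

lemma pfiso_Domain: "pfiso R ==> subfld (Domain R)"
 by unfold_locales (auto intro: pfisoD pfiso_zero)

lemma prel_intros:
 assumes R: "pfiso R"
 shows "prel R f g ==> prel R f' g' ==> prel R (f + f') (g + g')"
  "prel R f g ==> prel R f' g' ==> prel R (f * f') (g * g')"
  "prel R f g ==> prel R (- f) (- g)"
  "(a, b) : R ==> prel R f g ==> prel R (pCons a f) (pCons b g)" "prel R 0 0"
 unfolding prel_def coeff_mult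
 by (auto intro!: pfisoD[OF R] pfiso_sum[OF R] pfiso_zero[OF R] simp: coeff_pCons split: nat.splits)

lemma prel_exists: "pfiso R ==> pover (Domain R) f ==> EX g. prel R f g"
proof (induction f)
 case 0
 thus ?case using prel_intros(5) by blast
next
 case (pCons a f)
 then interpret D: subfld "Domain R" using pfiso_Domain by blast
 from pCons D.pover_pCons[of a f] obtain b g where "(a, b) : R" "prel R f g" by blast
 thus ?case using prel_intros(4)[OF pCons.prems(1)] by blast
qed

lemma prel_pover: "prel R f g ==> pover (Domain R) f"
 unfolding prel_def pover_def by blast

lemma prel_unique: "pfiso R ==> prel R f g ==> prel R f h ==> g = h"
 unfolding prel_def by (intro poly_eqI) (blast intro: pfiso_unique)

text \<open>The extension sends f(y) to f'(y'), where f' is the image of f. It is well defined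
  because f(y) = 0 makes f a multiple of \<open>m\<close>, and the image \<open>m'\<close> kills
  \<open>y'\<close>.\<close>

lemma pfiso_extend:
 assumes R: "pfiso R" and m: "is_minpoly (Domain R) y m" and mm: "prel R m m'" "poly m' y' = 0"
 shows "EX S. pfiso S & R \<subseteq> S & (y, y') : S"
proof -
 interpret D: subfld "Domain R" using pfiso_Domain R by blast
 have "algel (Domain R) y" using is_minpolyD[OF m] unfolding algel_def by blast
 then interpret A: subfld "adj (Domain R) y" by (rule D.subfld_adj)
 define S where "S = {(poly f y, poly g y') | f g. prel R f g}"
 note pr = prel_intros[OF R]
 have z: "poly g y' = 0" if fg: "prel R f g" "poly f y = 0" for f g
 proof -
  obtain h where h: "pover (Domain R) h" "f = m * h"
   using m prel_pover[OF fg(1)] fg(2) unfolding is_minpoly_def by blast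
  obtain h' where "prel R h h'" using prel_exists[OF R h(1)] by blast
  hence "prel R f (m' * h')" unfolding h(2) by (rule pr(2)[OF mm(1)])
  hence "g = m' * h'" using prel_unique[OF R fg(1)] by blast
  thus ?thesis using mm by simp
 qed
 have C: "prel R [:1:] [:1:]" by (intro pr pfisoD(1)[OF R])
 have inv: "EX u u'. prel R u u' & poly u y = inverse (poly f y) & poly u' y' = inverse (poly g y') & poly g y' ~= 0"
  if fg: "prel R f g" "poly f y ~= 0" for f g
 proof -
  have "poly f y : adj (Domain R) y" unfolding adj_def using prel_pover[OF fg(1)] by blast
  hence "inverse (poly f y) : adj (Domain R) y" by (rule A.inverse_mem)
  then obtain u where u: "pover (Domain R) u" "poly u y = inverse (poly f y)" by (auto simp: adj_def)
  obtain u' where u': "prel R u u'" using prel_exists[OF R u(1)] by blast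
  have "prel R (f * u + - [:1:]) (g * u' + - [:1:])" by (intro pr fg u' pfisoD(1)[OF R])
  from z[OF this] have "poly g y' * poly u' y' = 1" using u fg by simp
  hence "poly g y' ~= 0 & poly u' y' = inverse (poly g y')"
   by (metis inverse_unique mult_zero_left zero_neq_one)
  thus ?thesis using u u' by blast
 qed
 have "pfiso S" unfolding pfiso_def
 proof (intro conjI allI impI)
  show "(1, 1) : S" unfolding S_def using C by force
  fix a b assume "(a, b) : S"
  then obtain f g where fg: "prel R f g" "a = poly f y" "b = poly g y'" by (auto simp: S_def)
  show "(- a, - b) : S" unfolding S_def fg using pr(3)[OF fg(1)] by force
  show "a = 0 \<longleftrightarrow> b = 0"
  proof (cases "a = 0")
   case True
   thus ?thesis using z[OF fg(1)] fg by simp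
  next
   case False
   thus ?thesis using inv[OF fg(1)] fg by auto
  qed
  show "(inverse a, inverse b) : S"
  proof (cases "a = 0")
   case True
   thus ?thesis using z[OF fg(1)] fg pr(5) unfolding S_def by force
  next
   case False
   thus ?thesis using inv[OF fg(1)] fg unfolding S_def by force
  qed
  fix a' b' assume "(a', b') : S"
  then obtain f' g' where fg': "prel R f' g'" "a' = poly f' y" "b' = poly g' y'" by (auto simp: S_def)
  show "(a + a', b + b') : S" unfolding S_def fg fg' using pr(1)[OF fg(1) fg'(1)] by force
  show "(a * a', b * b') : S" unfolding S_def fg fg' using pr(2)[OF fg(1) fg'(1)] by force
 qed
 moreover have "R \<subseteq> S"
 proof
  fix p assume "p : R"
  moreover obtain a b where "p = (a, b)" by (cases p)
  ultimately have "prel R [:a:] [:b:]" by (auto intro: pr)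
  thus "p : S" unfolding S_def \<open>p = (a, b)\<close> by force
 qed
 moreover have "(y, y') : S" unfolding S_def
  using pr(4)[OF pfiso_zero[OF R] C] by force
 ultimately show ?thesis by blast
qed

definition faut :: "'a::field set => ('a => 'a) => bool" where
 "faut k sg \<longleftrightarrow> bij sg & (ALL x y. sg (x + y) = sg x + sg y & sg (x * y) = sg x * sg y) & (ALL c:k. sg c = c) & sg 1 = 1"

text \<open>The image of a minimal polynomial has positive degree and hence a root, so a partial
  isomorphism whose domain omits some \<open>y\<close> can still be extended.\<close>

lemma pfiso_total:
 fixes R :: "('a::alg_closed_field \<times> 'a) set"
 assumes R: "pfiso R" and max: "!!S. pfiso S ==> R \<subseteq> S ==> S = R"
  and al: "!!y. algel (Domain R) y"
 shows "Domain R = UNIV"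
proof -
 interpret D: subfld "Domain R" using pfiso_Domain R by blast
 have "y : Domain R" for y
 proof -
  obtain m where m: "is_minpoly (Domain R) y m" using D.ex_minpoly al by blast
  obtain m' where mm: "prel R m m'" using prel_exists[OF R is_minpolyD(1)[OF m]] by blast
  have "(coeff m (degree m), coeff m' (degree m)) : R" using mm by (simp add: prel_def)
  hence "coeff m' (degree m) ~= 0" using pfisoD(6)[OF R] is_minpolyD(2)[OF m] by force
  hence "degree m' > 0" using D.minpoly_degree_pos[OF m] le_degree[of m' "degree m"] by linarith
  then obtain y' where "poly m' y' = 0" using alg_closed_imp_poly_has_root by blast
  from pfiso_extend[OF R m mm this] max show ?thesis by blast
 qed
 thus ?thesis by blast
qed

text \<open>Zorn's lemma gives a maximal extension of \<open>R\<close>; totality of this relation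
  and of its converse makes it the graph of a bijection.\<close>

lemma pfiso_faut:
 fixes R :: "('a::alg_closed_field \<times> 'a) set"
 assumes R: "pfiso R" and kR: "Id_on k \<subseteq> R" and k: "subfld k" and al: "!!y. algel k y"
 shows "EX sg. faut k sg & (ALL (a, b):R. sg a = b)"
proof -
 define \<F> where "\<F> = {S. pfiso S & R \<subseteq> S}"
 have "EX M:\<F>. ALL S:\<F>. M \<subseteq> S --> S = M"
 proof (rule subset_Zorn_nonempty)
  show "\<F> ~= {}" using R by (auto simp: \<F>_def)
  fix \<C> assume C: "\<C> ~= {}" "subset.chain \<F> \<C>"
  hence cf: "S : \<C> ==> pfiso S" and ch: "S : \<C> ==> S' : \<C> ==> S \<subseteq> S' \<or> S' \<subseteq> S" for S S'
   unfolding subset_chain_def \<F>_def by blast+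
  have "pfiso (\<Union>\<C>)" unfolding pfiso_def
  proof (intro conjI allI impI)
   show "(1, 1) : \<Union>\<C>" using C cf pfisoD(1) by blast
   fix a b assume "(a, b) : \<Union>\<C>"
   then obtain S where S: "S : \<C>" "(a, b) : S" by blast
   show "(- a, - b) : \<Union>\<C>" "(inverse a, inverse b) : \<Union>\<C>" "a = 0 \<longleftrightarrow> b = 0"
    using S pfisoD(4,5,6)[OF cf[OF S(1)] S(2)] by blast+
   fix a' b' assume "(a', b') : \<Union>\<C>"
   then obtain S' where S': "S' : \<C>" "(a', b') : S'" by blast
   obtain T where T: "T : \<C>" "(a, b) : T" "(a', b') : T" using ch S S' by blast
   show "(a + a', b + b') : \<Union>\<C>" "(a * a', b * b') : \<Union>\<C>"
    using T pfisoD(2,3)[OF cf[OF T(1)] T(2,3)] by blast+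
  qed
  moreover have "R \<subseteq> \<Union>\<C>" using C unfolding subset_chain_def \<F>_def by blast
  ultimately show "\<Union>\<C> : \<F>" by (simp add: \<F>_def)
 qed
 then obtain M where MF: "M : \<F>" "ALL S:\<F>. M \<subseteq> S --> S = M" by blast
 hence M: "pfiso M" "R \<subseteq> M" by (simp_all add: \<F>_def)
 have M: "pfiso M" "R \<subseteq> M" "!!S. pfiso S ==> M \<subseteq> S ==> S = M"
  using M MF(2) order_trans[OF M(2)] by (simp_all add: \<F>_def)
 have kD: "k \<subseteq> Domain M" "k \<subseteq> Domain (M\<inverse>)" using kR M(2) by (auto simp: Id_on_def)
 have D: "Domain M = UNIV"
  by (rule pfiso_total[OF M(1,3)]) (use al algel_mono kD in blast)+
 have "Domain (M\<inverse>) = UNIV"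
 proof (rule pfiso_total[OF pfiso_converse[OF M(1)]])
  show "S = M\<inverse>" if "pfiso S" "M\<inverse> \<subseteq> S" for S
  proof -
   have "M \<subseteq> S\<inverse>" using that(2) by auto
   hence "S\<inverse> = M" by (rule M(3)[OF pfiso_converse[OF that(1)]])
   thus ?thesis by auto
  qed
 qed (use al algel_mono kD in blast)
 hence Rg: "Range M = UNIV" by simp
 define sg where "sg a = (THE b. (a, b) : M)" for a
 have sg: "sg a = b \<longleftrightarrow> (a, b) : M" for a b
 proof -
  obtain c where c: "(a, c) : M" using D by blast
  hence "sg a = c" unfolding sg_def by (rule the_equality) (use c pfiso_unique[OF M(1)] in blast)
  thus ?thesis using c pfiso_unique[OF M(1)] by blast
 qed
 have sgM: "(a, sg a) : M" for a using sg[of a "sg a"] by simp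
 have "bij sg"
 proof (rule bijI)
  show "inj sg"
  proof (rule injI)
   fix a b assume "sg a = sg b"
   thus "a = b" using sgM[of a] sgM[of b] pfiso_unique[OF pfiso_converse[OF M(1)]]
    by (metis converse_iff)
  qed
  show "surj sg" using Rg sg by (metis RangeE UNIV_I surjI surj_def)
 qed
 moreover have "sg (x + y) = sg x + sg y" "sg (x * y) = sg x * sg y" "sg 1 = 1" for x y
  using sg sgM pfisoD(1,2,3)[OF M(1)] by blast+
 moreover have "sg c = c" if "c : k" for c using that kR M(2) sg by blast
 ultimately have "faut k sg" by (simp add: faut_def)
 thus ?thesis using sg M(2) by blast
qed

lemma faut_conjugate:
 fixes k :: "'a::alg_closed_field set"
 assumes k: "subfld k" and al: "!!y. algel k y" and m: "is_minpoly k x m" "poly m x' = 0"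
 shows "EX sg. faut k sg & sg x = x'"
proof -
 interpret k: subfld k by fact
 have R: "pfiso (Id_on k)" unfolding pfiso_def by (auto intro: k.fmems)
 have "prel (Id_on k) m m" using is_minpolyD(1)[OF m(1)] by (auto simp: prel_def pover_def)
 from pfiso_extend[OF R _ this m(2), of x] m obtain S where "pfiso S" "Id_on k \<subseteq> S" "(x, x') : S" by auto
 then obtain sg where "faut k sg" "ALL (a, b):S. sg a = b" using pfiso_faut[OF _ _ k al, of S] by blast
 thus ?thesis using \<open>(x, x') : S\<close> by auto
qed

text \<open>A separable \<open>x\<close> outside \<open>k\<close> has a minimal polynomial of degree
  at least two with simple roots, hence a conjugate different from \<open>x\<close>.\<close>

lemma faut_moves:
 fixes k :: "'a::alg_closed_field set"
 assumes k: "subfld k" and al: "!!y. algel k y" and x: "sepel k x" "x ~: k"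
 shows "EX sg. faut k sg & sg x ~= x"
proof -
 interpret k: subfld k by fact
 obtain m where m: "is_minpoly k x m" using k.ex_minpoly al by blast
 have "[:- x, 1:] dvd m" using is_minpolyD(3)[OF m] poly_eq_0_iff_dvd by blast
 then obtain g where g: "m = [:- x, 1:] * g" by (rule dvdE)
 have g0: "g ~= 0" using is_minpolyD(4)[OF m] g by auto
 have "degree g > 0"
 proof (rule ccontr)
  assume "~ ?thesis"
  hence "degree m = 1" using g g0 by (simp add: degree_mult_eq del: mult_pCons_left)
  then obtain a b where ab: "m = [:a, b:]" by (metis degree1_coeffs)
  hence "b = 1" "a + x = 0" using m \<open>degree m = 1\<close> by (auto simp: is_minpoly_def split: if_splits)
  hence "x = - coeff m 0" using ab by (simp add: eq_neg_iff_add_eq_0 add.commute)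
  thus False using m x(2) by (auto simp: is_minpoly_def pover_def intro: k.minus_mem)
 qed
 then obtain x' where x': "poly g x' = 0" using alg_closed_imp_poly_has_root by blast
 have "x' ~= x"
 proof
  assume "x' = x"
  hence "order x g >= 1" using x' g0 order_root[of g x] by (simp add: Suc_le_eq)
  moreover have "order x m = order x [:- x, 1:] + order x g"
   unfolding g by (rule order_mult) (use g g0 in \<open>simp del: mult_pCons_left\<close>)
  moreover have "order x [:- x, 1:] = 1" using order_power_n_n[of x 1] by simp
  moreover obtain f where f: "pover k f" "rsquarefree f" "poly f x = 0" using x by (auto simp: sepel_def)
  moreover obtain h where "f = m * h" using m f unfolding is_minpoly_def by blast
  moreover have "f ~= 0" "order x f <= 1" using f(2) unfolding rsquarefree_def by (auto simp: le_Suc_eq)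
  ultimately show False using order_mult[of m h x] by simp
 qed
 moreover have "poly m x' = 0" using x' by (simp add: g)
 ultimately show ?thesis using faut_conjugate[OF k al m] by blast
qed

subsection \<open>Existence of places\<close>

text \<open>Chevalley's construction: a subring that is maximal among those in which
  \<open>y\<close> has no inverse is a valuation ring of \<open>M\<close>.\<close>

locale subring_not_inverting = M: subfld M for M :: "'a::field set" +
 fixes S y
 assumes Ssub: "subrng S" "S \<subseteq> M" and ynz: "y : S" "y ~= 0" "inverse y ~: S"
  and maximal: "!!S'. subrng S' ==> S \<subseteq> S' ==> S' \<subseteq> M ==> inverse y ~: S' ==> S' = S"
begin

interpretation S: subrng S by (rule Ssub)

lemma adj_M: "x : M ==> adj S x \<subseteq> M"
 using adj_least[OF M.subrng_axioms Ssub(2)] .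

lemma inverse_y_adj:
 assumes "x : M" "x ~: S"
 obtains f where "pover S f" "poly f x = inverse y"
proof -
 have "inverse y : adj S x"
 proof (rule ccontr)
  assume "inverse y ~: adj S x"
  from maximal[OF S.adj_subrng S.adj_incl adj_M[OF assms(1)] this] S.adj_gen[of x] assms(2)
  show False by simp
 qed
 thus ?thesis using that by (auto simp: adj_def)
qed

text \<open>\<open>y\<close> lies in the Jacobson radical. With u = 1 - y g, if 1/u were outside
  \<open>S\<close>, maximality would put 1/y into S[1/u]; multiplying by a power of u, which is 1
  modulo y S, would put 1/y into \<open>S\<close>.\<close>

lemma unit_one_plus:
 assumes g: "g : S"
 shows "inverse (1 - y * g) : S"
proof (rule ccontr)
 define u where "u = 1 - y * g"
 assume n: "inverse (1 - y * g) ~: S"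
 have u: "u : S" using g ynz S.one_mem unfolding u_def by (auto intro!: S.mems)
 have u0: "u ~= 0"
 proof
  assume "u = 0"
  hence "inverse y = g" by (simp add: u_def inverse_unique)
  thus False using g ynz by simp
 qed
 have "inverse u : M" using u Ssub by (auto intro: M.inverse_mem)
 then obtain f where f: "pover S f" "poly f (inverse u) = inverse y"
  using inverse_y_adj n unfolding u_def by blast
 define N where "N = degree f"
 have pw: "EX c:S. u ^ n = 1 + y * c" for n
 proof (induction n)
  case 0
  show ?case by (rule bexI[of _ 0]) auto
 next
  case (Suc n)
  then obtain c where c: "c : S" "u ^ n = 1 + y * c" by blast
  have "u ^ Suc n = 1 + y * (c - g - y * c * g)" using c by (simp add: u_def algebra_simps)
  thus ?case using c g ynz by (intro bexI[of _ "c - g - y * c * g"]) (auto intro!: S.mems)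
 qed
 obtain c where c: "c : S" "u ^ N = 1 + y * c" using pw by blast
 have "u ^ N * poly f (inverse u) = (\<Sum>i\<le>N. coeff f i * u ^ (N - i))"
  unfolding poly_altdef N_def[symmetric] sum_distrib_left
 proof (intro sum.cong refl)
  fix i assume "i : {..N}"
  hence "u ^ N = u ^ (N - i) * u ^ i" by (simp add: power_add[symmetric])
  thus "u ^ N * (coeff f i * inverse u ^ i) = coeff f i * u ^ (N - i)"
   using u0 by (simp add: field_simps)
 qed
 also have "... : S" using f(1) u by (auto simp: pover_def intro!: S.mems)
 finally have "(1 + y * c) * inverse y : S" using c f by simp
 moreover have "(1 + y * c) * inverse y = inverse y + c" using ynz by (simp add: field_simps)
 ultimately have "inverse y + c - c : S" using c by (intro S.diff_mem) auto
 thus False using ynz by simp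
qed

text \<open>The expression of 1/y by 1/x writes x^n, up to a unit, by lower powers of x.
  Substituting this into the leading term of \<open>f\<close> lowers the degree.\<close>

lemma no_minimal_pair:
 assumes x: "x ~= 0"
  and f: "pover S f" "poly f x = inverse y" and g: "pover S g" "poly g (inverse x) = inverse y"
  and deg: "degree g <= degree f"
 obtains f' where "pover S f'" "poly f' x = inverse y" "degree f' < degree f"
proof -
 define n where "n = degree f"
 have "n ~= 0"
 proof
  assume "n = 0"
  then obtain a where "f = [:a:]" by (metis degree_0_id n_def)
  hence "inverse y = a" "a : S" using f S.pover_pCons by auto
  thus False using ynz by simp
 qed
 define u where "u = 1 - y * coeff g 0"
 have g0: "coeff g 0 : S" using g by (simp add: pover_def)
 have iu: "inverse u : S" unfolding u_def by (rule unit_one_plus[OF g0])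
 have u0: "u ~= 0"
 proof
  assume "u = 0"
  hence "inverse y = coeff g 0" by (simp add: u_def inverse_unique)
  thus False using g0 ynz by simp
 qed
 \<comment> \<open>The nonconstant part of g(1/x), multiplied by x^n; the condition on the degrees
   makes it a polynomial in x.\<close>
 define h where "h = (\<Sum>j\<in>{1..degree g}. monom (coeff g j) (n - j))"
 have ph: "pover S h" unfolding h_def
  using g(1) by (auto simp: pover_def coeff_sum intro!: S.sum_mem)
 have hx: "poly h x = x ^ n * (u * inverse y)"
 proof -
  have "poly h x = (\<Sum>j\<in>{1..degree g}. x ^ n * (coeff g j * inverse x ^ j))"
   unfolding h_def poly_sum poly_monom
  proof (intro sum.cong refl)
   fix j assume "j : {1..degree g}"
   hence "x ^ n = x ^ (n - j) * x ^ j" using deg by (simp add: power_add[symmetric] n_def)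
   thus "coeff g j * x ^ (n - j) = x ^ n * (coeff g j * inverse x ^ j)"
    using x by (simp add: field_simps)
  qed
  also have "... = x ^ n * (\<Sum>j\<in>{1..degree g}. coeff g j * inverse x ^ j)" by (simp add: sum_distrib_left)
  also have "(\<Sum>j\<in>{1..degree g}. coeff g j * inverse x ^ j) = poly g (inverse x) - coeff g 0"
  proof -
   have "{..degree g} = insert 0 {1..degree g}" by auto
   thus ?thesis by (simp add: poly_altdef)
  qed
  also have "... = u * inverse y" unfolding g(2) u_def using ynz by (simp add: field_simps)
  finally show ?thesis .
 qed
 define f' where "f' = (f - monom (coeff f n) n) + smult (coeff f n * y * inverse u) h"
 have fn: "coeff f n : S" using f by (simp add: pover_def)
 have "pover S f'" unfolding f'_def using f(1) fn ynz(1) iu ph by (intro S.pover_intros S.mult_mem) auto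
 moreover have "(coeff f n * y * inverse u) * (x ^ n * (u * inverse y)) = coeff f n * x ^ n"
  using ynz u0 by (simp add: field_simps)
 hence "poly f' x = inverse y" by (simp add: f'_def poly_monom hx f(2))
 moreover have "degree f' < n"
 proof (rule degree_lessI)
  show "ALL k>=n. coeff f' k = 0"
  proof (intro allI impI)
   fix k assume k: "n <= k"
   have "coeff h k = 0" unfolding h_def coeff_sum
   proof (rule sum.neutral, rule ballI)
    fix j assume "j : {1..degree g}"
    thus "coeff (monom (coeff g j) (n - j)) k = 0" using k \<open>n ~= 0\<close> by auto
   qed
   thus "coeff f' k = 0" using k by (cases "k = n") (auto simp: f'_def n_def coeff_eq_0)
  qed
 qed (use \<open>n ~= 0\<close> in simp)
 ultimately show ?thesis using that by (simp add: n_def)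
qed

text \<open>If both x and 1/x were outside \<open>S\<close>, each would express 1/y by a polynomial;
  among expressions of least degree, the one of larger degree could be shortened by the
  other.\<close>

lemma valuation:
 assumes "x : M"
 shows "x : S \<or> inverse x : S"
proof (rule ccontr)
 assume "~ ?thesis"
 hence n: "x ~: S" "inverse x ~: S" by auto
 hence x0: "x ~= 0" by auto
 define P where "P z f \<longleftrightarrow> pover S f & poly f z = inverse y" for z f
 obtain f0 where "P x f0" using inverse_y_adj[OF assms n(1)] by (auto simp: P_def)
 then obtain f where f: "P x f" "!!f'. P x f' ==> degree f <= degree f'"
  using ex_has_least_nat[of "P x" f0 degree] by blast
 obtain g0 where "P (inverse x) g0"
  using inverse_y_adj[OF M.inverse_mem[OF assms] n(2)] by (auto simp: P_def)
 then obtain g where g: "P (inverse x) g" "!!f'. P (inverse x) f' ==> degree g <= degree f'"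
  using ex_has_least_nat[of "P (inverse x)" g0 degree] by blast
 show False
 proof (cases "degree g <= degree f")
  case True
  then obtain f' where "P x f'" "degree f' < degree f"
   using no_minimal_pair[OF x0 _ _ _ _ True] f(1) g(1) unfolding P_def by blast
  thus False using f(2) by fastforce
 next
  case False
  hence "degree f <= degree g" by simp
  moreover have "inverse x ~= 0" "pover S f" "poly f (inverse (inverse x)) = inverse y"
   using x0 f(1) by (auto simp: P_def)
  ultimately obtain f' where "P (inverse x) f'" "degree f' < degree g"
   using no_minimal_pair[of "inverse x" g f] g(1) unfolding P_def by blast
  thus False using g(2) by fastforce
 qed
qed

end

lemma places_iff:
 "P : places k M \<longleftrightarrow> subrng P & k \<subseteq> P & P \<subset> M & (ALL x:M. x : P \<or> inverse x : P)"
 by (simp add: places_def subring_amb)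

text \<open>Chevalley's extension theorem: a non-unit of a subring vanishes at some place containing
  the subring. This produces the poles in \<open>L_0\<close> and the cusps over r = 0.\<close>

lemma ex_place:
 assumes M: "subfld M" and R0: "subrng R0" "k \<subseteq> R0" "R0 \<subseteq> M"
  and y: "y : R0" "y ~= 0" "inverse y ~: R0"
 shows "EX P:places k M. R0 \<subseteq> P & y : max_ideal P"
proof -
 interpret M: subfld M by fact
 define \<F> where "\<F> = {S. subrng S & R0 \<subseteq> S & S \<subseteq> M & inverse y ~: S}"
 have "EX S:\<F>. ALL S':\<F>. S \<subseteq> S' --> S' = S"
 proof (rule subset_Zorn_nonempty)
  show "\<F> ~= {}" using R0 y by (auto simp: \<F>_def)
  fix \<C> assume C: "\<C> ~= {}" "subset.chain \<F> \<C>"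
  hence cf: "S : \<C> ==> S : \<F>" and ch: "S : \<C> ==> S' : \<C> ==> S \<subseteq> S' \<or> S' \<subseteq> S" for S S'
   unfolding subset_chain_def by blast+
  have sr: "S : \<C> ==> subrng S" for S using cf by (simp add: \<F>_def)
  obtain S0 where S0: "S0 : \<C>" using C by blast
  have "subrng (\<Union>\<C>)"
  proof
   show "0 : \<Union>\<C>" "1 \<in> \<Union>\<C>" using S0 subrng.zero_mem[OF sr] subrng.one_mem[OF sr] by blast+
   fix a b assume "a : \<Union>\<C>"
   then obtain S where S: "S : \<C>" "a : S" by blast
   thus "- a : \<Union>\<C>" using subrng.minus_mem[OF sr] by blast
   assume "b : \<Union>\<C>"
   then obtain S' where S': "S' : \<C>" "b : S'" by blast
   obtain T where T: "T : \<C>" "a : T" "b : T" using ch S S' by blast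
   show "a + b : \<Union>\<C>" "a * b : \<Union>\<C>"
    using T subrng.add_mem[OF sr] subrng.mult_mem[OF sr] by blast+
  qed
  moreover have "R0 \<subseteq> \<Union>\<C>" using S0 cf unfolding \<F>_def by blast
  moreover have "\<Union>\<C> \<subseteq> M" "inverse y ~: \<Union>\<C>" using cf unfolding \<F>_def by blast+
  ultimately show "\<Union>\<C> : \<F>" by (simp add: \<F>_def)
 qed
 then obtain S where SF: "S : \<F>" "ALL S':\<F>. S \<subseteq> S' --> S' = S" by blast
 hence S: "subrng S" "R0 \<subseteq> S" "S \<subseteq> M" "inverse y ~: S" by (auto simp: \<F>_def)
 interpret subring_not_inverting M S y
 proof (intro subring_not_inverting.intro subring_not_inverting_axioms.intro M)
  fix S' assume "subrng S'" "S \<subseteq> S'" "S' \<subseteq> M" "inverse y ~: S'"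
  thus "S' = S" using SF(2) S(2) unfolding \<F>_def by blast
 qed (use S y in auto)
 have yM: "inverse y : M" using y R0 by (auto intro: M.inverse_mem)
 hence "S \<subset> M" using S by blast
 hence "S : places k M" unfolding places_iff using S R0 valuation by blast
 moreover have "y : max_ideal S" using S y by (auto simp: max_ideal_def)
 ultimately show ?thesis using S by blast
qed

subsection \<open>Valuation rings\<close>

locale vring = M: subfld M + K: subfld K for K M :: "'q::{finite,field} ambient set" +
 fixes P
 assumes place: "P : places K M"
begin

sublocale subrng P using place by (simp add: places_iff)

lemma KP: "K \<subseteq> P" and PM: "P \<subseteq> M" and P_neq: "P ~= M"
 and val: "x : M ==> x : P \<or> inverse x : P"
 using place unfolding places_iff by blast+

abbreviation "m \<equiv> max_ideal P"

lemma m_iff: "x : m \<longleftrightarrow> x : P & (x = 0 \<or> inverse x ~: P)"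
 by (simp add: max_ideal_def)

lemma m_P: "x : m ==> x : P" and zero_m [simp]: "0 : m" and one_not_m [simp]: "1 ~: m"
 by (auto simp: m_iff)

lemma notin_P: "x : M ==> x ~: P ==> inverse x : m"
 using val[of x] by (auto simp: m_iff)

lemma unit_iff: "x : P - m \<longleftrightarrow> x : P & inverse x : P & x ~= 0"
 by (auto simp: m_iff)

lemma unit_mult: "x : P - m ==> y : P - m ==> x * y : P - m"
 unfolding unit_iff by (auto simp: inverse_mult_distrib intro: mult_mem)

lemma unit_inverse: "x : P - m ==> inverse x : P - m"
 unfolding unit_iff by auto

lemma unit_powi:
 assumes "x : P - m" shows "x powi n : P - m"
proof -
 have *: "y ^ i : P - m" if "y : P - m" for y i
  using that
 proof (induction i)
  case (Suc i)
  thus ?case using unit_mult[of y "y ^ i"] by simp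
 qed (use one_mem in simp)
 show ?thesis unfolding power_int_def using *[OF assms] *[OF unit_inverse[OF assms]] by simp
qed

lemma m_mult:
 assumes "x : m" "a : P"
 shows "a * x : m"
proof (cases "a * x = 0")
 case False
 have "inverse (a * x) ~: P"
 proof
  assume "inverse (a * x) : P"
  hence "a * inverse (a * x) : P" using assms by (intro mult_mem)
  moreover have "a * inverse (a * x) = inverse x" using False by simp
  ultimately have "inverse x : P" by (simp only:)
  thus False using assms(1) False unfolding m_iff by auto
 qed
 thus ?thesis using assms unfolding m_iff by (auto intro: mult_mem)
next
 case True
 thus ?thesis using zero_m by (simp only:)
qed

lemma m_add:
 assumes "x : m" "y : m"
 shows "x + y : m"
proof -
 have *: "a + b : m" if "a : m" "b : m" "b ~= 0" "a / b : P" for a b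
 proof -
  have "a + b = (a / b + 1) * b" using that by (simp add: field_simps)
  moreover have "a / b + 1 : P" by (intro add_mem that one_mem)
  ultimately show ?thesis using m_mult[OF that(2), of "a / b + 1"] by (simp only:)
 qed
 show ?thesis
 proof (cases "x = 0 \<or> y = 0")
  case False
  have "x / y : M" using assms m_P PM by (auto intro!: M.divide_mem)
  hence "x / y : P \<or> y / x : P" using val[of "x / y"] by (simp add: inverse_eq_divide)
  thus ?thesis using *[of x y] *[of y x] False assms by (auto simp: add.commute)
 qed (use assms in auto)
qed

lemma m_minus: "x : m ==> - x : m"
 using m_mult[of x "- 1"] minus_mem[OF one_mem] by simp

lemma m_diff: "x : m ==> y : m ==> x - y : m"
 using m_add[of x "- y"] m_minus by simp

lemma m_prime: "x : P ==> y : P ==> x * y : m ==> x : m \<or> y : m"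
 using unit_mult by blast

lemma m_power: "x : P ==> x ^ n : m ==> x : m"
 by (induction n) (auto dest: m_prime[OF _ power_mem])

lemma K_unit: "c : K ==> c ~= 0 ==> c : P - m"
 using KP K.inverse_mem unfolding unit_iff by blast

lemma K_m: "c : K ==> c : m ==> c = 0"
 using K_unit by blast

lemma vsub_P: "vsub K P" and vsub_m: "vsub K m"
 unfolding vsub_def using KP by (auto intro: add_mem mult_mem m_add m_mult)

lemma unit_add_m: "x : P - m ==> y : m ==> x + y : P - m"
 using m_diff[of "x + y" y] m_P by (auto intro: add_mem)

end

text \<open>The valuation is defined as soon as the maximal ideal is generated by some \<open>t\<close>
 and every nonzero element is a power of \<open>t\<close> times a unit.\<close>

locale dvring = vring +
 fixes t
 assumes t_gen: "max_ideal P = (%x. t * x) ` P" and t_nz: "t ~= 0"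
  and t_fact: "f : P ==> f ~= 0 ==> EX n u. f = t ^ n * u & u : P - max_ideal P"
begin

lemma t_m: "t : m"
 unfolding t_gen by (metis imageI mult.right_neutral one_mem)

lemma t_M: "t : M"
 using t_m m_P PM by blast

lemma pow_unit:
 assumes "t powi n * u = t powi n' * u'" "u : P - m" "u' : P - m"
 shows "n = n'"
proof -
 have *: "~ (a < b)" if "t powi a * x = t powi b * y" "x : P - m" "y : P - m" for a b x y
 proof
  assume ab: "a < b"
  have "x = t powi (b - a) * y"
   using that(1) t_nz by (simp add: power_int_diff field_simps)
  also have "t powi (b - a) = t ^ nat (b - a - 1) * t"
  proof -
   have "b - a = int (nat (b - a - 1)) + 1" using ab by simp
   thus ?thesis using t_nz by (metis power_int_add_1 power_int_of_nat)
  qed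
  finally have "x = (t ^ nat (b - a - 1) * y) * t" by (simp add: mult_ac)
  moreover have "(t ^ nat (b - a - 1) * y) * t : m"
   using that t_m m_P by (intro m_mult mult_mem power_mem) auto
  ultimately show False using that by blast
 qed
 from *[OF assms] *[OF assms(1)[symmetric] assms(3,2)] show ?thesis by simp
qed

text \<open>\<open>ord_at\<close> refers to an arbitrary generator of the maximal ideal. Any two
  generators differ by a unit, so the exponent is the one computed with the fixed
  \<open>t\<close>.\<close>

lemma ord_at_eqI:
 assumes "f = t powi n * u" "u : P - m"
 shows "ord_at P f = n"
 unfolding ord_at_def
proof (rule the_equality)
 show "EX t u. m = (%x. t * x) ` P & u : P - m & f = t powi n * u"
  using t_gen assms by blast
 fix n' assume "EX t u. m = (%x. t * x) ` P & u : P - m & f = t powi n' * u"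
 then obtain t' u' where t': "m = (%x. t' * x) ` P" "u' : P - m" "f = t' powi n' * u'" by blast
 obtain a where a: "a : P" "t = t' * a" using t_m unfolding t' by blast
 have "t' : m" using t'(1) by (metis imageI mult.right_neutral one_mem)
 then obtain b where b: "b : P" "t' = t * b" unfolding t_gen by blast
 have "t * (a * b) = (t * b) * a" by (simp add: mult_ac)
 also have "... = t' * a" by (simp only: b(2))
 also have "... = t * 1" by (simp only: a(2)[symmetric] mult_1_right)
 finally have "t * (a * b) = t * 1" .
 hence "a * b = 1" using t_nz by (simp only: mult_cancel_left) simp
 hence "inverse b = a" using inverse_unique[of b a] by (simp add: mult.commute)
 hence bu: "b : P - m" using a b \<open>a * b = 1\<close> unfolding unit_iff by auto
 have "b powi n' : P - m" by (rule unit_powi[OF bu])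
 hence "b powi n' * u' : P - m" using t' by (intro unit_mult)
 moreover have "f = t powi n' * (b powi n' * u')" by (simp add: t' b power_int_mult_distrib mult_ac)
 ultimately show "n' = n" using pow_unit assms by metis
qed

lemma factor:
 assumes "f : M" "f ~= 0"
 obtains u where "f = t powi (ord_at P f) * u" "u : P - m"
proof -
 have "EX n u. f = t powi n * u & u : P - m"
 proof (cases "f : P")
  case True
  from t_fact[OF this assms(2)] show ?thesis by (metis power_int_of_nat)
 next
  case False
  hence "inverse f : P" "inverse f ~= 0" using val assms by auto
  from t_fact[OF this] obtain n u where u: "inverse f = t ^ n * u" "u : P - m" by blast
  have "f = inverse (t ^ n * u)" by (simp only: u(1)[symmetric] inverse_inverse_eq)
  also have "... = t powi (- int n) * inverse u" by (simp add: power_int_minus)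
  finally have "f = t powi (- int n) * inverse u" .
  moreover have "inverse u : P - m" using u(2) by (rule unit_inverse)
  ultimately show ?thesis by blast
 qed
 thus ?thesis using ord_at_eqI that by metis
qed

lemma ord_mult:
 assumes "f : M" "f ~= 0" "g : M" "g ~= 0"
 shows "ord_at P (f * g) = ord_at P f + ord_at P g"
proof -
 obtain u where u: "f = t powi (ord_at P f) * u" "u : P - m" using factor assms by blast
 obtain w where w: "g = t powi (ord_at P g) * w" "w : P - m" using factor assms by blast
 show ?thesis
 proof (rule ord_at_eqI)
  show "f * g = t powi (ord_at P f + ord_at P g) * (u * w)"
   by (subst u(1), subst w(1)) (simp add: power_int_add t_nz mult_ac)
 qed (rule unit_mult[OF u(2) w(2)])
qed

lemma ord_unit: "u : P - m ==> ord_at P u = 0"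
 by (rule ord_at_eqI[of _ _ u]) auto

lemma ord_one [simp]: "ord_at P 1 = 0"
 by (rule ord_unit) auto

lemma ord_t: "ord_at P t = 1"
 by (rule ord_at_eqI[of _ _ 1]) auto

lemma ord_K: "c : K ==> c ~= 0 ==> ord_at P c = 0"
 by (rule ord_unit[OF K_unit])

lemma ord_inverse:
 assumes "f : M" "f ~= 0" shows "ord_at P (inverse f) = - ord_at P f"
 using ord_mult[OF assms M.inverse_mem[OF assms(1)]] assms by simp

lemma ord_divide:
 "f : M ==> f ~= 0 ==> g : M ==> g ~= 0 ==> ord_at P (f / g) = ord_at P f - ord_at P g"
 using ord_mult[of f "inverse g"] ord_inverse[of g] M.inverse_mem by (simp add: divide_inverse)

lemma ord_power: "f : M ==> f ~= 0 ==> ord_at P (f ^ n) = int n * ord_at P f"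
 by (induction n) (auto simp: ord_mult M.power_mem algebra_simps)

lemma ord_uminus: "f : M ==> f ~= 0 ==> ord_at P (- f) = ord_at P f"
 using ord_mult[of "- 1" f] ord_unit[of "- 1"] K_unit[of "- 1"] K.minus_mem[OF K.one_mem]
  M.minus_mem[OF M.one_mem] by simp

lemma ord_ge_0_iff:
 assumes "f : M" "f ~= 0" shows "ord_at P f >= 0 \<longleftrightarrow> f : P"
proof
 obtain u where u: "f = t powi (ord_at P f) * u" "u : P - m" using factor assms by blast
 show "f : P" if "ord_at P f >= 0"
 proof -
  have "t ^ nat (ord_at P f) * u : P" using u(2) m_P[OF t_m] by (auto intro!: mult_mem power_mem)
  also have "t ^ nat (ord_at P f) * u = f" using u(1) that by (simp only: power_int_def if_True)
  finally show ?thesis .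
 qed
 show "ord_at P f >= 0" if f: "f : P"
 proof -
  obtain n u where "f = t ^ n * u" "u : P - m" using t_fact[OF f assms(2)] by blast
  hence "ord_at P f = int n" by (intro ord_at_eqI) auto
  thus ?thesis by simp
 qed
qed

definition ordge :: "int => 'a ambient set" where
 "ordge n = {f : M. f = 0 \<or> n <= ord_at P f}"

lemma ordge_iff: "f : ordge n \<longleftrightarrow> f : M & (f = 0 \<or> n <= ord_at P f)"
 by (simp add: ordge_def)

lemma ordge_scale: "x : M ==> x ~= 0 ==> x * f : ordge n \<longleftrightarrow> f : ordge (n - ord_at P x)"
 using M.mult_cancel_mem[of x f] by (auto simp: ordge_iff ord_mult M.mult_mem)

lemma ordge_0: "ordge 0 = P"
proof (rule Set.set_eqI)
 fix f
 show "f : ordge 0 \<longleftrightarrow> f : P"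
  by (cases "f = 0") (use ord_ge_0_iff[of f] PM in \<open>auto simp: ordge_def\<close>)
qed

lemma ordge_eq: "f : ordge n \<longleftrightarrow> t powi (- n) * f : P"
proof -
 have *: "t powi (- n) : M" "t powi (- n) ~= 0" using t_M t_nz by (auto intro: M.powi_mem)
 moreover have "ord_at P (t powi (- n)) = - n" by (rule ord_at_eqI[of _ _ 1]) auto
 ultimately show ?thesis using ordge_scale[OF *, of f 0] by (simp add: ordge_0)
qed

lemma vsub_ordge: "vsub K (ordge n)"
 unfolding vsub_def ordge_eq
proof (intro conjI ballI)
 fix c x assume "c : K" "x : ordge n"
 hence "c * (t powi (- n) * x) : P"
  using KP mult_mem[of c "t powi (- n) * x"] unfolding ordge_eq by blast
 thus "t powi (- n) * (c * x) : P" by (simp add: mult_ac)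
qed (auto simp: ordge_eq distrib_left intro: add_mem)

lemma ordge_add: "f : ordge n ==> g : ordge n ==> f + g : ordge n"
 using vsubD(2)[OF vsub_ordge] .

lemma ordge_diff: "f : ordge n ==> g : ordge n ==> f - g : ordge n"
 using K.vsub_diff[OF vsub_ordge] .

lemma ordge_mult: "f : ordge n ==> g : ordge k ==> f * g : ordge (n + k)"
 by (auto simp: ordge_iff ord_mult M.mult_mem)

lemma ordge_mono: "n <= k ==> ordge k \<subseteq> ordge n"
 by (auto simp: ordge_def)

lemma ord_eqI: "f : ordge n ==> f ~: ordge (n + 1) ==> ord_at P f = n"
 by (auto simp: ordge_iff)

lemma ordge_1: "ordge 1 = m"
proof -
 have "f : ordge 1 \<longleftrightarrow> f : (%x. t * x) ` P" for f
 proof -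
  have "f : ordge 1 \<longleftrightarrow> inverse t * f : P" by (simp add: ordge_eq power_int_minus)
  also have "... \<longleftrightarrow> f : (%x. t * x) ` P"
   using t_nz by (auto simp: mult.assoc[symmetric] intro!: image_eqI[of _ _ "inverse t * f"])
  finally show ?thesis .
 qed
 thus ?thesis using t_gen by blast
qed

lemma ord_add_eq:
 assumes "f : M" "f ~= 0" "g : ordge (ord_at P f + 1)"
 shows "ord_at P (f + g) = ord_at P f" "f + g ~= 0"
proof -
 have f: "f : ordge (ord_at P f)" "f ~: ordge (ord_at P f + 1)" using assms by (auto simp: ordge_iff)
 have "f + g : ordge (ord_at P f)" using f(1) assms(3) ordge_mono[of "ord_at P f" "ord_at P f + 1"]
  by (intro ordge_add) auto
 moreover have "f + g ~: ordge (ord_at P f + 1)"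
  using ordge_diff[OF _ assms(3), of "f + g"] f(2) by auto
 ultimately show "ord_at P (f + g) = ord_at P f" by (rule ord_eqI)
 show "f + g ~= 0" using \<open>f + g ~: ordge (ord_at P f + 1)\<close> by (auto simp: ordge_iff)
qed

lemma m_iff_ord: "f : M ==> f ~= 0 ==> f : m \<longleftrightarrow> ord_at P f >= 1"
 unfolding ordge_1[symmetric] by (simp add: ordge_iff)

lemma unit_iff_ord: "f : M ==> f ~= 0 ==> f : P - m \<longleftrightarrow> ord_at P f = 0"
 using ord_ge_0_iff[of f] m_iff_ord[of f] by auto

text \<open>A larger valuation ring would contain 1/t, hence every power of t times a unit, that is,
  all of \<open>M\<close>. Distinct places are therefore incomparable, which starts weak
  approximation.\<close>

lemma maximal:
 assumes "P' : places K M" "P \<subseteq> P'"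
 shows "P' = P"
proof -
 interpret P': vring K M P' by unfold_locales (rule assms)
 have "f : P" if f: "f : P'" for f
 proof (rule ccontr)
  assume "f ~: P"
  hence i: "inverse f : m" "f ~= 0" using notin_P f P'.PM by auto
  then obtain a where a: "a : P" "inverse f = t * a" unfolding t_gen by blast
  hence "inverse t = f * a" using i(2) t_nz by (simp add: field_simps)
  hence it: "inverse t : P'" using f a assms by (auto intro: P'.mult_mem)
  have "M \<subseteq> P'"
  proof
   fix g assume g: "g : M"
   show "g : P'"
   proof (cases "g = 0")
    case False
    obtain u where u: "g = t powi (ord_at P g) * u" "u : P - m" using factor g False by blast
    have "t : P'" "u : P'" using t_m m_P u assms by auto
    thus ?thesis using it by (subst u(1)) (auto simp: power_int_def intro!: P'.mult_mem P'.power_mem)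
   qed auto
  qed
  thus False using P'.PM P'.P_neq by blast
 qed
 thus ?thesis using assms by blast
qed

end

subsection \<open>Function fields with a degree filtration\<close>

text \<open>\<open>W k\<close> plays the role of the functions with poles of order at most \<open>k\<close> at the poles of \<open>r\<close>.
 Its size controls everything else: zeros have bounded degree because \<open>W\<close> is not too big,
 and Riemann's inequality holds because \<open>W\<close> is not too small.\<close>

locale ffield = M: subfld M + K: subfld K for K M :: "'q::{finite,field} ambient set" +
 fixes r :: "'q ambient" and W :: "nat => 'q ambient set" and g0 :: nat
 assumes KM: "K \<subseteq> M" and rM: "r : M" and r_trans: "~ algel K r"
  and K_closed: "f : M ==> algel K f ==> f : K"
  and WM: "W i \<subseteq> M" and vsub_W: "vsub K (W i)" and W_mono: "i <= j ==> W i \<subseteq> W j"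
  and W_mult: "f : W i ==> g : W j ==> f * g : W (i + j)"
  and W_span: "EX S. spans K {0} S (W i) & card S <= 2 * i + 2"
  and W_poly: "pover K p ==> degree p <= i ==> poly p r : W i"
  and W_frac: "f : M ==> EX i a b. a : W i & b : W i & b ~= 0 & f = a / b"
  and W_indep: "\<exists>U\<subseteq>W i. indep K {0} U & 2 * i <= card U + g0"
  and W_finite: "P : places K M ==> r : P ==> W i \<subseteq> P"
  and W_infinite: "P : places K M ==> r ~: P ==> f : W i ==> f * inverse r ^ i : P"
begin

lemma W_one: "1 : W i"
 using W_poly[of 1 i] by simp

lemma W_pow: "f : W i ==> f ^ n : W (n * i)"
 by (induction n) (auto simp: W_one dest: W_mult)

lemma common_denominator:
 assumes "finite U" "U \<subseteq> M"
 shows "EX i b. b : W i & b ~= 0 & (ALL u:U. u * b : W i)"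
 using assms
proof (induction U rule: finite_induct)
 case empty
 thus ?case using W_one by (intro exI[of _ 0] exI[of _ 1]) auto
next
 case (insert x U)
 then obtain i b where b: "b : W i" "b ~= 0" "ALL u:U. u * b : W i" by auto
 obtain j a c where c: "a : W j" "c : W j" "c ~= 0" "x = a / c" using W_frac insert.prems by blast
 have "b * c : W (i + j)" using W_mult b c by blast
 moreover have "u * (b * c) : W (i + j)" if "u : U" for u
  using W_mult[of "u * b" i c j] b c that by (simp add: mult.assoc)
 moreover have "x * (b * c) : W (i + j)" using W_mult[of b i a j] b c by (simp add: mult_ac)
 ultimately show ?case using b c by (intro exI[of _ "i + j"] exI[of _ "b * c"]) auto
qed

text \<open>The inequality [M : K(x)] <= 2c in disguise. After clearing denominators the products of
  elements of \<open>U\<close> with powers of \<open>x\<close> lie in one space \<open>W\<close>,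
  whose dimension grows by only 2c with each further power, while their number grows by at least 2c
  + 1.\<close>

lemma powers_relation:
 assumes x: "x = a / b" "a : W c" "b : W c" "b ~= 0" and U: "finite U" "U \<subseteq> M" "card U > 2 * c"
 shows "EX d L. (ALL p. d p : K) & (EX u:U. EX j<=L. d (u, j) ~= 0) & (\<Sum>u\<in>U. \<Sum>j\<le>L. d (u, j) * (x ^ j * u)) = 0"
proof -
 obtain e \<delta> where \<delta>: "\<delta> : W e" "\<delta> ~= 0" "ALL u:U. u * \<delta> : W e" using common_denominator[OF U(1,2)] by blast
 \<comment> \<open>Large enough that (2c + 1)(L + 1) exceeds the bound 2(Lc + e) + 2 on the
   dimension.\<close>
 define L where "L = 2 * e + 2"
 define v where "v = (%(u, j). x ^ j * u * \<delta> * b ^ L)"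
 obtain S where S: "spans K {0} S (W (L * c + e))" "card S <= 2 * (L * c + e) + 2" using W_span by blast
 let ?I = "U \<times> {..L}"
 have "card ?I = card U * (L + 1)" by (simp add: card_cartesian_product)
 moreover have "(2 * c + 1) * (L + 1) <= card U * (L + 1)" using U(3) by (intro mult_right_mono) auto
 moreover have "2 * (L * c + e) + 2 < (2 * c + 1) * (L + 1)" by (simp add: L_def algebra_simps)
 ultimately have card: "card S < card ?I" using S(2) by linarith
 have v: "v p : W (L * c + e)" if pI: "p : ?I" for p
 proof -
  obtain u j where p: "p = (u, j)" "u : U" "j <= L" using pI by (cases p) auto
  have "x ^ j * b ^ L = a ^ j * b ^ (L - j)"
  proof -
   have "b ^ L = b ^ j * b ^ (L - j)" using p by (simp add: power_add[symmetric])
   thus ?thesis using x by (simp add: power_divide)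
  qed
  hence "v p = a ^ j * b ^ (L - j) * (u * \<delta>)" by (simp add: v_def p mult_ac)
  moreover have "a ^ j * b ^ (L - j) * (u * \<delta>) : W (j * c + (L - j) * c + e)"
   using x \<delta> p by (intro W_mult W_pow) auto
  moreover have "j * c + (L - j) * c = L * c" using p by (simp add: add_mult_distrib[symmetric])
  ultimately show ?thesis by simp
 qed
 obtain d where d: "ALL i. d i : K" "EX i:?I. d i ~= 0" "(\<Sum>i\<in>?I. d i * v i) : {0}"
  using K.spanned_relation[OF vsub_zero S(1) _ card, of v] v U(1) by blast
 have "(\<Sum>i\<in>?I. d i * v i) = (\<Sum>u\<in>U. \<Sum>j\<le>L. d (u, j) * v (u, j))"
  by (simp add: sum.cartesian_product)
 also have "... = (\<Sum>u\<in>U. \<Sum>j\<le>L. d (u, j) * (x ^ j * u)) * (\<delta> * b ^ L)"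
  by (simp add: v_def sum_distrib_left sum_distrib_right mult_ac)
 finally have "(\<Sum>u\<in>U. \<Sum>j\<le>L. d (u, j) * (x ^ j * u)) = 0" using d(3) x(4) \<delta>(2) by auto
 thus ?thesis using d by (intro exI[of _ d] exI[of _ L]) auto
qed

text \<open>A relation between the products x^j u is divided by the lowest power of \<open>x\<close>
  that occurs. What remains is a nontrivial combination of \<open>U\<close> lying in xQ, so Q/xQ has
  dimension at most 2c.\<close>

lemma indep_mod_mult:
 assumes x: "x = a / b" "a : W c" "b : W c" "b ~= 0" "x ~= 0"
  and Q: "vsub K Q" "!!f. f : Q ==> x * f : Q" "Q \<subseteq> M" and U: "indep K ((*) x ` Q) U" "U \<subseteq> Q"
 shows "card U <= 2 * c"
proof (rule ccontr)
 assume "~ ?thesis"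
 hence cU: "card U > 2 * c" by simp
 have fU: "finite U" using U by (simp add: indep_def)
 obtain d L where d: "ALL p. d p : K" "EX u:U. EX j<=L. d (u, j) ~= 0"
  "(\<Sum>u\<in>U. \<Sum>j\<le>L. d (u, j) * (x ^ j * u)) = 0"
  using powers_relation[OF x(1-4) fU order_trans[OF U(2) Q(3)] cU] by blast
 \<comment> \<open>The lowest power of \<open>x\<close> that occurs in the relation.\<close>
 define i where "i = (LEAST j. EX u:U. j <= L & d (u, j) ~= 0)"
 have i: "EX u:U. i <= L & d (u, i) ~= 0"
  unfolding i_def by (rule LeastI_ex) (use d in blast)
 have low: "d (u, j) = 0" if "u : U" "j < i" for u j
  using not_less_Least[of j "%j. EX u:U. j <= L & d (u, j) ~= 0"] that i unfolding i_def[symmetric] by auto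
 have pow: "x ^ n * f : Q" if "f : Q" for n f
  using that Q(2) by (induction n) (auto simp: mult.assoc)
 have "(\<Sum>j\<le>L. d (u, j) * (x ^ j * u)) = x ^ i * (d (u, i) * u + x * (\<Sum>j\<in>{i<..L}. d (u, j) * (x ^ (j - i - 1) * u)))"
  if u: "u : U" for u
 proof -
  have "{..L} = {..<i} \<union> insert i {i<..L}" using i by auto
  hence "(\<Sum>j\<le>L. d (u, j) * (x ^ j * u)) = (\<Sum>j\<in>{..<i} \<union> insert i {i<..L}. d (u, j) * (x ^ j * u))" by simp
  also have "... = (\<Sum>j<i. d (u, j) * (x ^ j * u)) + (\<Sum>j\<in>insert i {i<..L}. d (u, j) * (x ^ j * u))"
   by (rule sum.union_disjoint) auto
  also have "(\<Sum>j<i. d (u, j) * (x ^ j * u)) = 0" using low[OF u] by simp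
  also have "(\<Sum>j\<in>insert i {i<..L}. d (u, j) * (x ^ j * u)) =
   d (u, i) * (x ^ i * u) + (\<Sum>j\<in>{i<..L}. d (u, j) * (x ^ j * u))" by simp
  also have "(\<Sum>j\<in>{i<..L}. d (u, j) * (x ^ j * u)) =
   x ^ i * (x * (\<Sum>j\<in>{i<..L}. d (u, j) * (x ^ (j - i - 1) * u)))"
   unfolding sum_distrib_left
  proof (intro sum.cong refl)
   fix j assume "j : {i<..L}"
   hence "x ^ j = x ^ i * (x * x ^ (j - i - 1))"
    by (simp add: power_add[symmetric] power_Suc[symmetric] del: power_Suc)
   thus "d (u, j) * (x ^ j * u) = x ^ i * (x * (d (u, j) * (x ^ (j - i - 1) * u)))"
    by (simp add: mult_ac)
  qed
  finally show ?thesis by (simp add: distrib_left mult_ac)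
 qed
 hence "0 = (\<Sum>u\<in>U. x ^ i * (d (u, i) * u + x * (\<Sum>j\<in>{i<..L}. d (u, j) * (x ^ (j - i - 1) * u))))"
  using d(3) by simp
 also have "... = x ^ i * ((\<Sum>u\<in>U. d (u, i) * u) + x * (\<Sum>u\<in>U. \<Sum>j\<in>{i<..L}. d (u, j) * (x ^ (j - i - 1) * u)))"
  by (simp only: sum_distrib_left[symmetric] sum.distrib)
 finally have "(\<Sum>u\<in>U. d (u, i) * u) + x * (\<Sum>u\<in>U. \<Sum>j\<in>{i<..L}. d (u, j) * (x ^ (j - i - 1) * u)) = 0"
  using x(5) by simp
 hence "(\<Sum>u\<in>U. d (u, i) * u) = x * (- 1 * (\<Sum>u\<in>U. \<Sum>j\<in>{i<..L}. d (u, j) * (x ^ (j - i - 1) * u)))"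
  by (simp add: eq_neg_iff_add_eq_0)
 moreover have "- 1 * (\<Sum>u\<in>U. \<Sum>j\<in>{i<..L}. d (u, j) * (x ^ (j - i - 1) * u)) : Q"
 proof -
  have "d (u, j) * (x ^ (j - i - 1) * u) : Q" if "u : U" for u j
   using vsubD(3)[OF Q(1)] d(1) pow[of u] U(2) that by blast
  hence "(\<Sum>u\<in>U. \<Sum>j\<in>{i<..L}. d (u, j) * (x ^ (j - i - 1) * u)) : Q"
   by (intro vsub_sum[OF Q(1)])
  thus ?thesis by (rule vsubD(3)[OF Q(1) K.minus_mem[OF K.one_mem]])
 qed
 ultimately have "(\<Sum>u\<in>U. d (u, i) * u) : (*) x ` Q" by (simp only:) (rule imageI)
 hence "ALL u:U. d (u, i) = 0" using indepD[OF U(1), of "%u. d (u, i)"] d(1) by blast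
 thus False using i by blast
qed

lemma frac_bound:
 assumes "x : M"
 obtains a b c where "x = a / b" "a : W c" "b : W c" "b ~= 0"
 using W_frac[OF assms] that by blast

lemma mdim_mod_mult:
 assumes "x : M" "x ~= 0" "vsub K Q" "!!f. f : Q ==> x * f : Q" "Q \<subseteq> M"
 shows "EX n. mdim K Q ((*) x ` Q) n"
proof -
 obtain a b c where c: "x = a / b" "a : W c" "b : W c" "b ~= 0" using frac_bound[OF assms(1)] .
 have "vsub K ((*) x ` Q)" using assms(3) unfolding vsub_def
  by (auto simp: image_iff mult.left_commute intro!: bexI simp flip: distrib_left)
 from K.mdim_exists[OF this indep_mod_mult[OF c assms(2-5)]] show ?thesis by blast
qed

lemma vring: "P : places K M ==> vring K M P"
 by unfold_locales

text \<open>A generator of the maximal ideal is found by minimising the dimension of \<open>P/tP\<close>.\<close>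

lemma ex_uniformizer:
 assumes P: "P : places K M"
 shows "EX t. dvring K M P t"
proof -
 interpret vring K M P by (rule vring[OF P])
 have dimP: "EX n. mdim K P ((*) x ` P) n" if "x : P" "x ~= 0" for x
  using that PM by (intro mdim_mod_mult vsub_P) (auto intro: mult_mem)
 have vs: "vsub K ((*) x ` P)" for x unfolding vsub_def using vsub_P[unfolded vsub_def]
  by (auto simp: image_iff mult.left_commute intro!: bexI simp flip: distrib_left)
 define dm where "dm x = (SOME n. mdim K P ((*) x ` P) n)" for x
 have dm: "mdim K P ((*) x ` P) (dm x)" if "x : P" "x ~= 0" for x
  unfolding dm_def by (rule someI_ex[OF dimP[OF that]])
 \<comment> \<open>P contains yP, and yP strictly contains xP because \<open>z\<close> is not a
   unit; dimensions add along this chain.\<close>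
 have dm_less: "dm y < dm x" if "y : P" "y ~= 0" "x = y * z" "z : m" "z ~= 0" for x y z
 proof -
  have x: "x : P" "x ~= 0" using that m_P by (auto intro: mult_mem)
  have sub: "(*) x ` P \<subseteq> (*) y ` P"
  proof
   fix w assume "w : (*) x ` P"
   then obtain v where v: "w = x * v" "v : P" by blast
   hence "w = y * (z * v)" by (simp add: that(3) mult.assoc)
   moreover have "z * v : P" by (intro mult_mem m_P that v)
   ultimately show "w : (*) y ` P" by blast
  qed
  have subP: "(*) y ` P \<subseteq> P" using that by (auto intro: mult_mem)
  obtain a b where ab: "mdim K P ((*) y ` P) a" "mdim K ((*) y ` P) ((*) x ` P) b" "dm x = a + b"
   using K.mdim_quot[OF vs vs dm[OF x] sub subP] .
  have "a = dm y" by (rule K.mdim_unique[OF vs ab(1) dm[OF that(1,2)]])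
  moreover have "b ~= 0"
  proof
   assume "b = 0"
   hence "(*) y ` P \<subseteq> (*) x ` P" using ab(2) K.mdim_0D by simp
   moreover have "y : (*) y ` P" by (metis imageI mult.right_neutral one_mem)
   ultimately obtain v where v: "v : P" "y = x * v" by blast
   hence "y * (v * z) = y * 1" using that(3) by (simp add: mult_ac)
   hence "v * z = 1" using that(2) by (simp only: mult_cancel_left) simp
   thus False using m_mult[OF that(4) v(1)] one_not_m by simp
  qed
  ultimately show ?thesis using ab(3) by simp
 qed
 obtain x0 where x0: "x0 : m" "x0 ~= 0"
 proof -
  obtain f where "f : M" "f ~: P" using P_neq PM by blast
  thus ?thesis using that[of "inverse f"] notin_P by (metis inverse_nonzero_iff_nonzero zero_mem)
 qed
 obtain t where t: "t : m" "t ~= 0" "!!x. x : m ==> x ~= 0 ==> dm t <= dm x"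
  using x0 ex_has_least_nat[of "%x. x : m & x ~= 0" x0 dm] by blast
 have tP: "t : P" "t : M" using t m_P PM by auto
 have gen: "EX y:P. z = t * y" if z: "z : m" for z
 proof (rule ccontr)
  assume n: "~ ?thesis"
  have z0: "z ~= 0" using n by (metis mult_zero_right zero_mem)
  have zM: "z : P" "z / t : M" using z m_P PM tP by (auto intro!: M.divide_mem)
  have "z / t ~: P" using n t by force
  hence "inverse (z / t) : m" using notin_P zM by blast
  hence "dm z < dm t" using dm_less[of z t "inverse (z / t)"] zM z0 t by simp
  thus False using t(3)[OF z z0] by simp
 qed
 show ?thesis
 proof (intro exI[of _ t] dvring.intro dvring_axioms.intro vring_axioms)
  show "m = (*) t ` P" using gen t m_mult[OF t(1)] by (auto simp: image_iff mult.commute)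
  show "t ~= 0" by fact
  \<comment> \<open>Each division by \<open>t\<close> lowers the dimension of P/fP, so it stops at a
    unit.\<close>
  show "EX n u. f = t ^ n * u & u : P - m" if "f : P" "f ~= 0" for f
   using that
  proof (induction "dm f" arbitrary: f rule: less_induct)
   case less
   show ?case
   proof (cases "f : m")
    case True
    then obtain g where g: "g : P" "f = t * g" using gen by blast
    hence "g ~= 0" "dm g < dm f" using less.prems dm_less[of g f t] t by (auto simp: mult.commute)
    then obtain n u where nu: "g = t ^ n * u" "u : P - m" using less.hyps g by blast
    hence "f = t ^ Suc n * u" using g by (simp add: mult_ac)
    thus ?thesis using nu(2) by blast
   next
    case False
    thus ?thesis using less.prems by (intro exI[of _ 0] exI[of _ f]) simp
   qed
  qed
 qed
qed

definition unif :: "'q ambient set => 'q ambient" where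
 "unif P = (SOME t. dvring K M P t)"

lemma dvring: "P : places K M ==> dvring K M P (unif P)"
 unfolding unif_def by (rule someI_ex[OF ex_uniformizer])

definition og :: "'q ambient set => int => 'q ambient set" where
 "og P n = {f : M. f = 0 \<or> n <= ord_at P f}"

lemma og_eq: "P : places K M ==> og P n = dvring.ordge M P n"
 using dvring[of P] by (simp add: og_def dvring.ordge_def)

subsection \<open>Residue degrees\<close>

definition dg :: "'q ambient set => nat" where
 "dg P = (THE n. mdim K P (max_ideal P) n)"

lemma dg:
 assumes P: "P : places K M"
 shows "mdim K P (max_ideal P) (dg P)" "dg P > 0"
proof -
 interpret dvring K M P "unif P" by (rule dvring[OF P])
 have "EX n. mdim K P ((*) (unif P) ` P) n"
  using t_M t_nz t_m m_P by (intro mdim_mod_mult vsub_P PM) (auto intro: mult_mem)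
 then obtain n where n: "mdim K P m n" unfolding t_gen by blast
 hence "dg P = n" unfolding dg_def
  by (rule the_equality) (use K.mdim_unique[OF vsub_m n] in blast)
 thus "mdim K P m (dg P)" using n by simp
 show "dg P > 0"
 proof (rule ccontr)
  assume "~ ?thesis"
  hence "P \<subseteq> m" using n \<open>dg P = n\<close> K.mdim_0D by simp
  thus False using one_mem one_not_m by blast
 qed
qed

text \<open>Multiplication by the power -n of a uniformizer carries the quotient of
  \<open>og P n\<close> by \<open>og P (n + 1)\<close> to the residue field P/m, of dimension
  \<open>dg P\<close>.\<close>

lemma indep_og_le:
 assumes P: "P : places K M" and U: "indep K Z U" "U \<subseteq> V" "vsub K V" "V \<subseteq> og P n"
  and Z: "!!f. f : V ==> f : og P (n + 1) ==> f : Z"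
 shows "card U <= dg P"
proof -
 interpret dvring K M P "unif P" by (rule dvring[OF P])
 define x where "x = unif P powi (- n)"
 have x: "x ~= 0" "x : M" using t_nz t_M by (auto simp: x_def intro: M.powi_mem)
 have ox: "ord_at P x = - n" unfolding x_def by (rule ord_at_eqI[of _ _ 1]) auto
 have sc: "x * v : ordge k \<longleftrightarrow> v : ordge (k + n)" for v k using ordge_scale[OF x(2,1), of v k] ox by simp
 have "indep K m ((*) x ` U)" "card ((*) x ` U) = card U"
 proof (rule K.indep_scale[OF U(1-3) x(1)])
  fix v assume "v : V" "x * v : m"
  thus "v : Z" using Z sc[of v 1] unfolding ordge_1[symmetric] og_eq[OF P] by (simp add: add.commute)
 qed (rule K.indep_scale(2)[OF U(1-3) x(1)], use Z sc ordge_1 og_eq[OF P] in \<open>auto simp: add.commute\<close>)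
 moreover have "(*) x ` U \<subseteq> P"
  using U(2,4) sc[of _ 0] unfolding ordge_0 og_eq[OF P] by auto
 ultimately show ?thesis using K.mdim_indep_le[OF vsub_m dg(1)[OF P]] by metis
qed

end

lemma (in subfld) family_indep:
 assumes fin: "finite I"
  and ind: "!!c. (!!i. i : I ==> c i : k) ==> (\<Sum>i\<in>I. c i * g i) : W ==> ALL i:I. c i = 0"
  and W: "0 : W"
 shows "indep k W (g ` I)" "card (g ` I) = card I"
proof -
 have inj: "inj_on g I"
 proof (rule ccontr)
  assume "~ ?thesis"
  then obtain i j where ij: "i : I" "j : I" "i ~= j" "g i = g j" by (auto simp: inj_on_def)
  have "(\<Sum>l\<in>I. (if l = i then 1 else if l = j then - 1 else 0) * g l) =
   (\<Sum>l\<in>I. if l = i then g l else 0) - (\<Sum>l\<in>I. if l = j then g l else 0)"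
   unfolding sum_subtractf[symmetric] using ij by (intro sum.cong) auto
  also have "... = 0" using ij fin by simp
  finally have "ALL l:I. (if l = i then 1 else if l = j then - 1 else 0) = (0::'a)"
   by (intro ind) (auto intro: minus_mem simp: W)
  thus False using ij by auto
 qed
 thus "card (g ` I) = card I" by (rule card_image)
 show "indep k W (g ` I)" unfolding indep_def
 proof (intro conjI allI impI)
  fix c assume c: "ALL u:g ` I. c u : k" "(\<Sum>u\<in>g ` I. c u * u) : W"
  have "(\<Sum>i\<in>I. c (g i) * g i) : W" using c(2) unfolding sum.reindex[OF inj] by simp
  hence "ALL i:I. c (g i) = 0" using c(1) by (intro ind[of "%i. c (g i)"]) auto
  thus "ALL u:g ` I. c u = 0" by auto
 qed (use fin in simp)
qed

context ffield
begin

subsection \<open>Weak approximation\<close>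

lemma ogD:
 assumes P: "P : places K M"
 shows "vsub K (og P n)" and "f : og P n ==> g : og P n ==> f + g : og P n"
  and "f : og P n ==> g : og P n ==> f - g : og P n"
  and "f : og P n ==> g : og P k ==> f * g : og P (n + k)"
  and "n <= k ==> og P k \<subseteq> og P n" and "og P 0 = P" and "og P 1 = max_ideal P"
  and "x : M ==> x ~= 0 ==> x * f : og P n \<longleftrightarrow> f : og P (n - ord_at P x)"
proof -
 interpret dvring K M P "unif P" by (rule dvring[OF P])
 note [simp] = og_eq[OF P]
 show "vsub K (og P n)" "f : og P n ==> g : og P n ==> f + g : og P n"
  "f : og P n ==> g : og P n ==> f - g : og P n"
  "f : og P n ==> g : og P k ==> f * g : og P (n + k)"
  "n <= k ==> og P k \<subseteq> og P n" "og P 0 = P" "og P 1 = max_ideal P"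
  "x : M ==> x ~= 0 ==> x * f : og P n \<longleftrightarrow> f : og P (n - ord_at P x)"
  using vsub_ordge ordge_add ordge_diff ordge_mult ordge_mono ordge_0 ordge_1 ordge_scale by simp_all
qed

lemma ord_facts:
 assumes P: "P : places K M" and f: "f : M" "f ~= 0"
 shows "g : M ==> g ~= 0 ==> ord_at P (f * g) = ord_at P f + ord_at P g"
  "g : M ==> g ~= 0 ==> ord_at P (f / g) = ord_at P f - ord_at P g"
  "ord_at P (inverse f) = - ord_at P f" "ord_at P (f ^ n) = int n * ord_at P f"
  "ord_at P 1 = 0" "f : K ==> ord_at P f = 0" "ord_at P f >= 0 \<longleftrightarrow> f : P"
  "ord_at P f >= 1 \<longleftrightarrow> f : max_ideal P"
  "g : og P (ord_at P f + 1) ==> ord_at P (f + g) = ord_at P f & f + g ~= 0"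
proof -
 interpret dvring K M P "unif P" by (rule dvring[OF P])
 show "g : M ==> g ~= 0 ==> ord_at P (f * g) = ord_at P f + ord_at P g"
  "g : M ==> g ~= 0 ==> ord_at P (f / g) = ord_at P f - ord_at P g"
  "ord_at P (inverse f) = - ord_at P f" "ord_at P (f ^ n) = int n * ord_at P f"
  "ord_at P 1 = 0" "f : K ==> ord_at P f = 0" "ord_at P f >= 0 \<longleftrightarrow> f : P"
  "ord_at P f >= 1 \<longleftrightarrow> f : max_ideal P"
  "g : og P (ord_at P f + 1) ==> ord_at P (f + g) = ord_at P f & f + g ~= 0"
  using f ord_mult ord_divide ord_inverse ord_power ord_K ord_ge_0_iff m_iff_ord ord_add_eq og_eq[OF P]
  by simp_all
qed

lemma separate2:
 assumes P: "P : places K M" and Q: "Q : places K M" and PQ: "P ~= Q"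
 shows "EX f:M. f ~= 0 & ord_at P f > 0 & ord_at Q f < 0"
proof -
 have "~ P \<subseteq> Q" "~ Q \<subseteq> P" using dvring.maximal[OF dvring[OF P] Q] dvring.maximal[OF dvring[OF Q] P] PQ by blast+
 then obtain a b where ab: "a : P" "a ~: Q" "b : Q" "b ~: P" by blast
 have M: "a : M" "b : M" using ab P Q by (auto simp: places_iff)
 have nz: "a ~= 0" "b ~= 0" using ab P Q by (auto simp: places_iff intro: subrng.zero_mem)
 have "ord_at P a >= 0" "ord_at Q a < 0" "ord_at Q b >= 0" "ord_at P b < 0"
  using ord_facts(7)[OF P] ord_facts(7)[OF Q] ab M nz by force+
 thus ?thesis using ord_facts(2)[OF P M(1) nz(1) M(2) nz(2)] ord_facts(2)[OF Q M(1) nz(1) M(2) nz(2)] M nz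
  by (intro bexI[of _ "a / b"]) (auto intro: M.divide_mem)
qed

text \<open>The new place is treated by adding a power of \<open>w\<close> to \<open>u\<close>. The
  exponent exceeds all orders of \<open>u\<close> on \<open>S\<close> in absolute value, so at each
  place the two orders differ and the smaller one wins.\<close>

lemma separate:
 assumes P: "P : places K M" and S: "finite S" "S \<subseteq> places K M" "P ~: S"
 shows "EX u:M. u ~= 0 & ord_at P u > 0 & (ALL Q:S. ord_at Q u < 0)"
 using S
proof (induction S rule: finite_induct)
 case empty
 interpret dvring K M P "unif P" by (rule dvring[OF P])
 show ?case using t_M t_nz ord_t by (intro bexI[of _ "unif P"]) auto
next
 case (insert Q S)
 then obtain u where u: "u : M" "u ~= 0" "ord_at P u > 0" "ALL Q:S. ord_at Q u < 0" by auto
 have Q: "Q : places K M" using insert by auto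
 obtain w where w: "w : M" "w ~= 0" "ord_at P w > 0" "ord_at Q w < 0" using separate2[OF P Q] insert by auto
 show ?case
 proof (cases "ord_at Q u < 0")
  case False
  define k where "k = Suc (nat (\<Sum>Q\<in>S. \<bar>ord_at Q u\<bar>))"
  have k: "int k > \<bar>ord_at R u\<bar>" if "R : S" for R
  proof -
   have "\<bar>ord_at R u\<bar> <= (\<Sum>Q\<in>S. \<bar>ord_at Q u\<bar>)"
    using that insert.hyps(1) by (intro member_le_sum) auto
   thus ?thesis unfolding k_def by linarith
  qed
  have wk: "w ^ k : M" "w ^ k ~= 0" using w by (auto intro: M.power_mem)
  have ordk: "ord_at R (w ^ k) = int k * ord_at R w" if "R : places K M" for R
   using ord_facts(4)[OF that w(1,2)] .
  have "int k * ord_at Q w <= 1 * ord_at Q w" using w(4) by (intro mult_right_mono_neg) (auto simp: k_def)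
  hence oQ: "ord_at Q (w ^ k) < 0" using ordk[OF Q] w(4) by linarith
  have "u : og Q (ord_at Q (w ^ k) + 1)" using oQ False u by (simp add: og_def)
  hence sQ: "ord_at Q (w ^ k + u) = ord_at Q (w ^ k)" "w ^ k + u ~= 0" using ord_facts(9)[OF Q wk] by blast+
  have "int k * ord_at P w >= 1 * ord_at P w" using w(3) by (intro mult_right_mono) (auto simp: k_def)
  hence "ord_at P (w ^ k) >= 1" using w(3) ordk[OF P] by linarith
  hence "w ^ k : og P 1" "u : og P 1" using u wk by (auto simp: og_def)
  hence "w ^ k + u : og P 1" by (rule ogD(2)[OF P])
  hence sP: "ord_at P (w ^ k + u) > 0" using sQ by (simp add: og_def)
  have "ord_at R (w ^ k + u) < 0" if R: "R : S" for R
  proof -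
   have RP: "R : places K M" using R insert by auto
   have "ord_at R (w ^ k) ~= ord_at R u"
   proof (cases "ord_at R w = 0")
    case True
    thus ?thesis using u(4) R ordk[OF RP] by auto
   next
    case False
    hence "int k * 1 <= int k * \<bar>ord_at R w\<bar>" by (intro mult_left_mono) auto
    hence "\<bar>ord_at R u\<bar> < \<bar>ord_at R (w ^ k)\<bar>" using k[OF R] ordk[OF RP] by (simp add: abs_mult)
    thus ?thesis by auto
   qed
   then consider "ord_at R (w ^ k) < ord_at R u" | "ord_at R u < ord_at R (w ^ k)" by linarith
   thus ?thesis
   proof cases
    case 1
    hence "u : og R (ord_at R (w ^ k) + 1)" using u by (simp add: og_def)
    thus ?thesis using ord_facts(9)[OF RP wk] 1 u(4) R by fastforce
   next
    case 2
    hence "w ^ k : og R (ord_at R u + 1)" using wk by (simp add: og_def)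
    thus ?thesis using ord_facts(9)[OF RP u(1,2)] u(4) R by (fastforce simp: add.commute)
   qed
  qed
  thus ?thesis using sP sQ oQ wk u by (intro bexI[of _ "w ^ k + u"]) (auto intro: M.add_mem)
 qed (use u in auto)
qed

text \<open>If \<open>u\<close> vanishes at \<open>P\<close> and has poles on \<open>S\<close>, then
  1/(1 + u^k) tends to 1 at \<open>P\<close> and to 0 on \<open>S\<close> as k grows.\<close>

lemma approx_one:
 assumes P: "P : places K M" and S: "finite S" "S \<subseteq> places K M" "P ~: S"
 shows "EX w:M. w - 1 : og P n & (ALL Q:S. w : og Q n)"
proof -
 obtain u where u: "u : M" "u ~= 0" "ord_at P u > 0" "ALL Q:S. ord_at Q u < 0" using separate[OF assms] by blast
 define k where "k = Suc (nat n)"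
 have k: "int k >= 1" "int k >= n" by (simp_all add: k_def)
 have uk: "u ^ k : M" "u ^ k ~= 0" using u by (auto intro: M.power_mem)
 have ordk: "ord_at R (u ^ k) = int k * ord_at R u" if "R : places K M" for R
  using ord_facts(4)[OF that u(1,2)] .
 define d where "d = 1 + u ^ k"
 have dM: "d : M" using uk by (auto simp: d_def intro: M.add_mem)
 have "int k * 1 <= int k * ord_at P u" using u(3) by (intro mult_left_mono) auto
 hence kP: "ord_at P (u ^ k) >= int k" using ordk[OF P] by simp
 have "u ^ k : og P (ord_at P 1 + 1)" using kP k uk ord_facts(5)[OF P u(1,2)] by (simp add: og_def)
 hence d: "ord_at P d = 0" "d ~= 0"
  using ord_facts(9)[OF P M.one_mem] ord_facts(5)[OF P u(1,2)] unfolding d_def by auto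
 have e: "inverse d - 1 = - (u ^ k / d)" using d(2) by (simp add: d_def field_simps)
 have "ord_at P (u ^ k / d) = ord_at P (u ^ k)" using ord_facts(2)[OF P uk dM d(2)] d by simp
 hence "u ^ k / d : og P n" using kP k uk dM by (auto simp: og_def intro: M.divide_mem)
 hence "0 - u ^ k / d : og P n" by (intro ogD(3)[OF P]) (auto simp: og_def)
 moreover have "inverse d : og Q n" if "Q : S" for Q
 proof -
  have Q: "Q : places K M" "ord_at Q u < 0" using that S u by auto
  have "int k * ord_at Q u <= int k * (- 1)" using Q(2) by (intro mult_left_mono) auto
  hence kQ: "ord_at Q (u ^ k) <= - int k" using ordk[OF Q(1)] by simp
  hence "1 : og Q (ord_at Q (u ^ k) + 1)" using k ord_facts(5)[OF Q(1) u(1,2)] by (simp add: og_def)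
  hence "ord_at Q d = ord_at Q (u ^ k)"
   using ord_facts(9)[OF Q(1) uk] by (simp add: d_def add.commute)
  hence "ord_at Q (inverse d) >= int k" using ord_facts(3)[OF Q(1) dM d(2)] kQ by simp
  thus ?thesis using dM k by (auto simp: og_def intro: M.inverse_mem)
 qed
 ultimately show ?thesis using dM e by (intro bexI[of _ "inverse d"]) (auto intro: M.inverse_mem)
qed

lemma approx:
 assumes P: "P : places K M" and S: "finite S" "S \<subseteq> places K M" "P ~: S" and f: "f : M"
 shows "EX g:M. g - f : og P n & (ALL Q:S. g : og Q n)"
proof (cases "f = 0")
 case True
 thus ?thesis by (intro bexI[of _ 0]) (auto simp: og_def)
next
 case False
 define n' where "n' = n + \<bar>ord_at P f\<bar> + (\<Sum>Q\<in>S. \<bar>ord_at Q f\<bar>)"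
 obtain w where w: "w : M" "w - 1 : og P n'" "ALL Q:S. w : og Q n'" using approx_one[OF P S] by blast
 have s0: "(\<Sum>Q\<in>S. \<bar>ord_at Q f\<bar>) >= 0" by (intro sum_nonneg) auto
 have "f * (w - 1) : og P n"
  unfolding ogD(8)[OF P f False] by (rule subsetD[OF ogD(5)[OF P] w(2)]) (use s0 abs_ge_minus_self[of "ord_at P f"] in \<open>unfold n'_def, linarith\<close>)
 moreover have "f * w : og Q n" if Q: "Q : S" for Q
 proof -
  have QP: "Q : places K M" using Q S by auto
  have "\<bar>ord_at Q f\<bar> <= (\<Sum>Q\<in>S. \<bar>ord_at Q f\<bar>)" using Q S(1) by (intro member_le_sum) auto
  hence "n - ord_at Q f <= n'" by (simp add: n'_def)
  thus ?thesis unfolding ogD(8)[OF QP f False] using ogD(5)[OF QP] w(3) Q by blast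
 qed
 ultimately show ?thesis using f w(1) by (intro bexI[of _ "f * w"]) (auto simp: right_diff_distrib intro: M.mult_mem)
qed

text \<open>Riemann-Roch spaces with conditions at the places of \<open>S\<close> only. There is no
  global obstruction, so by approximation the dimensions of their quotients are exactly the expected
  ones.\<close>

definition OS :: "'q ambient set set => ('q ambient set => int) => 'q ambient set" where
 "OS S A = {f : M. ALL Q:S. f : og Q (- A Q)}"

lemma vsub_OS: "S \<subseteq> places K M ==> vsub K (OS S A)"
 unfolding vsub_def OS_def using ogD(1) KM unfolding vsub_def by (auto intro: M.add_mem M.mult_mem)

text \<open>The upper bound is the dimension of the residue field. For the lower bound, a basis of
  the residue field is scaled to the right order at \<open>P\<close> and approximated by functions
  that are small at the rest of \<open>S\<close>.\<close>

lemma mdim_OS_step: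
 assumes S: "finite S" "S \<subseteq> places K M" and P: "P : S"
 shows "mdim K (OS S (A(P := A P + 1))) (OS S A) (dg P)"
proof -
 have PP: "P : places K M" using S P by blast
 interpret dvring K M P "unif P" by (rule dvring[OF PP])
 define V where "V = OS S (A(P := A P + 1))"
 have "V \<subseteq> og P (- (A P + 1))" using P by (auto simp: V_def OS_def)
 moreover have "f : OS S A" if "f : V" "f : og P (- (A P + 1) + 1)" for f
  using that by (auto simp: V_def OS_def split: if_splits)
 ultimately have bd: "card U <= dg P" if "indep K (OS S A) U" "U \<subseteq> V" for U
  using indep_og_le[OF PP that, of "- (A P + 1)"] vsub_OS[OF S(2)] by (simp add: V_def)
 obtain n where n: "n <= dg P" "mdim K V (OS S A) n" using K.mdim_exists[OF vsub_OS[OF S(2)]] bd by metis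
 obtain U where U: "indep K m U" "U \<subseteq> P" "card U = dg P" using dg(1)[OF PP] by (auto simp: mdim_def)
 define y where "y = unif P powi (- (A P + 1))"
 have y: "y : M" "y ~= 0" "ord_at P y = - (A P + 1)"
  unfolding y_def using t_M t_nz by (auto intro: M.powi_mem ord_at_eqI[of _ _ 1])
 \<comment> \<open>A precision that exceeds every bound occurring in \<open>A\<close>, so the
   approximation error satisfies all the conditions on \<open>S\<close>.\<close>
 define N where "N = \<bar>A P\<bar> + (\<Sum>Q\<in>S. \<bar>A Q\<bar>)"
 have s0: "(\<Sum>Q\<in>S. \<bar>A Q\<bar>) >= 0" by (intro sum_nonneg) auto
 have "EX g. ALL u:U. g u : M & g u - y * u : og P N & (ALL Q:S - {P}. g u : og Q N)"
 proof (rule bchoice, rule ballI)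
  fix u assume "u : U"
  hence "y * u : M" using U PM y by (auto intro: M.mult_mem)
  thus "EX g. g : M & g - y * u : og P N & (ALL Q:S - {P}. g : og Q N)"
   using approx[OF PP, of "S - {P}" "y * u" N] S by auto
 qed
 then obtain g where g: "!!u. u : U ==> g u : M" "!!u. u : U ==> g u - y * u : og P N"
  "!!u Q. u : U ==> Q : S - {P} ==> g u : og Q N" by blast
 have gP: "g u - y * u : og P (- A P)" if "u : U" for u
  by (rule subsetD[OF ogD(5)[OF PP] g(2)[OF that]]) (use s0 abs_ge_minus_self[of "A P"] in \<open>unfold N_def, linarith\<close>)
 have yP: "y * v : og P (- A P - 1) \<longleftrightarrow> v : P" "y * v : og P (- A P) \<longleftrightarrow> v : m" for v
  unfolding ogD(8)[OF PP y(1,2)] y(3) using ogD(6,7)[OF PP] by simp_all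
 have gV: "g u : V" if u: "u : U" for u
 proof -
  have "g u - y * u : og P (- A P - 1)" using gP[OF u] ogD(5)[OF PP, of "- A P - 1" "- A P"] by auto
  moreover have "y * u : og P (- A P - 1)" using yP(1) U u by blast
  ultimately have "g u - y * u + y * u : og P (- A P - 1)" by (rule ogD(2)[OF PP])
  hence 1: "g u : og P (- (A P + 1))" by simp
  have "g u : og Q (- A Q)" if Q: "Q : S - {P}" for Q
  proof -
   have "\<bar>A Q\<bar> <= (\<Sum>Q\<in>S. \<bar>A Q\<bar>)" using Q S(1) by (intro member_le_sum) auto
   hence "- A Q <= N" by (simp add: N_def)
   thus ?thesis using ogD(5)[of Q "- A Q" N] g(3)[OF u Q] Q S by blast
  qed
  thus ?thesis using 1 g(1)[OF u] unfolding V_def OS_def by auto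
 qed
 have fam: "ALL u:U. c u = 0" if c: "!!u. u : U ==> c u : K" "(\<Sum>u\<in>U. c u * g u) : OS S A" for c
 proof -
  have 1: "(\<Sum>u\<in>U. c u * g u) : og P (- A P)" using P c(2) by (simp add: OS_def)
  have 2: "(\<Sum>u\<in>U. c u * (g u - y * u)) : og P (- A P)"
   using c gP by (intro vsub_sum[OF ogD(1)[OF PP]] vsubD(3)[OF ogD(1)[OF PP]])
  have "(\<Sum>u\<in>U. c u * g u) - (\<Sum>u\<in>U. c u * (g u - y * u)) = y * (\<Sum>u\<in>U. c u * u)"
   by (simp add: sum_subtractf[symmetric] right_diff_distrib sum_distrib_left mult_ac)
  hence "y * (\<Sum>u\<in>U. c u * u) : og P (- A P)" using ogD(3)[OF PP 1 2] by simp
  thus ?thesis using yP(2) indepD[OF U(1), of c] c(1) by blast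
 qed
 have fU: "finite U" using U(1) by (simp add: indep_def)
 have "indep K (OS S A) (g ` U)" "card (g ` U) = card U"
  using K.family_indep[OF fU fam vsubD(1)[OF vsub_OS[OF S(2)]]] by blast+
 hence "dg P <= n" using K.mdim_indep_le[OF vsub_OS[OF S(2)] n(2), of "g ` U"] gV U(3) by force
 thus ?thesis using n unfolding V_def by simp
qed

lemma mdim_OS:
 assumes S: "finite S" "S \<subseteq> places K M"
 shows "mdim K (OS S (%P. B P + int (E P))) (OS S B) (\<Sum>P\<in>S. E P * dg P)"
proof (induction "\<Sum>P\<in>S. E P" arbitrary: E)
 case 0
 hence "ALL P:S. E P = 0" using S by auto
 hence "OS S (%P. B P + int (E P)) = OS S B" by (auto simp: OS_def)
 moreover have "(\<Sum>P\<in>S. E P * dg P) = 0" using \<open>ALL P:S. E P = 0\<close> by simp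
 ultimately show ?case using K.mdim_refl[OF vsub_OS[OF S(2)], of "OS S B" B] by simp
next
 case (Suc n)
 then obtain P where P: "P : S" "E P > 0" by (metis gr0I sum.neutral zero_neq_one nat.distinct(1))
 define E' where "E' = E(P := E P - 1)"
 have E: "E = E'(P := E' P + 1)" using P by (auto simp: E'_def)
 have sumE: "(\<Sum>Q\<in>S. E Q * h Q) = (\<Sum>Q\<in>S. E' Q * h Q) + h P" for h :: "'q ambient set => nat"
  using S(1) P(1) by (subst E) (simp add: sum.remove[of S P] algebra_simps)
 have "n = (\<Sum>P\<in>S. E' P)" using sumE[of "%_. 1"] Suc(2) by simp
 from Suc(1)[OF this] have 1: "mdim K (OS S (%P. B P + int (E' P))) (OS S B) (\<Sum>P\<in>S. E' P * dg P)" .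
 have "(%Q. B Q + int (E Q)) = (%Q. B Q + int (E' Q))(P := B P + int (E' P) + 1)" by (subst E) auto
 hence 2: "mdim K (OS S (%P. B P + int (E P))) (OS S (%P. B P + int (E' P))) (dg P)"
  using mdim_OS_step[OF S P(1), of "%P. B P + int (E' P)"] by simp
 have sub: "OS S A \<subseteq> OS S A'" if "!!P. A P <= A' P" for A A'
  using that ogD(5) S(2) unfolding OS_def by (smt (verit) Collect_mono_iff neg_le_iff_le subsetD)
 have le: "OS S (%P. B P + int (E' P)) \<subseteq> OS S (%P. B P + int (E P))" by (rule sub) (simp add: E'_def)
 have ge: "OS S B \<subseteq> OS S (%P. B P + int (E' P))" by (rule sub) simp
 from K.mdim_add[OF vsub_OS[OF S(2)] vsub_OS[OF S(2)] ge le 2 1] show ?case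
  using sumE[of dg] by (simp add: add.commute)
qed

text \<open>Let Q be the functions regular on \<open>S\<close>. The quotient Q/xQ has the left-hand
  side as its dimension by \<open>mdim_OS\<close>, and dimension at most 2c by
  \<open>indep_mod_mult\<close>.\<close>

lemma zeros_bound:
 assumes x: "x = a / b" "a : W c" "b : W c" "b ~= 0" "x ~= 0"
  and S: "finite S" "S \<subseteq> places K M" "!!P. P : S ==> ord_at P x >= 0"
 shows "(\<Sum>P\<in>S. ord_at P x * int (dg P)) <= 2 * int c"
proof -
 have xM: "x : M" using x WM by (auto intro!: M.divide_mem)
 define B where "B P = - ord_at P x" for P
 define E where "E P = nat (ord_at P x)" for P
 let ?Q = "OS S (%_. 0)"
 have "OS S (%P. B P + int (E P)) = ?Q" using S(3) by (auto simp: OS_def B_def E_def)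
 hence 1: "mdim K ?Q (OS S B) (\<Sum>P\<in>S. E P * dg P)" using mdim_OS[OF S(1,2), of B E] by simp
 have sc: "x * f : OS S B \<longleftrightarrow> f : ?Q" if "f : M" for f
  using ogD(8)[OF _ xM x(5), of _ f] that xM S(2) by (auto simp: OS_def B_def M.mult_mem subset_iff)
 have QM: "?Q \<subseteq> M" by (auto simp: OS_def)
 have B: "OS S B = (*) x ` ?Q"
 proof (intro equalityI subsetI)
  fix f assume f: "f : OS S B"
  hence fx: "f / x : M" using xM by (auto simp: OS_def intro: M.divide_mem)
  have "f = x * (f / x)" using x(5) by simp
  thus "f : (*) x ` ?Q" using sc[OF fx] f by (metis imageI)
 qed (use sc QM in auto)
 have "x * f : ?Q" if "f : ?Q" for f
 proof -
  have "x * f : OS S B" using sc that QM by blast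
  thus ?thesis using S ogD(5)[of _ 0] unfolding OS_def B_def by fastforce
 qed
 from indep_mod_mult[OF x vsub_OS[OF S(2)] this QM]
 have le: "card U <= 2 * c" if "indep K (OS S B) U" "U \<subseteq> ?Q" for U using that B by simp
 obtain U where "indep K (OS S B) U" "U \<subseteq> ?Q" "card U = (\<Sum>P\<in>S. E P * dg P)"
  using 1 unfolding mdim_def by blast
 hence "(\<Sum>P\<in>S. E P * dg P) <= 2 * c" using le by metis
 hence "int (\<Sum>P\<in>S. E P * dg P) <= 2 * int c" by linarith
 thus ?thesis using S(3) by (simp add: E_def)
qed

lemma finite_zeros:
 assumes "x : M" "x ~= 0"
 shows "finite {P : places K M. ord_at P x > 0}"
proof (rule ccontr)
 obtain a b c where c: "x = a / b" "a : W c" "b : W c" "b ~= 0" using frac_bound[OF assms(1)] .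
 assume "infinite {P : places K M. ord_at P x > 0}"
 then obtain S where S: "finite S" "card S = 2 * c + 1" "S \<subseteq> {P : places K M. ord_at P x > 0}"
  using infinite_arbitrarily_large by blast
 have "(\<Sum>P\<in>S. 1) <= (\<Sum>P\<in>S. ord_at P x * int (dg P))"
 proof (rule sum_mono)
  fix P assume "P : S"
  hence "ord_at P x >= 1" "dg P >= 1" using S dg(2)[of P] by auto
  hence "1 * 1 <= ord_at P x * int (dg P)" by (intro mult_mono) auto
  thus "1 <= ord_at P x * int (dg P)" by simp
 qed
 also have "... <= 2 * int c" using S by (intro zeros_bound[OF c assms(2)]) auto
 finally show False using S by simp
qed

lemma finite_ord:
 assumes "x : M" "x ~= 0"
 shows "finite {P : places K M. ord_at P x ~= 0}"
proof -
 have "{P : places K M. ord_at P x ~= 0} \<subseteq>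
  {P : places K M. ord_at P x > 0} \<union> {P : places K M. ord_at P (inverse x) > 0}"
  using ord_facts(3)[OF _ assms] by auto
 thus ?thesis using finite_zeros[OF assms] finite_zeros[of "inverse x"] assms M.inverse_mem
  by (meson finite_UnI finite_subset inverse_nonzero_iff_nonzero)
qed

end

lemma lookup_Abs: "finite {P. f P ~= 0} ==> Poly_Mapping.lookup (Abs_poly_mapping f) P = f P"
 by simp

context ffield
begin

subsection \<open>Divisors\<close>

definition isdiv :: "'q divisor => bool" where
 "isdiv D \<longleftrightarrow> Poly_Mapping.keys D \<subseteq> places K M"

definition degd :: "'q divisor => int" where
 "degd D = (\<Sum>P\<in>Poly_Mapping.keys D. Poly_Mapping.lookup D P * int (dg P))"

abbreviation lk where "lk \<equiv> Poly_Mapping.lookup"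

lemma degd_superset: "finite S ==> Poly_Mapping.keys D \<subseteq> S ==> degd D = (\<Sum>P\<in>S. lk D P * int (dg P))"
 unfolding degd_def by (intro sum.mono_neutral_left) (auto simp: in_keys_iff)

lemma degd_add: "degd (D + E) = degd D + degd E"
proof -
 let ?S = "Poly_Mapping.keys D \<union> Poly_Mapping.keys E"
 have "Poly_Mapping.keys (D + E) \<subseteq> ?S" by (rule Poly_Mapping.keys_add)
 thus ?thesis using degd_superset[of ?S D] degd_superset[of ?S E] degd_superset[of ?S "D + E"]
  by (simp add: lookup_add sum.distrib algebra_simps)
qed

lemma degd_minus: "degd (- D) = - degd D"
 by (simp add: degd_def sum_negf)

lemma degd_diff: "degd (D - E) = degd D - degd E"
 using degd_add[of D "- E"] degd_minus[of E] by simp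

lemma degd_0 [simp]: "degd 0 = 0"
 by (simp add: degd_def)

lemma degd_frag_of: "degd (frag_of P) = int (dg P)"
 by (simp add: degd_def)

lemma degd_cmul: "degd (frag_cmul k D) = k * degd D"
proof -
 have "Poly_Mapping.keys (frag_cmul k D) \<subseteq> Poly_Mapping.keys D" by (rule keys_cmul)
 thus ?thesis using degd_superset[of "Poly_Mapping.keys D" "frag_cmul k D"]
  by (simp add: degd_def sum_distrib_left mult.assoc)
qed

lemma isdivI: "(!!P. lk D P ~= 0 ==> P : places K M) ==> isdiv D"
 by (auto simp: isdiv_def in_keys_iff)

lemma isdivD: "isdiv D ==> lk D P ~= 0 ==> P : places K M"
 by (auto simp: isdiv_def in_keys_iff)

lemma isdiv_intros: "isdiv 0" "isdiv D ==> isdiv E ==> isdiv (D + E)" "isdiv D ==> isdiv (- D)"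
 "isdiv D ==> isdiv E ==> isdiv (D - E)" "isdiv D ==> isdiv (frag_cmul k D)" "P : places K M ==> isdiv (frag_of P)"
 using Poly_Mapping.keys_add[of D E] keys_diff[of D E] keys_cmul[of k D] unfolding isdiv_def by auto

lemma degd_nonneg: "(!!P. lk D P >= 0) ==> degd D >= 0"
 unfolding degd_def by (intro sum_nonneg) auto

definition pdiv :: "'q ambient => 'q divisor" where
 "pdiv f = princ_div K M f"

lemma lk_pdiv:
 assumes "f : M" "f ~= 0"
 shows "lk (pdiv f) P = (if P : places K M then ord_at P f else 0)"
proof -
 have "{P. (if P : places K M then ord_at P f else 0) ~= 0} = {P : places K M. ord_at P f ~= 0}" by auto
 thus ?thesis unfolding pdiv_def princ_div_def using finite_ord[OF assms] by (subst lookup_Abs) auto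
qed

lemma isdiv_pdiv: "f : M ==> f ~= 0 ==> isdiv (pdiv f)"
 by (rule isdivI) (simp add: lk_pdiv split: if_splits)

lemma pdiv_mult: "f : M ==> f ~= 0 ==> g : M ==> g ~= 0 ==> pdiv (f * g) = pdiv f + pdiv g"
 by (rule poly_mapping_eqI) (auto simp: lookup_add lk_pdiv ord_facts(1) M.mult_mem)

lemma pdiv_inverse: "f : M ==> f ~= 0 ==> pdiv (inverse f) = - pdiv f"
 by (rule poly_mapping_eqI) (auto simp: lk_pdiv ord_facts(3) M.inverse_mem)

lemma pdiv_divide: "f : M ==> f ~= 0 ==> g : M ==> g ~= 0 ==> pdiv (f / g) = pdiv f - pdiv g"
 by (rule poly_mapping_eqI) (auto simp: lookup_minus lk_pdiv ord_facts(2) M.divide_mem)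

lemma pdiv_power: "f : M ==> f ~= 0 ==> pdiv (f ^ n) = frag_cmul (int n) (pdiv f)"
 by (rule poly_mapping_eqI) (auto simp: lk_pdiv ord_facts(4) M.power_mem)

subsection \<open>Riemann--Roch spaces\<close>

definition L :: "'q divisor => 'q ambient set" where
 "L D = {f : M. ALL P:places K M. f : og P (- lk D P)}"

lemma vsub_L: "vsub K (L D)"
 unfolding vsub_def L_def using ogD(1) KM unfolding vsub_def by (auto intro: M.add_mem M.mult_mem)

lemma L_mono: "(!!P. lk D P <= lk E P) ==> L D \<subseteq> L E"
 unfolding L_def using ogD(5) by (smt (verit) Collect_mono_iff neg_le_iff_le subsetD)

lemma L_scale:
 assumes "x : M" "x ~= 0"
 shows "L D = (*) x ` L (D + pdiv x)"
proof (intro equalityI subsetI)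
 have sc: "x * f : L D \<longleftrightarrow> f : L (D + pdiv x)" if f: "f : M" for f
 proof -
  have "x * f : og P (- lk D P) \<longleftrightarrow> f : og P (- lk (D + pdiv x) P)" if P: "P : places K M" for P
  proof -
   have "- lk (D + pdiv x) P = - lk D P - ord_at P x" using P by (simp add: lookup_add lk_pdiv[OF assms])
   thus ?thesis using ogD(8)[OF P assms, of f "- lk D P"] by simp
  qed
  thus ?thesis using f assms(1) M.mult_mem by (simp add: L_def)
 qed
 fix f
 show "f : L D" if "f : (*) x ` L (D + pdiv x)" using that sc by (auto simp: L_def)
 assume f: "f : L D"
 hence fx: "f / x : M" using assms by (auto simp: L_def intro: M.divide_mem)
 have "f = x * (f / x)" using assms by simp
 thus "f : (*) x ` L (D + pdiv x)" using sc[OF fx] f by (metis imageI)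
qed

lemma L_step:
 assumes P: "P : places K M"
 shows "EX n<=dg P. mdim K (L (D + frag_of P)) (L D) n"
proof (rule K.mdim_exists[OF vsub_L])
 fix U assume U: "U \<subseteq> L (D + frag_of P)" "indep K (L D) U"
 have lkD: "lk (D + frag_of P) Q = lk D Q + (if Q = P then 1 else 0)" for Q
  by (simp add: lookup_add lookup_frag_of)
 show "card U <= dg P"
 proof (rule indep_og_le[OF P U(2,1) vsub_L])
  show "L (D + frag_of P) \<subseteq> og P (- lk D P - 1)" using P unfolding L_def lkD by auto
  fix f assume "f : L (D + frag_of P)" "f : og P (- lk D P - 1 + 1)"
  thus "f : L D" unfolding L_def lkD by (auto split: if_splits)
 qed
qed

lemma L_dim_le:
 assumes "isdiv D" "isdiv E" "!!P. lk D P <= lk E P"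
 shows "EX n. mdim K (L E) (L D) n & int n <= degd E - degd D"
 using assms(2,3)
proof (induction "nat (\<Sum>P\<in>Poly_Mapping.keys (E - D). lk (E - D) P)" arbitrary: E rule: less_induct)
 case less
 define F where "F = E - D"
 have F0: "lk F P >= 0" for P using less.prems(2)[of P] by (simp add: F_def lookup_minus)
 show ?case
 proof (cases "F = 0")
  case True
  hence "E = D" by (simp add: F_def)
  thus ?thesis using K.mdim_refl[OF vsub_L, of "L D" D] by (intro exI[of _ 0]) simp
 next
  case False
  then obtain P where P: "lk F P ~= 0" by (metis lookup_zero poly_mapping_eqI)
  hence lP: "lk F P >= 1" using F0[of P] by simp
  define E' where "E' = E - frag_of P"
  have PP: "P : places K M" using P isdivD isdiv_intros(4)[OF less.prems(1) assms(1)] unfolding F_def by blast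
  have lkE': "lk E' Q = lk E Q - (if Q = P then 1 else 0)" for Q
   by (simp add: E'_def lookup_minus lookup_frag_of)
  have le: "lk D Q <= lk E' Q" for Q
   using less.prems(2)[of Q] lP unfolding lkE' F_def by (auto simp: lookup_minus)
  have iE': "isdiv E'" unfolding E'_def using less.prems(1) PP by (intro isdiv_intros)
  have F': "E' - D = F - frag_of P" by (simp add: E'_def F_def)
  have keysF: "Poly_Mapping.keys (F - frag_of P) \<subseteq> Poly_Mapping.keys F"
   using P keys_diff[of F "frag_of P"] by (auto simp: in_keys_iff)
  have "(\<Sum>Q\<in>Poly_Mapping.keys (F - frag_of P). lk (F - frag_of P) Q) =
   (\<Sum>Q\<in>Poly_Mapping.keys F. lk (F - frag_of P) Q)"
   using keysF by (intro sum.mono_neutral_left) (auto simp: in_keys_iff)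
  also have "... = (\<Sum>Q\<in>Poly_Mapping.keys F. lk F Q) - (\<Sum>Q\<in>Poly_Mapping.keys F. if Q = P then 1 else 0)"
   unfolding sum_subtractf[symmetric] by (intro sum.cong) (simp_all add: lookup_minus)
  also have "... = (\<Sum>Q\<in>Poly_Mapping.keys F. lk F Q) - 1" using P by (simp add: in_keys_iff)
  finally have s: "(\<Sum>Q\<in>Poly_Mapping.keys (E' - D). lk (E' - D) Q) = (\<Sum>Q\<in>Poly_Mapping.keys F. lk F Q) - 1"
   using F' by simp
  have "(\<Sum>Q\<in>Poly_Mapping.keys F. lk F Q) >= lk F P"
   using F0 P by (intro member_le_sum) (auto simp: in_keys_iff)
  hence "nat (\<Sum>Q\<in>Poly_Mapping.keys (E' - D). lk (E' - D) Q) < nat (\<Sum>Q\<in>Poly_Mapping.keys (E - D). lk (E - D) Q)"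
   using s lP unfolding F_def[symmetric] by linarith
  from less.hyps[OF this iE' le] obtain n where n: "mdim K (L E') (L D) n" "int n <= degd E' - degd D" by blast
  obtain j where j: "j <= dg P" "mdim K (L E) (L E') j" using L_step[OF PP, of E'] by (auto simp: E'_def)
  have "mdim K (L E) (L D) (j + n)"
   by (rule K.mdim_add[OF vsub_L vsub_L L_mono L_mono j(2) n(1)]) (use le lkE' in auto)
  moreover have "degd E' = degd E - int (dg P)" by (simp add: E'_def degd_diff degd_frag_of)
  ultimately show ?thesis using n j by (intro exI[of _ "j + n"]) auto
 qed
qed

text \<open>A nonconstant f is transcendental over \<open>K\<close>, hence not in K[1/f]. So 1/f is
  not a unit of that ring and vanishes at some place, where f has a pole.\<close>

lemma L_0: "L 0 = K"
proof (intro equalityI subsetI)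
 fix f assume f: "f : L 0"
 show "f : K"
 proof (rule ccontr)
  assume n: "f ~: K"
  hence f0: "f ~= 0" by auto
  have fM: "f : M" using f by (simp add: L_def)
  have y: "inverse f : adj K (inverse f)" "inverse f ~= 0" using K.adj_gen f0 by auto
  have "f ~: adj K (inverse f)"
  proof
   assume "f : adj K (inverse f)"
   then obtain p where p: "pover K p" "f = poly p (inverse f)" by (auto simp: adj_def)
   define N where "N = degree p"
   define g where "g = monom 1 (Suc N) - (\<Sum>i\<le>N. monom (coeff p i) (N - i))"
   have "f ^ N * poly p (inverse f) = (\<Sum>i\<le>N. coeff p i * f ^ (N - i))"
    unfolding poly_altdef N_def[symmetric] sum_distrib_left
   proof (intro sum.cong refl)
    fix i assume "i : {..N}"
    hence "f ^ N = f ^ (N - i) * f ^ i" by (simp add: power_add[symmetric])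
    thus "f ^ N * (coeff p i * inverse f ^ i) = coeff p i * f ^ (N - i)"
     using f0 by (simp add: field_simps)
   qed
   hence "poly g f = 0" using p(2)[symmetric] by (simp add: g_def poly_sum poly_monom mult.commute)
   moreover have "pover K g" unfolding g_def
   proof (intro K.pover_intros)
    show "pover K (\<Sum>i\<le>N. monom (coeff p i) (N - i))"
     using p(1) by (auto simp: pover_def coeff_sum intro!: K.sum_mem)
   qed auto
   moreover have "coeff g (Suc N) = 1" by (auto simp: g_def coeff_sum intro!: sum.neutral)
   hence "g ~= 0" by (metis coeff_0 zero_neq_one)
   ultimately have "algel K f" unfolding algel_def by blast
   thus False using K_closed fM n by blast
  qed
  hence "inverse (inverse f) ~: adj K (inverse f)" by simp
  from ex_place[OF M.subfld_axioms K.adj_subrng K.adj_incl adj_least[OF M.subrng_axioms KM] y this]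
  obtain P where P: "P : places K M" "inverse f : max_ideal P" using fM M.inverse_mem by blast
  hence "f ~: P" using f0 by (auto simp: max_ideal_def)
  thus False using f P(1) ogD(6)[OF P(1)] unfolding L_def by force
 qed
next
 fix c assume c: "c : K"
 thus "c : L 0" using KM ogD(6) unfolding L_def by (auto simp: places_iff)
qed

lemma mdim_K: "mdim K K {0} 1"
proof -
 have "spans K {0} {1} K" unfolding spans_def
 proof (intro conjI ballI)
  fix v assume "v : K"
  thus "EX c. (ALL u:{1}. c u : K) & v - (\<Sum>u\<in>{1}. c u * u) : {0}"
   by (intro exI[of _ "%_. v"]) simp
 qed simp
 moreover have "indep K {0} {1}" by (simp add: indep_def)
 ultimately show ?thesis unfolding mdim_def by (intro exI[of _ "{1}"]) simp
qed

lemma ex_upper: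
 assumes "isdiv D" "isdiv E"
 shows "EX F. isdiv F & (ALL P. lk D P <= lk F P & lk E P <= lk F P)"
proof -
 define F where "F = Abs_poly_mapping (%P. max (lk D P) (lk E P))"
 have "{P. max (lk D P) (lk E P) ~= 0} \<subseteq> Poly_Mapping.keys D \<union> Poly_Mapping.keys E"
  by (auto simp: in_keys_iff max_def split: if_splits)
 hence "finite {P. max (lk D P) (lk E P) ~= 0}" by (rule finite_subset) simp
 hence F: "lk F P = max (lk D P) (lk E P)" for P unfolding F_def by (rule lookup_Abs)
 have "isdiv F" using isdivD[OF assms(1)] isdivD[OF assms(2)]
  by (intro isdivI) (auto simp: F max_def split: if_splits)
 thus ?thesis using F by auto
qed

lemma ell_exists:
 assumes "isdiv D" shows "EX n. mdim K (L D) {0} n"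
proof -
 obtain F where F: "isdiv F" "!!P. lk D P <= lk F P" "!!P. lk 0 P <= lk F P"
  using ex_upper[OF assms isdiv_intros(1)] by blast
 obtain n where n: "mdim K (L F) K n" using L_dim_le[OF isdiv_intros(1) F(1,3)] by (auto simp: L_0)
 have "K \<subseteq> L F" using L_mono[of 0 F] F(3) by (simp add: L_0)
 hence "mdim K (L F) {0} (n + 1)" by (intro K.mdim_add[OF K.vsub_self vsub_zero _ _ n mdim_K]) auto
 thus ?thesis using K.mdim_sub[OF vsub_zero] L_mono[of D F] F(2) by blast
qed

definition ell :: "'q divisor => nat" where
 "ell D = (THE n. mdim K (L D) {0} n)"

lemma ell: "isdiv D ==> mdim K (L D) {0} (ell D)"
proof -
 assume "isdiv D"
 then obtain n where n: "mdim K (L D) {0} n" using ell_exists by blast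
 hence "ell D = n" unfolding ell_def
  by (rule the_equality) (use K.mdim_unique[OF vsub_zero n] in blast)
 thus ?thesis using n by simp
qed

lemma ell_eqI: "isdiv D ==> mdim K (L D) {0} n ==> ell D = n"
 using K.mdim_unique[OF vsub_zero ell] by blast

lemma ell_0: "ell 0 = 1"
 by (rule ell_eqI[OF isdiv_intros(1)]) (simp only: L_0 mdim_K)

text \<open>The quantity of Riemann's theorem: it grows with D, depends only on the divisor class,
  and is bounded above. Its maximum is the genus minus one.\<close>

definition gam :: "'q divisor => int" where
 "gam D = degd D - int (ell D)"

lemma gam_mono:
 assumes "isdiv D" "isdiv E" "!!P. lk D P <= lk E P"
 shows "gam D <= gam E" "ell D <= ell E"
proof -
 obtain n where n: "mdim K (L E) (L D) n" "int n <= degd E - degd D" using L_dim_le[OF assms] by blast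
 have "{0} \<subseteq> L D" using vsubD(1)[OF vsub_L] by blast
 hence "mdim K (L E) {0} (n + ell D)"
  by (intro K.mdim_add[OF vsub_L vsub_zero _ L_mono n(1) ell[OF assms(1)]]) (use assms(3) in auto)
 hence "ell E = n + ell D" by (rule ell_eqI[OF assms(2)])
 thus "gam D <= gam E" "ell D <= ell E" using n by (simp_all add: gam_def)
qed

lemma ell_pdiv:
 assumes "isdiv D" "x : M" "x ~= 0"
 shows "ell (D + pdiv x) = ell D"
proof -
 have "isdiv (D + pdiv x)" using assms isdiv_pdiv isdiv_intros by blast
 from K.mdim_scale[OF vsub_L assms(3) ell[OF this]] show ?thesis
  using ell_eqI[OF assms(1)] L_scale[OF assms(2,3), of D] by simp
qed

lemma r_nz: "r ~= 0"
 using r_trans K.algel_mem K.zero_mem by blast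

definition B :: "'q divisor" where
 "B = Abs_poly_mapping (%P. if P : places K M & r ~: P then - ord_at P r else 0)"

lemma lk_B: "lk B P = (if P : places K M & r ~: P then - ord_at P r else 0)"
proof -
 have "{P. (if P : places K M & r ~: P then - ord_at P r else 0) ~= 0} \<subseteq> {P : places K M. ord_at P r ~= 0}"
  by auto
 hence "finite {P. (if P : places K M & r ~: P then - ord_at P r else 0) ~= 0}"
  using finite_ord[OF rM r_nz] finite_subset by blast
 thus ?thesis unfolding B_def by (rule lookup_Abs)
qed

lemma isdiv_B: "isdiv B"
 by (rule isdivI) (auto simp: lk_B split: if_splits)

lemma lk_B_pos: "P : places K M ==> r ~: P ==> lk B P >= 1"
 using ord_facts(7)[of P r] rM r_nz by (simp add: lk_B)

lemma degd_B: "degd B <= 2"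
proof -
 define S where "S = {P : places K M. r ~: P}"
 have "S \<subseteq> {P : places K M. ord_at P r ~= 0}" using ord_facts(7)[OF _ rM r_nz] by (fastforce simp: S_def)
 hence S: "finite S" "S \<subseteq> places K M" using finite_ord[OF rM r_nz] finite_subset by (auto simp: S_def)
 have "degd B = (\<Sum>P\<in>S. lk B P * int (dg P))"
  by (rule degd_superset[OF S(1)]) (auto simp: in_keys_iff lk_B S_def split: if_splits)
 also have "... = (\<Sum>P\<in>S. ord_at P (inverse r) * int (dg P))"
  by (intro sum.cong) (auto simp: S_def lk_B ord_facts(3)[OF _ rM r_nz])
 also have "... <= 2 * int 1"
 proof (rule zeros_bound[OF _ _ _ r_nz _ S])
  show "inverse r = 1 / r" by (simp add: inverse_eq_divide)
  show "1 : W 1" by (rule W_one)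
  show "r : W 1" using W_poly[of "[:0, 1:]" 1] by simp
  show "inverse r ~= 0" using r_nz by simp
  show "ord_at P (inverse r) >= 0" if "P : S" for P
   using that ord_facts(3,7)[OF _ rM r_nz, of P] by (auto simp: S_def)
 qed
 finally show ?thesis by simp
qed

lemma W_L: "W k \<subseteq> L (frag_cmul (int k) B)"
proof
 fix f assume f: "f : W k"
 hence fM: "f : M" using WM by blast
 have "f : og P (- (int k * lk B P))" if P: "P : places K M" for P
 proof (cases "r : P")
  case True
  thus ?thesis using W_finite[OF P True] f ogD(6)[OF P] by (auto simp: lk_B)
 next
  case False
  have ik: "inverse r ^ k : M" "inverse r ^ k ~= 0" using rM r_nz by (auto intro: M.power_mem M.inverse_mem)
  have "ord_at P (inverse r ^ k) = int k * lk B P"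
   using ord_facts(4)[OF P M.inverse_mem[OF rM]] r_nz ord_facts(3)[OF P rM r_nz] P False by (simp add: lk_B)
  moreover have "inverse r ^ k * f : og P 0" using W_infinite[OF P False f] ogD(6)[OF P] by (simp add: mult.commute)
  ultimately show ?thesis unfolding ogD(8)[OF P ik] by simp
 qed
 thus "f : L (frag_cmul (int k) B)" using fM by (simp add: L_def)
qed

lemma ell_B: "2 * k <= ell (frag_cmul (int k) B) + g0"
proof -
 obtain U where U: "U \<subseteq> W k" "indep K {0} U" "2 * k <= card U + g0" using W_indep by blast
 have "card U <= ell (frag_cmul (int k) B)"
  using K.mdim_indep_le[OF vsub_zero ell[OF isdiv_intros(5)[OF isdiv_B]] U(2)] U(1) W_L by blast
 thus ?thesis using U(3) by simp
qed

text \<open>The residue field has finite dimension over \<open>K\<close>, so the powers of the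
  residue of \<open>r\<close> are linearly dependent.\<close>

lemma poly_at_finite:
 assumes P: "P : places K M" "r : P"
 shows "EX p. pover K p & p ~= 0 & poly p r : max_ideal P"
proof -
 interpret dvring K M P "unif P" by (rule dvring[OF P(1)])
 obtain S where S: "spans K m S P" "card S = dg P" using dg(1)[OF P(1)] by (auto simp: mdim_def)
 obtain c where c: "ALL i. c i : K" "EX i:{..dg P}. c i ~= 0" "(\<Sum>i\<le>dg P. c i * r ^ i) : m"
  using K.spanned_relation[OF vsub_m S(1), of "{..dg P}" "%i. r ^ i"] S(2) power_mem[OF P(2)] by auto
 define p where "p = (\<Sum>i\<le>dg P. monom (c i) i)"
 have cp: "coeff p j = (if j <= dg P then c j else 0)" for j
  unfolding p_def by (simp add: coeff_sum if_distrib cong: if_cong)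
 have "poly p r : m" using c(3) by (simp add: p_def poly_sum poly_monom)
 moreover have "pover K p" using c(1) by (auto simp: pover_def cp)
 moreover have "p ~= 0" using cp c(2) by (metis atMost_iff coeff_0)
 ultimately show ?thesis by blast
qed

lemma poly_r_nz: "pover K p ==> p ~= 0 ==> poly p r ~= 0"
 using r_trans unfolding algel_def by blast

lemma ord_poly_infinite:
 assumes P: "P : places K M" "r ~: P" and p: "pover K p" "p ~= 0"
 shows "ord_at P (poly p r) = int (degree p) * ord_at P r"
proof -
 interpret dvring K M P "unif P" by (rule dvring[OF P(1)])
 define d where "d = degree p"
 have im: "inverse r : m" using notin_P P rM by blast
 have bM: "poly p r : M" using M.poly_mem[OF pover_mono[OF p(1) KM] rM] .
 have ik: "inverse r ^ d : M" "inverse r ^ d ~= 0" using rM r_nz by (auto intro: M.power_mem M.inverse_mem)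
 have "inverse r ^ d * poly p r = (\<Sum>i\<le>d. coeff p i * inverse r ^ (d - i))"
  unfolding poly_altdef d_def[symmetric] sum_distrib_left
 proof (intro sum.cong refl)
  fix i assume "i : {..d}"
  hence "inverse r ^ d = inverse r ^ (d - i) * inverse r ^ i" by (simp add: power_add[symmetric])
  thus "inverse r ^ d * (coeff p i * r ^ i) = coeff p i * inverse r ^ (d - i)"
   using r_nz by (simp add: field_simps)
 qed
 also have "... = coeff p d + (\<Sum>i<d. coeff p i * inverse r ^ (d - i))"
  by (simp add: lessThan_Suc_atMost[symmetric] add.commute)
 also have "... : P - m"
 proof (rule unit_add_m)
  show "coeff p d : P - m" using K_unit p by (auto simp: pover_def d_def)
  have "coeff p i * inverse r ^ (d - i) : m" if "i < d" for i
  proof -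
   have "inverse r ^ (d - i) = inverse r ^ (d - i - 1) * inverse r"
    using that by (metis Suc_diff_Suc Suc_diff_eq_diff_pred diff_Suc_1 power_Suc2 zero_less_diff)
   hence "coeff p i * inverse r ^ (d - i) = (coeff p i * inverse r ^ (d - i - 1)) * inverse r" by simp
   also have "... : m" using im m_P KP p(1) by (intro m_mult mult_mem power_mem) (auto simp: pover_def)
   finally show ?thesis .
  qed
  thus "(\<Sum>i<d. coeff p i * inverse r ^ (d - i)) : m" by (intro vsub_sum[OF vsub_m]) auto
 qed
 finally have "ord_at P (inverse r ^ d * poly p r) = 0" by (rule ord_unit)
 moreover have "ord_at P (inverse r ^ d * poly p r) = ord_at P (inverse r ^ d) + ord_at P (poly p r)"
  by (rule ord_mult[OF ik bM poly_r_nz[OF p]])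
 moreover have "ord_at P (inverse r ^ d) = - int d * ord_at P r"
  using ord_power[OF M.inverse_mem[OF rM]] ord_inverse[OF rM r_nz] r_nz by simp
 ultimately show ?thesis by (simp add: d_def)
qed

text \<open>The tool for comparing an arbitrary divisor with a multiple of the pole divisor
  \<open>B\<close> of \<open>r\<close>: a polynomial in \<open>r\<close> can absorb everything at
  the places where \<open>r\<close> is finite.\<close>

lemma poly_clearing:
 assumes "isdiv D"
 shows "EX p. pover K p & p ~= 0 & (ALL P:places K M. r : P --> lk D P <= ord_at P (poly p r))"
proof -
 define S where "S = {P : Poly_Mapping.keys D. r : P}"
 have S: "finite S" "S \<subseteq> places K M" using assms by (auto simp: S_def isdiv_def)
 have "EX p. ALL P:S. pover K (p P) & p P ~= 0 & poly (p P) r : max_ideal P"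
  by (rule bchoice) (use S poly_at_finite in \<open>auto simp: S_def\<close>)
 then obtain p where p: "!!P. P : S ==> pover K (p P)" "!!P. P : S ==> p P ~= 0"
  "!!P. P : S ==> poly (p P) r : max_ideal P" by blast
 define q where "q = (\<Prod>P\<in>S. p P ^ nat (lk D P))"
 have q: "pover K q" "q ~= 0"
  using S(1) p unfolding q_def by (auto intro!: K.pover_power K.pover_prod)
 have qM: "poly q r : M" using M.poly_mem[OF pover_mono[OF q(1) KM] rM] .
 have "lk D P <= ord_at P (poly q r)" if P: "P : places K M" "r : P" for P
 proof -
  interpret dvring K M P "unif P" by (rule dvring[OF P(1)])
  have inP: "poly f r : P" if "pover K f" for f using poly_mem[OF pover_mono[OF that KP] P(2)] .
  show ?thesis
  proof (cases "P : S & lk D P >= 0")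
   case False
   hence "lk D P <= 0" using P by (cases "P : S") (auto simp: S_def in_keys_iff)
   moreover have "ord_at P (poly q r) >= 0" using inP[OF q(1)] ord_ge_0_iff[OF qM poly_r_nz[OF q]] by simp
   ultimately show ?thesis by simp
  next
   case True
   define q' where "q' = (\<Prod>P\<in>S - {P}. p P ^ nat (lk D P))"
   have "finite (S - {P})" using S by simp
   hence q': "pover K q'" "q' ~= 0"
    using p unfolding q'_def by (auto intro!: K.pover_power K.pover_prod)
   have e: "q = p P ^ nat (lk D P) * q'" using prod.remove[OF S(1), of P] True by (simp add: q_def q'_def)
   let ?a = "poly (p P) r" and ?b = "poly q' r"
   have a: "?a : M" "?a ~= 0" "ord_at P ?a >= 1"
    using p[of P] True poly_r_nz m_iff_ord[of ?a] m_P PM by auto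
   have b: "?b : M" "?b ~= 0" "ord_at P ?b >= 0"
    using inP[OF q'(1)] PM poly_r_nz[OF q'] ord_ge_0_iff by auto
   have "ord_at P (poly q r) = lk D P * ord_at P ?a + ord_at P ?b"
    using ord_mult[of "?a ^ nat (lk D P)" ?b] ord_power[OF a(1,2)] a b True
    by (simp add: e M.power_mem)
   moreover have "lk D P * ord_at P ?a >= lk D P * 1" using a True by (intro mult_left_mono) auto
   ultimately show ?thesis using b(3) by simp
  qed
 qed
 thus ?thesis using q by blast
qed

text \<open>Let b be the clearing polynomial, of degree d. Then D lies below E = Z + jB, with Z the
  zeros of b at finite \<open>r\<close>, and E is (j + d)B plus the divisor of b. So E has degree at
  most 2(j + d), while its space has dimension at least 2(j + d) - g0.\<close>

lemma gam_le:
 assumes D: "isdiv D" shows "gam D <= int g0"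
proof -
 obtain p where p: "pover K p" "p ~= 0" "!!P. P : places K M ==> r : P ==> lk D P <= ord_at P (poly p r)"
  using poly_clearing[OF D] by blast
 define d where "d = degree p"
 define b where "b = poly p r"
 have b: "b ~= 0" "b : M" using poly_r_nz[OF p(1,2)] M.poly_mem[OF pover_mono[OF p(1) KM] rM] by (auto simp: b_def)
 have inP: "ord_at P b >= 0" if "P : places K M" "r : P" for P
 proof -
  interpret dvring K M P "unif P" by (rule dvring[OF that(1)])
  show ?thesis using poly_mem[OF pover_mono[OF p(1) KP] that(2)] ord_ge_0_iff[OF b(2,1)] by (simp add: b_def)
 qed
 define Z where "Z = Abs_poly_mapping (%P. if P : places K M & r : P then ord_at P b else 0)"
 have "{P. (if P : places K M & r : P then ord_at P b else 0) ~= 0} \<subseteq> {P : places K M. ord_at P b ~= 0}"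
  by auto
 hence fin: "finite {P. (if P : places K M & r : P then ord_at P b else 0) ~= 0}"
  using finite_ord[OF b(2,1)] finite_subset by blast
 have lkZ: "lk Z P = (if P : places K M & r : P then ord_at P b else 0)" for P
  unfolding Z_def by (rule lookup_Abs[OF fin])
 have Z: "isdiv Z" by (rule isdivI) (auto simp: lkZ split: if_splits)
 have degZ: "degd Z <= 2 * int d"
 proof -
  have "degd Z = (\<Sum>P\<in>Poly_Mapping.keys Z. ord_at P b * int (dg P))"
   unfolding degd_def by (intro sum.cong) (auto simp: in_keys_iff lkZ split: if_splits)
  also have "... <= 2 * int d"
  proof (rule zeros_bound)
   show "b = b / 1" "(1::'q ambient) ~= 0" "b ~= 0" "b : W d" "1 : W d"
    using b W_poly[OF p(1)] W_one by (auto simp: b_def d_def)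
   show "Poly_Mapping.keys Z \<subseteq> places K M" using Z by (simp add: isdiv_def)
   show "0 <= ord_at P b" if "P : Poly_Mapping.keys Z" for P
    using that inP[of P] by (auto simp: in_keys_iff lkZ split: if_splits)
  qed simp
  finally show ?thesis .
 qed
 define j where "j = nat (\<Sum>P\<in>Poly_Mapping.keys D. \<bar>lk D P\<bar>)"
 have j: "lk D P <= int j" for P
 proof (cases "P : Poly_Mapping.keys D")
  case True
  hence "\<bar>lk D P\<bar> <= (\<Sum>P\<in>Poly_Mapping.keys D. \<bar>lk D P\<bar>)" by (intro member_le_sum) auto
  thus ?thesis unfolding j_def by linarith
 qed (simp add: in_keys_iff)
 define E where "E = Z + frag_cmul (int j) B"
 have E: "isdiv E" unfolding E_def by (intro isdiv_intros Z isdiv_B)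
 have lkE: "lk E P = lk Z P + int j * lk B P" for P by (simp add: E_def lookup_add)
 have DE: "lk D P <= lk E P" for P
 proof (cases "P : places K M")
  case True
  show ?thesis
  proof (cases "r : P")
   case rP: True
   thus ?thesis using p(3)[OF True rP] True by (simp add: lkE lkZ lk_B b_def)
  next
   case False
   have "int j * 1 <= int j * lk B P" using lk_B_pos[OF True False] by (intro mult_left_mono) auto
   thus ?thesis using j[of P] False by (simp add: lkE lkZ)
  qed
 next
  case False
  hence "lk D P = 0" using isdivD[OF D] by blast
  thus ?thesis using False by (simp add: lkE lkZ lk_B)
 qed
 have degE: "degd E <= 2 * int (j + d)"
 proof -
  have "int j * degd B <= int j * 2" using degd_B by (intro mult_left_mono) auto
  thus ?thesis using degZ by (simp add: E_def degd_add degd_cmul)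
 qed
 define m where "m = frag_cmul (int (j + d)) B"
 have m: "isdiv m" unfolding m_def by (intro isdiv_intros isdiv_B)
 have "m + pdiv b = E"
 proof (rule poly_mapping_eqI)
  fix P
  show "lk (m + pdiv b) P = lk E P"
  proof (cases "P : places K M & r ~: P")
   case True
   hence "ord_at P b = int d * ord_at P r" using ord_poly_infinite[OF _ _ p(1,2)] by (simp add: b_def d_def)
   thus ?thesis using True by (simp add: m_def lookup_add lk_pdiv[OF b(2,1)] lkE lkZ lk_B algebra_simps)
  qed (auto simp: m_def lookup_add lk_pdiv[OF b(2,1)] lkE lkZ lk_B)
 qed
 hence "ell E = ell m" using ell_pdiv[OF m b(2,1)] by simp
 moreover have "2 * (j + d) <= ell m + g0" unfolding m_def by (rule ell_B)
 ultimately have "gam E <= int g0" using degE by (simp add: gam_def)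
 thus ?thesis using gam_mono(1)[OF D E DE] by simp
qed

text \<open>A principal divisor always has a one-dimensional space of functions. If its degree were
  positive, powers of the function would make \<open>gam\<close> unbounded.\<close>

lemma degd_pdiv:
 assumes "x : M" "x ~= 0"
 shows "degd (pdiv x) = 0"
proof -
 have le: "degd (pdiv y) <= 0" if y: "y : M" "y ~= 0" for y
 proof (rule ccontr)
  assume "~ ?thesis"
  hence 1: "degd (pdiv y) >= 1" by simp
  \<comment> \<open>With this n the value of \<open>gam\<close> would be at least g0 + 1.\<close>
  define n where "n = g0 + 2"
  have yn: "y ^ n : M" "y ^ n ~= 0" using y by (auto intro: M.power_mem)
  have "ell (0 + pdiv (y ^ n)) = ell 0" by (rule ell_pdiv[OF isdiv_intros(1) yn])
  hence "ell (pdiv (y ^ n)) = 1" by (simp add: ell_0)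
  moreover have "degd (pdiv (y ^ n)) = int n * degd (pdiv y)" by (simp add: pdiv_power[OF y] degd_cmul)
  moreover have "int n * 1 <= int n * degd (pdiv y)" using 1 by (intro mult_left_mono) auto
  ultimately have "int n * 1 - 1 <= int g0" using gam_le[OF isdiv_pdiv[OF yn]] unfolding gam_def by linarith
  thus False by (simp add: n_def)
 qed
 have "degd (pdiv (inverse x)) <= 0" using assms by (intro le M.inverse_mem) auto
 thus ?thesis using le[OF assms] by (simp add: pdiv_inverse[OF assms] degd_minus)
qed

lemma gam_pdiv: "isdiv D ==> x : M ==> x ~= 0 ==> gam (D + pdiv x) = gam D"
 by (simp add: gam_def ell_pdiv degd_add degd_pdiv)

lemma L_nonzero:
 assumes "isdiv D" "f : L D" "f ~= 0"
 shows "!!P. lk (D + pdiv f) P >= 0" "degd D >= 0"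
proof -
 have fM: "f : M" using assms by (simp add: L_def)
 show 1: "lk (D + pdiv f) P >= 0" for P
 proof (cases "P : places K M")
  case True
  thus ?thesis using assms by (auto simp: L_def og_def lookup_add lk_pdiv[OF fM assms(3)])
 next
  case False
  hence "lk D P = 0" using isdivD[OF assms(1)] by blast
  thus ?thesis using False by (simp add: lookup_add lk_pdiv[OF fM assms(3)])
 qed
 have "degd (D + pdiv f) >= 0" by (rule degd_nonneg[OF 1])
 thus "degd D >= 0" by (simp add: degd_add degd_pdiv[OF fM assms(3)])
qed

lemma ell_pos_ex:
 assumes "isdiv D" "ell D > 0"
 obtains f where "f : L D" "f ~= 0"
proof -
 have "~ L D \<subseteq> {0}"
 proof
  assume "L D \<subseteq> {0}"
  hence "mdim K (L D) {0} 0" by (intro K.mdim_refl) auto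
  hence "ell D = 0" by (rule ell_eqI[OF assms(1)])
  thus False using assms(2) by simp
 qed
 thus ?thesis using that by blast
qed

text \<open>Take D0 with maximal \<open>gam\<close>. For D of large degree the divisor D - D0 has a
  nonzero function, so D dominates D0 up to equivalence, and monotonicity forces equality.\<close>

lemma riemann: "EX N \<gamma>. ALL D. isdiv D --> N <= degd D --> int (ell D) = degd D - \<gamma>"
proof -
 \<comment> \<open>The zero divisor has \<open>gam\<close> equal to -1. So the search may be
   restricted to values at least -1, which a shift by one turns into natural numbers.\<close>
 define Q where "Q D \<longleftrightarrow> isdiv D & gam D >= - 1" for D
 define h where "h D = nat (gam D + 1)" for D
 have Q0: "Q 0" by (simp add: Q_def gam_def ell_0 isdiv_intros)
 have g: "ALL D. Q D --> h D < Suc (g0 + 1)" using gam_le by (fastforce simp: h_def Q_def)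
 obtain D0 where D0: "Q D0" "ALL D. Q D --> h D <= h D0"
  using ex_has_greatest_nat[OF Q0 g] by blast
 have iD0: "isdiv D0" using D0 by (simp add: Q_def)
 have max: "gam D <= gam D0" if "isdiv D" for D
 proof (cases "Q D")
  case True
  hence "h D <= h D0" using D0 by blast
  thus ?thesis using True D0(1) unfolding h_def Q_def by linarith
 qed (use that D0(1) in \<open>simp add: Q_def\<close>)
 show ?thesis
 proof (intro exI allI impI)
  fix D assume D: "isdiv D" "degd D0 + gam D0 + 1 <= degd D"
  have D': "isdiv (D - D0)" by (intro isdiv_intros D iD0)
  have "int (ell (D - D0)) >= degd (D - D0) - gam D0" using max[OF D'] by (simp add: gam_def)
  hence "ell (D - D0) > 0" using D(2) by (simp add: degd_diff)
  then obtain f where f: "f : L (D - D0)" "f ~= 0" using ell_pos_ex[OF D'] by blast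
  have fM: "f : M" using f by (simp add: L_def)
  have "lk D0 P <= lk (D + pdiv f) P" for P
   using L_nonzero(1)[OF D' f, of P] by (simp add: lookup_add lookup_minus)
  hence "gam D0 <= gam (D + pdiv f)"
   by (intro gam_mono(1) iD0 isdiv_intros D isdiv_pdiv[OF fM f(2)])
  hence 1: "gam D0 <= gam D" by (simp add: gam_pdiv[OF D(1) fM f(2)])
  have "gam D <= gam D0" using max[OF D(1)] .
  thus "int (ell D) = degd D - gam D0" using 1 by (simp add: gam_def)
 qed
qed

lemma L_neg: "isdiv D ==> degd D < 0 ==> L D = {0}"
 using L_nonzero(2)[of D] vsubD(1)[OF vsub_L, of D] by fastforce

end

subsection \<open>Residue degrees as dimensions of residue fields\<close>

lemma (in vring) ring_P: "ring (amb\<lparr>carrier := P\<rparr>)"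
 by (rule ring.subring_is_ring[OF ring_amb]) (simp add: subring_amb subrng_axioms)

lemma (in vring) Span_P:
 assumes "set us \<subseteq> P" "distinct us"
 shows "ring.Span (amb\<lparr>carrier := P\<rparr>) K us = {\<Sum>u\<in>set us. c u * u | c. ALL u:set us. c u : K}"
proof -
 interpret R: ring "amb\<lparr>carrier := P\<rparr>" by (rule ring_P)
 have R: "x \<otimes>\<^bsub>amb\<lparr>carrier := P\<rparr>\<^esub> y = x * y" "x \<oplus>\<^bsub>amb\<lparr>carrier := P\<rparr>\<^esub> y = x + y" "\<zero>\<^bsub>amb\<lparr>carrier := P\<rparr>\<^esub> = 0" for x y
  by (simp_all add: amb_def ring_of_type_algebra_def)
 show ?thesis
  using assms
 proof (induction us)
  case (Cons u us)
  have "v : R.Span K (u # us) \<longleftrightarrow> v : {\<Sum>u\<in>set (u # us). c u * u | c. ALL u:set (u # us). c u : K}" for v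
  proof -
   have "v : R.Span K (u # us) \<longleftrightarrow> (EX k:K. EX w:R.Span K us. v = k * u + w)"
    using R.line_extension_mem_iff[of v K u "R.Span K us"] by (simp add: R)
   also have "... \<longleftrightarrow> (EX k:K. EX c. (ALL u:set us. c u : K) & v = k * u + (\<Sum>u\<in>set us. c u * u))"
    using Cons by auto
   also have "... \<longleftrightarrow> (EX c. (ALL u:set (u # us). c u : K) & v = (\<Sum>u\<in>set (u # us). c u * u))"
   proof
    assume "EX k:K. EX c. (ALL u:set us. c u : K) & v = k * u + (\<Sum>u\<in>set us. c u * u)"
    then obtain k c where kc: "k : K" "ALL u:set us. c u : K" "v = k * u + (\<Sum>u\<in>set us. c u * u)" by blast
    have "(\<Sum>w\<in>set us. (c(u := k)) w * w) = (\<Sum>u\<in>set us. c u * u)"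
     using Cons.prems by (intro sum.cong) auto
    hence "v = (\<Sum>w\<in>set (u # us). (c(u := k)) w * w)" using kc Cons.prems by simp
    moreover have "ALL w:set (u # us). (c(u := k)) w : K" using kc by auto
    ultimately show "EX c. (ALL u:set (u # us). c u : K) & v = (\<Sum>u\<in>set (u # us). c u * u)" by blast
   next
    assume "EX c. (ALL u:set (u # us). c u : K) & v = (\<Sum>u\<in>set (u # us). c u * u)"
    then obtain c where c: "ALL u:set (u # us). c u : K" "v = (\<Sum>u\<in>set (u # us). c u * u)" by blast
    hence "v = c u * u + (\<Sum>u\<in>set us. c u * u)" using Cons.prems by simp
    thus "EX k:K. EX c. (ALL u:set us. c u : K) & v = k * u + (\<Sum>u\<in>set us. c u * u)"
     using c(1) by auto
   qed
   finally show ?thesis by blast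
  qed
  thus ?case by blast
 qed (simp add: R)
qed

text \<open>A set that is independent modulo m and spans P modulo m maps to a basis of the quotient
  ring P/m over the image of \<open>K\<close>, which links \<open>mdim\<close> to the dimension in
  the definition of the degree.\<close>

lemma (in vring) place_degree_eq:
 assumes "mdim K P m n"
 shows "place_degree K P = n"
proof -
 define R where "R = amb\<lparr>carrier := P\<rparr>"
 interpret R: ring R unfolding R_def by (rule ring_P)
 have Rs: "x \<otimes>\<^bsub>R\<^esub> y = x * y" "x \<oplus>\<^bsub>R\<^esub> y = x + y" "\<zero>\<^bsub>R\<^esub> = 0" "\<one>\<^bsub>R\<^esub> = 1" "carrier R = P" for x y
  by (simp_all add: R_def amb_def ring_of_type_algebra_def)
 have Rinv: "\<ominus>\<^bsub>R\<^esub> x = - x" if "x : P" for x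
  using that minus_mem[OF that] by (intro R.minus_equality) (simp_all add: Rs)
 have id: "ideal m R"
 proof (rule idealI)
  show "ring R" by (rule R.ring_axioms)
  show "subgroup m (add_monoid R)"
  proof (rule R.add.subgroupI)
   show "m ~= {}" using zero_m by blast
  qed (use m_P m_add m_minus Rinv in \<open>auto simp: Rs a_inv_def[symmetric]\<close>)
 qed (use m_mult m_P in \<open>auto simp: Rs mult.commute\<close>)
 interpret m: ideal m R by (rule id)
 interpret h: ring_hom_ring R "R Quot m" "(+>\<^bsub>R\<^esub>) m" by (rule m.rcos_ring_hom_ring)
 have coset: "m +>\<^bsub>R\<^esub> x = {a + x | a. a : m}" for x by (auto simp: a_r_coset_defs Rs)
 have coset_amb: "m +>\<^bsub>amb\<^esub> x = m +>\<^bsub>R\<^esub> x" for x by (auto simp: a_r_coset_defs Rs)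
 have coset_eq: "m +>\<^bsub>R\<^esub> x = m +>\<^bsub>R\<^esub> y \<longleftrightarrow> x - y : m" for x y
 proof
  assume "m +>\<^bsub>R\<^esub> x = m +>\<^bsub>R\<^esub> y"
  moreover have "x : m +>\<^bsub>R\<^esub> x" unfolding coset using zero_m by force
  ultimately show "x - y : m" unfolding coset by auto
 next
  assume d: "x - y : m"
  have "a + x = (a + (x - y)) + y" "a + y = (a - (x - y)) + x" for a by simp_all
  thus "m +>\<^bsub>R\<^esub> x = m +>\<^bsub>R\<^esub> y" unfolding coset using m_add[OF _ d] m_diff[OF _ d] by blast
 qed
 have KR: "subfield K R"
 proof -
  have "inv\<^bsub>amb\<^esub> c = inverse c" if "c : K" "c ~= 0" for c
   using that by (intro monoid.inv_char[OF ring.is_monoid[OF ring_amb]]) auto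
  hence "subfield K amb"
   by (intro field.subfieldI'[OF field_amb]) (auto simp: subring_amb K.subrng_axioms K.inverse_mem)
  hence "field (amb\<lparr>carrier := K\<rparr>)" by (rule ring.subfield_iff(2)[OF ring_amb])
  hence "field (R\<lparr>carrier := K\<rparr>)" by (simp add: R_def)
  thus ?thesis using R.subfield_iff(1) KP by (simp add: Rs)
 qed
 have ne: "\<one>\<^bsub>R Quot m\<^esub> ~= \<zero>\<^bsub>R Quot m\<^esub>"
 proof
  assume "\<one>\<^bsub>R Quot m\<^esub> = \<zero>\<^bsub>R Quot m\<^esub>"
  hence "m +>\<^bsub>R\<^esub> 1 = m +>\<^bsub>R\<^esub> 0" using h.hom_one h.hom_zero by (simp add: Rs)
  thus False by (simp add: coset_eq)
 qed
 have sf: "subfield ((+>\<^bsub>R\<^esub>) m ` K) (R Quot m)" by (rule h.img_is_subfield(2)[OF KR ne])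
 obtain U where U: "indep K m U" "spans K m U P" "U \<subseteq> P" "card U = n" using assms by (auto simp: mdim_def)
 have fU: "finite U" using U(1) by (simp add: indep_def)
 then obtain us where us: "set us = U" "distinct us" using finite_distinct_list by blast
 hence len: "length us = n" using U(4) distinct_card by fastforce
 have SpanR: "R.Span K vs = {\<Sum>u\<in>set vs. c u * u | c. ALL u:set vs. c u : K}" if "set vs \<subseteq> P" "distinct vs" for vs
  using Span_P[OF that] by (simp add: R_def)
 have hSpan: "h.S.Span ((+>\<^bsub>R\<^esub>) m ` K) (map ((+>\<^bsub>R\<^esub>) m) vs) = (+>\<^bsub>R\<^esub>) m ` R.Span K vs" if "set vs \<subseteq> P" for vs
  using h.Span_hom[of K vs] KP that by (simp add: Rs)
 have "h.S.independent ((+>\<^bsub>R\<^esub>) m ` K) (map ((+>\<^bsub>R\<^esub>) m) vs)" if "set vs \<subseteq> U" "distinct vs" for vs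
  using that
 proof (induction vs)
  case (Cons v vs)
  have vsP: "set vs \<subseteq> P" "v : P" using Cons.prems U(3) by auto
  have "m +>\<^bsub>R\<^esub> v ~: h.S.Span ((+>\<^bsub>R\<^esub>) m ` K) (map ((+>\<^bsub>R\<^esub>) m) vs)"
  proof
   assume "m +>\<^bsub>R\<^esub> v : h.S.Span ((+>\<^bsub>R\<^esub>) m ` K) (map ((+>\<^bsub>R\<^esub>) m) vs)"
   then obtain c where c: "ALL u:set vs. c u : K" "m +>\<^bsub>R\<^esub> v = m +>\<^bsub>R\<^esub> (\<Sum>u\<in>set vs. c u * u)"
    using hSpan[OF vsP(1)] SpanR[OF vsP(1)] Cons.prems by auto
   hence "v - (\<Sum>u\<in>set vs. c u * u) : m" by (simp add: coset_eq)
   define d where "d u = (if u = v then 1 else if u : set vs then - c u else 0)" for u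
   have fU: "finite U" using U(1) by (simp add: indep_def)
   have "(\<Sum>u\<in>U. d u * u) = (\<Sum>u\<in>insert v (set vs). d u * u)"
    using Cons.prems fU by (intro sum.mono_neutral_right) (auto simp: d_def)
   also have "... = d v * v + (\<Sum>u\<in>set vs. d u * u)" using Cons.prems by simp
   also have "(\<Sum>u\<in>set vs. d u * u) = (\<Sum>u\<in>set vs. - (c u * u))"
    using Cons.prems by (intro sum.cong) (auto simp: d_def)
   finally have "(\<Sum>u\<in>U. d u * u) = v - (\<Sum>u\<in>set vs. c u * u)" by (simp add: d_def sum_negf)
   hence "(\<Sum>u\<in>U. d u * u) : m" using \<open>v - (\<Sum>u\<in>set vs. c u * u) : m\<close> by simp
   moreover have "d u : K" for u using c(1) by (auto simp: d_def intro: K.minus_mem)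
   ultimately have "d v = 0" using indepD[OF U(1), of d v] Cons.prems by auto
   thus False by (simp add: d_def)
  qed
  moreover have "m +>\<^bsub>R\<^esub> v : carrier (R Quot m)" using vsP h.hom_closed by (simp add: Rs)
  ultimately show ?case using Cons by (auto intro: h.S.independent.li_Cons)
 qed simp
 hence "h.S.dimension (length (map ((+>\<^bsub>R\<^esub>) m) us)) ((+>\<^bsub>R\<^esub>) m ` K) (h.S.Span ((+>\<^bsub>R\<^esub>) m ` K) (map ((+>\<^bsub>R\<^esub>) m) us))"
  using us by (intro h.S.dimension_independent) auto
 moreover have "h.S.Span ((+>\<^bsub>R\<^esub>) m ` K) (map ((+>\<^bsub>R\<^esub>) m) us) = carrier (R Quot m)"
 proof -
  have "(+>\<^bsub>R\<^esub>) m ` R.Span K us = (+>\<^bsub>R\<^esub>) m ` P"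
  proof (intro equalityI subsetI)
   fix w assume "w : (+>\<^bsub>R\<^esub>) m ` P"
   then obtain x where x: "x : P" "w = m +>\<^bsub>R\<^esub> x" by blast
   then obtain c where c: "ALL u:U. c u : K" "x - (\<Sum>u\<in>U. c u * u) : m" using U(2) unfolding spans_def by blast
   have "(\<Sum>u\<in>U. c u * u) : R.Span K us" unfolding SpanR[of us, unfolded us(1), OF U(3) us(2)] using c(1) by blast
   moreover have "w = m +>\<^bsub>R\<^esub> (\<Sum>u\<in>U. c u * u)" unfolding x(2) coset_eq by (rule c(2))
   ultimately show "w : (+>\<^bsub>R\<^esub>) m ` R.Span K us" by (rule rev_image_eqI)
  next
   fix w assume "w : (+>\<^bsub>R\<^esub>) m ` R.Span K us"
   thus "w : (+>\<^bsub>R\<^esub>) m ` P" using R.Span_in_carrier[of K us] us U(3) KP by (auto simp: Rs)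
  qed
  moreover have "carrier (R Quot m) = (+>\<^bsub>R\<^esub>) m ` P"
   by (auto simp: FactRing_def A_RCOSETS_defs a_r_coset_def r_coset_def Rs)
  ultimately show ?thesis using hSpan[of us] us U(3) by simp
 qed
 ultimately have "h.S.dimension n ((+>\<^bsub>R\<^esub>) m ` K) (carrier (R Quot m))" using len by simp
 hence "(h.S.dim over ((+>\<^bsub>R\<^esub>) m ` K)) (carrier (R Quot m)) = n" by (rule h.S.dimI[OF sf])
 moreover have "(%x. m +>\<^bsub>amb\<^esub> x) ` K = (+>\<^bsub>R\<^esub>) m ` K" by (simp add: coset_amb)
 ultimately show ?thesis
  unfolding place_degree_def residue_field_def R_def[symmetric] by (simp add: over_def)
qed

context ffield
begin

lemma place_degree: "P : places K M ==> place_degree K P = dg P"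
 using vring.place_degree_eq[OF vring dg(1)] .

lemma div_degree: "isdiv D ==> div_degree K D = degd D"
 unfolding div_degree_def degd_def isdiv_def by (intro sum.cong) (auto simp: place_degree)

subsection \<open>The class group\<close>

abbreviation DG where "DG \<equiv> div0_group K M"
abbreviation Pr where "Pr \<equiv> princ_divs K M"
abbreviation J where "J \<equiv> pic0 K M"

definition cl :: "'q divisor => 'q divisor set" where
 "cl D = div_class K M D"

lemma carrier_DG: "D : carrier DG \<longleftrightarrow> isdiv D & degd D = 0"
 by (auto simp: div0_group_def div_degree isdiv_def)

lemma DG_simps [simp]: "x \<otimes>\<^bsub>DG\<^esub> y = x + y" "\<one>\<^bsub>DG\<^esub> = 0"
 by (simp_all add: div0_group_def free_Abelian_group_def)

lemma group_DG: "comm_group DG"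
proof (rule comm_groupI)
 show "EX y:carrier DG. y \<otimes>\<^bsub>DG\<^esub> x = \<one>\<^bsub>DG\<^esub>" if "x : carrier DG" for x
  using that by (intro bexI[of _ "- x"]) (auto simp: carrier_DG degd_minus intro: isdiv_intros)
qed (auto simp: carrier_DG degd_add intro: isdiv_intros)

lemma inv_DG: "x : carrier DG ==> inv\<^bsub>DG\<^esub> x = - x"
 by (rule group.inv_equality[OF comm_group.axioms(2)[OF group_DG]])
  (auto simp: carrier_DG degd_minus intro: isdiv_intros)

lemma Pr_iff: "D : Pr \<longleftrightarrow> (EX f:M. f ~= 0 & D = pdiv f)"
 by (auto simp: princ_divs_def pdiv_def)

lemma Pr_subset: "Pr \<subseteq> carrier DG"
 by (auto simp: Pr_iff carrier_DG isdiv_pdiv degd_pdiv)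

lemma subgroup_Pr: "subgroup Pr DG"
proof (rule group.subgroupI[OF comm_group.axioms(2)[OF group_DG] Pr_subset])
 have "pdiv 1 : Pr" unfolding Pr_iff using M.one_mem by (intro bexI[of _ 1]) auto
 thus "Pr ~= {}" by blast
 show "inv\<^bsub>DG\<^esub> D : Pr" if D: "D : Pr" for D
 proof -
  obtain f where f: "f : M" "f ~= 0" "D = pdiv f" using D by (auto simp: Pr_iff)
  hence "inv\<^bsub>DG\<^esub> D = pdiv (inverse f)" using D Pr_subset by (auto simp: inv_DG pdiv_inverse)
  thus ?thesis unfolding Pr_iff using f by (intro bexI[of _ "inverse f"]) (auto intro: M.inverse_mem)
 qed
 show "D \<otimes>\<^bsub>DG\<^esub> E : Pr" if DE: "D : Pr" "E : Pr" for D E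
 proof -
  obtain f where f: "f : M" "f ~= 0" "D = pdiv f" using DE by (auto simp: Pr_iff)
  obtain g where g: "g : M" "g ~= 0" "E = pdiv g" using DE by (auto simp: Pr_iff)
  show ?thesis unfolding Pr_iff using f g
   by (intro bexI[of _ "f * g"]) (auto simp: pdiv_mult intro: M.mult_mem)
 qed
qed

lemma normal_Pr: "Pr \<lhd> DG"
 by (rule comm_group.subgroup_imp_normal[OF group_DG subgroup_Pr])

lemma group_J: "comm_group J"
 unfolding pic0_def by (rule comm_group.abelian_FactGroup[OF group_DG subgroup_Pr])

lemma cl_def': "cl D = Pr #>\<^bsub>DG\<^esub> D"
 by (simp add: cl_def div_class_def)

lemma mem_cl: "E : cl D \<longleftrightarrow> E - D : Pr"
 unfolding cl_def' r_coset_def by (auto intro!: bexI[of _ "E - D"])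

lemma carrier_J: "carrier J = cl ` carrier DG"
 by (simp add: pic0_def carrier_FactGroup cl_def'[abs_def])

lemma cl_eq_iff:
 assumes "D : carrier DG" "E : carrier DG"
 shows "cl D = cl E \<longleftrightarrow> D - E : Pr"
proof
 have "0 : Pr" using subgroup.one_closed[OF subgroup_Pr] by simp
 hence "D : cl D" by (simp add: mem_cl)
 thus "D - E : Pr" if "cl D = cl E" using that by (simp add: mem_cl)
 assume DE: "D - E : Pr"
 hence ED: "E - D : Pr" using subgroup.m_inv_closed[OF subgroup_Pr DE] Pr_subset by (auto simp: inv_DG)
 have "F : cl D \<longleftrightarrow> F : cl E" for F
 proof -
  have "F - D : Pr ==> F - E : Pr" using subgroup.m_closed[OF subgroup_Pr _ DE, of "F - D"] by simp
  moreover have "F - E : Pr ==> F - D : Pr" using subgroup.m_closed[OF subgroup_Pr _ ED, of "F - E"] by simp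
  ultimately show ?thesis unfolding mem_cl by blast
 qed
 thus "cl D = cl E" by blast
qed

lemma cl_mult: "D : carrier DG ==> E : carrier DG ==> cl D \<otimes>\<^bsub>J\<^esub> cl E = cl (D + E)"
 using normal.rcos_sum[OF normal_Pr, of D E] by (simp add: pic0_def cl_def')

lemma cl_one: "\<one>\<^bsub>J\<^esub> = cl 0"
proof -
 have "cl 0 = Pr" by (auto simp: mem_cl)
 thus ?thesis by (simp add: pic0_def)
qed

lemma cl_inv: "D : carrier DG ==> inv\<^bsub>J\<^esub> (cl D) = cl (- D)"
 by (rule group.inv_equality[OF comm_group.axioms(2)[OF group_J]])
  (auto simp: carrier_J carrier_DG degd_minus cl_mult cl_one isdiv_intros)

lemma cmul_DG: "D : carrier DG ==> frag_cmul k D : carrier DG"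
 by (simp add: carrier_DG isdiv_intros degd_cmul)

lemma subgroup_cl_cmul:
 assumes D: "D : carrier DG" and H: "subgroup H J" "cl D : H"
 shows "cl (frag_cmul k D) : H"
proof -
 have nat: "cl (frag_cmul (int n) D) : H" for n
 proof (induction n)
  case 0
  thus ?case using subgroup.one_closed[OF H(1)] by (simp add: cl_one)
 next
  case (Suc n)
  have "cl (frag_cmul (int (Suc n)) D) = cl (frag_cmul (int n) D) \<otimes>\<^bsub>J\<^esub> cl D"
   using cl_mult[OF cmul_DG[OF D] D] by (simp add: frag_cmul_distrib add.commute)
  thus ?case using subgroup.m_closed[OF H(1) Suc H(2)] by simp
 qed
 show ?thesis
 proof (cases "k >= 0")
  case True
  thus ?thesis using nat[of "nat k"] by simp
 next
  case False
  have "cl (frag_cmul k D) = inv\<^bsub>J\<^esub> (cl (frag_cmul (int (nat (- k))) D))"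
   using cl_inv[OF cmul_DG[OF D]] False by simp
  thus ?thesis using subgroup.m_inv_closed[OF H(1) nat] by (simp only:)
 qed
qed

lemma cyclic_subgroup_cl:
 assumes D: "D : carrier DG"
 shows "subgroup (range (%k. cl (frag_cmul k D))) J"
proof (rule group.subgroupI[OF comm_group.axioms(2)[OF group_J]])
 show "range (%k. cl (frag_cmul k D)) \<subseteq> carrier J" using cmul_DG[OF D] by (auto simp: carrier_J)
 fix a assume "a : range (%k. cl (frag_cmul k D))"
 then obtain k where k: "a = cl (frag_cmul k D)" by blast
 have "inv\<^bsub>J\<^esub> a = cl (frag_cmul (- k) D)" using cl_inv[OF cmul_DG[OF D]] by (simp add: k)
 thus "inv\<^bsub>J\<^esub> a : range (%k. cl (frag_cmul k D))" by blast
 fix b assume "b : range (%k. cl (frag_cmul k D))"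
 then obtain l where l: "b = cl (frag_cmul l D)" by blast
 have "a \<otimes>\<^bsub>J\<^esub> b = cl (frag_cmul (k + l) D)"
  using cl_mult[OF cmul_DG[OF D] cmul_DG[OF D]] by (simp add: k l frag_cmul_distrib)
 thus "a \<otimes>\<^bsub>J\<^esub> b : range (%k. cl (frag_cmul k D))" by blast
qed simp

lemma cyclic_subgroup_iso:
 assumes D: "D : carrier DG" and N: "N > 0"
  and ord: "!!k. frag_cmul k D : Pr \<longleftrightarrow> int N dvd k"
 shows "J\<lparr>carrier := range (%k. cl (frag_cmul k D))\<rparr> \<cong> integer_mod_group N"
proof -
 let ?C = "range (%k. cl (frag_cmul k D))"
 let ?G = "J\<lparr>carrier := ?C\<rparr>"
 have eq: "cl (frag_cmul k D) = cl (frag_cmul l D) \<longleftrightarrow> int N dvd k - l" for k l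
  using cl_eq_iff[OF cmul_DG[OF D] cmul_DG[OF D], of k l] ord[of "k - l"] by (simp add: frag_cmul_diff_distrib)
 have "(%k. cl (frag_cmul k D)) : iso (integer_mod_group N) ?G"
 proof (rule isoI)
  show "(%k. cl (frag_cmul k D)) : hom (integer_mod_group N) ?G"
  proof (rule homI)
   fix x y :: int
   have "cl (frag_cmul ((x + y) mod int N) D) = cl (frag_cmul (x + y) D)"
    unfolding eq by (simp add: mod_eq_dvd_iff[symmetric])
   also have "... = cl (frag_cmul x D) \<otimes>\<^bsub>J\<^esub> cl (frag_cmul y D)"
    using cl_mult[OF cmul_DG[OF D] cmul_DG[OF D]] by (simp add: frag_cmul_distrib)
   finally show "cl (frag_cmul (x \<otimes>\<^bsub>integer_mod_group N\<^esub> y) D) = cl (frag_cmul x D) \<otimes>\<^bsub>?G\<^esub> cl (frag_cmul y D)"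
    by simp
  qed simp
  show "bij_betw (%k. cl (frag_cmul k D)) (carrier (integer_mod_group N)) (carrier ?G)"
   unfolding bij_betw_def
  proof
   show "inj_on (%k. cl (frag_cmul k D)) (carrier (integer_mod_group N))"
   proof (rule inj_onI)
    fix x y assume "x : carrier (integer_mod_group N)" "y : carrier (integer_mod_group N)"
     "cl (frag_cmul x D) = cl (frag_cmul y D)"
    thus "x = y" using N unfolding eq mod_eq_dvd_iff[symmetric] by (simp add: carrier_integer_mod_group)
   qed
   have "cl (frag_cmul k D) : (%k. cl (frag_cmul k D)) ` {0..<int N}" for k
   proof (rule image_eqI)
    show "cl (frag_cmul k D) = cl (frag_cmul (k mod int N) D)"
     unfolding eq by (simp add: mod_eq_dvd_iff[symmetric])
   qed (use N in simp)
   thus "(%k. cl (frag_cmul k D)) ` carrier (integer_mod_group N) = carrier ?G"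
    using N by (auto simp: carrier_integer_mod_group)
  qed
 qed
 hence "integer_mod_group N \<cong> ?G" by (auto simp: is_iso_def)
 thus ?thesis by (rule group.iso_sym[OF group_integer_mod_group])
qed

end

subsection \<open>Rational functions in \<open>r\<close>\<close>

definition ratf :: "'a::field set => 'a => 'a set" where
 "ratf k r = {poly a r / poly b r | a b. pover k a & pover k b & b ~= 0}"

lemma (in subfld) subfld_ratf:
 assumes tr: "~ algel k r"
 shows "subfld (ratf k r)" and "k \<subseteq> ratf k r" and "r : ratf k r"
proof -
 have nz: "poly b r ~= 0" if "pover k b" "b ~= 0" for b using tr that unfolding algel_def by blast
 have I: "poly a r / poly b r : ratf k r" if "pover k a" "pover k b" "b ~= 0" for a b
  using that unfolding ratf_def by blast
 have C: "c : ratf k r" if "c : k" for c using I[of "[:c:]" 1] that by simp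
 show "k \<subseteq> ratf k r" using C by blast
 show "r : ratf k r" using I[of "[:0, 1:]" 1] by simp
 show "subfld (ratf k r)"
 proof
  show "0 : ratf k r" "1 : ratf k r" by (rule C, simp)+
  fix x assume "x : ratf k r"
  then obtain a b where ab: "pover k a" "pover k b" "b ~= 0" "x = poly a r / poly b r" by (auto simp: ratf_def)
  show "- x : ratf k r" using I[of "- a" b] ab pover_uminus by simp
  show "inverse x : ratf k r"
  proof (cases "a = 0")
   case True
   thus ?thesis using C[of 0] ab by simp
  next
   case False
   thus ?thesis using I[of b a] ab by simp
  qed
  fix y assume "y : ratf k r"
  then obtain c d where cd: "pover k c" "pover k d" "d ~= 0" "y = poly c r / poly d r" by (auto simp: ratf_def)
  have "x + y = poly (a * d + c * b) r / poly (b * d) r"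
   unfolding ab(4) cd(4) using nz[OF ab(2,3)] nz[OF cd(2,3)] by (simp add: field_simps)
  thus "x + y : ratf k r" using I[of "a * d + c * b" "b * d"] ab cd by (simp add: pover_add pover_mult)
  show "x * y : ratf k r" using I[of "a * c" "b * d"] ab cd by (simp add: pover_mult)
 qed
qed

lemma ratf_least: "subfld N ==> k \<subseteq> N ==> r : N ==> ratf k r \<subseteq> N"
 unfolding ratf_def by (auto intro!: subfld.divide_mem subrng.poly_mem[OF subfld.axioms(1)] dest: pover_mono)

subsection \<open>The curve\<close>

text \<open>With \<open>\<theta> = T\<close>, the equation \<open>\<theta> s\<^sup>2 + (1 + \<theta> (r^q - r)) s = r\<close> describes \<open>X\<^sub>0(T\<^sup>3)\<close>.\<close>

locale curve_eq =
 fixes \<theta> r s :: "'q::{finite,field} ambient" and q :: nat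
 assumes th_nz: "\<theta> ~= 0" and q_card: "q = CARD('q)"
  and curve: "\<theta> * s\<^sup>2 + (1 + \<theta> * (r ^ q - r)) * s = r"
begin

lemma q_ge_2: "q >= 2"
proof -
 have "card {0, 1 :: 'q} <= q" unfolding q_card by (intro card_mono) auto
 thus ?thesis by simp
qed

text \<open>With \<open>z\<close> the quadratic equation becomes a pair of product formulas for r
  and r^q, from which all divisors are read off. The second root of the quadratic is
  \<open>- (1 + \<theta> * z) / \<theta>\<close>.\<close>

definition z :: "'q ambient" where "z = s + r ^ q - r"

lemma eq_r: "s * (1 + \<theta> * z) = r" and eq_z: "z * (1 + \<theta> * s) = r ^ q"
proof -
 show *: "s * (1 + \<theta> * z) = r" using curve by (simp add: z_def power2_eq_square algebra_simps)
 have "z * (1 + \<theta> * s) = z + s * (1 + \<theta> * z) - s" by (simp add: algebra_simps)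
 thus "z * (1 + \<theta> * s) = r ^ q" unfolding * by (simp add: z_def)
qed

end

locale curve_over = curve_eq \<theta> r s q + k: subfld k for \<theta> r s :: "'q::{finite,field} ambient" and q k +
 assumes th_k: "\<theta> : k" and tr: "~ algel k r"
begin

sublocale R: subfld "ratf k r" by (rule k.subfld_ratf[OF tr])

lemma k_R: "k \<subseteq> ratf k r" and r_R: "r : ratf k r"
 by (rule k.subfld_ratf[OF tr])+

lemma poly_nz: "pover k p ==> p ~= 0 ==> poly p r ~= 0"
 using tr unfolding algel_def by blast

lemma r_nz: "r ~= 0"
 using tr k.algel_mem k.zero_mem by blast

lemma poly_R: "pover k p ==> poly p r : ratf k r"
 using R.poly_mem[OF pover_mono[OF _ k_R] r_R] .

definition cpol :: "'q ambient poly" where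
 "cpol = 1 + smult \<theta> (monom 1 q - [:0, 1:])"

lemma cpol: "pover k cpol" "poly cpol r = 1 + \<theta> * (r ^ q - r)" "degree cpol <= q" "cpol ~= 0"
proof -
 show "pover k cpol" unfolding cpol_def by (intro k.pover_intros k.pover_1 th_k) auto
 show "poly cpol r = 1 + \<theta> * (r ^ q - r)" by (simp add: cpol_def poly_monom)
 show "degree cpol <= q" unfolding cpol_def
  by (intro degree_add_le degree_diff_le order_trans[OF degree_smult_le] degree_monom_le) (use q_ge_2 in auto)
 have "coeff cpol q = \<theta>" using q_ge_2 by (simp add: cpol_def coeff_1 coeff_pCons split: nat.splits)
 thus "cpol ~= 0" using th_nz by auto
qed

text \<open>The two values of \<open>s\<close> over \<open>r\<close> have product \<open>-r/\<theta>\<close>; if they were polynomials in \<open>r\<close>,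
 one of them would be constant or of degree one and the other one of degree \<open>q\<close>.\<close>

lemma s_irrational: "s ~: ratf k r"
proof
 assume "s : ratf k r"
 then obtain a b where ab: "pover k a" "pover k b" "b ~= 0" "s = poly a r / poly b r" by (auto simp: ratf_def)
 define F where "F = smult \<theta> (a * a) + cpol * a * b - [:0, 1:] * (b * b)"
 have bn: "poly b r ~= 0" using poly_nz ab by blast
 have A: "poly a r = s * poly b r" using ab(4) bn by simp
 have "poly F r = \<theta> * (poly a r * poly a r) + (1 + \<theta> * (r ^ q - r)) * poly a r * poly b r - r * (poly b r * poly b r)"
  by (simp add: F_def cpol(2))
 also have "... = (\<theta> * s\<^sup>2 + (1 + \<theta> * (r ^ q - r)) * s - r) * (poly b r * poly b r)"
  unfolding A by (simp add: power2_eq_square algebra_simps)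
 also have "... = 0" using curve by simp
 finally have "poly F r = 0" .
 moreover have "pover k F" unfolding F_def
  using ab cpol(1) th_k by (intro k.pover_intros) auto
 ultimately have "F = 0" using poly_nz by blast
 define g where "g = gcd a b"
 have g0: "g ~= 0" using ab(3) by (simp add: g_def)
 obtain a' b' where ab': "a = a' * g" "b = b' * g" "coprime a' b'"
  unfolding g_def using gcd_coprime_exists[of a b] ab(3) by auto
 have b0: "b' ~= 0" using ab' ab(3) by auto
 have "F = g * g * (smult \<theta> (a' * a') + cpol * a' * b' - [:0, 1:] * (b' * b'))"
  unfolding F_def ab' by (simp add: algebra_simps)
 hence F': "smult \<theta> (a' * a') + cpol * a' * b' - [:0, 1:] * (b' * b') = 0" using \<open>F = 0\<close> g0 by simp
 hence "smult \<theta> (a' * a') = b' * ([:0, 1:] * b' - cpol * a')" by (simp add: algebra_simps)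
 hence "b' dvd smult \<theta> (a' * a')" by (rule dvdI)
 hence "b' dvd a' * a'" using th_nz dvd_smult_iff by blast
 moreover have "coprime b' (a' * a')" using ab'(3) by (simp add: coprime_commute)
 ultimately have "is_unit b'" by (metis coprime_absorb_left)
 then obtain c where c: "b' = [:c:]" "c ~= 0" using is_unit_polyE by (metis b0 pCons_eq_0_iff)
 have F2: "a' * (smult \<theta> a' + smult c cpol) = smult (c * c) [:0, 1:]"
  using F' by (simp add: c algebra_simps)
 hence nz: "a' ~= 0" "smult \<theta> a' + smult c cpol ~= 0" using c(2) by auto
 have "degree (a' * (smult \<theta> a' + smult c cpol)) = 1" unfolding F2 using c(2) by simp
 hence deg: "degree a' + degree (smult \<theta> a' + smult c cpol) = 1" using nz by (simp add: degree_mult_eq)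
 hence "degree a' < q" using q_ge_2 by simp
 hence "coeff (smult \<theta> a' + smult c cpol) q = c * coeff cpol q" by (simp add: coeff_eq_0)
 moreover have "coeff cpol q = \<theta>" using q_ge_2 by (simp add: cpol_def coeff_1 coeff_pCons split: nat.splits)
 ultimately have "coeff (smult \<theta> a' + smult c cpol) q ~= 0" using c(2) th_nz by simp
 hence "q <= degree (smult \<theta> a' + smult c cpol)" by (rule le_degree)
 thus False using deg q_ge_2 by simp
qed

definition Mf :: "'q ambient set" where "Mf = adj (ratf k r) s"

definition spol :: "'q ambient poly" where "spol = [:- r, 1 + \<theta> * (r ^ q - r), \<theta>:]"

lemma spol: "pover (ratf k r) spol" "poly spol s = 0" "degree spol = 2" "spol ~= 0"
proof -
 show "pover (ratf k r) spol" unfolding spol_def using th_k k_R r_R by (auto intro!: R.mems)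
 show "poly spol s = 0" using curve by (simp add: spol_def power2_eq_square algebra_simps)
qed (use th_nz in \<open>simp_all add: spol_def\<close>)

sublocale M: subfld Mf
 unfolding Mf_def by (rule R.subfld_adj) (use spol in \<open>auto simp: algel_def\<close>)

lemma R_M: "ratf k r \<subseteq> Mf" and s_M: "s : Mf" and k_M: "k \<subseteq> Mf" and r_M: "r : Mf" and z_M: "z : Mf" and th_M: "\<theta> : Mf"
proof -
 show *: "ratf k r \<subseteq> Mf" "s : Mf" unfolding Mf_def by (rule R.adj_incl R.adj_gen)+
 thus "k \<subseteq> Mf" "r : Mf" "\<theta> : Mf" using k_R r_R th_k by blast+
 thus "z : Mf" unfolding z_def using * by (auto intro!: M.mems)
qed

lemma Mf_least: "subfld N ==> k \<subseteq> N ==> r : N ==> s : N ==> Mf \<subseteq> N"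
 unfolding Mf_def using adj_least[OF subfld.axioms(1) ratf_least] by blast

lemma Mf_repr:
 assumes "f : Mf"
 obtains \<alpha> \<beta> where "\<alpha> : ratf k r" "\<beta> : ratf k r" "f = \<alpha> + \<beta> * s"
proof -
 obtain p where p: "pover (ratf k r) p" "f = poly p s" using assms by (auto simp: Mf_def adj_def)
 obtain h g where hg: "pover (ratf k r) g" "p = spol * h + g" "g = 0 \<or> degree g < degree spol"
  using R.pover_divmod[OF spol(1,4) p(1)] by blast
 have "degree g <= 1" using hg(3) spol(3) by auto
 hence "g = [:coeff g 0, coeff g 1:]"
  by (intro poly_eqI) (auto simp: coeff_pCons coeff_eq_0 split: nat.splits)
 from arg_cong[OF this, of "%p. poly p s"] have "poly g s = coeff g 0 + coeff g 1 * s"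
  by (simp add: mult.commute)
 hence "f = coeff g 0 + coeff g 1 * s" using p(2) hg(2) spol(2) by simp
 thus ?thesis using that[of "coeff g 0" "coeff g 1"] hg(1) by (auto simp: pover_def)
qed

lemma Mf_frac:
 assumes "f : Mf"
 obtains a b c where "pover k a" "pover k b" "pover k c" "c ~= 0" "f = (poly a r + poly b r * s) / poly c r"
proof -
 obtain \<alpha> \<beta> where ab: "\<alpha> : ratf k r" "\<beta> : ratf k r" "f = \<alpha> + \<beta> * s" using Mf_repr[OF assms] .
 obtain a b where 1: "pover k a" "pover k b" "b ~= 0" "\<alpha> = poly a r / poly b r" using ab by (auto simp: ratf_def)
 obtain c d where 2: "pover k c" "pover k d" "d ~= 0" "\<beta> = poly c r / poly d r" using ab by (auto simp: ratf_def)
 have "f = (poly (a * d) r + poly (c * b) r * s) / poly (b * d) r"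
  using poly_nz[OF 1(2,3)] poly_nz[OF 2(2,3)] by (simp add: ab(3) 1(4) 2(4) field_simps)
 thus ?thesis using that[of "a * d" "c * b" "b * d"] 1 2 by (simp add: k.pover_mult)
qed

lemma Mf_unique:
 assumes "\<alpha> : ratf k r" "\<beta> : ratf k r" "\<alpha> + \<beta> * s = 0"
 shows "\<beta> = 0" "\<alpha> = 0"
proof -
 show "\<beta> = 0"
 proof (rule ccontr)
  assume "\<beta> ~= 0"
  hence "s = - \<alpha> / \<beta>" using assms(3) by (simp add: field_simps eq_neg_iff_add_eq_0 add.commute)
  thus False using s_irrational assms(1,2) by (simp add: R.fmems)
 qed
 thus "\<alpha> = 0" using assms(3) by simp
qed

text \<open>The curve equation still defines a quadratic extension after adjoining f to the
  constants. Comparing f = alpha + beta s with the constant f there gives beta = 0; so f is a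
  rational function of r, and being algebraic it lies in \<open>k\<close>.\<close>

lemma algebraic_constant:
 assumes f: "f : Mf" "algel k f"
 shows "f : k"
proof -
 interpret K': subfld "adj k f" by (rule k.subfld_adj[OF f(2)])
 have al: "algel k y" if "y : adj k f" for y
  using k.fd_algel[OF k.fd_adj[OF k.fd_self f(2)] that] .
 have tr': "~ algel (adj k f) r" using k.algel_trans al tr by blast
 interpret C: curve_over \<theta> r s q "adj k f"
  by unfold_locales (use tr' th_k k.adj_incl[of f] in auto)
 have kk: "ratf k r \<subseteq> ratf (adj k f) r" using pover_mono k.adj_incl[of f] unfolding ratf_def by blast
 have fR: "f : ratf (adj k f) r" using C.k_R k.adj_gen by blast
 obtain \<alpha> \<beta> where ab: "\<alpha> : ratf k r" "\<beta> : ratf k r" "f = \<alpha> + \<beta> * s" using Mf_repr[OF f(1)] .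
 have "(\<alpha> - f) + \<beta> * s = 0" using ab(3) by simp
 moreover have "\<alpha> - f : ratf (adj k f) r" "\<beta> : ratf (adj k f) r"
  using ab(1,2) kk fR by (blast intro: C.R.diff_mem)+
 ultimately have "\<beta> = 0" using C.Mf_unique(1)[of "\<alpha> - f" \<beta>] by blast
 hence "f : ratf k r" using ab by simp
 then obtain a b where ab: "pover k a" "pover k b" "b ~= 0" "f = poly a r / poly b r" by (auto simp: ratf_def)
 have "poly (smult f b - a) r = 0" using ab(4) poly_nz[OF ab(2,3)] by simp
 moreover have "pover (adj k f) (smult f b - a)"
  using ab pover_mono[OF _ k.adj_incl] by (intro K'.pover_intros k.adj_gen) auto
 ultimately have "smult f b = a" using tr' unfolding algel_def by (metis eq_iff_diff_eq_0)
 hence "f * lead_coeff b = coeff a (degree b)" by auto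
 hence "f = coeff a (degree b) / lead_coeff b" using ab(3) by (simp add: field_simps)
 thus ?thesis using ab by (auto simp: pover_def intro!: k.divide_mem)
qed

subsection \<open>The degree filtration of the curve\<close>

text \<open>Where r has a pole, the pole of s is at most q times as high; hence s has weight q and r
  has weight 1.\<close>

definition W :: "nat => 'q ambient set" where
 "W i = {poly a r + poly b r * s | a b. pover k a & pover k b & degree a <= i & (b = 0 \<or> degree b + q <= i)}"

lemma W_I: "pover k a ==> pover k b ==> degree a <= i ==> b = 0 \<or> degree b + q <= i ==> poly a r + poly b r * s : W i"
 unfolding W_def by blast

lemma W_mult:
 assumes "f : W i" "g : W j"
 shows "f * g : W (i + j)"
proof -
 obtain a b where ab: "pover k a" "pover k b" "degree a <= i" "b = 0 \<or> degree b + q <= i" "f = poly a r + poly b r * s"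
  using assms by (auto simp: W_def)
 obtain c d where cd: "pover k c" "pover k d" "degree c <= j" "d = 0 \<or> degree d + q <= j" "g = poly c r + poly d r * s"
  using assms by (auto simp: W_def)
 define A where "A = a * c + smult (inverse \<theta>) ([:0, 1:] * (b * d))"
 define C where "C = a * d + b * c - smult (inverse \<theta>) (cpol * (b * d))"
 have "\<theta> * (s * s) = r - poly cpol r * s" using curve by (simp add: cpol(2) power2_eq_square eq_diff_eq)
 hence ss: "s * s = inverse \<theta> * (r - poly cpol r * s)" using th_nz by (simp add: field_simps)
 have "f * g = poly a r * poly c r + (poly a r * poly d r + poly b r * poly c r) * s + poly b r * poly d r * (s * s)"
  unfolding ab(5) cd(5) by (simp add: algebra_simps)
 also have "... = poly A r + poly C r * s"
  unfolding ss A_def C_def by (simp add: algebra_simps)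
 finally have fg: "f * g = poly A r + poly C r * s" .
 have it: "inverse \<theta> : k" using th_k by (rule k.inverse_mem)
 have "degree A <= i + j"
 proof -
  have "degree (a * c) <= i + j" using degree_mult_le[of a c] ab(3) cd(3) by simp
  moreover have "degree (smult (inverse \<theta>) ([:0, 1:] * (b * d))) <= i + j"
  proof (cases "b = 0 \<or> d = 0")
   case False
   hence "degree ([:0, 1:] * (b * d)) = Suc (degree b + degree d)"
    using degree_mult_eq[of "[:0, 1:]" "b * d"] degree_mult_eq[of b d] by (simp del: mult_pCons_left)
   thus ?thesis using False ab(4) cd(4) q_ge_2 degree_smult_le[of "inverse \<theta>" "[:0, 1:] * (b * d)"] by linarith
  qed auto
  ultimately show ?thesis unfolding A_def by (rule degree_add_le)
 qed
 moreover have "C = 0 \<or> degree C + q <= i + j"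
 proof (cases "b = 0 & d = 0")
  case False
  have "degree (a * d) + q <= i + j \<or> d = 0" using degree_mult_le[of a d] ab(3) cd(4) by linarith
  moreover have "degree (b * c) + q <= i + j \<or> b = 0" using degree_mult_le[of b c] ab(4) cd(3) by linarith
  moreover have "degree (smult (inverse \<theta>) (cpol * (b * d))) + q <= i + j \<or> b * d = 0"
   using degree_mult_le[of cpol "b * d"] degree_mult_le[of b d] cpol(3) ab(4) cd(4)
    degree_smult_le[of "inverse \<theta>" "cpol * (b * d)"] by (cases "b = 0 \<or> d = 0") auto
  moreover have "q <= i + j" using False ab(4) cd(4) by auto
  ultimately have "degree (a * d) <= i + j - q" "degree (b * c) <= i + j - q"
   "degree (smult (inverse \<theta>) (cpol * (b * d))) <= i + j - q" by auto
  hence "degree C <= i + j - q" unfolding C_def by (intro degree_diff_le degree_add_le)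
  hence "degree C + q <= i + j" using \<open>q <= i + j\<close> by linarith
  thus ?thesis ..
 qed (simp add: C_def)
 moreover have "pover k A" "pover k C"
  unfolding A_def C_def using ab cd cpol(1) it by (auto intro!: k.pover_intros simp del: mult_pCons_left)
 ultimately show ?thesis unfolding fg by (intro W_I)
qed

lemma vsub_W: "vsub k (W i)"
 unfolding vsub_def
proof (intro conjI ballI)
 show "0 : W i" using W_I[of 0 0 i] by simp
 fix f assume "f : W i"
 then obtain a b where ab: "pover k a" "pover k b" "degree a <= i" "b = 0 \<or> degree b + q <= i" "f = poly a r + poly b r * s"
  by (auto simp: W_def)
 show "f + g : W i" if g: "g : W i" for g
 proof -
  obtain c d where cd: "pover k c" "pover k d" "degree c <= i" "d = 0 \<or> degree d + q <= i" "g = poly c r + poly d r * s"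
   using g by (auto simp: W_def)
  have "f + g = poly (a + c) r + poly (b + d) r * s" by (simp add: ab cd algebra_simps)
  moreover have "b + d = 0 \<or> degree (b + d) + q <= i"
   using ab(4) cd(4) degree_add_le_max[of b d] by (auto simp: max_def split: if_splits)
  moreover have "pover k (a + c)" "pover k (b + d)" "degree (a + c) <= i"
   using ab cd by (auto intro: k.pover_add degree_add_le)
  ultimately show ?thesis using W_I by (simp only:)
 qed
 show "c * f : W i" if "c : k" for c
 proof -
  have "c * f = poly (smult c a) r + poly (smult c b) r * s" by (simp add: ab algebra_simps)
  moreover have "smult c b = 0 \<or> degree (smult c b) + q <= i" using ab(4) degree_smult_le[of c b] by auto
  moreover have "pover k (smult c a)" "pover k (smult c b)" "degree (smult c a) <= i"
   using ab(1,2) that order_trans[OF degree_smult_le ab(3)] by (auto intro: k.pover_smult)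
  ultimately show ?thesis using W_I by (simp only:)
 qed
qed

definition wb :: "nat \<times> nat => 'q ambient" where "wb = (%(j, e). r ^ j * s ^ e)"

lemma poly_sum_le: "degree p <= n ==> poly p x = (\<Sum>j\<le>n. coeff p j * x ^ j)" for p :: "'b::field poly"
 unfolding poly_altdef by (intro sum.mono_neutral_left) (auto simp: coeff_eq_0)

lemma W_span: "EX S. spans k {0} S (W i) & card S <= 2 * i + 2"
proof (intro exI conjI)
 let ?I = "{..i} \<times> {0, 1::nat}"
 show "spans k {0} (wb ` ?I) (W i)"
 proof (rule k.spansI_family)
  fix f assume "f : W i"
  then obtain a b where ab: "pover k a" "pover k b" "degree a <= i" "b = 0 \<or> degree b + q <= i" "f = poly a r + poly b r * s"
   by (auto simp: W_def)
  hence "degree b <= i" by auto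
  define c where "c = (%(j, e::nat). if e = 0 then coeff a j else coeff b j)"
  have "(\<Sum>p\<in>?I. c p * wb p) = (\<Sum>j\<le>i. \<Sum>e\<in>{0, 1}. c (j, e) * wb (j, e))"
   by (rule sum.cartesian_product')
  also have "... = (\<Sum>j\<le>i. coeff a j * r ^ j) + (\<Sum>j\<le>i. coeff b j * r ^ j) * s"
   by (simp add: c_def wb_def sum.distrib sum_distrib_right mult.assoc)
  also have "... = f" using poly_sum_le[OF ab(3)] poly_sum_le[OF \<open>degree b <= i\<close>] by (simp add: ab(5))
  finally have "f - (\<Sum>p\<in>?I. c p * wb p) : {0}" by simp
  moreover have "ALL p:?I. c p : k" using ab by (auto simp: c_def pover_def)
  ultimately show "EX c. (ALL p:?I. c p : k) & f - (\<Sum>p\<in>?I. c p * wb p) : {0}" by blast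
 qed simp
 have "card (wb ` ?I) <= card ?I" by (rule card_image_le) simp
 thus "card (wb ` ?I) <= 2 * i + 2" by (simp add: card_cartesian_product)
qed

lemma W_poly: "pover k p ==> degree p <= i ==> poly p r : W i"
 using W_I[of p 0 i] by simp

lemma W_mono: "i <= j ==> W i \<subseteq> W j"
 unfolding W_def by fastforce

lemma W_M: "W i \<subseteq> Mf"
 unfolding W_def using poly_R R_M s_M by (auto intro!: M.mems)

lemma W_frac:
 assumes "f : Mf" shows "EX i a b. a : W i & b : W i & b ~= 0 & f = a / b"
proof -
 obtain a b c where abc: "pover k a" "pover k b" "pover k c" "c ~= 0" "f = (poly a r + poly b r * s) / poly c r"
  using Mf_frac[OF assms] .
 define i where "i = degree a + degree b + q + degree c"
 have "poly a r + poly b r * s : W i" "poly c r : W i"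
  using abc by (auto intro!: W_I W_poly simp: i_def)
 thus ?thesis using abc poly_nz by blast
qed

lemma W_indep: "\<exists>U\<subseteq>W i. indep k {0} U & 2 * i <= card U + q"
proof -
 define I where "I = {..i} \<times> {0::nat} \<union> {j. j + q <= i} \<times> {1}"
 have fin2: "finite {j. j + q <= i}" by (rule finite_subset[of _ "{..i}"]) auto
 hence fin: "finite I" by (simp add: I_def)
 have "{j. j + q <= i} = {..<Suc i - q}" by auto
 hence "card {j. j + q <= i} = Suc i - q" by simp
 hence cI: "card I = Suc i + (Suc i - q)"
  unfolding I_def using fin2 by (subst card_Un_disjoint) (auto simp: card_cartesian_product)
 have wI: "wb p : W i" if "p : I" for p
 proof -
  consider j where "p = (j, 0)" "j <= i" | j where "p = (j, 1)" "j + q <= i" using \<open>p : I\<close> by (auto simp: I_def)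
  thus ?thesis
  proof cases
   case 1
   thus ?thesis using W_I[of "monom 1 j" 0 i] k.pover_monom[of 1 j]
    by (simp add: wb_def poly_monom degree_monom_eq)
  next
   case 2
   thus ?thesis using W_I[of 0 "monom 1 j" i] k.pover_monom[of 1 j]
    by (simp add: wb_def poly_monom degree_monom_eq)
  qed
 qed
 have fam: "ALL p:I. c p = 0" if c: "!!p. p : I ==> c p : k" "(\<Sum>p\<in>I. c p * wb p) : {0}" for c
 proof -
  define a where "a = (\<Sum>j\<le>i. monom (c (j, 0)) j)"
  define b where "b = (\<Sum>j\<in>{j. j + q <= i}. monom (c (j, 1)) j)"
  have ca: "coeff a j = (if j <= i then c (j, 0) else 0)" for j
   unfolding a_def by (simp add: coeff_sum if_distrib cong: if_cong)
  have cb: "coeff b j = (if j + q <= i then c (j, 1) else 0)" for j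
   unfolding b_def using fin2 by (simp add: coeff_sum if_distrib cong: if_cong)
  have pa: "pover k a" "pover k b" using c(1) by (auto simp: pover_def ca cb I_def)
  have "(\<Sum>p\<in>I. c p * wb p) = (\<Sum>p\<in>{..i} \<times> {0::nat}. c p * wb p) + (\<Sum>p\<in>{j. j + q <= i} \<times> {1}. c p * wb p)"
   unfolding I_def using fin2 by (intro sum.union_disjoint) auto
  also have "(\<Sum>p\<in>{..i} \<times> {0::nat}. c p * wb p) = poly a r"
   unfolding a_def poly_sum poly_monom by (subst sum.cartesian_product') (simp add: wb_def)
  also have "(\<Sum>p\<in>{j. j + q <= i} \<times> {1}. c p * wb p) = poly b r * s"
   unfolding b_def poly_sum poly_monom sum_distrib_right
   by (subst sum.cartesian_product') (simp add: wb_def mult.assoc)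
  finally have "poly a r + poly b r * s = 0" using c(2) by simp
  hence "poly b r = 0" "poly a r = 0" using Mf_unique[OF poly_R[OF pa(1)] poly_R[OF pa(2)]] by blast+
  hence "a = 0" "b = 0" using poly_nz pa by blast+
  show ?thesis
  proof
   fix p assume "p : I"
   then consider j where "p = (j, 0)" "j <= i" | j where "p = (j, 1)" "j + q <= i" by (auto simp: I_def)
   thus "c p = 0" using ca cb \<open>a = 0\<close> \<open>b = 0\<close> by cases (metis coeff_0)+
  qed
 qed
 have "indep k {0} (wb ` I)" "card (wb ` I) = card I"     using k.family_indep[where g = wb and W = "{0}", OF fin fam] by blast+
 thus ?thesis using wI cI by (intro exI[of _ "wb ` I"]) auto
qed

text \<open>Valuation rings are integrally closed, and the nonzero constant \<open>a\<close> is a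
  unit at every place: a pole of x would write \<open>a\<close> as an element of the maximal
  ideal.\<close>

lemma quadratic_integral:
 assumes P: "P : places k Mf" and x: "x : Mf" "a * x\<^sup>2 + b * x = c" "a : k" "a ~= 0" "b : P" "c : P"
 shows "x : P"
proof (rule ccontr)
 assume n: "x ~: P"
 interpret V: vring k Mf P by unfold_locales (rule P)
 have im: "inverse x : V.m" and x0: "x ~= 0" using V.notin_P[OF x(1) n] n V.zero_mem by auto
 have "a = (c * inverse x - b) * inverse x" using x(2) x0 by (simp add: field_simps power2_eq_square)
 also have "... : V.m" using im x V.m_P by (intro V.m_mult V.diff_mem V.mult_mem)
 finally show False using V.K_m[OF x(3)] x(4) by blast
qed

lemma W_finite:
 assumes P: "P : places k Mf" "r : P" shows "W i \<subseteq> P"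
proof -
 interpret V: vring k Mf P by unfold_locales (rule P(1))
 have "s : P" by (rule quadratic_integral[OF P(1) s_M curve th_k th_nz])
  (use th_k V.KP P(2) in \<open>auto intro!: V.mems\<close>)
 moreover have "poly p r : P" if "pover k p" for p using V.poly_mem[OF pover_mono[OF that V.KP] P(2)] .
 ultimately show ?thesis unfolding W_def by (auto intro!: V.mems)
qed

lemma W_infinite:
 assumes P: "P : places k Mf" "r ~: P" and f: "f : W i"
 shows "f * inverse r ^ i : P"
proof -
 interpret V: vring k Mf P by unfold_locales (rule P(1))
 define \<rho> where "\<rho> = inverse r"
 have rP: "\<rho> : P" using V.val[OF r_M] P(2) by (simp add: \<rho>_def)
 have rr: "r * \<rho> = 1" using r_nz by (simp add: \<rho>_def)
 have pol: "poly p r * \<rho> ^ n : P" if p: "pover k p" "degree p <= n" for p n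
 proof -
  have "poly p r * \<rho> ^ n = (\<Sum>j\<le>n. coeff p j * \<rho> ^ (n - j))"
   unfolding poly_sum_le[OF p(2)] sum_distrib_right
  proof (intro sum.cong refl)
   fix j assume "j : {..n}"
   hence "\<rho> ^ n = \<rho> ^ j * \<rho> ^ (n - j)" by (simp add: power_add[symmetric])
   hence "coeff p j * r ^ j * \<rho> ^ n = coeff p j * (r * \<rho>) ^ j * \<rho> ^ (n - j)" by (simp add: power_mult_distrib)
   thus "coeff p j * r ^ j * \<rho> ^ n = coeff p j * \<rho> ^ (n - j)" by (simp add: rr)
  qed
  also have "... : P" using p(1) V.KP rP by (auto simp: pover_def intro!: V.mems)
  finally show ?thesis .
 qed
 \<comment> \<open>The curve equation, multiplied by the power 2q of 1/r, is a quadratic equation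
   for this product with coefficients in P.\<close>
 have sP: "s * \<rho> ^ q : P"
 proof (rule quadratic_integral[OF P(1) _ _ th_k th_nz])
  show "s * \<rho> ^ q : Mf" using s_M V.PM rP by (auto intro!: M.mems)
  show "poly cpol r * \<rho> ^ q : P" by (rule pol[OF cpol(1,3)])
  show "poly [:0, 1:] r * \<rho> ^ (q + q) : P" by (rule pol) (use q_ge_2 in auto)
  have "\<theta> * (s * \<rho> ^ q)\<^sup>2 + poly cpol r * \<rho> ^ q * (s * \<rho> ^ q) = (\<theta> * s\<^sup>2 + poly cpol r * s) * (\<rho> ^ q * \<rho> ^ q)"
   by (simp add: power2_eq_square algebra_simps)
  also have "... = r * \<rho> ^ (q + q)" using curve by (simp add: cpol(2) power_add)
  finally show "\<theta> * (s * \<rho> ^ q)\<^sup>2 + poly cpol r * \<rho> ^ q * (s * \<rho> ^ q) = poly [:0, 1:] r * \<rho> ^ (q + q)" by simp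
 qed
 obtain a b where ab: "pover k a" "pover k b" "degree a <= i" "b = 0 \<or> degree b + q <= i" "f = poly a r + poly b r * s"
  using f by (auto simp: W_def)
 have "poly b r * s * \<rho> ^ i : P"
 proof (cases "b = 0")
  case False
  hence d: "degree b <= i - q" "\<rho> ^ i = \<rho> ^ (i - q) * \<rho> ^ q" using ab(4) by (auto simp: power_add[symmetric])
  have "(poly b r * \<rho> ^ (i - q)) * (s * \<rho> ^ q) : P" by (rule V.mult_mem[OF pol[OF ab(2) d(1)] sP])
  thus ?thesis by (simp add: d(2) mult_ac)
 qed simp
 hence "poly a r * \<rho> ^ i + poly b r * s * \<rho> ^ i : P" by (rule V.add_mem[OF pol[OF ab(1,3)]])
 thus ?thesis by (simp add: ab(5) distrib_right \<rho>_def)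
qed

text \<open>The defect is q: the basis elements r^j with j <= i and r^j s with j + q <= i number at
  least 2i - q.\<close>

sublocale ffield k Mf r W q
proof
 show "k \<subseteq> Mf" by (rule k_M)
qed (rule r_M tr algebraic_constant W_M vsub_W W_mono W_mult W_span W_poly W_frac W_indep W_finite W_infinite; assumption)+

end

subsection \<open>The ground fields\<close>

lemma of_F_simps [simp]:
 fixes f g :: "'q::{finite,field} ratfun"
 shows "of_F (0 :: 'q ratfun) = 0" "of_F (1 :: 'q ratfun) = 1" "of_F (f + g) = of_F f + of_F g" "of_F (f * g) = of_F f * of_F g"
 "of_F (- f) = - of_F f"
proof -
 have "[:1:] = (1 :: 'q ratfun poly)" "[:f + g:] = [:f:] + [:g:]" "[:f * g:] = [:f:] * [:g:]" "[:- f:] = - [:f:]"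
  by simp_all
 thus "of_F (0 :: 'q ratfun) = 0" "of_F (1 :: 'q ratfun) = 1" "of_F (f + g) = of_F f + of_F g" "of_F (f * g) = of_F f * of_F g"
  "of_F (- f) = - of_F f"
  unfolding of_F_def by (simp_all only: to_fract_0 to_fract_1 to_fract_add to_fract_mult to_fract_uminus
    to_ac_0 to_ac_1 to_ac_add to_ac_mult to_ac_minus pCons_0_0)
qed

lemma of_F_eq_iff [simp]: "of_F f = of_F g \<longleftrightarrow> f = g"
 by (simp add: of_F_def)

lemma of_F_inverse: "of_F (inverse f) = inverse (of_F f)"
proof (cases "f = 0")
 case False
 hence "of_F f * of_F (inverse f) = 1" using of_F_simps(4)[of f "inverse f"] by simp
 thus ?thesis by (metis inverse_unique)
qed simp

lemma of_A_simps [simp]: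
 "of_A 0 = 0" "of_A 1 = 1" "of_A (a + b) = of_A a + of_A b" "of_A (a * b) = of_A a * of_A b"
 "of_A (- a) = - of_A a" "of_A a = of_A b \<longleftrightarrow> a = b"
 by (simp_all add: of_A_def)

lemma of_A_pow: "of_A (a ^ n) = of_A a ^ n"
 by (induction n) auto

lemma subfld_F: "subfld (field_F :: 'q::{finite,field} ambient set)"
proof
 fix x :: "'q ambient" assume "x : field_F"
 then obtain f where f: "x = of_F f" by (auto simp: field_F_def)
 show "- x : field_F" "inverse x : field_F"
  unfolding f of_F_simps(5)[symmetric] of_F_inverse[symmetric] field_F_def by (rule rangeI)+
 fix y :: "'q ambient" assume "y : field_F"
 then obtain g where g: "y = of_F g" by (auto simp: field_F_def)
 show "x + y : field_F" "x * y : field_F"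
  unfolding f g of_F_simps(3,4)[symmetric] field_F_def by (rule rangeI)+
qed (auto simp: field_F_def intro: range_eqI[of _ _ 0] range_eqI[of _ _ 1])

lemma subfld_Fj: "subfld (field_Fj :: 'q::{finite,field} ambient set)"
proof
 fix x :: "'q ambient" assume "x : field_Fj"
 then obtain f where f: "x = to_ac f" by (auto simp: field_Fj_def)
 show "- x : field_Fj" "inverse x : field_Fj"
  unfolding f to_ac_minus[symmetric] to_ac_inverse[symmetric] field_Fj_def by (rule rangeI)+
 fix y :: "'q ambient" assume "y : field_Fj"
 then obtain g where g: "y = to_ac g" by (auto simp: field_Fj_def)
 show "x + y : field_Fj" "x * y : field_Fj"
  unfolding f g to_ac_add[symmetric] to_ac_mult[symmetric] field_Fj_def by (rule rangeI)+
qed (auto simp: field_Fj_def intro: range_eqI[of _ _ 0] range_eqI[of _ _ 1])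

lemma of_A_F: "of_A a : field_F"
 by (simp add: of_A_def field_F_def)

lemma F_Fj: "field_F \<subseteq> field_Fj"
 by (auto simp: field_F_def field_Fj_def of_F_def)

lemma j_Fj: "j_gen : field_Fj"
 by (auto simp: j_gen_def field_Fj_def)

lemma algel_Fj: "algel field_Fj y"
proof -
 obtain p where p: "p ~= 0" "poly (map_poly to_ac p) y = 0" using alg_closure_algebraic[of y] .
 have "coeff (map_poly to_ac p) i = to_ac (coeff p i)" for i by (simp add: coeff_map_poly)
 hence "pover field_Fj (map_poly to_ac p)" "map_poly to_ac p ~= 0"
  using p(1) by (auto simp: pover_def field_Fj_def poly_eq_iff)
 thus ?thesis using p(2) unfolding algel_def by blast
qed

lemma poly_j: "poly (map_poly of_F p) j_gen = to_ac (to_fract p)"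
proof (induction p)
 case (pCons a p)
 have "pCons a p = [:a:] + [:0, 1:] * p" by simp
 hence "to_ac (to_fract (pCons a p)) = of_F a + j_gen * to_ac (to_fract p)"
  unfolding of_F_def j_gen_def by (simp only: to_fract_add to_fract_mult to_ac_add to_ac_mult)
 thus ?case using pCons by (simp add: map_poly_pCons)
qed simp

lemma j_trans: "~ algel field_F (j_gen :: 'q::{finite,field} ambient)"
proof
 assume "algel field_F (j_gen :: 'q ambient)"
 then obtain p :: "'q ambient poly" where p: "pover field_F p" "p ~= 0" "poly p j_gen = 0" by (auto simp: algel_def)
 define g where "g x = (SOME f. of_F f = x)" for x :: "'q ambient"
 have g: "of_F (g x) = x" if "x : field_F" for x
  unfolding g_def by (rule someI_ex) (use that in \<open>auto simp: field_F_def\<close>)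
 have g0: "g 0 = 0" using g[of 0] subfld_F subrng.zero_mem[OF subfld.axioms(1)] of_F_eq_iff of_F_simps(1) by metis
 have "map_poly of_F (map_poly g p) = p"
  using p(1) g g0 by (intro poly_eqI) (simp add: coeff_map_poly pover_def)
 hence "to_ac (to_fract (map_poly g p)) = 0" using poly_j[of "map_poly g p"] p(3) by simp
 hence "map_poly g p = 0" by simp
 thus False using \<open>map_poly of_F (map_poly g p) = p\<close> p(2) by simp
qed

lemma Fj_least:
 fixes N :: "'q::{finite,field} ambient set"
 assumes "subfld N" "field_F \<subseteq> N" "j_gen : N"
 shows "field_Fj \<subseteq> N"
proof
 interpret subfld N by fact
 fix y :: "'q ambient" assume "y : field_Fj"
 then obtain f where f: "y = to_ac f" by (auto simp: field_Fj_def)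
 obtain a b where "f = Fract a b" by (cases f) auto
 hence "f = to_fract a / to_fract b" by (simp add: Fract_conv_to_fract)
 hence "y = poly (map_poly of_F a) j_gen / poly (map_poly of_F b) j_gen" by (simp add: f poly_j)
 moreover have "poly (map_poly of_F c) j_gen : N" for c
  using assms by (intro poly_mem) (auto simp: pover_def coeff_map_poly field_F_def)
 ultimately show "y : N" by (simp add: divide_mem)
qed

lemma of_nat_amb: "(of_nat n :: 'q::{finite,field} ambient) = of_A [:of_nat n:]"
proof (induction n)
 case (Suc n)
 have "[:of_nat (Suc n):] = 1 + [:of_nat n :: 'q:]" by (simp add: one_pCons)
 thus ?case using Suc by (simp only: of_nat_Suc of_A_simps)
qed simp

declare CHAR_alg_closure [simp del]

lemma CHAR_amb: "CHAR('q::{finite,field} ambient) = CHAR('q)"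
proof -
 have "(of_nat n :: 'q ambient) = 0 \<longleftrightarrow> (of_nat n :: 'q) = 0" for n
  unfolding of_nat_amb of_A_simps(1)[symmetric] of_A_simps(6) by simp
 hence *: "CHAR('q ambient) dvd n \<longleftrightarrow> CHAR('q) dvd n" for n by (simp only: of_nat_eq_0_iff_char_dvd)
 have "CHAR('q ambient) dvd CHAR('q)" "CHAR('q) dvd CHAR('q ambient)"
  by (rule iffD2[OF * dvd_refl], rule iffD1[OF * dvd_refl])
 thus ?thesis by (rule dvd_antisym)
qed

lemma CHAR_finite_pos: "CHAR('q::{finite,field}) > 0"
 by (rule finite_imp_CHAR_pos) simp

text \<open>A finite field is a vector space over its prime field, here the image \<open>K0\<close>
  of the natural numbers, which has p elements.\<close>

lemma card_finite_field: "EX e>0. CARD('q::{finite,field}) = CHAR('q) ^ e"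
proof -
 define K0 where "K0 = range (of_nat :: nat => 'q)"
 let ?p = "CHAR('q)"
 have p: "?p > 0" by (rule CHAR_finite_pos)
 have K0: "subrng K0"
 proof
  show "0 : K0" "1 : K0" unfolding K0_def by (metis rangeI of_nat_0, metis rangeI of_nat_1)
  fix x assume "x : K0"
  then obtain m where m: "x = of_nat m" by (auto simp: K0_def)
  have "of_nat (m * (?p - 1)) + x = of_nat (m * (?p - 1) + m)" unfolding m by (simp only: of_nat_add)
  also have "m * (?p - 1) + m = m * ?p"
  proof -
   have "m * (k - 1) + m = m * k" if "k > 0" for k using that by (cases k) auto
   thus ?thesis using p by blast
  qed
  finally have "of_nat (m * (?p - 1)) + x = 0" by (simp only: of_nat_mult of_nat_CHAR mult_zero_right)
  hence "- x = of_nat (m * (?p - 1))" by (metis add.commute minus_unique)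
  thus "- x : K0" unfolding K0_def by (metis rangeI)
  fix y assume "y : K0"
  then obtain n where n: "y = of_nat n" by (auto simp: K0_def)
  show "x + y : K0" "x * y : K0" unfolding m n of_nat_add[symmetric] of_nat_mult[symmetric] K0_def by (rule rangeI)+
 qed
 interpret K0: subrng K0 by (rule K0)
 interpret K0: subfld K0
 proof
  fix x assume x: "x : K0"
  show "inverse x : K0"
  proof (cases "x = 0")
   case False
   have "inj_on ((*) x) K0" using False by (auto simp: inj_on_def)
   moreover have "(*) x ` K0 \<subseteq> K0" using x by (auto intro: K0.mult_mem)
   ultimately have "(*) x ` K0 = K0" by (intro endo_inj_surj) simp_all
   then obtain y where "y : K0" "1 = x * y" using K0.one_mem by (metis imageE)
   thus ?thesis by (metis inverse_unique)
  qed (use x in simp)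
 qed
 have cK0: "card K0 = ?p"
 proof -
  have "K0 = of_nat ` {..<?p}"
  proof (intro equalityI subsetI)
   fix x assume "x : K0"
   then obtain m where "x = of_nat m" by (auto simp: K0_def)
   moreover have "of_nat (m div ?p * ?p + m mod ?p) = (of_nat (m mod ?p) :: 'q)"
    by (simp only: of_nat_add of_nat_mult of_nat_CHAR mult_zero_right add_0)
   hence "of_nat m = (of_nat (m mod ?p) :: 'q)" by (simp only: div_mult_mod_eq)
   ultimately show "x : of_nat ` {..<?p}" using p by (metis imageI lessThan_iff mod_less_divisor)
  qed (auto simp: K0_def)
  moreover have "inj_on (of_nat :: nat => 'q) {..<?p}"
  proof (rule linorder_inj_onI)
   fix i j assume ij: "i < j" "i : {..<?p}" "j : {..<?p}"
   show "(of_nat i :: 'q) ~= of_nat j"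
   proof
    assume "(of_nat i :: 'q) = of_nat j"
    hence "(of_nat (j - i) :: 'q) = 0" using ij by (simp add: of_nat_diff)
    hence "?p dvd j - i" by (simp add: of_nat_eq_0_iff_char_dvd)
    thus False using ij by (auto dest: dvd_imp_le)
   qed
  qed auto
  ultimately show ?thesis by (simp add: card_image)
 qed
 obtain n where "mdim K0 (UNIV :: 'q set) {0} n"
  using K0.mdim_exists[OF vsub_zero, of "UNIV :: 'q set" "CARD('q)"] by (auto simp: card_mono)
 then obtain U :: "'q set" where U: "indep K0 {0} U" "spans K0 {0} U UNIV" by (auto simp: mdim_def)
 define F where "F c = (\<Sum>u\<in>U. c u * u)" for c :: "'q => 'q"
 have "bij_betw F (U \<rightarrow>\<^sub>E K0) UNIV"
  unfolding bij_betw_def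
 proof
  show "inj_on F (U \<rightarrow>\<^sub>E K0)"
  proof (rule inj_onI)
   fix c d assume cd: "c : U \<rightarrow>\<^sub>E K0" "d : U \<rightarrow>\<^sub>E K0" "F c = F d"
   hence "(\<Sum>u\<in>U. (c u - d u) * u) : {0}" by (simp add: F_def left_diff_distrib sum_subtractf)
   hence "c u - d u = 0" if "u : U" for u
    using indepD[OF U(1), of "%u. c u - d u" u] cd that by (auto intro: K0.diff_mem)
   thus "c = d" using cd by (intro PiE_ext[of c U]) auto
  qed
  show "F ` (U \<rightarrow>\<^sub>E K0) = UNIV"
  proof (intro equalityI subsetI)
   fix v :: 'q
   obtain c where c: "ALL u:U. c u : K0" "v - (\<Sum>u\<in>U. c u * u) : {0}" using U(2) unfolding spans_def by blast
   have "F (restrict c U) = v" using c(2) by (simp add: F_def)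
   moreover have "restrict c U : U \<rightarrow>\<^sub>E K0" using c(1) by auto
   ultimately show "v : F ` (U \<rightarrow>\<^sub>E K0)" by blast
  qed simp
 qed
 hence "card (U \<rightarrow>\<^sub>E K0) = CARD('q)" by (rule bij_betw_same_card)
 hence *: "CARD('q) = ?p ^ card U" by (simp add: card_PiE cK0)
 have "card {0, 1 :: 'q} <= CARD('q)" by (intro card_mono) auto
 hence "card U > 0" using * by (cases "card U") auto
 thus ?thesis using * by blast
qed

lemma CHAR_amb_pos: "CHAR('q::{finite,field} ambient) > 0"
 by (simp add: CHAR_amb CHAR_finite_pos)

lemma frob_add: "(a + b :: 'q::{finite,field} ambient) ^ CARD('q) = a ^ CARD('q) + b ^ CARD('q)"
proof -
 obtain e where "CARD('q) = CHAR('q ambient) ^ e" using card_finite_field[where ?'q = 'q] by (auto simp: CHAR_amb)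
 thus ?thesis using freshmans_dream'[OF char_prime[OF CHAR_amb_pos[where ?'q = 'q]]] by blast
qed

lemma of_nat_card_amb: "(of_nat CARD('q) :: 'q::{finite,field} ambient) = 0"
 using card_finite_field[where ?'q = 'q]
 by (auto simp: of_nat_eq_0_iff_char_dvd CHAR_amb dvd_power)

lemma frob_minus: "(- a :: 'q::{finite,field} ambient) ^ CARD('q) = - (a ^ CARD('q))"
 using frob_add[of "- a" a] by (simp add: eq_neg_iff_add_eq_0 zero_power)

lemma frob_diff: "(a - b :: 'q::{finite,field} ambient) ^ CARD('q) = a ^ CARD('q) - b ^ CARD('q)"
 using frob_add[of a "- b"] frob_minus[of b] by simp

lemma power_card_finite_field: "(c :: 'q::{finite,field}) ^ CARD('q) = c"
proof (cases "c = 0")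
 case False
 let ?S = "UNIV - {0 :: 'q}"
 have "bij_betw ((*) c) ?S ?S"
  by (rule bij_betwI[of _ _ _ "(*) (inverse c)"]) (use False in auto)
 hence "(\<Prod>x\<in>?S. c * x) = (\<Prod>x\<in>?S. x)" by (rule prod.reindex_bij_betw)
 moreover have "(\<Prod>x\<in>?S. c * x) = c ^ card ?S * (\<Prod>x\<in>?S. x)" by (simp add: prod.distrib)
 moreover have "(\<Prod>x\<in>?S. x) ~= 0" by simp
 ultimately have 1: "c ^ card ?S = 1" by simp
 have "CARD('q) = Suc (card ?S)" by (rule card.remove) auto
 hence "c ^ CARD('q) = c * c ^ card ?S" by (simp only: power_Suc)
 thus ?thesis by (simp only: 1 mult_1_right)
qed simp

definition Fq :: "'q::{finite,field} ambient set" where "Fq = range (%c. of_A [:c:])"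

text \<open>X^q - X has at most q roots, and the constants already provide q of them. Membership in
  the finite field thus becomes an equation, which is how later translations are recognised as
  constants.\<close>

lemma Fq_iff: "x : Fq \<longleftrightarrow> x ^ CARD('q) = (x :: 'q::{finite,field} ambient)"
proof -
 have sub: "Fq \<subseteq> {x :: 'q ambient. x ^ CARD('q) = x}"
 proof
  fix x :: "'q ambient" assume "x : Fq"
  then obtain c where x: "x = of_A [:c:]" by (auto simp: Fq_def)
  have "[:c:] ^ CARD('q) = [:c:]" by (simp add: poly_const_pow power_card_finite_field)
  thus "x : {x. x ^ CARD('q) = x}" by (simp add: x of_A_pow[symmetric])
 qed
 define p where "p = monom 1 (CARD('q)) - [:0, 1 :: 'q ambient:]"
 have "card {0, 1 :: 'q} <= CARD('q)" by (intro card_mono) auto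
 hence q2: "CARD('q) >= 2" by simp
 have "coeff p (CARD('q)) = 1" using q2 by (simp add: p_def coeff_pCons split: nat.splits)
 hence p0: "p ~= 0" by (metis coeff_0 zero_neq_one)
 have roots: "{x :: 'q ambient. x ^ CARD('q) = x} = {x. poly p x = 0}" by (simp add: p_def poly_monom)
 have "degree p <= CARD('q)" unfolding p_def using q2 by (intro degree_diff_le degree_monom_le) simp
 hence "card {x. poly p x = 0} <= CARD('q)" using card_poly_roots_bound[OF p0] by linarith
 moreover have "card (Fq :: 'q ambient set) = CARD('q)"
  unfolding Fq_def by (rule card_image) (auto simp: inj_on_def)
 ultimately have "Fq = {x :: 'q ambient. x ^ CARD('q) = x}"
  using card_seteq[OF _ sub] poly_roots_finite[OF p0] by (simp add: roots)
 thus ?thesis by blast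
qed

subsection \<open>Drinfeld modules of rank two\<close>

lemma drinfeld_T:
 assumes dm: "drinfeld_module 2 (\<phi> :: 'q::{finite,field} poly => 'q ambient poly)"
 shows "\<phi> [:0, 1:] = monom (of_A [:0, 1:]) 1 + monom (coeff (\<phi> [:0, 1:]) (CARD('q))) (CARD('q))
  + monom (coeff (\<phi> [:0, 1:]) (CARD('q) ^ 2)) (CARD('q) ^ 2)"
  "coeff (\<phi> [:0, 1:]) (CARD('q) ^ 2) ~= 0"
proof -
 let ?q = "CARD('q)" and ?p = "\<phi> [:0, 1:]"
 have "card {0, 1 :: 'q} <= ?q" by (intro card_mono) auto
 hence q2: "?q >= 2" by simp
 have deg: "degree ?p = ?q ^ 2" using dm by (simp add: drinfeld_module_def)
 thus "coeff ?p (?q ^ 2) ~= 0" using q2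
  by (metis leading_coeff_0_iff degree_0 power_eq_0_iff not_numeral_le_zero)
 have c1: "coeff ?p 1 = of_A [:0, 1:]" using dm by (simp add: drinfeld_module_def)
 have ne: "1 ~= ?q" "1 ~= ?q ^ 2" "?q ~= ?q ^ 2" using q2 by (auto simp: power2_eq_square)
 show "?p = monom (of_A [:0, 1:]) 1 + monom (coeff ?p ?q) ?q + monom (coeff ?p (?q ^ 2)) (?q ^ 2)"
 proof (rule poly_eqI)
  fix i
  consider "i = 1" | "i = ?q" | "i = ?q ^ 2" | "i ~= 1" "i ~= ?q" "i ~= ?q ^ 2" by blast
  thus "coeff ?p i = coeff (monom (of_A [:0, 1:]) 1 + monom (coeff ?p ?q) ?q + monom (coeff ?p (?q ^ 2)) (?q ^ 2)) i"
  proof cases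
   case 4
   have "coeff ?p i = 0"
   proof (rule ccontr)
    assume n: "coeff ?p i ~= 0"
    then obtain m where m: "i = ?q ^ m" using dm unfolding drinfeld_module_def by blast
    have "i <= ?q ^ 2" using n le_degree deg by metis
    hence "m <= 2" unfolding m using q2 by (simp add: power_increasing_iff)
    hence "m = 0 \<or> m = 1 \<or> m = 2" by linarith
    thus False using 4 m by auto
   qed
   thus ?thesis using 4 by simp
  qed (use ne c1 in auto)
 qed
qed

lemma drinfeld_pCons:
 assumes dm: "drinfeld_module 2 (\<phi> :: 'q::{finite,field} poly => 'q ambient poly)"
 shows "\<phi> (pCons c a) = [:0, of_A [:c:]:] + pcompose (\<phi> [:0, 1:]) (\<phi> a)"
  "poly (\<phi> (pCons c a)) v = of_A [:c:] * v + poly (\<phi> a) (poly (\<phi> [:0, 1:]) v)"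
proof -
 have D: "\<phi> (a + b) = \<phi> a + \<phi> b" "\<phi> (a * b) = pcompose (\<phi> a) (\<phi> b)" "\<phi> [:c:] = [:0, of_A [:c:]:]" for a b c
  using dm by (auto simp: drinfeld_module_def)
 have e: "pCons c a = [:c:] + [:0, 1:] * a" "pCons c a = [:c:] + a * [:0, 1:]" by simp_all
 have "\<phi> (pCons c a) = \<phi> [:c:] + \<phi> ([:0, 1:] * a)" by (simp only: e(1) D(1))
 thus "\<phi> (pCons c a) = [:0, of_A [:c:]:] + pcompose (\<phi> [:0, 1:]) (\<phi> a)" by (simp only: D(2,3))
 have "\<phi> (pCons c a) = \<phi> [:c:] + \<phi> (a * [:0, 1:])" by (simp only: e(2) D(1))
 thus "poly (\<phi> (pCons c a)) v = of_A [:c:] * v + poly (\<phi> a) (poly (\<phi> [:0, 1:]) v)"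
  by (simp only: D(2,3) poly_add poly_pcompose) simp
qed

lemma drinfeld_poly_0:
 assumes dm: "drinfeld_module 2 (\<phi> :: 'q::{finite,field} poly => 'q ambient poly)"
 shows "poly (\<phi> a) 0 = 0"
proof (rule ccontr)
 assume "poly (\<phi> a) 0 ~= 0"
 hence "coeff (\<phi> a) 0 ~= 0" unfolding poly_0_coeff_0 .
 then obtain m where "0 = CARD('q) ^ m" using dm unfolding drinfeld_module_def by blast
 thus False by simp
qed

lemma fautD:
 assumes "faut k sg"
 shows "sg (x + y) = sg x + sg y" "sg (x * y) = sg x * sg y" "sg 1 = 1" "sg 0 = 0" "sg (- x) = - sg x"
  "sg (x - y) = sg x - sg y" "sg (x ^ n) = sg x ^ n" "sg (inverse x) = inverse (sg x)" "sg (x / y) = sg x / sg y"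
  "sg x = 0 \<longleftrightarrow> x = 0" "sg x = sg y \<longleftrightarrow> x = y" "bij sg" "c : k ==> sg c = c"
proof -
 note a = assms[unfolded faut_def]
 show add: "sg (x + y) = sg x + sg y" and mu: "sg (x * y) = sg x * sg y" and one: "sg 1 = 1"
  and b: "bij sg" and c: "c : k ==> sg c = c" for x y c
  using a by auto
 have "sg 0 + sg 0 = sg 0 + 0" using add[of 0 0] by (simp only: add_0_right)
 thus z: "sg 0 = 0" by (simp only: add_left_cancel)
 show inj: "sg x = sg y \<longleftrightarrow> x = y" for x y using b by (auto simp: bij_def inj_def)
 show z': "sg x = 0 \<longleftrightarrow> x = 0" for x using inj[of x 0] z by simp
 show m: "sg (- x) = - sg x" for x using add[of x "- x"] z by (simp add: eq_neg_iff_add_eq_0 add.commute)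
 show "sg (x - y) = sg x - sg y" using add[of x "- y"] m[of y] by simp
 show "sg (x ^ n) = sg x ^ n" by (induction n) (simp_all add: one mu)
 show i: "sg (inverse x) = inverse (sg x)" for x
 proof (cases "x = 0")
  case False
  hence "sg x * sg (inverse x) = 1" using mu[of x "inverse x"] one by simp
  thus ?thesis by (metis inverse_unique)
 qed (simp add: z)
 show "sg (x / y) = sg x / sg y" by (simp add: divide_inverse mu i)
qed

lemma faut_poly: "faut k sg ==> poly (map_poly sg p) (sg v) = sg (poly p v)"
 by (induction p) (simp_all add: fautD map_poly_pCons)

lemma faut_fixed: "faut k sg ==> subfld {x. sg x = x}"
 by unfold_locales (simp_all add: fautD)

lemma faut_inv: "faut k sg ==> faut k (inv_into UNIV sg)"
proof -
 let ?i = "inv_into UNIV sg"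
 assume f: "faut k sg"
 have s: "sg (?i x) = x" for x using fautD(12)[OF f] by (simp add: bij_is_surj surj_f_inv_f)
 have i: "?i (sg x) = x" for x using fautD(12)[OF f] by (simp add: bij_is_inj)
 have "?i (x + y) = ?i x + ?i y" "?i (x * y) = ?i x * ?i y" for x y
  using i[of "?i x + ?i y"] i[of "?i x * ?i y"] by (simp_all only: fautD(1,2)[OF f] s)
 moreover have "?i c = c" if "c : k" for c using i[of c] fautD(13)[OF f that] by simp
 moreover have "?i 1 = 1" using i[of 1] fautD(3)[OF f] by simp
 ultimately show ?thesis using fautD(12)[OF f] by (simp add: faut_def bij_imp_bij_inv)
qed

lemma auts_iff: "sg : auts k \<longleftrightarrow> faut k sg"
 unfolding auts_def faut_def ring_iso_def ring_hom_def by auto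

lemma subfield_amb: "subfield N amb \<longleftrightarrow> subfld N"
proof
 assume "subfld N"
 then interpret subfld N .
 show "subfield N amb"
 proof (intro field.subfieldI'[OF field_amb])
  show "subring N amb" by (simp add: subring_amb subrng_axioms)
  fix x assume x: "x : N - {\<zero>\<^bsub>amb\<^esub>}"
  hence "inv\<^bsub>amb\<^esub> x = inverse x"
   using monoid.inv_unique'[OF ring.is_monoid[OF ring_amb], of x "inverse x"] by simp
  thus "inv\<^bsub>amb\<^esub> x : N" using x inverse_mem by simp
 qed
next
 assume N: "subfield N amb"
 interpret subrng N using subfieldE(1)[OF N] by (simp only: subring_amb)
 show "subfld N"
 proof
  fix x assume x: "x : N"
  show "inverse x : N"
  proof (cases "x = 0")
   case False
   hence "inv\<^bsub>amb\<^esub> x : N" "x * inv\<^bsub>amb\<^esub> x = 1"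
    using ring.subfield_m_inv[OF ring_amb N, of x] x by auto
   thus ?thesis by (metis inverse_unique)
  qed simp
 qed
qed

lemma generate_field_amb:
 shows "subfld (generate_field amb H)" "H \<subseteq> generate_field amb H"
  "subfld N ==> H \<subseteq> N ==> generate_field amb H \<subseteq> N"
 using field.generate_field_is_subfield[OF field_amb, of H] field.generate_field_min_subfield1[OF field_amb, of H N]
 by (auto simp: subfield_amb intro: generate_field.incl)

lemma infinite_amb: "infinite (UNIV :: 'q::{finite,field} ambient set)"
proof
 assume "finite (UNIV :: 'q ambient set)"
 hence "finite (range (%n. of_A (monom (1 :: 'q) n)))" by (rule finite_subset[rotated]) simp
 moreover have "inj (%n. of_A (monom (1 :: 'q) n))"
  by (rule injI) (simp add: monom_eq_iff')
 ultimately show False using finite_imageD[of "%n. of_A (monom (1 :: 'q) n)" UNIV] by simp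
qed

lemma poly_eqI_amb: "(!!v. poly f v = poly g v) ==> f = (g :: 'q::{finite,field} ambient poly)"
 using poly_roots_finite[of "f - g"] infinite_amb by auto

lemma sep_closure_sepel: "sep_closure k = {x. sepel k x}"
 by (simp add: sep_closure_def sepel_def pover_def)

locale t3_pair =
 fixes \<phi> :: "'q::{finite,field} poly => 'q ambient poly" and C :: "'q ambient set"
  and x \<theta> :: "'q ambient" and q :: nat
 assumes dm: "drinfeld_module 2 \<phi>" and j\<phi>: "j_invariant \<phi> = j_gen"
  and ann: "!!a. poly (\<phi> a) x = 0 \<longleftrightarrow> [:0, 1:] ^ 3 dvd a" and C_def: "C = range (%a. poly (\<phi> a) x)"
  and th_def: "\<theta> = of_A [:0, 1:]" and q_card: "q = CARD('q)"
begin

lemma q2: "q >= 2"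
proof -
 have "card {0, 1 :: 'q} <= q" unfolding q_card by (intro card_mono) auto
 thus ?thesis by simp
qed

lemma fr: "(a + b :: 'q ambient) ^ q = a ^ q + b ^ q" "(a - b :: 'q ambient) ^ q = a ^ q - b ^ q"
  "(of_nat q :: 'q ambient) = 0"
 unfolding q_card by (rule frob_add frob_diff of_nat_card_amb)+

lemma Fq_q: "c : Fq \<longleftrightarrow> c ^ q = (c :: 'q ambient)"
 unfolding q_card by (rule Fq_iff)

definition g where "g = coeff (\<phi> [:0, 1:]) q"
definition dl where "dl = coeff (\<phi> [:0, 1:]) (q ^ 2)"
definition tau where "tau v = \<theta> * v + g * v ^ q + dl * (v ^ q) ^ q"

lemma poly_T: "poly (\<phi> [:0, 1:]) v = tau v"
proof -
 note T = drinfeld_T(1)[OF dm, folded th_def q_card, folded g_def dl_def]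
 show ?thesis by (subst T) (simp add: tau_def poly_monom power2_eq_square power_mult)
qed

lemma poly_pC: "poly (\<phi> (pCons c a)) v = of_A [:c:] * v + poly (\<phi> a) (tau v)"
 using drinfeld_pCons(2)[OF dm] unfolding poly_T .

lemma tau_add: "tau (u + v) = tau u + tau v"
 by (simp add: tau_def fr algebra_simps)

lemma tau_cmul: "c : Fq ==> tau (c * v) = c * tau v"
 by (simp add: Fq_q tau_def power_mult_distrib algebra_simps)

lemma dl_nz: "dl ~= 0" and j_eq: "g ^ (q + 1) = j_gen * dl"
proof -
 show d: "dl ~= 0" using drinfeld_T(2)[OF dm] unfolding dl_def q_card[symmetric] .
 have "g ^ (q + 1) / dl = j_gen" using j\<phi> unfolding j_invariant_def q_card[symmetric] g_def dl_def .
 thus "g ^ (q + 1) = j_gen * dl" using d by (metis nonzero_divide_eq_eq)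
qed

definition x1 where "x1 = tau x"
definition x0 where "x0 = tau x1"

lemma poly3: "poly (\<phi> (pCons c0 (pCons c1 (pCons c2 b)))) x = of_A [:c0:] * x + of_A [:c1:] * x1 + of_A [:c2:] * x0 + poly (\<phi> b) (tau x0)"
 unfolding poly_pC x1_def[symmetric] x0_def[symmetric] by simp

lemma poly_phi_0: "poly (\<phi> a) 0 = 0" by (rule drinfeld_poly_0[OF dm])

lemma T3: "[:0, 1:] ^ 3 * b = pCons 0 (pCons 0 (pCons (0::'q) b))"
 by (simp add: numeral_3_eq_3)

lemma T3_dvd: "[:0, 1:] ^ 3 dvd pCons c0 (pCons c1 (pCons (c2::'q) 0)) \<longleftrightarrow> c0 = 0 & c1 = 0 & c2 = 0"
proof
 assume "[:0, 1:] ^ 3 dvd pCons c0 (pCons c1 (pCons c2 0))"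
 then obtain b where "pCons c0 (pCons c1 (pCons c2 0)) = [:0, 1:] ^ 3 * b" by (elim dvdE)
 thus "c0 = 0 & c1 = 0 & c2 = 0" unfolding T3 by (simp only: pCons_eq_iff)
qed simp

lemma tau_x0: "tau x0 = 0"
proof -
 have "poly (\<phi> ([:0, 1:] ^ 3 * 1)) x = 0" unfolding ann by simp
 hence "poly (\<phi> 1) (tau x0) = 0" unfolding T3 poly3 by simp
 moreover have "\<phi> [:1:] = [:0, of_A [:1:]:]" using dm by (simp add: drinfeld_module_def)
 ultimately show ?thesis by (simp add: one_pCons[symmetric])
qed

lemma C_eq: "C = {c0 * x + c1 * x1 + c2 * x0 | c0 c1 c2. c0 : Fq & c1 : Fq & c2 : Fq}"
proof (intro equalityI subsetI)
 fix y assume "y : C"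
 then obtain a where a: "y = poly (\<phi> a) x" by (auto simp: C_def)
 obtain c0 a1 where 0: "a = pCons c0 a1" by (cases a)
 obtain c1 a2 where 1: "a1 = pCons c1 a2" by (cases a1)
 obtain c2 b where 2: "a2 = pCons c2 b" by (cases a2)
 have "y = of_A [:c0:] * x + of_A [:c1:] * x1 + of_A [:c2:] * x0"
  unfolding a 0 1 2 poly3 tau_x0 poly_phi_0 by simp
 thus "y : {c0 * x + c1 * x1 + c2 * x0 | c0 c1 c2. c0 : Fq & c1 : Fq & c2 : Fq}" unfolding Fq_def by blast
next
 fix y assume "y : {c0 * x + c1 * x1 + c2 * x0 | c0 c1 c2. c0 : Fq & c1 : Fq & c2 : Fq}"
 then obtain c0 c1 c2 where "y = of_A [:c0:] * x + of_A [:c1:] * x1 + of_A [:c2:] * x0" by (auto simp: Fq_def)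
 hence "y = poly (\<phi> (pCons c0 (pCons c1 (pCons c2 0)))) x" unfolding poly3 tau_x0 poly_phi_0 by simp
 thus "y : C" by (auto simp: C_def)
qed

lemma indep3:
 assumes "c0 : Fq" "c1 : Fq" "c2 : Fq" "c0 * x + c1 * x1 + c2 * x0 = 0"
 shows "c0 = 0" "c1 = 0" "c2 = 0"
proof -
 obtain d0 d1 d2 where d: "c0 = of_A [:d0:]" "c1 = of_A [:d1:]" "c2 = of_A [:d2:]" using assms by (auto simp: Fq_def)
 have "poly (\<phi> (pCons d0 (pCons d1 (pCons d2 0)))) x = 0"
  unfolding poly3 tau_x0 poly_phi_0 using assms(4) by (simp add: d)
 hence "d0 = 0 & d1 = 0 & d2 = 0" unfolding ann T3_dvd .
 thus "c0 = 0" "c1 = 0" "c2 = 0" by (simp_all add: d)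
qed

lemma Fq_01 [simp]: "(0 :: 'q ambient) : Fq" "(1 :: 'q ambient) : Fq" using q2 by (auto simp: Fq_q)

lemma Fq_subfld: "subfld (Fq :: 'q ambient set)"
proof
 fix a b :: "'q ambient" assume a: "a : Fq"
 show "- a : Fq" using a unfolding Fq_q using fr(2)[of 0 a] q2 by simp
 show "inverse a : Fq" using a unfolding Fq_q by (simp add: power_inverse)
 assume "b : Fq"
 with a show "a + b : Fq" "a * b : Fq" unfolding Fq_q by (simp_all add: fr power_mult_distrib)
qed simp_all

sublocale Fq: subfld "Fq :: 'q ambient set" by (rule Fq_subfld)

lemma x0_nz: "x0 ~= 0" using indep3[of 0 0 1] by auto

text \<open>The isomorphic module obtained by scaling with 1/x0 has \<open>G\<close> and
  \<open>D\<close> as the higher coefficients of the action of T; \<open>y\<close> and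
  \<open>w\<close> are the images of \<open>x1\<close> and \<open>x\<close> there.\<close>

definition y where "y = x1 / x0"
definition w where "w = x / x0"
definition G where "G = g * x0 ^ (q - 1)"
definition D where "D = dl * x0 ^ (q\<^sup>2 - 1)"
text \<open>For another generator, y becomes y + a and w becomes w + a y + b with a, b in the finite
  field. Then y^q - y is unchanged, w^q - w moves by a multiple a of it, the quotient
  \<open>t\<close> moves by a, and t^q - t is unchanged.\<close>

definition zz where "zz = y ^ q - y"
definition t where "t = (w ^ q - w) / zz"
definition s where "s = t ^ q - t"
definition r where "r = s * (1 + \<theta> * zz)"

lemma th_nz: "\<theta> ~= 0" unfolding th_def using of_A_simps(6)[of "[:0, 1:]" 0] by simp

lemma zz_nz: "zz ~= 0"
proof
 assume "zz = 0"
 hence y: "y : Fq" by (simp add: zz_def Fq_q)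
 moreover have "1 * x1 + (- y) * x0 = 0" using x0_nz by (simp add: y_def)
 ultimately show False using indep3[of 0 1 "- y"] by (simp add: Fq.minus_mem)
qed

lemma x0_pows: "g * (u * x0) ^ q = G * u ^ q * x0" "dl * ((u * x0) ^ q) ^ q = D * (u ^ q) ^ q * x0"
proof -
 have q2s: "q * q = Suc (q\<^sup>2 - 1)" using q2 by (simp add: power2_eq_square)
 have "x0 ^ q = x0 ^ (q - 1) * x0" using q2 by (metis Suc_diff_1 less_le_trans mult.commute pos2 power_Suc)
 thus "g * (u * x0) ^ q = G * u ^ q * x0" by (simp add: G_def power_mult_distrib algebra_simps)
 have "(x0 ^ q) ^ q = x0 ^ (q\<^sup>2 - 1) * x0" unfolding power_mult[symmetric] q2s by simp
 thus "dl * ((u * x0) ^ q) ^ q = D * (u ^ q) ^ q * x0" by (simp add: D_def power_mult_distrib algebra_simps)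
qed

lemma tau_scaled: "tau (u * x0) = (\<theta> * u + G * u ^ q + D * (u ^ q) ^ q) * x0"
 unfolding tau_def x0_pows by (simp add: algebra_simps)

lemma D_nz: "D ~= 0" using dl_nz x0_nz by (simp add: D_def)

lemma G_eq: "G = - (\<theta> + D)"
proof -
 have "(\<theta> + G + D) * x0 = 0" using tau_scaled[of 1] tau_x0 by simp
 hence "\<theta> + G + D = 0" using x0_nz by simp
 thus ?thesis by (simp add: eq_neg_iff_add_eq_0 algebra_simps)
qed

text \<open>Eliminating \<open>G\<close> turns the scaled action of T into u -> D (u^q - u)^q -
  theta (u^q - u). It sends y to 1, which is this equation, and w to y, which is
  \<open>v_eq\<close>.\<close>

lemma D_eq: "D * zz ^ q = 1 + \<theta> * zz"
proof -
 have "tau (y * x0) = x0" using x0_nz by (simp add: y_def x0_def)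
 hence "(\<theta> * y + G * y ^ q + D * (y ^ q) ^ q) * x0 = 1 * x0" unfolding tau_scaled by simp
 hence "\<theta> * y + G * y ^ q + D * (y ^ q) ^ q = 1" using x0_nz mult_right_cancel by blast
 thus ?thesis unfolding zz_def fr G_eq by (simp add: algebra_simps)
qed

lemma v_eq: "D * (w ^ q - w) ^ q - \<theta> * (w ^ q - w) = y"
proof -
 have "tau (w * x0) = y * x0" using x0_nz by (simp add: w_def y_def x1_def)
 hence "\<theta> * w + G * w ^ q + D * (w ^ q) ^ q = y" unfolding tau_scaled using x0_nz by simp
 thus ?thesis unfolding fr G_eq by (simp add: algebra_simps)
qed

lemma y_eq: "y = t ^ q + \<theta> * zz * s"
proof -
 have v: "w ^ q - w = t * zz" using zz_nz by (simp add: t_def)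
 have "y = (D * zz ^ q) * t ^ q - \<theta> * (t * zz)" using v_eq unfolding v power_mult_distrib by (simp add: algebra_simps)
 thus ?thesis unfolding D_eq s_def by (simp add: algebra_simps)
qed

text \<open>Apply u -> u^q - u to both sides of \<open>y_eq\<close>: the left side becomes
  \<open>zz\<close>, and t^q becomes s^q.\<close>

lemma z_rel: "zz * (1 + \<theta> * s) = (s * (1 + \<theta> * zz)) ^ q"
proof -
 have "zz = (t ^ q + \<theta> * zz * s) ^ q - (t ^ q + \<theta> * zz * s)" using zz_def y_eq by simp
 also have "... = s ^ q + (\<theta> * zz * s) ^ q - \<theta> * zz * s" unfolding s_def fr by (simp add: algebra_simps)
 finally have "zz * (1 + \<theta> * s) = s ^ q + (s * (\<theta> * zz)) ^ q" by (simp add: algebra_simps)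
 also have "... = (s + s * (\<theta> * zz)) ^ q" by (simp only: fr)
 finally show ?thesis by (simp add: algebra_simps)
qed

lemma z_eq: "zz = s + r ^ q - r"
 using z_rel unfolding r_def by (simp add: algebra_simps)

lemma curve: "\<theta> * s\<^sup>2 + (1 + \<theta> * (r ^ q - r)) * s = r"
proof -
 have "s * (1 + \<theta> * (s + r ^ q - r)) = r" unfolding z_eq[symmetric] by (simp add: r_def)
 thus ?thesis by (simp add: algebra_simps power2_eq_square)
qed

sublocale curve_eq \<theta> r s q
 by unfold_locales (use th_nz q_card curve in auto)

lemma zz_z: "z = zz" by (simp add: z_def z_eq)

lemma j_D: "(- (\<theta> + D)) ^ (q + 1) = j_gen * D"
proof -
 have "(q - 1) * (q + 1) = q\<^sup>2 - 1" by (simp add: algebra_simps power2_eq_square)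
 hence "(x0 ^ (q - 1)) ^ (q + 1) = x0 ^ (q\<^sup>2 - 1)" by (metis power_mult)
 thus ?thesis unfolding G_eq[symmetric] using j_eq by (simp add: G_def D_def power_mult_distrib algebra_simps)
qed


section \<open>Separability over the field of the j-line\<close>

lemma sepel_D: "sepel field_Fj D"
 unfolding sepel_def
proof (intro exI conjI)
 interpret J: subfld "field_Fj :: 'q ambient set" by (rule subfld_Fj)
 have th: "\<theta> : field_Fj" using of_A_F F_Fj unfolding th_def by blast
 define n where "n = q + 1"
 have n: "n - Suc 0 = q" "of_nat n = (1 :: 'q ambient)" using fr(3) by (simp_all add: n_def)
 let ?f = "[:- \<theta>, - 1:] ^ n - [:0, j_gen:]"
 have f: "poly ?f a = (- \<theta> - a) ^ n - j_gen * a" for a by simp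
 show "pover field_Fj ?f" using th j_Fj by (intro J.pover_diff J.pover_power) (auto intro: J.mems)
 show "poly ?f D = 0" using j_D unfolding f n_def[symmetric] by (simp add: algebra_simps)
 have d: "poly (pderiv ?f) a = - ((- \<theta> - a) ^ q) - j_gen" for a
  by (simp add: pderiv_diff pderiv_power pderiv_pCons n)
 have j0: "j_gen * \<theta> ~= 0"
  using th_nz by (simp add: j_gen_def)
 \<comment> \<open>Since q + 1 is 1 in the field, f + (- theta - X) f' is the nonzero constant j
   theta, so f and its derivative have no common root.\<close>
 have id: "poly ?f a + (- \<theta> - a) * poly (pderiv ?f) a = j_gen * \<theta>" for a
 proof -
  have "(- \<theta> - a) ^ n = (- \<theta> - a) * (- \<theta> - a) ^ q" by (simp add: n_def)
  thus ?thesis unfolding f d by (simp add: right_diff_distrib left_diff_distrib)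
 qed
 show "rsquarefree ?f"
 proof (rule rsquarefreeI)
  show "?f ~= 0"
  proof
   assume "?f = 0"
   thus False using id[of 0] j0 by (metis pderiv_0 poly_0 mult_zero_right add_0_right)
  qed
  fix a assume "poly ?f a = 0"
  thus "poly (pderiv ?f) a ~= 0" using id[of a] j0 by (metis add_0_left mult_zero_right)
 qed
qed

text \<open>The derivative of a X^q + b X + c is the nonzero constant b, whatever a is.\<close>

lemma sepel_frob:
 fixes u :: "'q ambient"
 assumes l: "subfld l" and c: "a : l" "b : l" "c : l" "b ~= 0" and u: "a * u ^ q + b * u + c = 0"
 shows "sepel l u"
 unfolding sepel_def
proof (intro exI conjI)
 interpret l: subfld l by fact
 let ?f = "monom a q + [:c, b:]"
 show "pover l ?f" using c by (intro l.pover_add l.pover_monom) auto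
 show "poly ?f u = 0" using u by (simp add: poly_monom algebra_simps)
 have d: "pderiv ?f = [:b:]" by (simp add: pderiv_add pderiv_monom pderiv_pCons fr(3))
 show "rsquarefree ?f"
 proof (rule rsquarefreeI)
  show "?f ~= 0"
  proof
   assume "?f = 0"
   hence "pderiv ?f = 0" by (simp only: pderiv_0)
   thus False using d c(4) by simp
  qed
  show "poly (pderiv ?f) a ~= 0" for a unfolding d using c(4) by simp
 qed
qed

text \<open>A tower: \<open>D\<close> over F(j), then \<open>zz\<close> by \<open>D_eq\<close>, then
  \<open>s\<close> by \<open>z_rel\<close>. The last two equations involve only a q-th power and a
  linear term of the new element.\<close>

lemma sepel_rs: "sepel field_Fj r" "sepel field_Fj s"
proof -
 interpret J: subfld "field_Fj :: 'q ambient set" by (rule subfld_Fj)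
 have th: "\<theta> : field_Fj" using of_A_F F_Fj unfolding th_def by blast
 note ch = CHAR_amb_pos[where ?'q = 'q]
 interpret JD: subfld "adj field_Fj D" by (rule J.subfld_adj[OF sepel_algel[OF sepel_D]])
 have "sepel (adj field_Fj D) zz"
  by (rule sepel_frob[OF JD.subfld_axioms, of D "- \<theta>" "- 1"])
   (use J.adj_incl[of D] J.adj_gen[of D] th D_eq th_nz in \<open>auto simp: JD.minus_mem\<close>)
 moreover have "zz : adj (adj field_Fj D) zz" by (rule JD.adj_gen)
 ultimately have z: "sepel field_Fj zz" using J.sepel_tower[OF ch sepel_D] by blast
 interpret Jz: subfld "adj field_Fj zz" by (rule J.subfld_adj[OF sepel_algel[OF z]])
 have m: "\<theta> : adj field_Fj zz" "zz : adj field_Fj zz" using J.adj_incl[of zz] J.adj_gen[of zz] th by auto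
 have "sepel (adj field_Fj zz) s"
  by (rule sepel_frob[OF Jz.subfld_axioms, of "(1 + \<theta> * zz) ^ q" "- \<theta> * zz" "- zz"])
   (use m z_rel[unfolded power_mult_distrib] zz_nz th_nz in \<open>auto intro!: Jz.mems simp: algebra_simps\<close>)
 moreover have "s : adj (adj field_Fj zz) s" by (rule Jz.adj_gen)
 ultimately show s: "sepel field_Fj s" using J.sepel_tower[OF ch z] by blast
 interpret S: subfld "{x. sepel field_Fj (x :: 'q ambient)}" by (rule J.sepel_subfld[OF ch])
 have "s * (1 + \<theta> * zz) : {x. sepel field_Fj x}"
  by (intro S.mult_mem S.add_mem S.one_mem) (use J.sepel_mem[OF th] z s in auto)
 thus "sepel field_Fj r" by (simp add: r_def)
qed

lemma th_rs: "s ~= 0 ==> \<theta> = (r - s) / (s * z)"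
 unfolding zz_z using zz_nz by (simp add: r_def algebra_simps)

lemma j_field:
 assumes N: "subfld N" "\<theta> : N" "r : N" "s : N"
 shows "j_gen : N" "z : N" "D : N"
proof -
 interpret N: subfld N by fact
 show z: "z : N" using N by (auto simp: z_def intro: N.mems)
 have "D = (1 + \<theta> * z) / z ^ q" using D_eq zz_nz by (simp add: zz_z field_simps)
 thus D: "D : N" using N z by (auto intro!: N.fmems)
 have "j_gen = (- (\<theta> + D)) ^ (q + 1) / D" using j_D D_nz by (simp add: field_simps)
 thus "j_gen : N" using N(2) D by (metis N.divide_mem N.power_mem N.minus_mem N.add_mem)
qed

lemma th_F: "\<theta> : field_F" by (simp add: th_def of_A_F)

text \<open>If r were algebraic over F, the curve equation would make s algebraic, and then j too,
  since j is a rational function of theta, r and s.\<close>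

lemma r_trans_F: "~ algel field_F r"
proof
 interpret F: subfld "field_F :: 'q ambient set" by (rule subfld_F)
 assume r: "algel field_F r"
 interpret Fr: subfld "adj field_F r" by (rule F.subfld_adj[OF r])
 have m: "\<theta> : adj field_F r" "r : adj field_F r" using F.adj_incl F.adj_gen th_F by auto
 have "algel (adj field_F r) s"
  unfolding algel_def
 proof (intro exI conjI)
  show "pover (adj field_F r) [:- r, 1 + \<theta> * (r ^ q - r), \<theta>:]" using m by (auto intro!: Fr.mems)
  show "poly [:- r, 1 + \<theta> * (r ^ q - r), \<theta>:] s = 0" using curve by (simp add: algebra_simps power2_eq_square)
 qed (use th_nz in auto)
 moreover have "algel field_F a" if "a : adj field_F r" for a
  using F.fd_algel[OF F.fd_adj[OF F.fd_self r] that] .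
 ultimately have s: "algel field_F s" by (rule F.algel_trans)
 obtain R where R: "fd field_F R" "{r, s} \<subseteq> R" using F.fd_finite_set[of "{r, s}"] r s by auto
 have "field_F \<subseteq> R" using R(1) by (simp add: fd_def)
 hence "j_gen : R" using j_field(1)[OF F.fd_subfld[OF R(1)]] R(2) th_F by blast
 thus False using F.fd_algel[OF R(1)] j_trans by blast
qed

abbreviation K where "K \<equiv> sep_closure (field_F :: 'q ambient set)"

lemma K_subfld: "subfld K" and F_K: "field_F \<subseteq> K"
 unfolding sep_closure_sepel
 by (rule subfld.sepel_subfld[OF subfld_F CHAR_amb_pos]) (auto intro: subfld.sepel_mem[OF subfld_F])

lemma K_algel: "a : K ==> algel field_F a"
 by (simp add: sep_closure_sepel sepel_algel)

lemma r_trans_K: "~ algel K r"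
 using subfld.algel_trans[OF subfld_F _ K_algel, of K r] r_trans_F by blast

sublocale F: curve_over \<theta> r s q "field_F :: 'q ambient set"
 by (intro curve_over.intro curve_over_axioms.intro curve_eq_axioms subfld_F th_F r_trans_F)

sublocale K: curve_over \<theta> r s q K
 by (intro curve_over.intro curve_over_axioms.intro curve_eq_axioms K_subfld r_trans_K) (use F_K th_F in blast)

lemma Fj_M: "field_Fj \<subseteq> F.Mf"
 using Fj_least[OF F.M.subfld_axioms F.k_M] j_field(1)[OF F.M.subfld_axioms F.th_M F.r_M F.s_M] by blast


section \<open>The field of moduli of the pair\<close>

lemma faut_tau:
 assumes "faut k sg"
 shows "poly (map_poly sg (\<phi> [:0, 1:])) (sg v) = sg (tau v)"
 using faut_poly[OF assms] poly_T by metis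

text \<open>An isomorphism maps \<open>x\<close> to \<open>c\<^sub>0 x + c\<^sub>1 x\<^sub>1 + c\<^sub>2 x\<^sub>0\<close>, which translates \<open>y\<close> and \<open>t\<close> by \<open>c\<^sub>1/c\<^sub>0\<close>.\<close>

lemma pair_iso_fixes:
 assumes sg: "faut field_Fj sg" and iso: "pair_iso \<phi> C (%a. map_poly sg (\<phi> a)) (sg ` C)"
 shows "sg r = r" "sg s = s"
proof -
 note S = fautD[OF sg]
 have th: "sg \<theta> = \<theta>" using S(13) th_F F_Fj by blast
 have Fqc: "sg c = c" if "c : Fq" for c
  using that S(13) of_A_F F_Fj unfolding Fq_def by blast
 obtain u where u: "u ~= 0" "!!a. smult u (\<phi> a) = pcompose (map_poly sg (\<phi> a)) [:0, u:]" "(%v. u * v) ` C = sg ` C"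
  using iso unfolding pair_iso_def by blast
 have tu: "sg (tau v) = u * tau v'" if "sg v = u * v'" for v v'
 proof -
  have "sg (tau v) = poly (pcompose (map_poly sg (\<phi> [:0, 1:])) [:0, u:]) v'"
   using faut_tau[OF sg, of v] that by (simp add: poly_pcompose mult.commute)
  thus ?thesis unfolding u(2)[symmetric] by (simp add: poly_T)
 qed
 have "x : C" unfolding C_eq by (rule CollectI, rule exI[of _ 1], rule exI[of _ 0], rule exI[of _ 0]) simp
 hence "sg x : (%v. u * v) ` C" unfolding u(3) by blast
 then obtain c0 c1 c2 where c: "c0 : Fq" "c1 : Fq" "c2 : Fq" "sg x = u * (c0 * x + c1 * x1 + c2 * x0)"
  unfolding C_eq by blast
 have e1: "sg x1 = u * (c0 * x1 + c1 * x0)"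
  using tu[OF c(4)] c(1-3) unfolding x1_def[symmetric] tau_add by (simp add: tau_cmul x1_def[symmetric] x0_def[symmetric] tau_x0)
 have e0: "sg x0 = u * (c0 * x0)"
  using tu[OF e1] c(1-3) unfolding x0_def[symmetric] tau_add by (simp add: tau_cmul x0_def[symmetric] tau_x0)
 have c0: "c0 ~= 0" using e0 S(10)[of x0] x0_nz by auto
 define a b where "a = c1 / c0" and "b = c2 / c0"
 have ab: "a ^ q = a" "b ^ q = b" using c(1-3) Fq.divide_mem unfolding a_def b_def Fq_q[symmetric] by blast+
 have "sg y = y + a" unfolding y_def S(9) e1 e0 a_def using u(1) c0 x0_nz by (simp add: add_divide_distrib)
 moreover have "sg w = w + a * y + b" unfolding w_def y_def S(9) c(4) e0 a_def b_def using u(1) c0 x0_nz by (simp add: add_divide_distrib)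
 ultimately have zz: "sg zz = zz" and v: "sg (w ^ q - w) = (w ^ q - w) + a * zz"
  unfolding zz_def S(6,7) by (simp_all only: fr power_mult_distrib ab) (simp_all add: algebra_simps)
 have "sg t = t + a" unfolding t_def S(9) v zz using zz_nz by (simp add: add_divide_distrib)
 thus s: "sg s = s" unfolding s_def S(6,7) by (simp only: fr ab) simp
 show "sg r = r" unfolding r_def S(1,2,3) s th zz ..
qed

text \<open>An isomorphism must scale x0 to its image, which gives \<open>u\<close>. The scaled
  coefficients \<open>G\<close> and \<open>D\<close> are fixed, so \<open>u\<close> intertwines the
  two actions. That it maps C to its image needs the displacements a and b of y and w to lie in the
  finite field.\<close>

lemma fixes_pair_iso:
 assumes sg: "faut field_Fj sg" and rs: "sg r = r" "sg s = s"
 shows "pair_iso \<phi> C (%a. map_poly sg (\<phi> a)) (sg ` C)"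
proof -
 note S = fautD[OF sg]
 have th: "sg \<theta> = \<theta>" using S(13) th_F F_Fj by blast
 have FqD: "sg c = c" if "c : Fq" for c
  using that S(13) of_A_F F_Fj unfolding Fq_def by blast
 have z: "sg zz = zz" and D: "sg D = D"
  using j_field(2,3)[OF faut_fixed[OF sg]] rs th by (auto simp: zz_z)
 have G: "sg G = G" unfolding G_eq S(1,5) th D ..
 define a b where "a = sg y - y" and "b = sg w - w - a * y"
 have "a ^ q - a = sg zz - zz" unfolding a_def zz_def S(6,7) fr by (simp add: algebra_simps)
 hence a: "a ^ q = a" using z by simp
 \<comment> \<open>By \<open>y_eq\<close> the displacement of y is the q-th power of that of t, and
   the latter lies in the finite field because s = t^q - t is fixed. So y and t move by the same
   constant.\<close>
 have "a = sg t ^ q - t ^ q" unfolding a_def y_eq S(1,2,7) th z rs by simp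
 also have "... = (sg t - t) ^ q" by (simp only: fr)
 also have "... = sg t - t"
 proof -
  have "(sg t - t) ^ q - (sg t - t) = sg s - s" unfolding s_def S(6,7) fr by (simp add: algebra_simps)
  thus ?thesis using rs by simp
 qed
 finally have ta: "a = sg t - t" .
 have v: "w ^ q - w = t * zz" using zz_nz by (simp add: t_def)
 have "b ^ q - b = sg (w ^ q - w) - (w ^ q - w) - a * zz"
  unfolding b_def zz_def S(6,7) fr power_mult_distrib a by (simp add: algebra_simps)
 also have "... = 0" unfolding v S(2) z ta by (simp add: algebra_simps)
 finally have b: "b ^ q = b" by simp
 have ab: "a : Fq" "b : Fq" using a b by (simp_all add: Fq_q)
 define u where "u = sg x0 / x0"
 have u0: "u ~= 0" using S(10) x0_nz by (simp add: u_def)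
 have e0: "sg x0 = u * x0" using x0_nz by (simp add: u_def)
 have yw: "y * x0 = x1" "w * x0 = x" using x0_nz by (simp_all add: y_def w_def)
 have "sg y = y + a" "sg w = w + a * y + b" by (simp_all add: a_def b_def)
 hence "sg (y * x0) = u * (y * x0 + a * x0)" "sg (w * x0) = u * (w * x0 + a * (y * x0) + b * x0)"
  by (simp_all add: S(2) e0 algebra_simps)
 hence e1: "sg x1 = u * (x1 + a * x0)" and e: "sg x = u * (x + a * x1 + b * x0)" unfolding yw .
 have T: "sg (tau v) = u * tau v'" if "sg v = u * v'" for v v'
 proof -
  have v: "v = (v / x0) * x0" "v' = (v' / x0) * x0" using x0_nz by simp_all
  have q: "sg (v / x0) = v' / x0" unfolding S(9) e0 that using u0 x0_nz by simp
  have "sg (tau v) = (\<theta> * (v' / x0) + G * (v' / x0) ^ q + D * ((v' / x0) ^ q) ^ q) * (u * x0)"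
   by (subst v(1), unfold tau_scaled S(1,2,7) th G D q e0) (rule refl)
  also have "... = u * ((\<theta> * (v' / x0) + G * (v' / x0) ^ q + D * ((v' / x0) ^ q) ^ q) * x0)" by (simp add: algebra_simps)
  also have "... = u * tau v'" unfolding tau_scaled[symmetric] v(2)[symmetric] ..
  finally show ?thesis .
 qed
 have all: "sg (poly (\<phi> c) v) = u * poly (\<phi> c) v'" if "sg v = u * v'" for c v v'
  using that
 proof (induction c arbitrary: v v')
  case 0
  have "\<phi> 0 = 0" using dm unfolding drinfeld_module_def by (metis add_cancel_right_right)
  thus ?case by (simp add: S(4))
 next
  case (pCons c d)
  have "sg (of_A [:c:]) = of_A [:c:]" by (rule FqD) (simp add: Fq_def)
  thus ?case unfolding poly_pC S(1,2) pCons.prems pCons.IH[OF T[OF pCons.prems]] by (simp add: algebra_simps)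
 qed
 have "smult u (\<phi> c) = pcompose (map_poly sg (\<phi> c)) [:0, u:]" for c
 proof (rule poly_eqI_amb)
  fix v
  have "sg (inv_into UNIV sg (u * v)) = u * v" using S(12) by (simp add: bij_is_surj surj_f_inv_f)
  thus "poly (smult u (\<phi> c)) v = poly (pcompose (map_poly sg (\<phi> c)) [:0, u:]) v"
   using all[of "inv_into UNIV sg (u * v)" v c] faut_poly[OF sg, of "\<phi> c" "inv_into UNIV sg (u * v)"]
   by (simp add: poly_pcompose mult.commute)
 qed
 moreover have "(%v. u * v) ` C = sg ` C"
 proof (intro equalityI subsetI)
  fix m assume "m : (%v. u * v) ` C"
  then obtain c0 c1 c2 where c: "c0 : Fq" "c1 : Fq" "c2 : Fq" "m = u * (c0 * x + c1 * x1 + c2 * x0)"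
   unfolding C_eq by blast
  define d1 where "d1 = c1 - a * c0"
  define d2 where "d2 = c2 - b * c0 - a * d1"
  have d: "d1 : Fq" "d2 : Fq" using c ab by (auto simp: d1_def d2_def intro!: Fq.mems)
  have "m = u * (c0 * x + (d1 + a * c0) * x1 + (d2 + b * c0 + a * d1) * x0)" unfolding c(4) by (simp add: d1_def d2_def)
  also have "... = sg (c0 * x + d1 * x1 + d2 * x0)"
   unfolding S(1,2) FqD[OF c(1)] FqD[OF d(1)] FqD[OF d(2)] e e1 e0 by (simp add: algebra_simps)
  finally show "m : sg ` C" unfolding C_eq using c(1) d by blast
 next
  fix m assume "m : sg ` C"
  then obtain c0 c1 c2 where c: "c0 : Fq" "c1 : Fq" "c2 : Fq" "m = sg (c0 * x + c1 * x1 + c2 * x0)"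
   unfolding C_eq by blast
  have "m = u * (c0 * x + (c1 + a * c0) * x1 + (c2 + b * c0 + a * c1) * x0)"
   unfolding c(4) S(1,2) FqD[OF c(1)] FqD[OF c(2)] FqD[OF c(3)] e e1 e0 by (simp add: algebra_simps)
  moreover have "c1 + a * c0 : Fq" "c2 + b * c0 + a * c1 : Fq" using c ab by (auto intro!: Fq.mems)
  ultimately show "m : (%v. u * v) ` C" unfolding C_eq using c(1) by blast
 qed
 ultimately show ?thesis unfolding pair_iso_def using u0 by blast
qed

text \<open>The automorphisms for which the pair is isomorphic to its conjugate are those fixing r
  and s. A separable element fixed by all of them lies in F(r, s) by
  \<open>faut_moves\<close>.\<close>

lemma X0_field_eq: "X0_field \<phi> C = F.Mf"
proof (intro equalityI subsetI)
 interpret J: subfld "field_Fj :: 'q ambient set" by (rule subfld_Fj)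
 fix f assume f: "f : X0_field \<phi> C"
 show "f : F.Mf"
 proof (rule ccontr)
  assume "f ~: F.Mf"
  moreover have "sepel F.Mf f" using f Fj_M by (auto simp: X0_field_def sep_closure_sepel intro: sepel_mono)
  ultimately obtain sg where s: "faut F.Mf sg" "sg f ~= f"
   using faut_moves[OF F.M.subfld_axioms algel_mono[OF algel_Fj Fj_M]] by blast
  have "faut field_Fj sg" using s(1) Fj_M by (auto simp: faut_def)
  moreover have "sg r = r" "sg s = s" using fautD(13)[OF s(1)] F.r_M F.s_M by blast+
  ultimately have "pair_iso \<phi> C (%a. map_poly sg (\<phi> a)) (sg ` C)" "sg : auts field_Fj"
   by (auto simp: auts_iff intro: fixes_pair_iso)
  thus False using s(2) f by (auto simp: X0_field_def)
 qed
next
 interpret J: subfld "field_Fj :: 'q ambient set" by (rule subfld_Fj)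
 interpret S: subfld "{x. sepel field_Fj (x :: 'q ambient)}" by (rule J.sepel_subfld[OF CHAR_amb_pos])
 fix f assume f: "f : F.Mf"
 have "F.Mf \<subseteq> {x. sepel field_Fj x}"
  by (rule F.Mf_least[OF S.subfld_axioms]) (use F_Fj J.sepel_mem sepel_rs in auto)
 moreover have "sg f = f" if "faut field_Fj sg" "pair_iso \<phi> C (%a. map_poly sg (\<phi> a)) (sg ` C)" for sg
 proof -
  have "F.Mf \<subseteq> {x. sg x = x}"
   by (rule F.Mf_least[OF faut_fixed[OF that(1)]]) (use F_Fj fautD(13)[OF that(1)] pair_iso_fixes[OF that] in auto)
  thus ?thesis using f by blast
 qed
 ultimately show "f : X0_field \<phi> C" using f unfolding X0_field_def sep_closure_sepel by (auto simp: auts_iff)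
qed

lemma X0_sep_field_eq: "X0_sep_field \<phi> C = K.Mf"
proof
 have "F.Mf \<subseteq> K.Mf" by (rule F.Mf_least[OF K.M.subfld_axioms]) (use F_K K.k_M K.r_M K.s_M in auto)
 thus "X0_sep_field \<phi> C \<subseteq> K.Mf"
  unfolding X0_sep_field_def X0_field_eq by (intro generate_field_amb(3)[OF K.M.subfld_axioms]) (use K.k_M in auto)
 show "K.Mf \<subseteq> X0_sep_field \<phi> C"
  unfolding X0_sep_field_def X0_field_eq
  by (rule K.Mf_least[OF generate_field_amb(1)]) (use generate_field_amb(2) F.r_M F.s_M in blast)+
qed

end

lemma generic_pair_t3:
 fixes \<phi> :: "'q::{finite,field} poly => 'q ambient poly"
 assumes "generic_pair ([:0, 1:] ^ 3) \<phi> C"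
 obtains x where "t3_pair \<phi> C x (of_A [:0, 1:]) (CARD('q))"
 using assms unfolding generic_pair_def cyclic_subgroup_def t3_pair_def by blast

subsection \<open>Rational places\<close>

text \<open>Denominators may be zero: the value is then 0, so the set is still the field of
  fractions. Only sums need a case distinction.\<close>

lemma frac_subfld:
 assumes "subrng (R :: 'a::field set)"
 shows "subfld {a / b | a b. a : R & b : R}"
proof -
 interpret subrng R by fact
 let ?F = "{a / b | a b. a : R & b : R}"
 have I: "a / b : ?F" if "a : R" "b : R" for a b using that by blast
 show ?thesis
 proof
  show "0 : ?F" "1 : ?F" using I[of 0 1] I[of 1 1] by simp_all
  fix x assume "x : ?F"
  then obtain a b where x: "a : R" "b : R" "x = a / b" by blast
  show "- x : ?F" using I[of "- a" b] x minus_mem by simp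
  show "inverse x : ?F" using I[of b a] x by simp
  fix y assume "y : ?F"
  then obtain c d where y: "c : R" "d : R" "y = c / d" by blast
  show "x * y : ?F" using I[of "a * c" "b * d"] x y mult_mem by simp
  show "x + y : ?F"
  proof (cases "b = 0 \<or> d = 0")
   case True
   hence "x + y = c / d \<or> x + y = a / b" using x y by auto
   thus ?thesis
   proof
    assume "x + y = c / d"
    thus ?thesis using I[OF y(1,2)] by (simp only:)
   next
    assume "x + y = a / b"
    thus ?thesis using I[OF x(1,2)] by (simp only:)
   qed
  next
   case False
   thus ?thesis using I[of "a * d + c * b" "b * d"] x y by (simp add: mult_mem add_mem add_frac_eq)
  qed
 qed
qed

lemma const_plus_ideal_subrng:
 assumes "subrng (k :: 'a::field set)" "subrng R" "k \<subseteq> R" "t : R"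
 shows "subrng {c + t * a | c a. c : k & a : R}"
proof -
 interpret k: subrng k by fact
 interpret R: subrng R by fact
 let ?S = "{c + t * a | c a. c : k & a : R}"
 have I: "c + t * a : ?S" if "c : k" "a : R" for c a using that by blast
 show ?thesis
 proof
  show "0 : ?S" "1 : ?S" using I[of 0 0] I[of 1 0] by simp_all
  fix x assume "x : ?S"
  then obtain c a where x: "c : k" "a : R" "x = c + t * a" by blast
  show "- x : ?S" using I[of "- c" "- a"] x by (simp add: k.minus_mem R.minus_mem)
  fix y assume "y : ?S"
  then obtain d b where y: "d : k" "b : R" "y = d + t * b" by blast
  show "x + y : ?S" using I[of "c + d" "a + b"] x y by (simp add: k.add_mem R.add_mem algebra_simps)
  have "c * d + t * (c * b + d * a + t * (a * b)) : ?S"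
   by (rule I) (use x y assms(3,4) in \<open>auto intro!: k.mems R.mems\<close>)
  thus "x * y : ?S" using x y by (simp add: algebra_simps)
 qed
qed

text \<open>R = K + tR makes tR a maximal ideal with residue field \<open>K\<close>. Every function
  is a power of t times a quotient of elements outside tR, so the place is the localisation of R at
  tR and is determined by R and t.\<close>

lemma (in ffield) rational_place:
 assumes R: "subrng R" "K \<subseteq> R" "R \<subseteq> M" "t : R" "t ~= 0"
  and frac: "!!f. f : M ==> EX a:R. EX b:R. f = a / b"
  and dec: "!!a. a : R ==> EX c:K. EX b:R. a = c + t * b"
  and P: "P : places K M" "R \<subseteq> P" "t : max_ideal P"
 shows "ord_at P t = 1" "dg P = 1" "P = {a / b | a b. a : R & b : R - (*) t ` R}"
proof -
 interpret R: subrng R by fact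
 interpret dvring K M P "unif P" by (rule dvring[OF P(1)])
 have tM: "t : M" using R by blast
 have vt: "ord_at P t >= 1" using m_iff_ord[OF tM R(5)] P(3) by simp
 have fac: "EX n b. b : R - (*) t ` R & a = t ^ n * b" if "a : R" "a ~= 0" for a
  using that
 proof (induction "nat (ord_at P a)" arbitrary: a rule: less_induct)
  case less
  show ?case
  proof (cases "a : (*) t ` R")
   case True
   then obtain b where b: "b : R" "a = t * b" by blast
   hence b0: "b ~= 0" using less.prems by auto
   have bM: "b : M" using b R by blast
   have "ord_at P b >= 0" using ord_ge_0_iff[OF bM b0] b P(2) by blast
   moreover have "ord_at P a = ord_at P t + ord_at P b" using ord_mult[OF tM R(5) bM b0] b by simp
   ultimately have "nat (ord_at P b) < nat (ord_at P a)" using vt by linarith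
   from less.hyps[OF this b(1) b0] obtain n c where "c : R - (*) t ` R" "b = t ^ n * c" by blast
   thus ?thesis using b by (intro exI[of _ "Suc n"]) auto
  next
   case False
   thus ?thesis using less.prems by (intro exI[of _ "0 :: nat"] exI[of _ a]) auto
  qed
 qed
 have unit: "b : P - m & (EX c:K. c ~= 0 & b - c : m)" if b: "b : R - (*) t ` R" for b
 proof -
  obtain c d where cd: "c : K" "d : R" "b = c + t * d" using dec b by blast
  hence c0: "c ~= 0" using b by auto
  have td: "t * d : m" using m_mult[OF P(3), of d] cd P(2) by (auto simp: mult.commute)
  hence "b : P - m" using unit_add_m[OF K_unit[OF cd(1) c0] td] cd by simp
  thus ?thesis using td cd c0 by (intro conjI bexI[of _ c]) auto
 qed
 have unitM: "b : M" "b ~= 0" "ord_at P b = 0" if b: "b : R - (*) t ` R" for b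
  using unit[OF b] PM ord_unit by auto
 have repr: "EX n a b. a : R - (*) t ` R & b : R - (*) t ` R & f = t powi n * (a / b) & ord_at P f = n * ord_at P t"
  if f: "f : M" "f ~= 0" for f
 proof -
  obtain a b where ab: "a : R" "b : R" "f = a / b" using frac f by blast
  hence "a ~= 0" "b ~= 0" using f by auto
  obtain i a' where a: "a' : R - (*) t ` R" "a = t ^ i * a'" using fac[OF ab(1) \<open>a ~= 0\<close>] by blast
  obtain j b' where b: "b' : R - (*) t ` R" "b = t ^ j * b'" using fac[OF ab(2) \<open>b ~= 0\<close>] by blast
  have "f = t powi (int i - int j) * (a' / b')" using R(5) by (simp add: ab(3) a(2) b(2) power_int_diff)
  moreover have "ord_at P f = (int i - int j) * ord_at P t"
   unfolding ab(3) a(2) b(2) using unitM[OF a(1)] unitM[OF b(1)] tM R(5)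
   by (simp add: ord_divide ord_mult ord_power M.power_mem M.mult_mem left_diff_distrib)
  ultimately show ?thesis using a b by blast
 qed
 have uM: "unif P : M" "unif P ~= 0" using t_M t_nz by blast+
 \<comment> \<open>All orders are multiples of the order of t, and the uniformizer has order
   1.\<close>
 obtain n where "1 = n * ord_at P t" using repr[OF uM] ord_t by auto
 thus vt1: "ord_at P t = 1" using vt by (simp add: zmult_eq_1_iff)
 show "P = {a / b | a b. a : R & b : R - (*) t ` R}"
 proof (intro equalityI subsetI)
  fix f assume f: "f : P"
  show "f : {a / b | a b. a : R & b : R - (*) t ` R}"
  proof (cases "f = 0")
   case True
   have "1 ~: (*) t ` R"
   proof
    assume "1 : (*) t ` R"
    then obtain a where "a : R" "1 = t * a" by blast
    thus False using m_mult[OF P(3), of a] P(2) by (auto simp: mult.commute)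
   qed
   thus ?thesis using True by (intro CollectI exI[of _ 0] exI[of _ 1]) auto
  next
   case False
   have fM: "f : M" using f PM by blast
   obtain n a b where r: "a : R - (*) t ` R" "b : R - (*) t ` R" "f = t powi n * (a / b)" "ord_at P f = n * ord_at P t"
    using repr[OF fM False] by blast
   have "n >= 0" using ord_ge_0_iff[OF fM False] f r(4) vt1 by simp
   hence "f = (t ^ nat n * a) / b" using r(3) by (simp add: power_int_def)
   thus ?thesis using r R(4) by (intro CollectI exI[of _ "t ^ nat n * a"] exI[of _ b]) (auto intro: R.mems)
  qed
 next
  fix f assume "f : {a / b | a b. a : R & b : R - (*) t ` R}"
  then obtain a b where ab: "a : R" "b : R - (*) t ` R" "f = a / b" by blast
  thus "f : P" using unit_inverse[of b] unit[of b] P(2) by (auto simp: divide_inverse intro!: mult_mem)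
 qed
 have "mdim K P m 1"
  unfolding mdim_def
 proof (intro exI[of _ "{1}"] conjI)
  show "indep K m {1}" unfolding indep_def using K_m by auto
  show "spans K m {1} P"
   unfolding spans_def
  proof (intro conjI ballI)
   fix f assume f: "f : P"
   have "EX c:K. f - c : m"
   proof (cases "f : m")
    case False
    hence f0: "f ~= 0" by auto
    have fM: "f : M" using f PM by blast
    have "ord_at P f = 0" using unit_iff_ord[OF fM f0] f False by blast
    moreover obtain n a b where r: "a : R - (*) t ` R" "b : R - (*) t ` R" "f = t powi n * (a / b)" "ord_at P f = n * ord_at P t"
     using repr[OF fM f0] by blast
    ultimately have f: "f = a / b" using vt1 by simp
    obtain c d where cd: "c : K" "a - c : m" "d : K" "d ~= 0" "b - d : m" using unit[OF r(1)] unit[OF r(2)] by blast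
    have "c * inverse d * inverse b * (b - d) = c * inverse d * (inverse b * b) - c * inverse b * (inverse d * d)"
     by (simp only: right_diff_distrib mult_ac)
    also have "... = c * inverse d - c * inverse b" using unitM(2)[OF r(2)] cd(4) by simp
    finally have e: "c * inverse d * inverse b * (b - d) = c * inverse d - c * inverse b" .
    have "a * u - c * v = u * (a - c) - (c * v - c * u)" for u v by (simp add: right_diff_distrib mult.commute)
    hence "f - c / d = inverse b * (a - c) - c * inverse d * inverse b * (b - d)"
     unfolding e f divide_inverse .
    also have "... : m"
    proof (rule m_diff[OF m_mult[OF cd(2)] m_mult[OF cd(5)]])
     show b: "inverse b : P" using unit_inverse[of b] unit[OF r(2)] by blast
     have "c : P" "inverse d : P" using cd(1,3) KP K.inverse_mem by blast+
     thus "c * inverse d * inverse b : P" using b by (intro mult_mem)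
    qed
    finally show ?thesis using cd K.divide_mem by blast
   qed (use K.zero_mem in \<open>auto intro: bexI[of _ 0]\<close>)
   then obtain c where c: "c : K" "f - c : m" by blast
   show "EX c. (ALL u:{1}. c u : K) & f - (\<Sum>u\<in>{1}. c u * u) : m"
    by (rule exI[of _ "%_. c"]) (use c in simp)
  qed simp
 qed auto
 thus "dg P = 1" using K.mdim_unique[OF vsub_m dg(1)[OF P(1)]] by blast
qed

subsection \<open>Cusps\<close>

context curve_over
begin

lemma pow_q: "a ^ q = a * a ^ (q - 1)" "a ^ (q - 1) = a * a ^ (q - 2)" for a :: "'b::monoid_mult"
proof -
 have "q = Suc (q - 1)" "q - 1 = Suc (q - 2)" using q_ge_2 by auto
 thus "a ^ q = a * a ^ (q - 1)" "a ^ (q - 1) = a * a ^ (q - 2)" by (metis power_Suc)+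
qed

lemma frac_Mf:
 assumes R: "subrng R" "k \<subseteq> R" and rs: "r : {a / b | a b. a : R & b : R}" "s : {a / b | a b. a : R & b : R}"
  and f: "f : Mf"
 shows "EX a:R. EX b:R. f = a / b"
proof -
 interpret R: subrng R by fact
 have "c : {a / b | a b. a : R & b : R}" if "c : k" for c
  using that R(2) by (intro CollectI exI[of _ c] exI[of _ 1]) auto
 hence "Mf \<subseteq> {a / b | a b. a : R & b : R}"
  by (intro Mf_least frac_subfld R(1) rs) auto
 thus ?thesis using f by blast
qed

text \<open>A subring \<open>R\<close> generated by \<open>a\<close> and \<open>b\<close> with fraction field \<open>Mf\<close> and \<open>R = k + t R\<close>
 determines the place at which \<open>t\<close> vanishes.\<close>

lemma adj2_place:
 fixes a b t
 defines "R \<equiv> adj (adj k a) b"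
 assumes t: "t : R" "t ~= 0" and ab: "a : Mf" "b : Mf"
  and dec: "EX c:k. EX d:R. a = c + t * d" "EX c:k. EX d:R. b = c + t * d"
  and rs: "r : {x / y | x y. x : R & y : R}" "s : {x / y | x y. x : R & y : R}"
  and P: "P : places k Mf" "a : P" "b : P" "t : max_ideal P"
 shows "ord_at P t = 1" "dg P = 1" "P = {x / y | x y. x : R & y : R - (*) t ` R}"
proof -
 interpret V: vring k Mf P by unfold_locales (rule P(1))
 interpret ka: subrng "adj k a" by (rule k.adj_subrng)
 interpret R: subrng R unfolding R_def by (rule ka.adj_subrng)
 have kR: "k \<subseteq> R" using k.adj_incl ka.adj_incl unfolding R_def by blast
 have least: "R \<subseteq> S" if "subrng S" "k \<subseteq> S" "a : S" "b : S" for S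
  unfolding R_def by (intro adj_least that)
 have RM: "R \<subseteq> Mf" by (intro least M.subrng_axioms k_M ab)
 have RP: "R \<subseteq> P" by (intro least V.subrng_axioms V.KP P)
 have S: "subrng {c + t * d | c d. c : k & d : R}"
  by (rule const_plus_ideal_subrng[OF k.subrng_axioms R.subrng_axioms kR t(1)])
 have kS: "k \<subseteq> {c + t * d | c d. c : k & d : R}" by force
 have "R \<subseteq> {c + t * d | c d. c : k & d : R}"
  by (rule least[OF S kS]) (use dec in blast)+
 hence d: "EX c:k. EX d:R. x = c + t * d" if "x : R" for x using that by blast
 note * = rational_place[OF R.subrng_axioms kR RM t frac_Mf[OF R.subrng_axioms kR rs] d P(1) RP P(4)]
 show "ord_at P t = 1" "dg P = 1" "P = {x / y | x y. x : R & y : R - (*) t ` R}"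
  by (rule *; assumption)+
qed

text \<open>Over r = 0 one factor of s (1 + theta z) = r vanishes; over r = infinity, s is infinite
  or finite. Each of these four sets turns out to consist of one place of degree one.\<close>

definition P1s where "P1s = {P : places k Mf. r : P & s : max_ideal P}"
definition P2s where "P2s = {P : places k Mf. r : P & 1 + \<theta> * z : max_ideal P}"
definition Q1s where "Q1s = {P : places k Mf. r ~: P & s ~: P}"
definition Q2s where "Q2s = {P : places k Mf. r ~: P & s : P}"

lemma th_unit:
 assumes "P : places k Mf"
 shows "\<theta> : P" "inverse \<theta> : P" "ord_at P \<theta> = 0"
proof -
 interpret V: vring k Mf P by unfold_locales (rule assms)
 show "\<theta> : P" "inverse \<theta> : P" using V.KP th_k k.inverse_mem by blast+
 show "ord_at P \<theta> = 0" using ord_facts(6)[OF assms th_M th_nz th_k] .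
qed

lemma s_finite: "P : places k Mf ==> r : P ==> s : P & z : P"
proof -
 assume P: "P : places k Mf" "r : P"
 interpret V: vring k Mf P by unfold_locales (rule P(1))
 have s: "s : P" by (rule quadratic_integral[OF P(1) s_M curve th_k th_nz])
  (use th_unit[OF P(1)] P(2) in \<open>auto intro!: V.mems\<close>)
 thus ?thesis using P(2) by (auto simp: z_def intro: V.mems)
qed

lemma nz: "s ~= 0" "z ~= 0" "1 + \<theta> * z ~= 0" "1 + \<theta> * s ~= 0"
 using eq_r eq_z r_nz q_ge_2 by auto

lemma noncuspidal_units:
 assumes P: "P : places k Mf" "r : P" "P ~: P1s" "P ~: P2s"
 shows "r : P - max_ideal P" "s : P - max_ideal P" "z : P - max_ideal P" "1 + \<theta> * z : P - max_ideal P"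
  "1 + \<theta> * s : P - max_ideal P"
proof -
 interpret V: vring k Mf P by unfold_locales (rule P(1))
 note sz = s_finite[OF P(1,2)] th_unit[OF P(1)]
 show s: "s : P - V.m" and u: "1 + \<theta> * z : P - V.m" using P sz by (auto simp: P1s_def P2s_def intro: V.mems)
 thus r: "r : P - V.m" using V.unit_mult eq_r by metis
 have rq: "z * (1 + \<theta> * s) ~: V.m" unfolding eq_z using V.m_power[OF P(2), of q] r by blast
 have mem: "1 + \<theta> * s : P" using sz by (auto intro: V.mems)
 show "z : P - V.m" using rq V.m_mult[of z "1 + \<theta> * s"] mem sz by (auto simp: mult.commute)
 show "1 + \<theta> * s : P - V.m" using rq V.m_mult[of "1 + \<theta> * s" z] mem sz by auto
qed

text \<open>The factorisation r = s (1 + theta z) shows that s generates the ideal of this point in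
  k[r, s]. There z vanishes, both factors 1 + theta z and 1 + theta s are units, and the product
  formulas give all orders.\<close>

lemma P1s_facts:
 assumes P: "P : P1s"
 shows "dg P = 1" "ord_at P r = 1" "ord_at P s = 1" "ord_at P z = int q" "ord_at P (1 + \<theta> * z) = 0"
  "P' : P1s ==> P' = P"
proof -
 let ?R = "adj (adj k r) s"
 interpret ka: subrng "adj k r" by (rule k.adj_subrng)
 interpret R: subrng ?R by (rule ka.adj_subrng)
 have m: "r : ?R" "s : ?R" "k \<subseteq> ?R" using k.adj_incl k.adj_gen ka.adj_incl ka.adj_gen by blast+
 hence z: "z : ?R" and th: "\<theta> : ?R" using th_k by (auto simp: z_def intro: R.mems)
 have dr: "EX c:k. EX d:?R. r = c + s * d"
  by (rule bexI[of _ 0], rule bexI[of _ "1 + \<theta> * z"]) (use eq_r z th in \<open>auto intro: R.mems\<close>)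
 have ds: "EX c:k. EX d:?R. s = c + s * d"
  by (rule bexI[of _ 0], rule bexI[of _ 1]) auto
 have fr: "x : {x / y | x y. x : ?R & y : ?R}" if "x : ?R" for x
  using that by (intro CollectI exI[of _ x] exI[of _ 1]) auto
 note A = adj2_place[OF m(2) nz(1) r_M s_M dr ds fr[OF m(1)] fr[OF m(2)]]
 have P': "Q : places k Mf" "r : Q" "s : Q" "s : max_ideal Q" if "Q : P1s" for Q
  using that s_finite[of Q] by (auto simp: P1s_def)
 interpret V: vring k Mf P by unfold_locales (rule P'[OF P])
 show v: "ord_at P s = 1" and "dg P = 1" using A(1,2)[OF P'[OF P]] by auto
 show "P' = P" if "P' : P1s" using A(3)[OF P'[OF P]] A(3)[OF P'[OF that]] by simp
 note sz = s_finite[OF P'(1,2)[OF P]] th_unit[OF P'(1)[OF P]]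
 have tz: "\<theta> * z : P" "\<theta> : P" using sz V.mult_mem by blast+
 have rm: "r : V.m"
  using V.m_mult[OF P'(4)[OF P] V.add_mem[OF V.one_mem tz(1)]] unfolding mult.commute[of _ s] eq_r .
 have "z = s + (r ^ (q - 1) * r - r)" by (simp only: z_def pow_q(1)[of r] mult.commute) simp
 also have "... : V.m" by (rule V.m_add[OF P'(4)[OF P] V.m_diff[OF V.m_mult[OF rm V.power_mem[OF P'(2)[OF P]]] rm]])
 finally have "1 + \<theta> * z : P - V.m" "1 + \<theta> * s : P - V.m"
  using V.unit_add_m[of 1 "\<theta> * z"] V.unit_add_m[of 1 "\<theta> * s"] V.m_mult P'[OF P] sz by auto
 hence u: "ord_at P (1 + \<theta> * z) = 0" "ord_at P (1 + \<theta> * s) = 0"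
  using dvring.ord_unit[OF dvring[OF P'(1)[OF P]]] by auto
 thus "ord_at P (1 + \<theta> * z) = 0" by simp
 have M: "1 + \<theta> * z : Mf" "1 + \<theta> * s : Mf" using th_M z_M s_M by (auto intro: M.mems)
 show vr: "ord_at P r = 1" using ord_facts(1)[OF P'(1)[OF P] s_M nz(1) M(1) nz(3)] eq_r u v by simp
 have "ord_at P (r ^ q) = int q" using ord_facts(4)[OF P'(1)[OF P] r_M r_nz] vr by simp
 thus "ord_at P z = int q" using ord_facts(1)[OF P'(1)[OF P] z_M nz(2) M(2) nz(4)] eq_z u by simp
qed

text \<open>Here 1 + theta z is the local parameter, and s has the residue -1/theta.\<close>

lemma P2s_facts:
 assumes P: "P : P2s"
 shows "dg P = 1" "ord_at P r = 1" "ord_at P s = 0" "ord_at P z = 0" "ord_at P (1 + \<theta> * z) = 1"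
  "P' : P2s ==> P' = P"
proof -
 let ?R = "adj (adj k r) s" and ?t = "1 + \<theta> * z"
 interpret ka: subrng "adj k r" by (rule k.adj_subrng)
 interpret R: subrng ?R by (rule ka.adj_subrng)
 have m: "r : ?R" "s : ?R" "k \<subseteq> ?R" using k.adj_incl k.adj_gen ka.adj_incl ka.adj_gen by blast+
 hence z: "z : ?R" and th: "\<theta> : ?R" "inverse \<theta> : ?R" using th_k k.inverse_mem by (auto simp: z_def intro: R.mems)
 have t: "?t : ?R" using z th by (auto intro: R.mems)
 have dr: "EX c:k. EX d:?R. r = c + ?t * d"
  by (rule bexI[of _ 0], rule bexI[of _ s]) (use eq_r m in \<open>auto simp: mult.commute\<close>)
 have ds: "EX c:k. EX d:?R. s = c + ?t * d"
 \<comment> \<open>Write t for 1 + theta z, so that r = s t. The formula for r^q, multiplied by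
   theta, reads (t - 1)(1 + theta s) = theta s^q t^q, and this displays 1 + theta s as a multiple of
   t.\<close>
 proof (rule bexI[of _ "- inverse \<theta>"], rule bexI[of _ "inverse \<theta> * ((1 + \<theta> * s) - \<theta> * s ^ q * ?t ^ (q - 1))"])
  have "(?t - 1) * (1 + \<theta> * s) = \<theta> * (s * ?t) ^ q" unfolding eq_r eq_z[symmetric] by (simp add: algebra_simps)
  also have "... = ?t * (\<theta> * s ^ q * ?t ^ (q - 1))" unfolding power_mult_distrib pow_q(1)[of "1 + \<theta> * z"] by (simp only: mult_ac)
  finally have e: "(?t - 1) * (1 + \<theta> * s) = ?t * (\<theta> * s ^ q * ?t ^ (q - 1))" .
  have "a = b * (a - c)" if "(b - 1) * a = b * c" for a b c :: "'q ambient"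
   unfolding right_diff_distrib that[symmetric] by (simp add: left_diff_distrib)
  from arg_cong[OF this[OF e], of "%a. inverse \<theta> * a"]
  have "inverse \<theta> * (1 + \<theta> * s) = ?t * (inverse \<theta> * ((1 + \<theta> * s) - \<theta> * s ^ q * ?t ^ (q - 1)))"
   unfolding mult.left_commute[of "inverse \<theta>" ?t] .
  moreover have "inverse \<theta> * (1 + \<theta> * s) = inverse \<theta> + s" using th_nz by (simp add: distrib_left)
  ultimately have "?t * (inverse \<theta> * ((1 + \<theta> * s) - \<theta> * s ^ q * ?t ^ (q - 1))) = inverse \<theta> + s" by (simp only:)
  thus "s = - inverse \<theta> + ?t * (inverse \<theta> * ((1 + \<theta> * s) - \<theta> * s ^ q * ?t ^ (q - 1)))" by (simp only: minus_add_cancel)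
  show "inverse \<theta> * ((1 + \<theta> * s) - \<theta> * s ^ q * ?t ^ (q - 1)) : ?R"
   using th t m z by (intro R.mems) auto
  show "- inverse \<theta> : k" using th_k by (simp add: k.fmems)
 qed
 have fr: "x : {x / y | x y. x : ?R & y : ?R}" if "x : ?R" for x
  using that by (intro CollectI exI[of _ x] exI[of _ 1]) auto
 note A = adj2_place[OF t nz(3) r_M s_M dr ds fr[OF m(1)] fr[OF m(2)]]
 have P': "Q : places k Mf" "r : Q" "s : Q" "?t : max_ideal Q" if "Q : P2s" for Q
  using that s_finite[of Q] by (auto simp: P2s_def)
 interpret V: vring k Mf P by unfold_locales (rule P'[OF P])
 show v: "ord_at P ?t = 1" and "dg P = 1" using A(1,2)[OF P'[OF P]] by auto
 show "P' = P" if "P' : P2s" using A(3)[OF P'[OF P]] A(3)[OF P'[OF that]] by simp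
 note sz = s_finite[OF P'(1,2)[OF P]] th_unit[OF P'(1)[OF P]]
 have rm: "r : V.m" using V.m_mult[of ?t s] P'[OF P] eq_r by auto
 have zu: "z ~: V.m"
 proof
  assume "z : V.m"
  hence "?t - \<theta> * z : V.m" using P'(4)[OF P] sz V.m_diff V.m_mult by blast
  thus False by simp
 qed
 hence vz: "ord_at P z = 0" using dvring.ord_unit[OF dvring[OF P'(1)[OF P]]] sz by auto
 thus "ord_at P z = 0" .
 have "s ~: V.m"
 proof
  assume "s : V.m"
  moreover have "r ^ (q - 1) * r : V.m" using rm P'(2)[OF P] by (intro V.m_mult V.power_mem)
  hence "r ^ q : V.m" unfolding pow_q(1)[of r] by (simp only: mult.commute)
  ultimately have "z : V.m" unfolding z_def using rm by (intro V.m_add V.m_diff)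
  thus False using zu by blast
 qed
 thus vs: "ord_at P s = 0" using dvring.ord_unit[OF dvring[OF P'(1)[OF P]]] sz by auto
 have M: "?t : Mf" using th_M z_M by (auto intro: M.mems)
 show vr: "ord_at P r = 1" using ord_facts(1)[OF P'(1)[OF P] s_M nz(1) M nz(3)] eq_r vs v by simp
qed

text \<open>Near this point s behaves like r / (theta r^q). So 1/r and r^(q-1) s serve as
  coordinates; the curve equation divided by r shows that the second one is a unit with residue
  1/theta.\<close>

lemma Q2s_facts:
 assumes P: "P : Q2s"
 shows "dg P = 1" "ord_at P r = - 1" "ord_at P s = int q - 1" "ord_at P z = - int q" "ord_at P (1 + \<theta> * z) = - int q"
  "ord_at P (1 + \<theta> * s) = 0" "P' : Q2s ==> P' = P"
proof -
 define \<rho> where "\<rho> = inverse r"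
 define sg where "sg = r ^ (q - 1) * s"
 let ?R = "adj (adj k \<rho>) sg"
 interpret ka: subrng "adj k \<rho>" by (rule k.adj_subrng)
 interpret R: subrng ?R by (rule ka.adj_subrng)
 have m: "\<rho> : ?R" "sg : ?R" "k \<subseteq> ?R" using k.adj_incl k.adj_gen ka.adj_incl ka.adj_gen by blast+
 hence th: "\<theta> : ?R" "inverse \<theta> : ?R" using th_k k.inverse_mem by auto
 have M: "\<rho> : Mf" "sg : Mf" "1 + \<theta> * z : Mf" "1 + \<theta> * s : Mf"
  using r_M s_M th_M z_M by (auto simp: \<rho>_def sg_def intro!: M.fmems)
 have rr: "r * \<rho> = 1" "\<rho> ~= 0" using r_nz by (simp_all add: \<rho>_def)
 have rrn: "r ^ n * \<rho> ^ n = 1" for n using rr by (metis power_mult_distrib power_one)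
 have sig: "s = sg * \<rho> ^ (q - 1)" using rrn[of "q - 1"] by (simp add: sg_def mult_ac)
 have q1: "\<rho> ^ (q - 1) = \<rho> * \<rho> ^ (q - 2)" "\<rho> ^ q = \<rho> * \<rho> ^ (q - 1)" "r ^ q = r * r ^ (q - 1)"
  by (rule pow_q)+
 have rel: "\<rho> ^ q * (1 + \<theta> * s) * sg + \<theta> * (1 - \<rho> ^ (q - 1)) * sg = 1"
 proof -
  have "s * (1 + \<theta> * s) + \<theta> * (r ^ q - r) * s = r" using curve by (simp add: power2_eq_square algebra_simps)
  hence "\<rho> * (s * (1 + \<theta> * s) + \<theta> * (r ^ q - r) * s) = 1" using rr by (simp add: mult.commute)
  moreover have "\<rho> * s = \<rho> ^ q * sg" unfolding sig q1(2) by (simp add: mult_ac)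
  moreover have "\<rho> * (r ^ q - r) * s = (1 - \<rho> ^ (q - 1)) * sg"
  proof -
   have "\<rho> * (r ^ q - r) * s = (r * \<rho>) * (r ^ (q - 1) * s) - (r * \<rho>) * s" unfolding q1(3) by (simp add: algebra_simps)
   thus ?thesis unfolding rr sg_def[symmetric] by (simp add: sig algebra_simps)
  qed
  moreover have "\<rho> * (s * (1 + \<theta> * s) + \<theta> * (r ^ q - r) * s) = (\<rho> * s) * (1 + \<theta> * s) + \<theta> * (\<rho> * (r ^ q - r) * s)"
   by (simp add: algebra_simps)
  ultimately show ?thesis by (simp add: mult_ac)
 qed
 have dr: "EX c:k. EX d:?R. \<rho> = c + \<rho> * d"
  by (rule bexI[of _ 0], rule bexI[of _ 1]) auto
 have ds: "EX c:k. EX d:?R. sg = c + \<rho> * d"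
 proof (rule bexI[of _ "inverse \<theta>"], rule bexI[of _ "inverse \<theta> * (\<theta> * \<rho> ^ (q - 2) * sg - \<rho> ^ (q - 1) * (1 + \<theta> * s) * sg)"])
  let ?d = "\<theta> * \<rho> ^ (q - 2) * sg - \<rho> ^ (q - 1) * (1 + \<theta> * s) * sg"
  have "\<theta> * sg = 1 + \<theta> * \<rho> ^ (q - 1) * sg - \<rho> ^ q * (1 + \<theta> * s) * sg" using rel by (simp add: algebra_simps)
  also have "... = 1 + \<rho> * ?d" unfolding q1(2) unfolding q1(1) by (simp add: algebra_simps)
  finally have "\<theta> * sg = 1 + \<rho> * ?d" .
  moreover have "sg = inverse \<theta> + \<rho> * (inverse \<theta> * d)" if d: "\<theta> * sg = 1 + \<rho> * d" for d
  proof -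
   have "sg = inverse \<theta> * (\<theta> * sg)" using th_nz by simp
   also have "... = inverse \<theta> + \<rho> * (inverse \<theta> * d)"
    unfolding d by (simp only: distrib_left mult_1_right mult.left_commute)
   finally show ?thesis .
  qed
  ultimately show "sg = inverse \<theta> + \<rho> * (inverse \<theta> * ?d)" by blast
  have "s : ?R" unfolding sig using m by (intro R.mems)
  thus "inverse \<theta> * ?d : ?R" using th m by (intro R.mems) auto
  show "inverse \<theta> : k" using th_k by (simp add: k.fmems)
 qed
 have frr: "r : {x / y | x y. x : ?R & y : ?R}"
  by (rule CollectI, rule exI[of _ 1], rule exI[of _ \<rho>]) (intro conjI m(1) R.one_mem, use rr in \<open>simp add: eq_divide_eq\<close>)
 have frs: "s : {x / y | x y. x : ?R & y : ?R}"
  unfolding sig by (rule CollectI, rule exI[of _ "sg * \<rho> ^ (q - 1)"], rule exI[of _ 1]) (use m R.mult_mem R.power_mem in simp)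
 note A = adj2_place[OF m(1) rr(2) M(1,2) dr ds frr frs]
 have P': "Q : places k Mf & \<rho> : Q & sg : Q - max_ideal Q & \<rho> : max_ideal Q" if Q: "Q : Q2s" for Q
 proof -
  have Qp: "Q : places k Mf" "r ~: Q" "s : Q" using Q by (auto simp: Q2s_def)
  interpret V: vring k Mf Q by unfold_locales (rule Qp)
  have \<rho>: "\<rho> : V.m" using V.notin_P[OF r_M Qp(2)] by (simp add: \<rho>_def)
  hence \<rho>P: "\<rho> : Q" by (rule V.m_P)
  define e where "e = \<rho> ^ q * (1 + \<theta> * s) + \<theta> * (1 - \<rho> ^ (q - 1))"
  have "e = \<theta> + ((1 + \<theta> * s) * \<rho> ^ (q - 1) - \<theta> * \<rho> ^ (q - 2)) * \<rho>" unfolding e_def q1(2) unfolding q1(1)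
   by (simp add: algebra_simps)
  moreover have "(1 + \<theta> * s) * \<rho> ^ (q - 1) - \<theta> * \<rho> ^ (q - 2) : Q"
   using th_unit(1)[OF Qp(1)] Qp(3) \<rho>P
   by (intro V.diff_mem V.mult_mem V.add_mem V.power_mem V.one_mem)
  ultimately have "e : Q - V.m" using V.unit_add_m[OF V.K_unit[OF th_k th_nz] V.m_mult[OF \<rho>]] by simp
  moreover have "sg = inverse e" using rel by (intro inverse_unique[symmetric]) (simp add: e_def algebra_simps)
  ultimately have "sg : Q - V.m" using V.unit_inverse by blast
  thus ?thesis using Qp \<rho> \<rho>P by blast
 qed
 note PP = P'[OF P]
 interpret V: vring k Mf P by unfold_locales (use PP in blast)
 note PM = conjunct1[OF PP]
 have v\<rho>: "ord_at P \<rho> = 1" and "dg P = 1" using A(1,2)[of P] PP by auto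
 thus "dg P = 1" by blast
 show "P' = P" if "P' : Q2s" using A(3)[of P] A(3)[of P'] PP P'[OF that] by blast
 have vsg: "ord_at P sg = 0" using dvring.ord_unit[OF dvring[OF PM]] PP by auto
 have sg0: "sg ~= 0" using nz sig by auto
 show vr: "ord_at P r = - 1" using ord_facts(3)[OF PM r_M r_nz] v\<rho> by (simp add: \<rho>_def)
 have rq: "\<rho> ^ (q - 1) : Mf" "\<rho> ^ (q - 1) ~= 0" using M(1) rr M.power_mem by auto
 have "ord_at P (\<rho> ^ (q - 1)) = int q - 1" using ord_facts(4)[OF PM M(1) rr(2)] v\<rho> q_ge_2 by (simp add: of_nat_diff)
 thus vs: "ord_at P s = int q - 1" unfolding sig using ord_facts(1)[OF PM M(2) sg0 rq] vsg by simp
 have "s : V.m" using ord_facts(8)[OF PM s_M nz(1)] vs q_ge_2 by simp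
 hence "1 + \<theta> * s : P - V.m" using V.unit_add_m[of 1] V.m_mult th_unit[OF PM] by auto
 thus u: "ord_at P (1 + \<theta> * s) = 0" using dvring.ord_unit[OF dvring[OF PM]] by auto
 have "ord_at P (r ^ q) = - int q" using ord_facts(4)[OF PM r_M r_nz] vr by simp
 thus "ord_at P z = - int q" using ord_facts(1)[OF PM z_M nz(2) M(4) nz(4)] eq_z u by simp
 show "ord_at P (1 + \<theta> * z) = - int q" using ord_facts(1)[OF PM s_M nz(1) M(3) nz(3)] eq_r vr vs by simp
qed

text \<open>The other root \<open>s'\<close> of the quadratic equation gives a second copy of the curve, which
 exchanges the two cusps at infinity.\<close>

definition s' where "s' = - (1 + \<theta> * z) / \<theta>"

lemma curve': "\<theta> * s'\<^sup>2 + (1 + \<theta> * (r ^ q - r)) * s' = r"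
proof -
 define u where "u = 1 + \<theta> * z"
 have c: "1 + \<theta> * (r ^ q - r) = u - \<theta> * s" by (simp add: u_def z_def algebra_simps)
 have ts: "\<theta> * s' = - u" using th_nz by (simp add: s'_def u_def)
 have "\<theta> * (\<theta> * s'\<^sup>2 + (u - \<theta> * s) * s') = (\<theta> * s')\<^sup>2 + (u - \<theta> * s) * (\<theta> * s')"
  by (simp add: power2_eq_square algebra_simps)
 also have "... = \<theta> * (s * u)" unfolding ts by (simp add: power2_eq_square algebra_simps)
 finally show ?thesis unfolding c u_def eq_r using th_nz by simp
qed

lemma curve_over': "curve_over \<theta> r s' q k"
 by unfold_locales (use th_nz q_card curve' th_k tr in auto)

lemma S_eqs: "1 + \<theta> * curve_eq.z r s' q = - \<theta> * s" "1 + \<theta> * s' = - \<theta> * z"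
proof -
 interpret S: curve_over \<theta> r s' q k by (rule curve_over')
 have ts: "\<theta> * s' = - (1 + \<theta> * z)" using th_nz by (simp add: s'_def)
 thus "1 + \<theta> * s' = - \<theta> * z" by simp
 have "1 + \<theta> * S.z = 1 + \<theta> * s' + \<theta> * (r ^ q - r)" by (simp add: S.z_def algebra_simps)
 also have "... = - \<theta> * s" unfolding ts by (simp add: z_def algebra_simps)
 finally show "1 + \<theta> * S.z = - \<theta> * s" .
qed

lemma S_Mf: "curve_over.Mf r s' k = Mf"
proof
 interpret S: curve_over \<theta> r s' q k by (rule curve_over')
 have "s' : Mf" unfolding s'_def using th_M z_M by (auto intro!: M.fmems)
 thus "S.Mf \<subseteq> Mf" by (intro S.Mf_least M.subfld_axioms k_M r_M)
 have "s = - (1 + \<theta> * S.z) / \<theta>" unfolding S_eqs using th_nz by simp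
 also have "... : S.Mf" using S.th_M S.z_M by (auto intro!: S.M.fmems)
 finally show "Mf \<subseteq> S.Mf" by (intro Mf_least S.M.subfld_axioms S.k_M S.r_M)
qed

text \<open>It remains to see that 1 + theta z = r/s is finite. Otherwise s/r would vanish together
  with 1/r and 1/s, and the curve equation divided by s r^q would put the constant theta into the
  maximal ideal.\<close>

lemma Q1s_S: "P : Q1s ==> P : curve_over.Q2s r s' k"
proof -
 interpret S: curve_over \<theta> r s' q k by (rule curve_over')
 assume "P : Q1s"
 hence P: "P : places k Mf" "r ~: P" "s ~: P" by (auto simp: Q1s_def)
 interpret V: vring k Mf P by unfold_locales (rule P)
 define \<rho> where "\<rho> = inverse r"
 have \<rho>: "\<rho> : V.m" "inverse s : V.m" using V.notin_P[OF r_M P(2)] V.notin_P[OF s_M P(3)] by (auto simp: \<rho>_def)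
 have rr: "\<rho> * r = 1" using r_nz by (simp add: \<rho>_def)
 have "s * \<rho> ~: V.m"
 proof
  assume a: "s * \<rho> : V.m"
  have q1: "\<rho> ^ (q - 1) = \<rho> ^ (q - 2) * \<rho>" "\<rho> ^ q = \<rho> ^ (q - 1) * \<rho>" "r ^ q = r * r ^ (q - 1)"
   by (rule trans[OF pow_q(2) mult.commute] trans[OF pow_q(1) mult.commute] pow_q(1))+
  have "inverse s * \<rho> ^ q * (\<theta> * s\<^sup>2 + (1 + \<theta> * (r ^ q - r)) * s) = inverse s * \<rho> ^ q * r" by (simp only: curve)
  moreover have "inverse s * \<rho> ^ q * (\<theta> * s\<^sup>2 + (1 + \<theta> * (r ^ q - r)) * s)
    = (inverse s * s) * (\<theta> * s * \<rho> ^ q + \<rho> ^ q + \<theta> * ((\<rho> * r) ^ q - \<rho> ^ q * r))"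
   by (simp add: power2_eq_square power_mult_distrib algebra_simps)
  moreover have "\<rho> ^ q * r = \<rho> ^ (q - 1)" unfolding q1(2) using rr by (simp add: mult.assoc)
  ultimately have "\<theta> * s * \<rho> ^ q + \<rho> ^ q + \<theta> * (1 - \<rho> ^ (q - 1)) = inverse s * \<rho> ^ (q - 1)"
   using nz(1) rr by (simp add: mult.assoc)
  hence "\<theta> = inverse s * \<rho> ^ (q - 1) - (\<theta> * \<rho> ^ (q - 1)) * (s * \<rho>) - \<rho> ^ (q - 1) * \<rho> + (\<theta> * \<rho> ^ (q - 2)) * \<rho>"
   unfolding q1(2) unfolding q1(1) by (simp add: algebra_simps)
  also have "... : V.m"
  proof -
   have \<rho>P: "\<rho> ^ n : P" for n by (rule V.power_mem[OF V.m_P[OF \<rho>(1)]])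
   have "inverse s * \<rho> ^ (q - 1) : V.m" using V.m_mult[OF \<rho>(2) \<rho>P] by (simp add: mult.commute)
   thus ?thesis
    by (rule V.m_add[OF V.m_diff[OF V.m_diff[OF _ V.m_mult[OF a]] V.m_mult[OF \<rho>(1)]] V.m_mult[OF \<rho>(1)]])
     (use \<rho>P th_unit(1)[OF P(1)] V.mult_mem in blast)+
  qed
  finally show False using V.K_m[OF th_k] th_nz by blast
 qed
 moreover have sM: "s * \<rho> : Mf" using s_M V.m_P[OF \<rho>(1)] V.PM by (auto intro!: M.mems)
 ultimately have "inverse (s * \<rho>) : P" using V.val[OF sM] V.m_iff[of "s * \<rho>"] by blast
 moreover have "1 + \<theta> * z = inverse (s * \<rho>)" using eq_r nz(1) by (simp add: \<rho>_def field_simps)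
 ultimately have "s' : P" unfolding s'_def divide_inverse using th_unit[OF P(1)] by (auto intro!: V.mems)
 thus "P : S.Q2s" using P by (simp add: S.Q2s_def S_Mf)
qed

lemma Q1s_facts:
 assumes P: "P : Q1s"
 shows "dg P = 1" "ord_at P r = - 1" "ord_at P s = - int q" "ord_at P z = 0" "ord_at P (1 + \<theta> * z) = int q - 1"
  "P' : Q1s ==> P' = P"
proof -
 interpret S: curve_over \<theta> r s' q k by (rule curve_over')
 note S = S.Q2s_facts[OF Q1s_S[OF P]]
 show "dg P = 1" "ord_at P r = - 1" by (rule S)+
 show "P' = P" if "P' : Q1s" using S(7)[OF Q1s_S[OF that]] .
 have PM: "P : places k Mf" using P by (simp add: Q1s_def)
 have c: "- \<theta> : k" "- \<theta> : Mf" "- \<theta> ~= 0" using th_k th_M th_nz by (auto intro: k.mems M.mems)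
 note o = ord_facts(1)[OF PM c(2,3)] ord_facts(6)[OF PM c(2,3,1)]
 show "ord_at P s = - int q" using S(5) o(1)[OF s_M nz(1)] o(2) unfolding S_eqs by simp
 show "ord_at P z = 0" using S(6) o(1)[OF z_M nz(2)] o(2) unfolding S_eqs by simp
 have "1 + \<theta> * z = (- \<theta>) * s'" using th_nz by (simp add: s'_def)
 moreover have "s' : Mf" using S.s_M S_Mf by simp
 ultimately show "ord_at P (1 + \<theta> * z) = int q - 1" using S(3) o(1)[of s'] S.nz(1) o(2) by simp
qed

end

subsection \<open>Transport of places by automorphisms\<close>

lemma faut_image_iff: "faut l sg ==> sg x : sg ` A \<longleftrightarrow> x : A"
 by (auto simp: fautD(11))

lemma faut_image_all: "faut l sg ==> (!!y. y = sg (inv_into UNIV sg y))"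
 using fautD(12)[of l sg] by (simp add: bij_is_surj surj_f_inv_f)

lemma faut_place:
 fixes sg :: "'q::{finite,field} ambient => 'q ambient"
 assumes sg: "faut l sg" and K: "sg ` K = K" and M: "sg ` M = M" and P: "P : places K M"
 shows "sg ` P : places K M"
 unfolding places_iff
proof (intro conjI ballI)
 note S = fautD[OF sg]
 interpret P: subrng P using P by (simp add: places_iff)
 show "subrng (sg ` P)"
 proof
  show "0 : sg ` P" "1 : sg ` P" using S(3,4) by (metis imageI P.zero_mem, metis imageI P.one_mem)
  fix x assume "x : sg ` P"
  then obtain a where a: "a : P" "x = sg a" by blast
  show "- x : sg ` P" unfolding a(2) S(5)[symmetric] by (rule imageI, rule P.minus_mem, rule a)
  fix y assume "y : sg ` P"
  then obtain b where b: "b : P" "y = sg b" by blast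
  show "x + y : sg ` P" "x * y : sg ` P" unfolding a(2) b(2) S(1,2)[symmetric]
   using P.add_mem[OF a(1) b(1)] P.mult_mem[OF a(1) b(1)] by blast+
 qed
 have PP: "K \<subseteq> P" "P \<subset> M" "!!x. x : M ==> x : P \<or> inverse x : P" using P by (auto simp: places_iff)
 show "K \<subseteq> sg ` P" using PP(1) K by blast
 show "sg ` P \<subset> M"
 proof (rule psubsetI)
  show "sg ` P \<subseteq> M" using PP(2) M by blast
  show "sg ` P ~= M"
  proof
   assume "sg ` P = M"
   hence "sg ` P = sg ` M" using M by simp
   hence "P = M" using bij_is_inj[OF S(12)] by (simp add: inj_image_eq_iff)
   thus False using PP(2) by blast
  qed
 qed
 fix x assume "x : M"
 then obtain a where a: "a : M" "x = sg a" using M by blast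
 show "x : sg ` P \<or> inverse x : sg ` P"
  using PP(3)[OF a(1)] unfolding a(2) S(8)[symmetric] faut_image_iff[OF sg] .
qed

lemma faut_max_ideal: "faut l sg ==> max_ideal (sg ` P) = sg ` max_ideal P"
 for sg :: "'q::{finite,field} ambient => 'q ambient"
proof -
 assume sg: "faut l sg"
 have "sg a : max_ideal (sg ` P) \<longleftrightarrow> a : max_ideal P" for a
  unfolding max_ideal_def mem_Collect_eq fautD(8)[OF sg, symmetric] fautD(10)[OF sg] faut_image_iff[OF sg] ..
 thus ?thesis using faut_image_all[OF sg] by (metis Set.set_eqI faut_image_iff[OF sg])
qed

lemma faut_ord:
 fixes sg :: "'q::{finite,field} ambient => 'q ambient"
 assumes sg: "faut l sg"
 shows "ord_at (sg ` P) (sg f) = ord_at P f"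
proof -
 note S = fautD[OF sg]
 have pw: "sg (t powi n) = sg t powi n" for t n by (simp add: power_int_def S(7,8))
 have im: "(%x. sg t * x) ` sg ` P = sg ` (%x. t * x) ` P" for t by (auto simp: S(2) image_image)
 have inj: "sg ` A = sg ` B \<longleftrightarrow> A = B" for A B using bij_is_inj[OF S(12)] by (rule inj_image_eq_iff)
 have eq: "(max_ideal (sg ` P) = (%x. sg t * x) ` sg ` P & sg u : sg ` P - max_ideal (sg ` P) & sg f = sg t powi n * sg u)
   \<longleftrightarrow> (max_ideal P = (%x. t * x) ` P & u : P - max_ideal P & f = t powi n * u)" for t u n
  unfolding faut_max_ideal[OF sg] im inj pw[symmetric] S(2)[symmetric] S(11) Diff_iff faut_image_iff[OF sg] ..
 have "(EX t u. max_ideal (sg ` P) = (%x. t * x) ` sg ` P & u : sg ` P - max_ideal (sg ` P) & sg f = t powi n * u)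
   \<longleftrightarrow> (EX t u. max_ideal P = (%x. t * x) ` P & u : P - max_ideal P & f = t powi n * u)" (is "?A \<longleftrightarrow> ?B") for n
 proof
  assume ?A
  then obtain t u where h: "max_ideal (sg ` P) = (%x. t * x) ` sg ` P & u : sg ` P - max_ideal (sg ` P) & sg f = t powi n * u" by blast
  obtain t' u' where tu: "t = sg t'" "u = sg u'" using faut_image_all[OF sg] by blast
  show ?B using h unfolding tu eq by (intro exI)
 next
  assume ?B
  then obtain t u where "max_ideal P = (%x. t * x) ` P & u : P - max_ideal P & f = t powi n * u" by blast
  thus ?A using eq[of t u n] by blast
 qed
 thus ?thesis unfolding ord_at_def by simp
qed

context curve_over
begin

subsection \<open>Existence of the cusps\<close>

lemma W_union_subrng: "subrng {poly a r + poly b r * s | a b. pover k a & pover k b}" (is "subrng ?R")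
proof -
 have eq: "x : ?R \<longleftrightarrow> (EX i. x : W i)" for x
 proof
  assume "x : ?R"
  then obtain a b where "pover k a" "pover k b" "x = poly a r + poly b r * s" by blast
  thus "EX i. x : W i" by (intro exI[of _ "degree a + degree b + q"]) (auto intro: W_I)
 next
  assume "EX i. x : W i"
  thus "x : ?R" unfolding W_def by blast
 qed
 show ?thesis
 proof
  show "0 : ?R" "1 : ?R" unfolding eq using vsubD(1)[OF vsub_W[of 0]] W_one by blast+
  fix x assume "x : ?R"
  then obtain i where x: "x : W i" unfolding eq by blast
  show "- x : ?R" unfolding eq using vsubD(3)[OF vsub_W, of "- 1" x i] x k.minus_mem[OF k.one_mem] by auto
  fix y assume "y : ?R"
  then obtain j where y: "y : W j" unfolding eq by blast
  show "x * y : ?R" unfolding eq using W_mult[OF x y] by blast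
  have "x : W (max i j)" "y : W (max i j)" using x y W_mono[of i "max i j"] W_mono[of j "max i j"] by auto
  thus "x + y : ?R" unfolding eq using vsubD(2)[OF vsub_W] by blast
 qed
qed

lemma poly_r_eq_const: "pover k b ==> c : k ==> poly b r * r = c ==> c = 0"
 using poly_nz[of "pCons (- c) b"] by (auto simp: k.minus_mem mult.commute split: if_splits)

text \<open>A non-unit of k[r, s] vanishes at a place containing this ring, and such a place lies
  over a finite value of r.\<close>

lemma ex_finite_cusp:
 assumes y: "y : {poly a r + poly b r * s | a b. pover k a & pover k b}" "y ~= 0"
  and inv: "!!A B. pover k A ==> pover k B ==> y * (poly A r + poly B r * s) ~= 1"
 shows "EX P:places k Mf. r : P & y : max_ideal P"
proof -
 let ?R = "{poly a r + poly b r * s | a b. pover k a & pover k b}"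
 have mem: "poly a r + poly b r * s : ?R" if "pover k a" "pover k b" for a b using that by blast
 have kR: "k \<subseteq> ?R"
 proof
  fix c assume "c : k"
  thus "c : ?R" using mem[of "[:c:]" 0] by simp
 qed
 have rR: "r : ?R" using mem[of "[:0, 1:]" 0] by simp
 have RM: "?R \<subseteq> Mf"
 proof
  fix x assume "x : ?R"
  then obtain a b where "pover k a" "pover k b" "x = poly a r + poly b r * s" by blast
  thus "x : Mf" using poly_R R_M s_M by (auto intro!: M.add_mem M.mult_mem)
 qed
 have "inverse y ~: ?R"
 proof
  assume "inverse y : ?R"
  then obtain A B where AB: "pover k A" "pover k B" "inverse y = poly A r + poly B r * s" by blast
  have "y * inverse y = 1" using y(2) by simp
  thus False using inv[OF AB(1,2)] unfolding AB(3) by blast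
 qed
 from ex_place[OF M.subfld_axioms W_union_subrng kR RM y(1,2) this] rR show ?thesis by blast
qed

text \<open>If A + B s were an inverse of s, reducing s^2 by the curve equation and comparing the
  parts without s would give B(r) r = theta, against the transcendence of r.\<close>

lemma ex_P1: "EX P. P : P1s"
proof -
 have "s * (poly A r + poly B r * s) ~= 1" if AB: "pover k A" "pover k B" for A B
 proof
  assume e: "s * (poly A r + poly B r * s) = 1"
  let ?A = "poly A r" and ?B = "poly B r" and ?c = "poly cpol r"
  have c: "\<theta> * (s * s) = r - ?c * s" using curve unfolding cpol(2) power2_eq_square by (metis add_diff_cancel_right')
  have "\<theta> * (s * (?A + ?B * s)) = \<theta> * ?A * s + ?B * (\<theta> * (s * s))" by (simp add: algebra_simps)
  also have "... = ?B * r + (\<theta> * ?A - ?B * ?c) * s" unfolding c by (simp add: algebra_simps)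
  finally have "\<theta> = ?B * r + (\<theta> * ?A - ?B * ?c) * s" unfolding e by simp
  moreover have "y - x + w = 0" if "x = y + w" for x y w :: "'q ambient" using that by simp
  ultimately have "(?B * r - \<theta>) + (\<theta> * ?A - ?B * ?c) * s = 0" by blast
  moreover have "?B * r - \<theta> : ratf k r" "\<theta> * ?A - ?B * ?c : ratf k r"
   using AB poly_R cpol(1) k_R th_k r_R by (blast intro: R.diff_mem R.mult_mem)+
  ultimately have "?B * r - \<theta> = 0" using Mf_unique(2) by blast
  thus False using poly_r_eq_const[OF AB(2) th_k] th_nz by simp
 qed
 moreover have "s : {poly a r + poly b r * s | a b. pover k a & pover k b}"
  by (rule CollectI, rule exI[of _ 0], rule exI[of _ 1]) simp
 ultimately show ?thesis using ex_finite_cusp[of s] nz(1) unfolding P1s_def by blast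
qed

lemma ex_P2: "EX P. P : P2s"
proof -
 have uz: "1 + \<theta> * z = poly cpol r + \<theta> * s" unfolding cpol(2) by (simp add: z_def algebra_simps)
 have "(1 + \<theta> * z) * (poly A r + poly B r * s) ~= 1" if AB: "pover k A" "pover k B" for A B
 proof
  assume e: "(1 + \<theta> * z) * (poly A r + poly B r * s) = 1"
  let ?A = "poly A r" and ?B = "poly B r" and ?c = "poly cpol r"
  have "(1 + \<theta> * z) * (?A + ?B * s) = (?c + \<theta> * s) * ?A + ?B * (s * (1 + \<theta> * z))" unfolding uz by (simp add: algebra_simps)
  hence "(?c * ?A + ?B * r - 1) + (\<theta> * ?A) * s = 0" unfolding e eq_r by (simp add: algebra_simps)
  moreover have "?c * ?A + ?B * r - 1 : ratf k r" "\<theta> * ?A : ratf k r"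
   using AB poly_R cpol(1) k_R th_k r_R R.one_mem by (blast intro: R.diff_mem R.mult_mem R.add_mem)+
  ultimately have "\<theta> * ?A = 0" "?c * ?A + ?B * r - 1 = 0" using Mf_unique by blast+
  hence "?B * r = 1" using th_nz by simp
  thus False using poly_r_eq_const[OF AB(2) k.one_mem] by simp
 qed
 moreover have "1 + \<theta> * z : {poly a r + poly b r * s | a b. pover k a & pover k b}"
  unfolding uz by (rule CollectI, rule exI[of _ cpol], rule exI[of _ "[:\<theta>:]"]) (simp add: cpol(1) th_k)
 ultimately show ?thesis using ex_finite_cusp[of "1 + \<theta> * z"] nz(3) unfolding P2s_def by blast
qed

lemma s_s': "s * s' = - r / \<theta>"
proof -
 have "s * s' = - (s * (1 + \<theta> * z)) / \<theta>" by (simp only: s'_def times_divide_eq_right mult_minus_right)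
 thus ?thesis unfolding eq_r .
qed

text \<open>Since s does not lie in k(r), its minimal polynomial is the quadratic one up to a
  constant, and this has \<open>s'\<close> as its other root.\<close>

lemma conj_s: "EX sg. faut (ratf k r) sg & sg s = s'" if al: "!!y. algel (ratf k r) y"
proof -
 obtain m where m: "is_minpoly (ratf k r) s m" using R.ex_minpoly al by blast
 then obtain h where h: "spol = m * h" using spol(1,2) unfolding is_minpoly_def by blast
 have nz: "m ~= 0" "h ~= 0" using h spol(4) by auto
 have d: "degree m + degree h = 2" using spol(3) h degree_mult_eq[OF nz] by simp
 have "degree m ~= 1"
 proof
  assume d1: "degree m = 1"
  then obtain a b where ab: "m = [:a, b:]" by (metis degree1_coeffs)
  hence "b = 1" "a + s = 0" using m d1 by (auto simp: is_minpoly_def split: if_splits)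
  hence "s = - coeff m 0" using ab by (simp add: eq_neg_iff_add_eq_0 add.commute)
  thus False using m s_irrational by (auto simp: is_minpoly_def pover_def intro: R.minus_mem)
 qed
 hence "degree h = 0" using d R.minpoly_degree_pos[OF m] by linarith
 then obtain c where c: "h = [:c:]" by (rule degree_eq_zeroE)
 have "poly spol s' = 0" using curve' by (simp add: spol_def power2_eq_square algebra_simps)
 hence "poly m s' = 0" using h c nz by simp
 thus ?thesis by (rule faut_conjugate[OF R.subfld_axioms al m])
qed

text \<open>The nonconstant r has a pole, which lies at one of the two cusps over infinity; the
  automorphism exchanging s and \<open>s'\<close> carries it to the other.\<close>

lemma ex_Q:
 assumes al: "!!y. algel (ratf k r) y"
 shows "EX P. P : Q1s" "EX P. P : Q2s"
proof -
 obtain sg where sg: "faut (ratf k r) sg" "sg s = s'" using conj_s[OF al] by blast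
 note S = fautD[OF sg(1)]
 have fix_k: "sg c = c" if "c : k" for c using S(13) k_R that by blast
 have sr: "sg r = r" and st: "sg \<theta> = \<theta>" using S(13) r_R fix_k th_k by blast+
 have s'nz: "s' ~= 0" using nz(3) th_nz unfolding s'_def divide_eq_0_iff neg_equal_0_iff_equal by blast
 have "s = - r / \<theta> / s'" using s_s' s'nz by (metis nonzero_mult_div_cancel_right)
 moreover have "sg (- r / \<theta> / s) = - r / \<theta> / s'" unfolding S(5,9) sr st sg(2) ..
 moreover have "s' = - r / \<theta> / s" using s_s' nz(1) by (metis nonzero_mult_div_cancel_left)
 ultimately have ss': "sg s' = s" by simp
 have s'M: "s' : Mf" using th_M z_M by (auto simp: s'_def intro!: M.fmems)
 have "Mf \<subseteq> {x. sg x : Mf}"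
 proof (rule Mf_least)
  show "subfld {x. sg x : Mf}"
   by unfold_locales (auto simp: S(1,2,3,4,5,8) intro: M.fmems)
 qed (use fix_k sr sg(2) k_M r_M s'M in auto)
 moreover have "Mf \<subseteq> sg ` Mf"
 proof
  fix x assume "x : Mf"
  then obtain a b where ab: "a : ratf k r" "b : ratf k r" "x = a + b * s" by (rule Mf_repr)
  hence "x = sg (a + b * s')" unfolding S(1,2) ss' using S(13) by simp
  moreover have "a + b * s' : Mf" using ab R_M s'M by (auto intro!: M.mems)
  ultimately show "x : sg ` Mf" by blast
 qed
 ultimately have Mi: "sg ` Mf = Mf" by blast
 have Ki: "sg ` k = k" using fix_k by (auto simp: image_iff)
 have pl: "sg ` P : places k Mf" if "P : places k Mf" for P by (rule faut_place[OF sg(1) Ki Mi that])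
 have ri: "r : sg ` P \<longleftrightarrow> r : P" and si: "s : sg ` P \<longleftrightarrow> s' : P" for P
  using faut_image_iff[OF sg(1), of r P] faut_image_iff[OF sg(1), of s' P] unfolding sr ss' by auto
 have s'P: "s' : P \<longleftrightarrow> ord_at P (1 + \<theta> * z) >= 0" if P: "P : places k Mf" for P
 proof -
  have M: "1 + \<theta> * z : Mf" "- \<theta> : Mf" "- \<theta> : k" "- \<theta> ~= 0" using th_M z_M th_k th_nz by (auto intro!: M.mems k.mems)
  have "s' = (1 + \<theta> * z) / (- \<theta>)"
   by (simp only: s'_def minus_divide_left[symmetric] nonzero_minus_divide_right[OF th_nz])
  hence "ord_at P s' = ord_at P (1 + \<theta> * z)" using ord_facts(2)[OF P M(1) nz(3) M(2,4)] ord_facts(6)[OF P M(2,4,3)] by simp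
  thus ?thesis using ord_facts(7)[OF P s'M s'nz] by simp
 qed
 have 1: "sg ` P : Q1s" if "P : Q2s" for P
  using that pl ri si s'P[of P] Q2s_facts(5)[OF that] q_ge_2 by (auto simp: Q1s_def Q2s_def)
 have 2: "sg ` P : Q2s" if "P : Q1s" for P
  using that pl ri si s'P[of P] Q1s_facts(5)[OF that] q_ge_2 by (auto simp: Q1s_def Q2s_def)
 have "EX P:places k Mf. r ~: P"
 proof (rule ccontr)
  assume "~ ?thesis"
  hence "r : og P 0" if "P : places k Mf" for P
   using that ord_facts(7)[OF that r_M r_nz] r_M by (auto simp: og_def)
  hence "r : L 0" using r_M by (simp add: L_def)
  hence "r : k" by (simp only: L_0)
  thus False using tr k.algel_mem by blast
 qed
 then obtain P where "P : Q1s \<or> P : Q2s" unfolding Q1s_def Q2s_def by blast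
 thus "EX P. P : Q1s" "EX P. P : Q2s" using 1 2 by blast+
qed

end

locale curve_cusps = curve_over +
 fixes P1 P2 Q1 Q2
 assumes P1: "P1 : P1s" and P2: "P2 : P2s" and Q1: "Q1 : Q1s" and Q2: "Q2 : Q2s"
begin

lemma cusp_places: "P1 : places k Mf" "P2 : places k Mf" "Q1 : places k Mf" "Q2 : places k Mf"
 using P1 P2 Q1 Q2 by (auto simp: P1s_def P2s_def Q1s_def Q2s_def)

lemmas facts = P1s_facts(1-5)[OF P1] P2s_facts(1-5)[OF P2] Q1s_facts(1-5)[OF Q1] Q2s_facts(1-5)[OF Q2]

lemma cusps_neq: "P1 ~= P2" "P1 ~= Q1" "P1 ~= Q2" "P2 ~= Q1" "P2 ~= Q2" "Q1 ~= Q2"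
 using facts q_ge_2 by auto

definition nonc where "nonc = {P : places k Mf. r : P & P ~: P1s & P ~: P2s}"

lemma place_cases:
 assumes "P : places k Mf" obtains "P = P1" | "P = P2" | "P = Q1" | "P = Q2" | "P : nonc"
 using assms P1s_facts(6)[OF P1, of P] P2s_facts(6)[OF P2, of P] Q1s_facts(6)[OF Q1, of P] Q2s_facts(7)[OF Q2, of P]
 unfolding nonc_def Q1s_def Q2s_def by blast

lemma nonc: "P : nonc ==> P : places k Mf" "P : nonc ==> r : P" "P : nonc ==> P ~: {P1, P2, Q1, Q2}"
 using P1 P2 Q1 Q2 unfolding nonc_def Q1s_def Q2s_def by auto

lemma nonc_ord:
 assumes "P : nonc"
 shows "ord_at P r = 0" "ord_at P s = 0" "ord_at P z = 0" "ord_at P (1 + \<theta> * z) = 0"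
 using noncuspidal_units(1-4)[of P] dvring.ord_unit[OF dvring[of P]] assms unfolding nonc_def by auto

definition cd :: "int => int => int => int => 'a divisor" where
 "cd a b c d = frag_cmul a (frag_of P1) + frag_cmul b (frag_of P2) + frag_cmul c (frag_of Q1) + frag_cmul d (frag_of Q2)"

lemma lk_cd: "lk (cd a b c d) P = (if P = P1 then a else if P = P2 then b else if P = Q1 then c else if P = Q2 then d else 0)"
 using cusps_neq by (auto simp: cd_def lookup_add lookup_frag_cmul lookup_frag_of)

lemma cd_eqI:
 assumes f: "f : Mf" "f ~= 0" and nc: "!!P. P : nonc ==> ord_at P f = 0"
 shows "pdiv f = cd (ord_at P1 f) (ord_at P2 f) (ord_at Q1 f) (ord_at Q2 f)"
proof (rule poly_mapping_eqI)
 fix P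
 show "lk (pdiv f) P = lk (cd (ord_at P1 f) (ord_at P2 f) (ord_at Q1 f) (ord_at Q2 f)) P"
 proof (cases "P : places k Mf")
  case True
  thus ?thesis
   by (cases rule: place_cases) (use cusp_places nonc(3)[of P] nc[of P] nonc(1)[of P] cusps_neq in \<open>auto simp: lk_pdiv[OF f] lk_cd\<close>)
 next
  case False
  thus ?thesis using cusp_places by (auto simp: lk_pdiv[OF f] lk_cd)
 qed
qed

lemma pdiv_rsz:
 "pdiv r = cd 1 1 (- 1) (- 1)" "pdiv s = cd 1 0 (- int q) (int q - 1)" "pdiv z = cd (int q) 0 0 (- int q)"
 using cd_eqI[OF r_M r_nz nonc_ord(1)] cd_eqI[OF s_M nz(1) nonc_ord(2)] cd_eqI[OF z_M nz(2) nonc_ord(3)]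
 unfolding facts by auto

lemma cd_simps: "cd a b c d + cd a' b' c' d' = cd (a + a') (b + b') (c + c') (d + d')"
 "frag_cmul n (cd a b c d) = cd (n * a) (n * b) (n * c) (n * d)" "- cd a b c d = cd (- a) (- b) (- c) (- d)"
 by (rule poly_mapping_eqI, auto simp: lk_cd lookup_add lookup_frag_cmul lookup_minus)+

lemma degd_cd: "degd (cd a b c d) = a + b + c + d"
 unfolding cd_def degd_add degd_cmul degd_frag_of facts by simp

lemma isdiv_cd: "isdiv (cd a b c d)"
 unfolding cd_def using cusp_places by (intro isdiv_intros)

definition \<delta> where "\<delta> = cd 0 0 (- 1) 1"

text \<open>The function s^(a-b) r^b has the orders a and b at P1 and P2. What remains has degree 0
  and is supported on Q1 and Q2.\<close>

lemma cd_mod_delta: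
 assumes "a + b + c + d = 0"
 shows "EX n. EX f:Mf. f ~= 0 & cd a b c d = frag_cmul n \<delta> + pdiv f"
proof -
 define f where "f = s powi (a - b) * r powi b"
 have pw: "pdiv (x powi n) = frag_cmul n (pdiv x)" "x powi n : Mf" "x powi n ~= 0" if "x : Mf" "x ~= 0" for x n
 proof -
  have "frag_cmul (- n) (- D) = frag_cmul n D" for D :: "'a divisor"
   by (rule poly_mapping_eqI) (simp add: lookup_frag_cmul lookup_minus)
  thus "pdiv (x powi n) = frag_cmul n (pdiv x)"
   using that pdiv_power[OF that, of "nat n"] pdiv_power[OF M.inverse_mem[OF that(1)], of "nat (- n)"] pdiv_inverse[OF that]
   by (auto simp: power_int_def M.fmems)
  show "x powi n : Mf" "x powi n ~= 0" using that by (simp_all add: M.powi_mem)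
 qed
 note ps = pw[OF s_M nz(1)] pw[OF r_M r_nz]
 have "pdiv f = frag_cmul (a - b) (pdiv s) + frag_cmul b (pdiv r)"
  unfolding f_def pdiv_mult[OF ps(2,3,5,6)] ps(1,4) ..
 also have "... = cd a b (- int q * (a - b) - b) ((int q - 1) * (a - b) - b)"
  unfolding pdiv_rsz cd_simps by (simp add: algebra_simps)
 finally have 1: "pdiv f = cd a b (- int q * (a - b) - b) ((int q - 1) * (a - b) - b)" .
 have c: "c = - a - b - d" using assms by linarith
 have "cd a b c d = frag_cmul (d - ((int q - 1) * (a - b) - b)) \<delta> + pdiv f"
  unfolding 1 \<delta>_def cd_simps c by (simp add: algebra_simps)
 moreover have "f : Mf" unfolding f_def by (rule M.mult_mem[OF ps(2,5)])
 moreover have "f ~= 0" unfolding f_def using ps(3,6) by (rule no_zero_divisors)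
 ultimately show ?thesis by blast
qed

lemma delta_DG: "\<delta> : carrier DG"
 by (simp add: carrier_DG \<delta>_def isdiv_cd degd_cd)

text \<open>At P1 the order q of z is that of s^q, so the zeros there cancel.\<close>

lemma pdiv_eps: "pdiv (s ^ q / z) = frag_cmul (int (q ^ 2)) \<delta>"
proof -
 have "pdiv (s ^ q / z) = frag_cmul (int q) (pdiv s) + - pdiv z"
  using s_M nz z_M by (simp add: pdiv_divide pdiv_power M.power_mem)
 also have "... = frag_cmul (int (q ^ 2)) \<delta>"
  unfolding pdiv_rsz \<delta>_def cd_simps by (simp add: power2_eq_square algebra_simps)
 finally show ?thesis .
qed

subsection \<open>The order of the cuspidal group\<close>

text \<open>Elements of k M^p have t-adic expansions in t^p alone, after multiplication by a power
  of t^p. Frobenius carries the expansion of w, cut off at any order, to one of w^p, and finite sums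
  keep this shape.\<close>

lemma pspan_expansion:
 assumes f: "f : pspan k Mf" and p: "p = CHAR('a ambient)" and P: "P : places k Mf" "dg P = 1" and t: "t : Mf" "t ~= 0" "ord_at P t = 1"
 shows "f : Mf & (EX N. ALL j. EX a:adj k (t ^ p). (t ^ p) ^ N * f - a : og P (int j))"
proof -
 interpret V: dvring k Mf P "unif P" by (rule dvring[OF P(1)])
 have p0: "p > 0" unfolding p by (rule CHAR_amb_pos)
 note fr = freshmans_dream[OF char_prime[OF CHAR_amb_pos[where ?'q = 'a]] p]
 interpret T: subrng "adj k (t ^ p)" by (rule k.adj_subrng)
 have tT: "t ^ p : adj k (t ^ p)" "k \<subseteq> adj k (t ^ p)" by (rule k.adj_gen k.adj_incl)+
 have tP: "t : P" using ord_facts(7)[OF P(1) t(1,2)] t(3) by simp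
 have og0: "x : og P 0 \<longleftrightarrow> x : P" for x using V.ordge_0 og_eq[OF P(1)] by simp
 have res: "EX c:k. x - c : V.m" if x: "x : P" for x
 proof -
  have "mdim k P V.m 1" using dg(1)[OF P(1)] P(2) by simp
  then obtain U where U: "spans k V.m U P" "card U = 1" by (auto simp: mdim_def)
  obtain u where u: "U = {u}" using U(2) by (auto simp: card_1_singleton_iff)
  have sp: "EX c:k. v - c * u : V.m" if "v : P" for v using U(1) that unfolding u spans_def by auto
  obtain c where c: "c : k" "1 - c * u : V.m" using sp[OF V.one_mem] by blast
  obtain d where d: "d : k" "x - d * u : V.m" using sp[OF x] by blast
  have c0: "c ~= 0" using c by auto
  have "d / c : k" using c d by (intro k.divide_mem)
  moreover have "(x - d * u) - d / c * (1 - c * u) : V.m"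
   using \<open>d / c : k\<close> V.KP by (intro V.m_diff[OF d(2)] V.m_mult[OF c(2)]) blast
  moreover have "(x - d * u) - d / c * (1 - c * u) = x - d / c" using c0 by (simp add: right_diff_distrib)
  ultimately have "x - d / c : V.m" by (simp only:)
  thus ?thesis using \<open>d / c : k\<close> by blast
 qed
 have og_P: "x : P" if "x : og P (int j)" for x j
  using that ord_facts(7)[OF P(1), of x] by (cases "x = 0") (auto simp: og_def)
 \<comment> \<open>Expansion up to order j; the coefficients can be taken in \<open>k\<close>
   because the place has degree one.\<close>
 have exp: "EX a:adj k t. x - a : og P (int j)" if "x : P" for x j
  using that
 proof (induction j arbitrary: x)
  case 0
  interpret T1: subrng "adj k t" by (rule k.adj_subrng)
  show ?case using 0 by (intro bexI[of _ 0]) (auto simp: og0)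
 next
  case (Suc j)
  interpret T1: subrng "adj k t" by (rule k.adj_subrng)
  obtain c where c: "c : k" "x - c : V.m" using res Suc.prems by blast
  have xm: "x - c : Mf" using c V.m_P V.PM by blast
  have y: "(x - c) / t : P"
  proof (cases "x - c = 0")
   case False
   have "ord_at P ((x - c) / t) = ord_at P (x - c) - 1" using ord_facts(2)[OF P(1) xm False t(1,2)] t(3) by simp
   hence "ord_at P ((x - c) / t) >= 0" using ord_facts(8)[OF P(1) xm False] c(2) by simp
   thus ?thesis using ord_facts(7)[OF P(1) M.divide_mem[OF xm t(1)]] False t(2) by simp
  qed simp
  then obtain a where a: "a : adj k t" "(x - c) / t - a : og P (int j)" using Suc.IH by blast
  have "t : og P 1" using t by (simp add: og_def)
  hence "t * ((x - c) / t - a) : og P (1 + int j)" using ogD(4)[OF P(1)] a(2) by blast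
  also have "t * ((x - c) / t - a) = x - (c + t * a)" using t(2) by (simp add: right_diff_distrib)
  finally have "x - (c + t * a) : og P (int (Suc j))" by (simp only: of_nat_Suc)
  moreover have "c + t * a : adj k t" using c(1) a(1) k.adj_incl k.adj_gen by (blast intro: T1.add_mem T1.mult_mem)
  ultimately show ?case by blast
 qed
 have frob: "a ^ p : adj k (t ^ p)" if "a : adj k t" for a
 proof -
  have "subrng {a. a ^ p : adj k (t ^ p)}"
  proof
   fix x assume x: "x : {a. a ^ p : adj k (t ^ p)}"
   have "(- x) ^ p = (- 1) ^ p * x ^ p" by (metis mult_minus1 power_mult_distrib)
   thus "- x : {a. a ^ p : adj k (t ^ p)}" using x by (auto intro!: T.mult_mem T.power_mem T.minus_mem)
  qed (use p0 fr in \<open>auto simp: power_mult_distrib intro: T.mems\<close>)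
  hence "adj k t \<subseteq> {a. a ^ p : adj k (t ^ p)}"
   by (rule adj_least) (use tT in \<open>auto intro: T.power_mem\<close>)
  thus ?thesis using that by blast
 qed
 have tpog: "(t ^ p) ^ N * x : og P (int j)" if "x : og P (int j)" for N x j
 proof -
  have "(t ^ p) ^ N : og P 0" unfolding og0 using tP by (intro V.power_mem)
  thus ?thesis using ogD(4)[OF P(1), of "(t ^ p) ^ N" 0] that by fastforce
 qed
 show ?thesis
  using f
 proof induction
  case zero
  show ?case using vsubD(1)[OF ogD(1)[OF P(1)]] by (auto intro!: exI[of _ 0] bexI[of _ 0])
 next
  case (step v c w)
  then obtain N where vM: "v : Mf" and N: "!!j. EX a:adj k (t ^ p). (t ^ p) ^ N * v - a : og P (int j)" by blast
  have cM: "c : Mf" using step k_M by blast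
  obtain n where n: "t ^ n * w : P"
  proof (cases "w = 0")
   case False
   have "ord_at P (t ^ nat (- ord_at P w) * w) >= 0"
    using ord_facts(1)[OF P(1) M.power_mem[OF t(1)] _ step(3) False, of "nat (- ord_at P w)"]
     ord_facts(4)[OF P(1) t(1,2), of "nat (- ord_at P w)"] t by simp
   thus ?thesis using ord_facts(7)[OF P(1) M.mult_mem[OF M.power_mem[OF t(1)] step(3)]] False t(2) that by fastforce
  qed (use that[of 0] in simp)
  have "EX a:adj k (t ^ p). (t ^ p) ^ (N + n) * (c * w ^ p + v) - a : og P (int j)" for j
  proof -
   obtain a where a: "a : adj k (t ^ p)" "(t ^ p) ^ N * v - a : og P (int j)" using N by blast
   obtain b where b: "b : adj k t" "t ^ n * w - b : og P (int j)" using exp[OF n] by blast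
   have bP: "(t ^ n * w - b) ^ (p - 1) : og P 0" unfolding og0
    by (rule V.power_mem[OF og_P[OF b(2)]])
   have "(t ^ n * w - b) ^ p = (t ^ n * w - b) ^ (p - 1) * (t ^ n * w - b)" using p0 by (metis Suc_diff_1 mult.commute power_Suc)
   hence e1: "(t ^ n * w - b) ^ p : og P (int j)" using ogD(4)[OF P(1) bP b(2)] by simp
   have "(t ^ n * w) ^ p = (t ^ n * w - b) ^ p + b ^ p" using fr[of "t ^ n * w - b" b] by simp
   hence e2: "(t ^ p) ^ n * w ^ p - b ^ p : og P (int j)"
    using e1 by (simp add: power_mult_distrib power_mult[symmetric] mult.commute)
   have "(t ^ p) ^ n * ((t ^ p) ^ N * v - a) + (t ^ p) ^ N * (c * ((t ^ p) ^ n * w ^ p - b ^ p)) : og P (int j)"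
    by (intro vsubD(2)[OF ogD(1)[OF P(1)]] tpog a(2) vsubD(3)[OF ogD(1)[OF P(1)]] e2 step(2))
   also have "(t ^ p) ^ n * ((t ^ p) ^ N * v - a) + (t ^ p) ^ N * (c * ((t ^ p) ^ n * w ^ p - b ^ p))
    = (t ^ p) ^ (N + n) * (c * w ^ p + v) - ((t ^ p) ^ n * a + (t ^ p) ^ N * (c * b ^ p))"
    by (simp add: power_add algebra_simps)
   finally show ?thesis
   proof (rule bexI)
    show "(t ^ p) ^ n * a + (t ^ p) ^ N * (c * b ^ p) : adj k (t ^ p)"
     using tT step(2) by (intro T.add_mem T.mult_mem T.power_mem[OF tT(1)] a(1) frob[OF b(1)]) auto
   qed
  qed
  thus ?case unfolding p[symmetric] using vM cM step(3) by (auto intro!: M.mems)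
 qed
qed


text \<open>The lowest term of a polynomial in u determines its order, which is therefore a multiple
  of the order of u.\<close>

lemma adj_ord:
 assumes u: "u : Mf" "u ~= 0" "ord_at P u = m" "m > 0" and P: "P : places k Mf"
 shows "pover k b ==> b ~= 0 ==> poly b u ~= 0 & m dvd ord_at P (poly b u)"
proof (induction b)
 case (pCons c b)
 interpret V: dvring k Mf P "unif P" by (rule dvring[OF P])
 have um: "u : V.m" using ord_facts(8)[OF P u(1,2)] u(3,4) by simp
 have c: "c : k" and b: "pover k b" using pCons.prems by auto
 have bP: "poly b u : P" by (rule V.poly_mem[OF pover_mono[OF b V.KP] V.m_P[OF um]])
 have ub: "u * poly b u : V.m" using V.m_mult[OF um bP] by (simp add: mult.commute)
 show ?case
 proof (cases "c = 0")
  case True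
  hence "b ~= 0" using pCons.prems by auto
  hence IH: "poly b u ~= 0" "m dvd ord_at P (poly b u)" using pCons.IH b by auto
  have "ord_at P (u * poly b u) = m + ord_at P (poly b u)"
   using ord_facts(1)[OF P u(1,2) _ IH(1)] bP V.PM u(3) by blast
  thus ?thesis using True IH u(2) by simp
 next
  case False
  have "c + u * poly b u : P - V.m" by (rule V.unit_add_m[OF V.K_unit[OF c False] ub])
  thus ?thesis using V.ord_unit[of "c + u * poly b u"] by auto
 qed
qed simp

text \<open>Otherwise s times a power s^(pN) would agree, beyond its order pN + 1 at P1, with a
  polynomial in s^p, whose order is divisible by p.\<close>

lemma s_notin_pspan: "s ~: pspan k Mf"
proof
 define p where "p = CHAR('a ambient)"
 have p2: "p >= 2" unfolding p_def using char_prime[OF CHAR_amb_pos[where ?'q = 'a]] by (rule prime_ge_2_nat)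
 note PP = cusp_places(1) facts(1)
 assume "s : pspan k Mf"
 from pspan_expansion[OF this p_def PP s_M nz(1) facts(3)] obtain N
  where N: "!!j. EX a:adj k (s ^ p). (s ^ p) ^ N * s - a : og P1 (int j)" by blast
 define f where "f = (s ^ p) ^ N * s"
 define n where "n = p * N + 1"
 have f: "f = s ^ n" by (simp add: f_def n_def power_mult power_add)
 have fM: "f : Mf" "f ~= 0" "ord_at P1 f = int n"
  unfolding f using s_M nz(1) ord_facts(4)[OF PP(1) s_M nz(1), of n] facts(3) by (auto intro: M.power_mem)
 obtain a where a: "a : adj k (s ^ p)" "f - a : og P1 (int (n + 1))" using N[of "n + 1"] unfolding f_def by blast
 have "a - f : og P1 (ord_at P1 f + 1)"
  using vsubD(3)[OF ogD(1)[OF PP(1)] k.minus_mem[OF k.one_mem] a(2)] fM(3) by (simp add: minus_diff_eq add.commute)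
 from ord_facts(9)[OF PP(1) fM(1,2) this] have a0: "a ~= 0" "ord_at P1 a = int n" using fM(3) by auto
 obtain b where b: "pover k b" "a = poly b (s ^ p)" using a(1) by (auto simp: adj_def)
 have "b ~= 0" using a0 b by auto
 have sp: "s ^ p : Mf" "s ^ p ~= 0" "ord_at P1 (s ^ p) = int p"
  using s_M nz(1) ord_facts(4)[OF PP(1) s_M nz(1), of p] facts(3) by (auto intro: M.power_mem)
 have "int p dvd int n" using adj_ord[OF sp _ PP(1) b(1) \<open>b ~= 0\<close>] p2 b(2) a0 by simp
 hence "p dvd p * N + 1" by (simp only: int_dvd_int_iff n_def)
 hence "p dvd 1" by (simp only: dvd_add_right_iff[OF dvd_triv_left])
 thus False using p2 by simp
qed

lemma pdiv_0:
 assumes "f : Mf" "f ~= 0" "pdiv f = 0" shows "f : k"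
proof -
 have "ord_at P f = 0" if "P : places k Mf" for P using lk_pdiv[OF assms(1,2), of P] that assms(3) by simp
 hence "f : L 0" using assms(1) by (simp add: L_def og_def)
 thus ?thesis by (simp only: L_0)
qed

text \<open>If m delta with m = q^2/p is the divisor of h, then s^q / z is h^p times a constant.
  This constant need not be a p-th power, as the constant field is imperfect; still z lies in k M^p,
  and so does s = (r^q / z - 1) / theta.\<close>

lemma delta_order: "frag_cmul j \<delta> : Pr \<longleftrightarrow> int (q ^ 2) dvd j"
proof
 interpret Pr: subgroup Pr DG by (rule subgroup_Pr)
 have eps: "frag_cmul (int (q ^ 2)) \<delta> : Pr"
  unfolding Pr_iff pdiv_eps[symmetric] using s_M z_M nz by (auto intro!: bexI[of _ "s ^ q / z"] M.fmems)
 have mul: "frag_cmul (a * b) \<delta> : Pr" if "frag_cmul b \<delta> : Pr" for a b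
 proof -
  have "0 : carrier DG" by (simp add: carrier_DG isdiv_intros)
  hence iff: "cl E : {\<one>\<^bsub>J\<^esub>} \<longleftrightarrow> E : Pr" if "E : carrier DG" for E
   using cl_eq_iff[OF that, of 0] by (simp add: cl_one)
  have "cl (frag_cmul a (frag_cmul b \<delta>)) : {\<one>\<^bsub>J\<^esub>}"
   by (rule subgroup_cl_cmul[OF cmul_DG[OF delta_DG] group.triv_subgroup[OF comm_group.axioms(2)[OF group_J]]])
    (simp only: iff[OF cmul_DG[OF delta_DG]] that)
  thus ?thesis unfolding iff[OF cmul_DG[OF cmul_DG[OF delta_DG]]] by (simp only: frag_cmul_cmul)
 qed
 show "frag_cmul j \<delta> : Pr" if "int (q ^ 2) dvd j"
  using mul[OF eps, of "j div int (q ^ 2)"] that by simp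
 assume j: "frag_cmul j \<delta> : Pr"
 show "int (q ^ 2) dvd j"
 proof (rule ccontr)
  assume n: "~ ?thesis"
  define p where "p = CHAR('a ambient)"
  have pp: "normalization_semidom_class.prime p" unfolding p_def by (rule char_prime[OF CHAR_amb_pos])
  obtain e where e: "e > 0" "q = p ^ e" using card_finite_field[where ?'q = 'a] unfolding q_card p_def CHAR_amb by blast
  have q2e: "q ^ 2 = p ^ (2 * e)" by (simp add: e(2) power_mult[symmetric] mult.commute)
  \<comment> \<open>A proper divisor of the p-power q^2 divides q^2/p, so it is enough to treat that
    single multiple.\<close>
  define d where "d = gcd j (int (q ^ 2))"
  have "frag_cmul d \<delta> : Pr"
  proof -
   obtain u v where "u * j + v * int (q ^ 2) = d" using bezout_int[of j "int (q ^ 2)"] unfolding d_def by blast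
   moreover have "frag_cmul (u * j + v * int (q ^ 2)) \<delta> : Pr"
    using Pr.m_closed[OF mul[OF j, of u] mul[OF eps, of v]] by (simp add: frag_cmul_distrib)
   ultimately show ?thesis by simp
  qed
  have "nat d dvd p ^ (2 * e)" unfolding q2e[symmetric] d_def by (simp add: nat_dvd_iff)
  then obtain i where i: "i <= 2 * e" "nat d = p ^ i" using divides_primepow_nat[OF pp] by blast
  have dn: "d = int (p ^ i)" using i(2) unfolding d_def by (metis gcd_ge_0_int int_nat_eq)
  have "i ~= 2 * e"
  proof
   assume "i = 2 * e"
   hence "d = int (q ^ 2)" using dn q2e by simp
   thus False using n gcd_dvd1[of j "int (q ^ 2)"] unfolding d_def by simp
  qed
  hence ile: "i <= 2 * e - 1" using i(1) by simp
  define m where "m = p ^ (2 * e - 1)"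
  have "m = p ^ (2 * e - 1 - i) * p ^ i" unfolding m_def power_add[symmetric] using ile by (simp only: le_add_diff_inverse2)
  hence "int m = int (p ^ (2 * e - 1 - i)) * d" unfolding dn by (simp only: of_nat_mult)
  hence "frag_cmul (int m) \<delta> : Pr" using mul[OF \<open>frag_cmul d \<delta> : Pr\<close>] by simp
  then obtain h where h: "h : Mf" "h ~= 0" "frag_cmul (int m) \<delta> = pdiv h" unfolding Pr_iff by blast
  have mp: "p * m = q ^ 2" unfolding m_def q2e using e(1) by (metis Suc_diff_1 mult_pos_pos pos2 power_Suc)
  define f where "f = s ^ q / z / h ^ p"
  have hp: "h ^ p : Mf" "h ^ p ~= 0" using h M.power_mem by auto
  have sz: "s ^ q / z : Mf" "s ^ q / z ~= 0" using s_M z_M nz by (auto intro: M.fmems)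
  have "pdiv f = frag_cmul (int (q ^ 2)) \<delta> - frag_cmul (int p) (frag_cmul (int m) \<delta>)"
   unfolding f_def pdiv_divide[OF sz hp] pdiv_power[OF h(1,2)] h(3) pdiv_eps ..
  also have "... = 0" unfolding mp[symmetric] by (simp add: frag_cmul_cmul)
  finally have pf: "pdiv f = 0" .
  have f0: "f ~= 0" using sz(2) hp(2) unfolding f_def divide_eq_0_iff by blast
  have "f : Mf" unfolding f_def by (rule M.divide_mem[OF sz(1) hp(1)])
  hence fk: "f : k" by (rule pdiv_0[OF _ f0 pf])
  interpret N: subfld "pspan k Mf" by (rule pspan_subfld(1)[OF k.subfld_axioms M.subfld_axioms k_M])
  have kN: "k \<subseteq> pspan k Mf" by (rule pspan_subfld(2)[OF k.subfld_axioms M.subfld_axioms k_M])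
  have pw: "x ^ p : pspan k Mf" if "x : Mf" for x
   using pspan_gen[OF k.one_mem that] unfolding p_def by simp
  have qe: "x ^ q = (x ^ (p ^ (e - 1))) ^ p" for x :: "'a ambient"
   unfolding e(2) power_mult[symmetric] using e(1) by (metis Suc_diff_1 power_Suc2)
  have pq: "x ^ q : pspan k Mf" if "x : Mf" for x unfolding qe by (intro pw M.power_mem that)
  have "z = s ^ q / (f * h ^ p)" unfolding f_def using hp sz nz by simp
  hence zN: "z : pspan k Mf" using pq[OF s_M] pw[OF h(1)] fk kN by (auto intro: N.fmems)
  have "s = (r ^ q / z - 1) / \<theta>" using eq_z nz(2) th_nz by (simp add: eq_z[symmetric])
  also have "... : pspan k Mf" using pq[OF r_M] zN th_k kN by (auto intro!: N.fmems)
  finally show False using s_notin_pspan by blast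
 qed
qed

end

subsection \<open>Galois descent\<close>

text \<open>The span over \<open>k\<close> of a ring \<open>L\<close>, that is, the compositum kL as
  a ring. It is the space in which semilinear descent takes place, the group acting on the
  coefficients from \<open>k\<close> and trivially on \<open>L\<close>.\<close>

inductive_set lspan :: "'a::field set => 'a set => 'a set" for k L where
 zero: "0 : lspan k L"
| step: "v : lspan k L ==> c : k ==> u : L ==> c * u + v : lspan k L"

lemma lspan_add: "u : lspan k L ==> v : lspan k L ==> u + v : lspan k L"
 by (induction rule: lspan.induct) (auto simp: add.assoc intro: lspan.step)

lemma lspan_gen: "c : k ==> u : L ==> c * u : lspan k L"
 using lspan.step[OF lspan.zero] by fastforce

lemma lspan_subrng:
 assumes k: "subrng k" and L: "subrng L"
 shows "subrng (lspan k L)" "k \<subseteq> lspan k L" "L \<subseteq> lspan k L"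
proof -
 interpret k: subrng k by fact
 interpret L: subrng L by fact
 have sc: "c * u * v : lspan k L" if "v : lspan k L" "c : k" "u : L" for c u v
  using that(1)
 proof induction
  case (step v d w)
  have "(c * d) * (u * w) + c * u * v : lspan k L"
   using step that by (intro lspan.step k.mult_mem L.mult_mem)
  thus ?case by (simp add: algebra_simps)
 qed (simp add: lspan.zero)
 show "k \<subseteq> lspan k L" "L \<subseteq> lspan k L" using lspan_gen[of _ k 1 L] lspan_gen[of 1 k _ L] by auto
 show "subrng (lspan k L)"
 proof
  show "0 : lspan k L" "1 : lspan k L" using lspan.zero lspan_gen[of 1 k 1 L] by auto
  fix u v assume u: "u : lspan k L"
  show "- u : lspan k L" using sc[OF u, of "- 1" 1] k.minus_mem[OF k.one_mem] by simp
  assume v: "v : lspan k L"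
  show "u + v : lspan k L" by (rule lspan_add[OF u v])
  show "u * v : lspan k L" using u
  proof induction
   case (step u c w)
   thus ?case using lspan_add[OF sc[OF v, of c w]] by (simp add: algebra_simps)
  qed (simp add: lspan.zero)
 qed
qed

lemma lspan_repr:
 "f : lspan k L ==> EX (n::nat) a e. (ALL i<n. a i : k & e i : L) & f = (\<Sum>i<n. a i * e i)"
proof (induction rule: lspan.induct)
 case zero
 show ?case by (rule exI[of _ 0]) simp
next
 case (step v c u)
 from step.IH obtain n :: nat and a e where ae: "ALL i<n. a i : k & e i : L" "v = (\<Sum>i<n. a i * e i)" by (elim exE conjE)
 have "(\<Sum>i<n. (a(n := c)) i * (e(n := u)) i) = v" unfolding ae(2) by (rule sum.cong) auto
 hence "c * u + v = (\<Sum>i<Suc n. (a(n := c)) i * (e(n := u)) i)" by simp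
 moreover have "ALL i<Suc n. (a(n := c)) i : k & (e(n := u)) i : L" using ae(1) step.hyps by (simp add: less_Suc_eq)
 ultimately show ?case by (intro exI conjI)
qed

text \<open>A nonzero element of \<open>V\<close> with the fewest terms, scaled to have a coefficient 1, is invariant.\<close>

lemma galois_descent:
 fixes G :: "('a::field => 'a) set"
 assumes k: "subfld k" and V: "vsub k V" "V \<subseteq> lspan k L" and Z: "vsub k Z"
  and G: "!!sg. sg : G ==> faut L sg" "!!sg c. sg : G ==> c : k ==> sg c : k" "!!sg f. sg : G ==> f : V ==> sg f : V"
  and inv: "!!f. f : V ==> (!!sg. sg : G ==> sg f = f) ==> f : Z"
 shows "V \<subseteq> Z"
proof
 interpret k: subfld k by fact
 fix f assume f: "f : V"
 hence "f : lspan k L" using V(2) by blast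
 from lspan_repr[OF this] obtain n :: nat and a0 e where e0': "ALL i<n. a0 i : k & e i : L" "f = (\<Sum>i<n. a0 i * e i)"
  by (elim exE conjE)
 have e0: "!!i. i < n ==> a0 i : k & e i : L" "f = (\<Sum>i<n. a0 i * e i)" using e0' by auto
 have main: "(\<Sum>i\<in>T. a i * e i) : Z" if "T \<subseteq> {..<n}" "ALL i:T. a i : k" "(\<Sum>i\<in>T. a i * e i) : V" for T a
  using that
 proof (induction "card T" arbitrary: T a rule: less_induct)
  case less
  have fT: "finite T" using less.prems(1) finite_subset by blast
  show ?case
  proof (cases "(\<Sum>i\<in>T. a i * e i) = 0")
   case True
   thus ?thesis using vsubD(1)[OF Z] by simp
  next
   case False
   define Q where "Q T' \<longleftrightarrow> T' \<subseteq> T & (EX b. (ALL i:T'. b i : k) & (\<Sum>i\<in>T'. b i * e i) : V & (\<Sum>i\<in>T'. b i * e i) ~= 0)" for T'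
   have "Q T" unfolding Q_def using less.prems False by blast
   then obtain T' where T': "Q T'" "!!T''. Q T'' ==> card T' <= card T''" using ex_has_least_nat[of Q T card] by blast
   then obtain b where b: "T' \<subseteq> T" "ALL i:T'. b i : k" "(\<Sum>i\<in>T'. b i * e i) : V" "(\<Sum>i\<in>T'. b i * e i) ~= 0"
    unfolding Q_def by blast
   have fT': "finite T'" using b(1) fT finite_subset by blast
   have "EX i:T'. b i ~= 0"
   proof (rule ccontr)
    assume "~ ?thesis"
    hence "(\<Sum>i\<in>T'. b i * e i) = 0" by (intro sum.neutral) simp
    thus False using b(4) by (rule notE[rotated])
   qed
   then obtain i0 where i0: "i0 : T'" "b i0 ~= 0" by blast
   define b' where "b' i = inverse (b i0) * b i" for i
   define h where "h = (\<Sum>i\<in>T'. b' i * e i)"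
   have b'k: "b' i : k" if "i : T'" for i
    unfolding b'_def by (rule k.mult_mem[OF k.inverse_mem]) (use b(2) i0 that in simp_all)
   have b'1: "b' i0 = 1" using i0 by (simp add: b'_def)
   have hb: "h = inverse (b i0) * (\<Sum>i\<in>T'. b i * e i)" by (simp add: h_def b'_def sum_distrib_left mult.assoc)
   have hV: "h : V" unfolding hb by (rule vsubD(3)[OF V(1) k.inverse_mem b(3)]) (use b(2) i0 in simp)
   have "sg h = h" if sg: "sg : G" for sg
   proof (rule ccontr)
    assume ne: "sg h ~= h"
    note S = fautD[OF G(1)[OF sg]]
    have "sg (sum F A) = (\<Sum>i\<in>A. sg (F i))" if "finite A" for F :: "nat => 'a" and A
     using that by induction (simp_all add: S(1,4))
    hence "sg h = (\<Sum>i\<in>T'. sg (b' i) * sg (e i))" unfolding h_def using fT' S(2) by simp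
    also have "... = (\<Sum>i\<in>T'. sg (b' i) * e i)"
     by (rule sum.cong[OF refl]) (use S(13) e0(1) b(1) less.prems(1) in force)
    finally have "sg h - h = (\<Sum>i\<in>T'. (sg (b' i) - b' i) * e i)"
     by (simp add: h_def sum_subtractf left_diff_distrib)
    also have "... = (\<Sum>i\<in>T' - {i0}. (sg (b' i) - b' i) * e i)"
     using sum.remove[OF fT' i0(1), of "%i. (sg (b' i) - b' i) * e i"] b'1 S(3) by simp
    finally have eq: "sg h - h = (\<Sum>i\<in>T' - {i0}. (sg (b' i) - b' i) * e i)" .
    have "Q (T' - {i0})" unfolding Q_def
    proof (intro conjI exI[of _ "%i. sg (b' i) - b' i"], unfold eq[symmetric])
     show "T' - {i0} \<subseteq> T" using b(1) by blast
     show "ALL i:T' - {i0}. sg (b' i) - b' i : k"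
      using k.diff_mem[OF G(2)[OF sg b'k] b'k] by simp
     show "sg h - h : V" using k.vsub_diff[OF V(1) G(3)[OF sg hV] hV] .
     show "sg h - h ~= 0" using ne by simp
    qed
    from T'(2)[OF this] card_Diff1_less[OF fT' i0(1)] show False by linarith
   qed
   hence hZ: "h : Z" using inv[OF hV] by blast
   \<comment> \<open>Subtracting this multiple of the invariant element removes the term
     \<open>i0\<close>, so the induction on the number of terms applies.\<close>
   define a' where "a' i = a i - (if i : T' then a i0 * b' i else 0)" for i
   have iT: "i0 : T" "a i0 : k" using i0 b(1) less.prems(2) by auto
   have "(\<Sum>i\<in>T. a' i * e i) = (\<Sum>i\<in>T. a i * e i) - (\<Sum>i\<in>T. if i : T' then a i0 * (b' i * e i) else 0)"
    unfolding a'_def sum_subtractf[symmetric] by (rule sum.cong) (auto simp: left_diff_distrib)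
   also have "(\<Sum>i\<in>T. if i : T' then a i0 * (b' i * e i) else 0) = (\<Sum>i\<in>T'. a i0 * (b' i * e i))"
    using fT b(1) by (simp add: sum.inter_restrict[symmetric] inf_absorb2)
   also have "... = a i0 * h" by (simp add: h_def sum_distrib_left)
   finally have eq: "(\<Sum>i\<in>T. a' i * e i) = (\<Sum>i\<in>T. a i * e i) - a i0 * h" .
   have a'0: "a' i0 = 0" using i0 b'1 by (simp add: a'_def)
   have eq': "(\<Sum>i\<in>T - {i0}. a' i * e i) = (\<Sum>i\<in>T. a i * e i) - a i0 * h"
    using sum.remove[OF fT iT(1), of "%i. a' i * e i"] a'0 eq by simp
   have "(\<Sum>i\<in>T - {i0}. a' i * e i) : V" unfolding eq'
    by (rule k.vsub_diff[OF V(1) less.prems(3) vsubD(3)[OF V(1) iT(2) hV]])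
   moreover have "ALL i:T - {i0}. a' i : k"
    unfolding a'_def using less.prems(2) k.mult_mem[OF iT(2) b'k] by (auto intro!: k.diff_mem)
   moreover have "T - {i0} \<subseteq> {..<n}" using less.prems(1) by blast
   ultimately have "(\<Sum>i\<in>T - {i0}. a' i * e i) : Z"
    by (intro less.hyps card_Diff1_less[OF fT iT(1)])
   hence "(\<Sum>i\<in>T - {i0}. a' i * e i) + a i0 * h : Z" by (rule vsubD(2)[OF Z _ vsubD(3)[OF Z iT(2) hZ]])
   thus ?thesis unfolding eq' by simp
  qed
 qed
 show "f : Z" using main[of "{..<n}" a0] e0 f by auto
qed

section \<open>The Galois group of the extension of constants\<close>

context t3_pair
begin

abbreviation "Gal \<equiv> {sg. faut F.Mf sg}"

lemma F_M0: "field_F \<subseteq> F.Mf" by (rule F.k_M)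

lemma M0_M: "F.Mf \<subseteq> K.Mf"
 by (rule F.Mf_least[OF K.M.subfld_axioms]) (use F_K K.k_M K.r_M K.s_M in auto)

lemma gal_K1:
 assumes sg: "faut F.Mf sg" and c: "c : K"
 shows "sg c : K"
proof -
 obtain p where p: "pover field_F p" "rsquarefree p" "poly p c = 0" using c unfolding sep_closure_sepel sepel_def by blast
 have "sg (coeff p i) = coeff p i" for i using p(1) F_M0 fautD(13)[OF sg] unfolding pover_def by blast
 hence "map_poly sg p = p" by (intro poly_eqI) (simp add: coeff_map_poly fautD(4)[OF sg])
 hence "poly p (sg c) = 0" using faut_poly[OF sg, of p c] p(3) fautD(4)[OF sg] by simp
 thus ?thesis unfolding sep_closure_sepel sepel_def using p by blast
qed

lemma gal_M1:
 assumes sg: "faut F.Mf sg" and c: "c : K.Mf"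
 shows "sg c : K.Mf"
proof -
 note S = fautD[OF sg]
 have "K.Mf \<subseteq> {x. sg x : K.Mf}"
 proof (rule K.Mf_least)
  show "subfld {x. sg x : K.Mf}" by unfold_locales (auto simp: S(1,2,3,4,5,8) intro: K.M.fmems)
  show "r : {x. sg x : K.Mf}" "s : {x. sg x : K.Mf}" using S(13)[OF F.r_M] S(13)[OF F.s_M] K.r_M K.s_M by auto
 qed (use gal_K1[OF sg] K.k_M in blast)
 thus ?thesis using c by blast
qed

lemma gal_image:
 assumes sg: "faut F.Mf sg" shows "sg ` K = K" "sg ` K.Mf = K.Mf"
proof -
 have *: "A \<subseteq> sg ` A" if "!!\<tau> c. faut F.Mf \<tau> ==> c : A ==> \<tau> c : A" for A
 proof
  fix a assume "a : A"
  hence "inv_into UNIV sg a : A" by (rule that[OF faut_inv[OF sg]])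
  thus "a : sg ` A" using faut_image_all[OF sg, of a] by blast
 qed
 show "sg ` K = K" using *[of K] gal_K1 sg by blast
 show "sg ` K.Mf = K.Mf" using *[of K.Mf] gal_M1 sg by blast
qed

lemma M_sepel: "K.Mf \<subseteq> {x. sepel F.Mf x}"
proof -
 interpret S: subfld "{x. sepel F.Mf (x :: 'q ambient)}" by (rule F.M.sepel_subfld[OF CHAR_amb_pos])
 have "K \<subseteq> {x. sepel F.Mf x}" unfolding sep_closure_sepel using sepel_mono[OF _ F_M0] by blast
 thus ?thesis by (rule K.Mf_least[OF S.subfld_axioms]) (use F.M.sepel_mem F.r_M F.s_M in blast)+
qed

lemma gal_fixed: "f : K.Mf ==> (!!sg. faut F.Mf sg ==> sg f = f) ==> f : F.Mf"
 using faut_moves[OF F.M.subfld_axioms algel_mono[OF algel_Fj Fj_M]] M_sepel by blast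

text \<open>The compositum of K and F(r, s) is a ring all of whose elements are algebraic over F(r,
  s), hence already a field.\<close>

lemma M_lspan: "K.Mf \<subseteq> lspan K F.Mf"
proof -
 have Ks: "subrng K" using K_subfld subfld.axioms(1) by blast
 note L = lspan_subrng[OF Ks F.M.subrng_axioms]
 interpret S: subfld "{x. sepel F.Mf (x :: 'q ambient)}" by (rule F.M.sepel_subfld[OF CHAR_amb_pos])
 have "lspan K F.Mf \<subseteq> {x. sepel F.Mf x}"
 proof
  fix x assume "x : lspan K F.Mf"
  thus "x : {x. sepel F.Mf x}"
  proof induction
   case (step v c u)
   have "c : {x. sepel F.Mf x}" "u : {x. sepel F.Mf x}" using step(2,3) M_sepel K.k_M M0_M by blast+
   thus ?case using step.IH by (intro S.add_mem S.mult_mem)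
  qed (rule S.zero_mem)
 qed
 hence "subfld (lspan K F.Mf)"
  by (intro F.M.subfld_algel[OF L(1,3)] sepel_algel) blast
 thus ?thesis by (rule K.Mf_least) (use L F.r_M F.s_M in blast)+
qed

lemma descent:
 assumes "vsub K V" "V \<subseteq> K.Mf" "vsub K Z" "!!sg f. faut F.Mf sg ==> f : V ==> sg f : V" "V \<inter> F.Mf \<subseteq> Z"
 shows "V \<subseteq> Z"
proof (rule galois_descent[OF K_subfld assms(1) _ assms(3), of F.Mf Gal])
 show "V \<subseteq> lspan K F.Mf" using assms(2) M_lspan by blast
 show "f : Z" if f: "f : V" "!!sg. sg : Gal ==> sg f = f" for f
  using gal_fixed[of f] f assms(2,5) by auto
qed (use assms(4) gal_K1 in auto)

subsection \<open>Algebraic constants over the finite field\<close>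

text \<open>The algebraic closure of the finite field inside the ambient field. It provides the
  residues of functions at places where they are algebraic over the finite field.\<close>

definition kb :: "'q ambient set" where "kb = {x. algel Fq x}"

sublocale kb: subfld kb
proof -
 have *: "EX R. subfld R & a : R & b : R & R \<subseteq> kb" if "a : kb" "b : kb" for a b
 proof -
  obtain R where R: "fd Fq R" "{a, b} \<subseteq> R" using Fq.fd_finite_set[of "{a, b}"] \<open>a : kb\<close> \<open>b : kb\<close> by (auto simp: kb_def)
  have "R \<subseteq> kb" unfolding kb_def using Fq.fd_algel[OF R(1)] by blast
  thus ?thesis using R Fq.fd_subfld[OF R(1)] by blast
 qed
 show "subfld kb"
 proof
  show "0 : kb" "1 : kb" using Fq.algel_mem by (simp_all add: kb_def)
  fix a assume a: "a : kb"
  obtain R where "subfld R" "a : R" "R \<subseteq> kb" using *[OF a a] by blast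
  thus "- a : kb" "inverse a : kb" using subrng.minus_mem[OF subfld.axioms(1)] subfld.inverse_mem by blast+
  fix b assume b: "b : kb"
  obtain R where "subfld R" "a : R" "b : R" "R \<subseteq> kb" using *[OF a b] by blast
  thus "a + b : kb" "a * b : kb" using subrng.add_mem[OF subfld.axioms(1)] subrng.mult_mem[OF subfld.axioms(1)] by blast+
 qed
qed

lemma Fq_kb: "Fq \<subseteq> kb" using Fq.algel_mem by (auto simp: kb_def)

lemma Fq_F: "(Fq :: 'q ambient set) \<subseteq> field_F"
 unfolding Fq_def using of_A_F by blast

text \<open>Finite fields are perfect: on a finite extension of Fq the injective Frobenius map is
  onto, so the separability criterion by p-th powers applies.\<close>

lemma kb_K: "kb \<subseteq> K"
proof
 fix c assume "c : kb"
 hence c: "algel Fq c" by (simp add: kb_def)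
 let ?L = "adj Fq c"
 interpret L: subfld ?L by (rule Fq.subfld_adj[OF c])
 have fd: "fd Fq ?L" by (rule Fq.fd_adj[OF Fq.fd_self c])
 then obtain S where S: "spans Fq {0} S ?L" by (auto simp: fd_def)
 have fin: "finite ?L"
 proof (rule finite_subset)
  show "?L \<subseteq> (%c. \<Sum>u\<in>S. c u * u) ` (S \<rightarrow>\<^sub>E Fq)"
  proof
   fix v assume "v : ?L"
   then obtain c where c: "ALL u:S. c u : Fq" "v = (\<Sum>u\<in>S. c u * u)" using S unfolding spans_def by auto
   hence "v = (\<Sum>u\<in>S. restrict c S u * u)" "restrict c S : S \<rightarrow>\<^sub>E Fq" by auto
   thus "v : (%c. \<Sum>u\<in>S. c u * u) ` (S \<rightarrow>\<^sub>E Fq)" by blast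
  qed
  have "finite S" using S by (simp add: spans_def)
  moreover have "finite (Fq :: 'q ambient set)" by (simp add: Fq_def)
  ultimately show "finite ((%c. \<Sum>u\<in>S. c u * u) ` (S \<rightarrow>\<^sub>E Fq))" by (intro finite_imageI finite_PiE) auto
 qed
 let ?p = "CHAR('q ambient)"
 have inj: "inj_on (%a. a ^ ?p) ?L"
 proof (rule inj_onI)
  fix a b :: "'q ambient" assume "a ^ ?p = b ^ ?p"
  moreover have "((a - b) + b) ^ ?p = (a - b) ^ ?p + b ^ ?p"
   by (rule freshmans_dream[OF char_prime[OF CHAR_amb_pos[where ?'q = 'q]] refl])
  ultimately have "(a - b) ^ ?p = 0" by simp
  thus "a = b" by simp
 qed
 have "(%a. a ^ ?p) ` ?L = ?L" by (rule endo_inj_surj[OF fin _ inj]) (auto intro: L.power_mem)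
 hence "?L \<subseteq> pspan Fq ?L"
  using pspan_gen[OF Fq.one_mem, of _ ?L] by force
 hence "sepel Fq c" by (rule Fq.fd_pspan_sepel[OF CHAR_amb_pos fd _ Fq.adj_gen])
 thus "c : K" unfolding sep_closure_sepel using sepel_mono[OF _ Fq_F] by blast
qed

lemma of_A_poly: "of_A a = poly (map_poly (%c. of_A [:c:]) a) \<theta>"
proof (induction a)
 case (pCons c a)
 have "pCons c a = [:c:] + [:0, 1:] * a" by simp
 hence "of_A (pCons c a) = of_A [:c:] + \<theta> * of_A a" unfolding th_def by (simp only: of_A_simps)
 thus ?case using pCons by (simp add: map_poly_pCons)
qed simp

lemma th_notin_kb: "\<theta> ~: kb"
proof
 assume "\<theta> : kb"
 then obtain p where p: "pover Fq p" "p ~= 0" "poly p \<theta> = 0" by (auto simp: kb_def algel_def)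
 define c0 where "c0 a = (SOME c. of_A [:c:] = a)" for a :: "'q ambient"
 have c0: "of_A [:c0 a:] = a" if "a : Fq" for a
  unfolding c0_def by (rule someI_ex) (use that in \<open>auto simp: Fq_def\<close>)
 have "c0 0 = 0" using c0[of 0] of_A_simps(1,6) Fq.zero_mem by (metis pCons_eq_0_iff)
 hence e: "map_poly (%c. of_A [:c:]) (map_poly c0 p) = p"
  using p(1) c0 by (intro poly_eqI) (simp add: coeff_map_poly pover_def)
 hence "of_A (map_poly c0 p) = 0" using of_A_poly[of "map_poly c0 p"] p(3) by simp
 hence "map_poly c0 p = 0" using of_A_simps(1,6) by metis
 thus False using e p(2) by simp
qed

lemma F_least:
 assumes N: "subfld N" "Fq \<subseteq> N" "\<theta> : N" shows "field_F \<subseteq> N"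
proof
 interpret N: subfld N by fact
 have c: "of_A [:c:] : N" for c using N(2) unfolding Fq_def by blast
 have pv: "pover N (map_poly (%c. of_A [:c:]) a)" for a unfolding pover_def by (simp add: coeff_map_poly c)
 have A: "of_A a : N" for a using N.poly_mem[OF pv N(3), of a] unfolding of_A_poly[symmetric] .
 fix u :: "'q ambient" assume "u : field_F"
 then obtain f where f: "u = of_F f" by (auto simp: field_F_def)
 obtain a b where "f = Fract a b" by (cases f) auto
 hence "f = to_fract a * inverse (to_fract b)" by (simp add: Fract_conv_to_fract divide_inverse)
 hence "u = of_A a * inverse (of_A b)" unfolding f by (simp only: of_F_simps of_F_inverse of_A_def)
 thus "u : N" using A by (auto intro: N.fmems)
qed

text \<open>By the formula for \<open>\<theta>\<close>, the function field over \<open>F\<close> is rational over the finite field.\<close>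

lemma M0_frac:
 assumes R: "subrng R" "Fq \<subseteq> R" "r : R" "s : R" and f: "f : F.Mf"
 shows "EX a:R. EX b:R. f = a / b"
proof -
 interpret R: subrng R by fact
 interpret N: subfld "{a / b | a b. a : R & b : R}" by (rule frac_subfld[OF R(1)])
 have I: "c : {a / b | a b. a : R & b : R}" if "c : R" for c
  by (rule CollectI, rule exI[of _ c], rule exI[of _ 1]) (use that in simp)
 have rs: "r : {a / b | a b. a : R & b : R}" "s : {a / b | a b. a : R & b : R}" by (rule I[OF R(3)] I[OF R(4)])+
 have "z : {a / b | a b. a : R & b : R}" unfolding z_def by (intro N.add_mem N.diff_mem N.power_mem rs)
 hence "\<theta> : {a / b | a b. a : R & b : R}"
  using th_rs[OF K.nz(1)] rs by (metis (no_types, lifting) N.divide_mem N.diff_mem N.mult_mem)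
 hence "field_F \<subseteq> {a / b | a b. a : R & b : R}"
  by (rule F_least[OF N.subfld_axioms, rotated]) (use I R(2) in blast)
 hence "F.Mf \<subseteq> {a / b | a b. a : R & b : R}"
  by (rule F.Mf_least[OF N.subfld_axioms]) (rule rs)+
 thus ?thesis using f by blast
qed

text \<open>Over the algebraically closed \<open>kb\<close> the polynomial splits, and the maximal
  ideal, being prime, contains one of the linear factors at u.\<close>

lemma root_mod:
 assumes P: "P : places K K.Mf" and u: "u : P"
 shows "pover kb f ==> f ~= 0 ==> poly f u : max_ideal P ==> EX \<beta>:kb. u - \<beta> : max_ideal P"
proof (induction "degree f" arbitrary: f rule: less_induct)
 case less
 interpret V: vring K K.Mf P by unfold_locales (rule P)
 show ?case
 proof (cases "degree f = 0")
  case True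
  then obtain c where c: "f = [:c:]" by (rule degree_eq_zeroE)
  hence "c : K" "c ~= 0" "c : V.m" using less.prems kb_K by auto
  thus ?thesis using V.K_m by blast
 next
  case False
  then obtain \<beta> where \<beta>: "poly f \<beta> = 0" using alg_closed_imp_poly_has_root by blast
  have "algel kb \<beta>" using less.prems \<beta> unfolding algel_def by blast
  hence \<beta>k: "\<beta> : kb" using Fq.algel_trans[of kb \<beta>] unfolding kb_def by blast
  obtain h c where h: "pover kb h" "pover kb c" "f = [:- \<beta>, 1:] * h + c" "c = 0 \<or> degree c < degree [:- \<beta>, 1:]"
   using kb.pover_divmod[of "[:- \<beta>, 1:]" f] \<beta>k less.prems(1) by (auto simp: kb.minus_mem)
  have "poly c \<beta> = 0" using \<beta> h(3) by simp
  moreover have "degree c = 0" using h(4) by auto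
  ultimately have c0: "c = 0" by (metis degree_eq_zeroE pCons_0_0 poly_pCons mult_zero_right add_0_right poly_0)
  have fh: "f = [:- \<beta>, 1:] * h" using h(3) c0 by simp
  have h0: "h ~= 0" using fh less.prems(2) by auto
  have "degree f = Suc (degree h)" unfolding fh using h0 by (subst degree_mult_eq) auto
  have "(u - \<beta>) * poly h u : V.m" using less.prems(3) unfolding fh by (simp add: algebra_simps)
  moreover have "u - \<beta> : P" using u \<beta>k kb_K V.KP by (blast intro: V.diff_mem)
  moreover have "poly h u : P" using V.poly_mem[OF pover_mono[OF h(1)] u] kb_K V.KP by blast
  ultimately have "u - \<beta> : V.m \<or> poly h u : V.m" using V.m_prime by blast
  thus ?thesis using less.hyps[OF _ h(1) h0] \<open>degree f = Suc (degree h)\<close> \<beta>k by auto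
 qed
qed

end

lemma (in subrng) common_denom:
 assumes "finite H" "!!h. h : H ==> EX a:R. EX b:R. b ~= 0 & h = a / b"
 shows "EX b:R. b ~= 0 & (ALL h:H. b * h : R)"
 using assms
proof (induction H rule: finite_induct)
 case (insert h H)
 then obtain b where b: "b : R" "b ~= 0" "ALL h:H. b * h : R" by blast
 obtain c d where cd: "c : R" "d : R" "d ~= 0" "h = c / d" using insert.prems by blast
 have "b * d * h' : R" if "h' : H" for h' using mult_mem[OF cd(2), of "b * h'"] b(3) that by (simp add: mult_ac)
 moreover have "b * d * h : R" using mult_mem[OF b(1) cd(1)] cd by simp
 ultimately show ?case using b cd by (intro bexI[of _ "b * d"]) (auto intro: mult_mem)
qed (auto intro: bexI[of _ 1])

locale t3_cusps = t3_pair +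
 fixes P1 P2 Q1 Q2 :: "'a ambient set"
 assumes cusp_mem: "P1 : K.P1s" "P2 : K.P2s" "Q1 : K.Q1s" "Q2 : K.Q2s"
begin

sublocale cs: curve_cusps \<theta> r s q K P1 P2 Q1 Q2
 by (intro curve_cusps.intro curve_cusps_axioms.intro K.curve_over_axioms cusp_mem)

lemma nonc_facts:
 assumes "P : cs.nonc"
 shows "P : places K K.Mf" "r : P" "s : P" "z : P" "r : P - max_ideal P" "s : P - max_ideal P" "z : P - max_ideal P"
 using K.noncuspidal_units(1-3)[of P] assms unfolding cs.nonc_def by auto

subsection \<open>Principal divisors on the affine part\<close>

text \<open>The residue of r is transcendental over the finite field: the prime that P cuts out of
  the polynomials in r and s contains no nonzero polynomial in r alone.\<close>

definition hor :: "'a ambient set => bool" where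
 "hor P \<longleftrightarrow> (ALL f. pover Fq f --> f ~= 0 --> poly f r ~: max_ideal P)"

text \<open>The prescribed orders are attained locally by functions defined over F, each of which
  meets the prescription as a lower bound everywhere on the open curve. So \<open>e\<close> plays
  the role of a fractional ideal there.\<close>

definition good :: "('a ambient set => int) => bool" where
 "good e \<longleftrightarrow> finite {P : cs.nonc. e P ~= 0} &
  (ALL P:cs.nonc. EX h:F.Mf. h ~= 0 & (ALL Q:cs.nonc. e Q <= ord_at Q h) & ord_at P h = e P)"

lemma finite_nonc_ord: "f : F.Mf ==> f ~= 0 ==> finite {P : cs.nonc. ord_at P f ~= 0}"
proof -
 assume f: "f : F.Mf" "f ~= 0"
 have "{P : cs.nonc. ord_at P f ~= 0} \<subseteq> {P : places K K.Mf. ord_at P f ~= 0}" using nonc_facts(1) by blast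
 thus ?thesis using K.finite_ord[of f] M0_M f finite_subset by blast
qed

lemma good_shift:
 assumes e: "good e" and d: "d : F.Mf" "d ~= 0"
 shows "good (%Q. e Q - ord_at Q d)"
 unfolding good_def
proof (intro conjI ballI)
 have "finite ({P : cs.nonc. e P ~= 0} \<union> {P : cs.nonc. ord_at P d ~= 0})"
  using e finite_nonc_ord[OF d] by (simp add: good_def)
 thus "finite {P : cs.nonc. e P - ord_at P d ~= 0}" by (rule finite_subset[rotated]) auto
 fix P assume "P : cs.nonc"
 then obtain h where h: "h : F.Mf" "h ~= 0" "ALL Q:cs.nonc. e Q <= ord_at Q h" "ord_at P h = e P"
  using e unfolding good_def by blast
 have o: "ord_at Q (h / d) = ord_at Q h - ord_at Q d" if "Q : cs.nonc" for Q
  using K.ord_facts(2)[OF nonc_facts(1)[OF that]] M0_M h d by blast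
 show "EX h:F.Mf. h ~= 0 & (ALL Q:cs.nonc. e Q - ord_at Q d <= ord_at Q h) & ord_at P h = e P - ord_at P d"
 proof (intro bexI[of _ "h / d"] conjI ballI)
  show "h / d : F.Mf" by (rule F.M.divide_mem[OF h(1) d(1)])
  show "h / d ~= 0" using h d by simp
 qed (use o h(3,4) \<open>P : cs.nonc\<close> in auto)
qed

text \<open>Places where \<open>r\<close> is transcendental over the finite field come from the principal ideal
 domain \<open>R\<^sub>0[s]\<close> with \<open>R\<^sub>0\<close> the rational functions in \<open>r\<close>: take an element of least degree.\<close>

lemma horizontal:
 assumes e: "good e"
 shows "EX d:F.Mf. d ~= 0 & (ALL P:cs.nonc. hor P --> ord_at P d = e P)"
proof (cases "cs.nonc = {}")
 case True
 thus ?thesis by (intro bexI[of _ 1]) auto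
next
 case False
 have tr: "~ algel Fq r" using r_trans_F algel_mono Fq_F by blast
 interpret R0: subfld "ratf Fq r" by (rule Fq.subfld_ratf[OF tr])
 have FqR0: "Fq \<subseteq> ratf Fq r" "r : ratf Fq r" by (rule Fq.subfld_ratf[OF tr])+
 define R where "R = adj (ratf Fq r) s"
 interpret R: subrng R unfolding R_def by (rule R0.adj_subrng)
 have RR: "ratf Fq r \<subseteq> R" "s : R" unfolding R_def by (rule R0.adj_incl R0.adj_gen)+
 have RM0: "R \<subseteq> F.Mf" unfolding R_def
  by (rule adj_least[OF F.M.subrng_axioms ratf_least[OF F.M.subfld_axioms] F.s_M]) (use Fq_F F_M0 F.r_M in blast)+
 have RP: "R \<subseteq> P" if P: "P : cs.nonc" "hor P" for P
 proof -
  interpret V: vring K K.Mf P by unfold_locales (rule nonc_facts(1)[OF P(1)])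
  have pP: "poly a r : P" if "pover Fq a" for a
   by (rule V.poly_mem[OF pover_mono[OF that] nonc_facts(2)[OF P(1)]]) (use Fq_kb kb_K V.KP in blast)
  have "ratf Fq r \<subseteq> P"
  proof
   fix c assume "c : ratf Fq r"
   then obtain a b where ab: "pover Fq a" "pover Fq b" "b ~= 0" "c = poly a r / poly b r" by (auto simp: ratf_def)
   have "poly b r : P - V.m" using pP[OF ab(2)] P(2) ab(2,3) unfolding hor_def by blast
   hence "inverse (poly b r) : P" using V.unit_inverse by blast
   thus "c : P" unfolding ab(4) divide_inverse by (rule V.mult_mem[OF pP[OF ab(1)]])
  qed
  thus ?thesis unfolding R_def by (rule adj_least[OF V.subrng_axioms _ nonc_facts(3)[OF P(1)]])
 qed
 obtain P0 where P0: "P0 : cs.nonc" using False by blast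
 obtain h0 where h0: "h0 : F.Mf" "h0 ~= 0" "ALL Q:cs.nonc. e Q <= ord_at Q h0" using e P0 unfolding good_def by blast
 define Bad where "Bad = {P : cs.nonc. ord_at P h0 ~= e P}"
 have fB: "finite Bad"
 proof (rule finite_subset)
  show "Bad \<subseteq> {P : cs.nonc. ord_at P h0 ~= 0} \<union> {P : cs.nonc. e P ~= 0}" by (auto simp: Bad_def)
  show "finite ({P : cs.nonc. ord_at P h0 ~= 0} \<union> {P : cs.nonc. e P ~= 0})"
   using e finite_nonc_ord[OF h0(1,2)] by (simp add: good_def)
 qed
 have "ALL P:cs.nonc. EX h. h : F.Mf & h ~= 0 & (ALL Q:cs.nonc. e Q <= ord_at Q h) & ord_at P h = e P"
  using e unfolding good_def by blast
 then obtain hh where hh: "!!P. P : cs.nonc ==> hh P : F.Mf & hh P ~= 0 & (ALL Q:cs.nonc. e Q <= ord_at Q (hh P)) & ord_at P (hh P) = e P"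
  by metis
 \<comment> \<open>Finitely many functions suffice to realise \<open>e\<close> as a minimum of
   orders: \<open>h0\<close> is exact outside the finite set \<open>Bad\<close>.\<close>
 define H where "H = insert h0 (hh ` Bad)"
 have fH: "finite H" using fB by (simp add: H_def)
 have H: "h : F.Mf" "h ~= 0" "!!Q. Q : cs.nonc ==> e Q <= ord_at Q h" if "h : H" for h
  using that hh h0 unfolding H_def Bad_def by auto
 have H': "EX h:H. ord_at P h = e P" if "P : cs.nonc" for P
 proof (cases "P : Bad")
  case True
  thus ?thesis using hh[OF that] unfolding H_def by blast
 next
  case False
  thus ?thesis using that unfolding H_def Bad_def by blast
 qed
 have "EX a:R. EX b:R. b ~= 0 & h = a / b" if h: "h : H" for h
 proof -
  have "r : R" "Fq \<subseteq> R" using FqR0 RR by blast+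
  then obtain a b where "a : R" "b : R" "h = a / b" using M0_frac[OF R.subrng_axioms _ _ RR(2) H(1)[OF h]] by blast
  moreover from this have "b ~= 0" using H(2)[OF h] by auto
  ultimately show ?thesis by blast
 qed
 then obtain b where b: "b : R" "b ~= 0" "!!h. h : H ==> b * h : R" using R.common_denom[OF fH] by blast
 have bM: "b : K.Mf" using b(1) RM0 M0_M by blast
 \<comment> \<open>The ideal belonging to \<open>e\<close>, multiplied by a common denominator to
   lie in R. A nonzero element of least degree in s generates it, because remainders stay in
   it.\<close>
 define I where "I = {x : R. ALL P:cs.nonc. hor P --> x : K.og P (e P + ord_at P b)}"
 have bhI: "b * h : I" if h: "h : H" for h
 proof -
  have hM: "h : K.Mf" using H(1)[OF h] M0_M by blast
  have "ord_at P (b * h) = ord_at P b + ord_at P h" if "P : cs.nonc" for P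
   using K.ord_facts(1)[OF nonc_facts(1)[OF that] bM b(2) hM H(2)[OF h]] .
  thus ?thesis unfolding I_def K.og_def using b(3)[OF h] H(3)[OF h] K.M.mult_mem[OF bM hM] by auto
 qed
 have "EX p. pover (ratf Fq r) p & poly p s ~= 0 & poly p s : I"
 proof -
  have "h0 : H" by (simp add: H_def)
  have "b * h0 : R" using b(3)[OF \<open>h0 : H\<close>] .
  then obtain p where p: "b * h0 = poly p s" "pover (ratf Fq r) p" unfolding R_def adj_def by blast
  have "poly p s ~= 0" unfolding p(1)[symmetric] using b(2) h0(2) by simp
  thus ?thesis using bhI[OF \<open>h0 : H\<close>] p by metis
 qed
 then obtain p where p: "pover (ratf Fq r) p" "poly p s ~= 0" "poly p s : I"
  and min: "!!f. pover (ratf Fq r) f ==> poly f s ~= 0 ==> poly f s : I ==> degree p <= degree f"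
  using ex_has_least_nat[of "%p. pover (ratf Fq r) p & poly p s ~= 0 & poly p s : I" _ degree] by blast
 define d where "d = poly p s"
 have p0: "p ~= 0" using p(2) by auto
 have dM: "d : K.Mf" "d ~= 0" using p RM0 M0_M by (auto simp: d_def I_def)
 have mult: "EX c:R. x = d * c" if x: "x : I" for x
 proof -
  have "x : R" using x by (simp add: I_def)
  then obtain f where f: "pover (ratf Fq r) f" "x = poly f s" unfolding R_def adj_def by blast
  obtain h c where hc: "pover (ratf Fq r) h" "pover (ratf Fq r) c" "f = p * h + c" "c = 0 \<or> degree c < degree p"
   using R0.pover_divmod[OF p(1) p0 f(1)] by blast
  have hR: "poly h s : R" using hc(1) unfolding R_def adj_def by blast
  have cx: "poly c s = x - d * poly h s" using f(2) hc(3) by (simp add: d_def)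
  have "poly c s : I"
   unfolding I_def
  proof (intro CollectI conjI ballI impI)
   show "poly c s : R" using hc(2) unfolding R_def adj_def by blast
   fix P assume P: "P : cs.nonc" "hor P"
   note pl = nonc_facts(1)[OF P(1)]
   have "poly h s : P" using RP[OF P] hR by blast
   hence "poly h s : K.og P 0"
    using K.ord_facts(7)[OF pl, of "poly h s"] hR RM0 M0_M by (auto simp: K.og_def)
   moreover have dI: "d : K.og P (e P + ord_at P b)" "x : K.og P (e P + ord_at P b)" using p(3) x P by (auto simp: d_def I_def)
   ultimately have "d * poly h s : K.og P (e P + ord_at P b)" using K.ogD(4)[OF pl dI(1)] by fastforce
   thus "poly c s : K.og P (e P + ord_at P b)" unfolding cx using K.ogD(3)[OF pl dI(2)] by blast
  qed
  hence "poly c s = 0" using min[OF hc(2)] hc(4) by (metis not_less poly_0)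
  thus ?thesis using cx hR by (intro bexI[of _ "poly h s"]) auto
 qed
 have "ord_at P d = e P + ord_at P b" if P: "P : cs.nonc" "hor P" for P
 proof (rule antisym)
  note pl = nonc_facts(1)[OF P(1)]
  show "e P + ord_at P b <= ord_at P d" using p(3) P dM(2) by (auto simp: d_def I_def K.og_def)
  obtain h where h: "h : H" "ord_at P h = e P" using H' P(1) by blast
  obtain c where c: "c : R" "b * h = d * c" using mult[OF bhI[OF h(1)]] by blast
  have hM: "h : K.Mf" using H(1)[OF h(1)] M0_M by blast
  have "d * c ~= 0" unfolding c(2)[symmetric] using b(2) H(2)[OF h(1)] by simp
  hence c0: "c ~= 0" by auto
  have cM: "c : K.Mf" using c(1) RM0 M0_M by blast
  have "ord_at P c >= 0" using K.ord_facts(7)[OF pl cM c0] RP[OF P] c(1) by blast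
  moreover have "ord_at P b + ord_at P h = ord_at P d + ord_at P c"
   using K.ord_facts(1)[OF pl bM b(2) hM H(2)[OF h(1)]] K.ord_facts(1)[OF pl dM cM c0] c(2) by simp
  ultimately show "ord_at P d <= e P + ord_at P b" using h(2) by linarith
 qed
 hence "ord_at P (d / b) = e P" if "P : cs.nonc" "hor P" for P
  using K.ord_facts(2)[OF nonc_facts(1)[OF that(1)] dM bM b(2)] that by simp
 moreover have "d / b : F.Mf" using p(3) b(1) RM0 by (intro F.M.divide_mem) (auto simp: d_def I_def)
 moreover have "d / b ~= 0" using dM b by simp
 ultimately show ?thesis by blast
qed

lemma poly_Fq_P: "P : cs.nonc ==> pover Fq f ==> poly f r : P"
proof -
 assume P: "P : cs.nonc" "pover Fq f"
 interpret V: vring K K.Mf P by unfold_locales (rule nonc_facts(1)[OF P(1)])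
 show ?thesis by (rule V.poly_mem[OF pover_mono[OF P(2)] nonc_facts(2)[OF P(1)]]) (use Fq_kb kb_K V.KP in blast)
qed

text \<open>If \<open>r\<close> is algebraic over the finite field modulo \<open>P\<close>, then \<open>s\<close> is not, by the formula for \<open>\<theta>\<close>.\<close>

lemma not_both_algebraic:
 assumes P: "P : cs.nonc" and \<beta>: "\<beta> : kb" "r - \<beta> : max_ideal P" and \<gamma>: "\<gamma> : kb" "s - \<gamma> : max_ideal P"
 shows False
proof -
 note N = nonc_facts[OF P]
 interpret V: vring K K.Mf P by unfold_locales (rule N(1))
 have kP: "c : P" if "c : kb" for c using that kb_K V.KP by blast
 define \<zeta> where "\<zeta> = \<gamma> + \<beta> ^ q - \<beta>"
 have \<zeta>: "\<zeta> : kb" unfolding \<zeta>_def using \<beta>(1) \<gamma>(1) by (intro kb.add_mem kb.diff_mem kb.power_mem)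
 have "z - \<zeta> = (s - \<gamma>) + ((r - \<beta>) ^ (q - 1) * (r - \<beta>) - (r - \<beta>))"
  unfolding z_def \<zeta>_def using fr(2)[of r \<beta>] K.pow_q(1)[of "r - \<beta>"] by (simp add: mult.commute)
 also have "... : V.m"
  by (rule V.m_add[OF \<gamma>(2) V.m_diff[OF V.m_mult[OF \<beta>(2) V.power_mem[OF V.m_P[OF \<beta>(2)]]] \<beta>(2)]])
 finally have z\<zeta>: "z - \<zeta> : V.m" .
 have nz: "\<gamma> ~= 0" "\<zeta> ~= 0" using \<gamma>(2) z\<zeta> N(6,7) by auto
 have thP: "\<theta> : P" "\<theta> : K" using K.th_k V.KP by blast+
 have "\<theta> * s * z = r - s" using eq_r by (simp add: algebra_simps)
 hence "\<theta> * \<gamma> * \<zeta> - (\<beta> - \<gamma>) = (r - \<beta>) - (s - \<gamma>) - (\<theta> * z) * (s - \<gamma>) - (\<theta> * \<gamma>) * (z - \<zeta>)"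
  by (simp add: algebra_simps)
 also have "... : V.m"
  by (rule V.m_diff[OF V.m_diff[OF V.m_diff[OF \<beta>(2) \<gamma>(2)] V.m_mult[OF \<gamma>(2) V.mult_mem[OF thP(1) N(4)]]]
     V.m_mult[OF z\<zeta> V.mult_mem[OF thP(1) kP[OF \<gamma>(1)]]]])
 finally have m: "\<theta> * \<gamma> * \<zeta> - (\<beta> - \<gamma>) : V.m" .
 have kK: "\<gamma> : K" "\<zeta> : K" "\<beta> : K" using \<gamma>(1) \<zeta> \<beta>(1) kb_K by blast+
 have "\<theta> * \<gamma> * \<zeta> - (\<beta> - \<gamma>) : K" using thP(2) kK by (intro K.k.diff_mem K.k.mult_mem)
 hence "\<theta> * \<gamma> * \<zeta> - (\<beta> - \<gamma>) = 0" using m V.K_m by blast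
 hence "\<theta> = (\<beta> - \<gamma>) / (\<gamma> * \<zeta>)" using nz by (simp add: eq_divide_eq mult.assoc)
 hence "\<theta> : kb" using \<beta>(1) \<gamma>(1) \<zeta> by (auto intro: kb.divide_mem kb.diff_mem kb.mult_mem)
 thus False using th_notin_kb by blast
qed

lemma ex_min_poly:
 assumes P: "P : cs.nonc" and n: "pover Fq f0" "f0 ~= 0" "poly f0 r : max_ideal P"
 obtains f where "pover Fq f" "f ~= 0" "poly f r : max_ideal P" "degree f <= degree f0"
  "!!h. pover Fq h ==> h ~= 0 ==> poly h r : max_ideal P ==> degree f <= degree h" "degree f > 0"
proof -
 let ?Q = "%f. pover Fq f & f ~= 0 & poly f r : max_ideal P"
 obtain f where f: "?Q f" "!!h. ?Q h ==> degree f <= degree h"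
  using ex_has_least_nat[of ?Q f0 degree] n by blast
 interpret V: vring K K.Mf P by unfold_locales (rule nonc_facts(1)[OF P])
 have "degree f ~= 0"
 proof
  assume "degree f = 0"
  then obtain c where c: "f = [:c:]" by (rule degree_eq_zeroE)
  hence "c : K" "c : V.m" "c ~= 0" using f(1) Fq_kb kb_K by auto
  thus False using V.K_m by blast
 qed
 thus ?thesis using that[of f] f n by blast
qed

text \<open>Minimality at the prime ideal of P makes \<open>f\<close> irreducible. The least
  polynomial \<open>v\<close> vanishing at Q divides \<open>f\<close>, hence has the same degree, so
  a nonzero remainder of smaller degree cannot vanish at Q.\<close>

lemma min_poly_dvd:
 assumes P: "P : cs.nonc" and f: "pover Fq f" "poly f r : max_ideal P"
  "!!h. pover Fq h ==> h ~= 0 ==> poly h r : max_ideal P ==> degree f <= degree h" and f0: "f ~= 0"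
  and Q: "Q : cs.nonc" "poly f r : max_ideal Q" and h: "pover Fq h" "poly h r : max_ideal Q"
 shows "EX u. pover Fq u & h = f * u"
proof (rule ccontr)
 assume n: "~ ?thesis"
 interpret V: vring K K.Mf P by unfold_locales (rule nonc_facts(1)[OF P])
 interpret U: vring K K.Mf Q by unfold_locales (rule nonc_facts(1)[OF Q(1)])
 have rem: "poly c r : U.m" if "pover Fq u" "a = b * u + c" "poly a r : U.m" "poly b r : U.m" for a b u c
 proof -
  have "poly u r * poly b r : U.m" by (rule U.m_mult[OF that(4) poly_Fq_P[OF Q(1) that(1)]])
  hence "poly a r - poly u r * poly b r : U.m" by (rule U.m_diff[OF that(3)])
  thus ?thesis unfolding that(2) by (simp add: mult.commute)
 qed
 obtain u c where uc: "pover Fq u" "pover Fq c" "h = f * u + c" "c = 0 \<or> degree c < degree f"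
  using Fq.pover_divmod[OF f(1) f0 h(1)] by blast
 have c: "poly c r : U.m" by (rule rem[OF uc(1,3) h(2) Q(2)])
 have c0: "c ~= 0" using n uc by auto
 obtain v where v: "pover Fq v" "v ~= 0" "poly v r : U.m" "degree v <= degree c"
  "!!h. pover Fq h ==> h ~= 0 ==> poly h r : U.m ==> degree v <= degree h" "degree v > 0"
  using ex_min_poly[OF Q(1) uc(2) c0 c] by metis
 obtain a b where ab: "pover Fq a" "pover Fq b" "f = v * a + b" "b = 0 \<or> degree b < degree v"
  using Fq.pover_divmod[OF v(1,2) f(1)] by blast
 have "poly b r : U.m" by (rule rem[OF ab(1,3) Q(2) v(3)])
 hence "b = 0" using v(5)[OF ab(2)] ab(4) by force
 hence fva: "f = v * a" using ab(3) by simp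
 hence a0: "a ~= 0" using f0 by auto
 have dg: "degree f = degree v + degree a" unfolding fva by (rule degree_mult_eq[OF v(2) a0])
 have "poly v r * poly a r : V.m" using f(2) unfolding fva by simp
 hence "poly v r : V.m \<or> poly a r : V.m"
  by (rule V.m_prime[OF poly_Fq_P[OF P v(1)] poly_Fq_P[OF P ab(1)]])
 hence "degree f <= degree v \<or> degree f <= degree a" using f(3) v(1,2) ab(1) a0 by blast
 thus False using dg v(4,6) uc(4) c0 by auto
qed

text \<open>The polynomial \<open>f\<close> stays prime after adjoining s, so all places over f(r) =
  0 see the same multiplicity. It is found by dividing \<open>f\<close> out of all coefficients
  until one of them is no longer divisible; the function left over is a unit at all these
  places.\<close>

lemma vertical_uniform:
 assumes P: "P : cs.nonc" and f: "pover Fq f" "poly f r : max_ideal P"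
  "!!h. pover Fq h ==> h ~= 0 ==> poly h r : max_ideal P ==> degree f <= degree h" and f0: "f ~= 0" "degree f > 0"
  and g: "h : F.Mf" "h ~= 0"
 shows "EX i. ALL Q:cs.nonc. poly f r : max_ideal Q --> ord_at Q h = i * ord_at Q (poly f r)"
proof -
 have FqM: "Fq \<subseteq> K.Mf" using Fq_kb kb_K K.k_M by blast
 have pM: "poly a r : K.Mf" if "pover Fq a" for a by (rule K.M.poly_mem[OF pover_mono[OF that FqM] K.r_M])
 have fr0: "poly f r ~= 0" using r_trans_F f(1) f0(1) pover_mono[OF f(1) Fq_F] unfolding algel_def by blast
 have main: "EX i::nat. ALL Q:cs.nonc. poly f r : max_ideal Q --> ord_at Q x = int i * ord_at Q (poly f r)"
  if "!!i. pover Fq (A i)" "x = (\<Sum>i\<le>n. poly (A i) r * s ^ i)" "x ~= 0" for A n x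
  using that
 proof (induction "\<Sum>i\<le>n. degree (A i)" arbitrary: A x rule: less_induct)
  case less
  show ?case
  proof (cases "ALL i<=n. EX u. pover Fq u & A i = f * u")
   case True
   hence "ALL i. EX u. pover Fq u & (i <= n --> A i = f * u)" using Fq.pover_0 by blast
   then obtain B where B: "!!i. pover Fq (B i)" "!!i. i <= n ==> A i = f * B i" by metis
   define y where "y = (\<Sum>i\<le>n. poly (B i) r * s ^ i)"
   have xy: "x = poly f r * y" unfolding less.prems(2) y_def sum_distrib_left
    by (rule sum.cong) (auto simp: B(2) mult.assoc)
   have y0: "y ~= 0" using xy less.prems(3) by auto
   have dle: "degree (B i) <= degree (A i)" "B i ~= 0 ==> degree (B i) < degree (A i)" if "i <= n" for i
    using B(2)[OF that] f0 degree_mult_eq[OF f0(1), of "B i"] by (cases "B i = 0"; simp)+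
   obtain i where i: "i <= n" "B i ~= 0"
   proof (rule ccontr)
    assume "~ thesis"
    hence "B i = 0" if "i <= n" for i using that \<open>!!i. i <= n ==> B i ~= 0 ==> thesis\<close> by blast
    hence "y = 0" unfolding y_def by (intro sum.neutral) simp
    thus False using y0 by simp
   qed
   have "(\<Sum>i\<le>n. degree (B i)) < (\<Sum>i\<le>n. degree (A i))"
    by (rule sum_strict_mono_ex1) (use dle i in auto)
   from less.hyps[OF this B(1) y_def y0] obtain m :: nat
    where m: "ALL Q:cs.nonc. poly f r : max_ideal Q --> ord_at Q y = int m * ord_at Q (poly f r)" by blast
   have yM: "y : K.Mf" unfolding y_def using pM[OF B(1)] K.s_M by (intro K.M.sum_mem K.M.mult_mem K.M.power_mem)
   have "ord_at Q x = int (Suc m) * ord_at Q (poly f r)" if "Q : cs.nonc" "poly f r : max_ideal Q" for Q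
    using K.ord_facts(1)[OF nonc_facts(1)[OF that(1)] pM[OF f(1)] fr0 yM y0] m that unfolding xy
    by (simp add: algebra_simps)
   thus ?thesis by blast
  next
   case False
   then obtain j where j: "j <= n" "~ (EX u. pover Fq u & A j = f * u)" by blast
   have "ord_at Q x = 0" if Q: "Q : cs.nonc" "poly f r : max_ideal Q" for Q
   proof -
    note N = nonc_facts[OF Q(1)]
    interpret U: vring K K.Mf Q by unfold_locales (rule N(1))
    have kQ: "kb \<subseteq> Q" using kb_K U.KP by blast
    obtain \<beta> where \<beta>: "\<beta> : kb" "r - \<beta> : U.m" using root_mod[OF N(1,2) pover_mono[OF f(1) Fq_kb] f0(1) Q(2)] by blast
    have cong: "poly a r - poly a \<beta> : U.m" if "pover Fq a" for a
     using that
    proof (induction a)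
     case (pCons c a)
     have a: "pover Fq a" using pCons.prems by simp
     have "\<beta> * (poly a r - poly a \<beta>) + poly a r * (r - \<beta>) : U.m"
      by (rule U.m_add[OF U.m_mult[OF pCons.IH[OF a]] U.m_mult[OF \<beta>(2) poly_Fq_P[OF Q(1) a]]]) (use kQ \<beta>(1) in blast)
     thus ?case by (simp add: algebra_simps)
    qed simp
    have \<beta>kb: "poly (A i) \<beta> : kb" for i by (rule kb.poly_mem[OF pover_mono[OF less.prems(1) Fq_kb] \<beta>(1)])
    define Bp where "Bp = (\<Sum>i\<le>n. monom (poly (A i) \<beta>) i)"
    have cB: "coeff Bp i = (if i <= n then poly (A i) \<beta> else 0)" for i
     unfolding Bp_def by (simp add: coeff_sum if_distrib cong: if_cong)
    have Bk: "pover kb Bp" unfolding pover_def cB using \<beta>kb by simp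
    \<comment> \<open>Otherwise A_j(r) would vanish at Q and \<open>f\<close> would divide A_j,
      against the choice of j. So reducing r to its residue leaves a nonzero polynomial over
      \<open>kb\<close>, which cannot vanish at s.\<close>
    have "poly (A j) \<beta> ~= 0"
    proof
     assume "poly (A j) \<beta> = 0"
     hence "poly (A j) r : U.m" using cong[OF less.prems(1), of j] by simp
     thus False using min_poly_dvd[OF P f f0(1) Q less.prems(1)] j(2) by blast
    qed
    hence B0: "Bp ~= 0" using cB[of j] j(1) by auto
    have "x - poly Bp s = (\<Sum>i\<le>n. s ^ i * (poly (A i) r - poly (A i) \<beta>))"
     unfolding less.prems(2) Bp_def by (simp add: poly_sum poly_monom sum_subtractf[symmetric] algebra_simps)
    also have "... : U.m"
    proof -
     have si: "s ^ i * (poly (A i) r - poly (A i) \<beta>) : U.m" for i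
      by (rule U.m_mult[OF cong[OF less.prems(1)] U.power_mem[OF N(3)]])
     have "(\<Sum>i\<in>S. s ^ i * (poly (A i) r - poly (A i) \<beta>)) : U.m" if "finite S" for S
      using that by (induction rule: finite_induct) (auto intro: U.m_add[OF si])
     thus ?thesis by blast
    qed
    finally have xB: "x - poly Bp s : U.m" .
    have "poly Bp s ~: U.m"
    proof
     assume "poly Bp s : U.m"
     then obtain \<gamma> where "\<gamma> : kb" "s - \<gamma> : U.m" using root_mod[OF N(1,3) Bk B0] by blast
     thus False using not_both_algebraic[OF Q(1) \<beta>] by blast
    qed
    moreover have "poly Bp s : Q" by (rule U.poly_mem[OF pover_mono[OF Bk kQ] N(3)])
    ultimately have "poly Bp s + (x - poly Bp s) : Q - U.m" by (intro U.unit_add_m xB) blast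
    thus ?thesis using dvring.ord_unit[OF K.dvring[OF N(1)]] by simp
   qed
   thus ?thesis by (intro exI[of _ 0]) simp
  qed
 qed
 let ?R = "adj (adj Fq r) s"
 interpret F1: subrng "adj Fq r" by (rule Fq.adj_subrng)
 interpret R: subrng ?R by (rule F1.adj_subrng)
 have RR: "Fq \<subseteq> ?R" "r : ?R" "s : ?R" using Fq.adj_incl Fq.adj_gen F1.adj_incl F1.adj_gen by blast+
 have R1: "EX i::nat. ALL Q:cs.nonc. poly f r : max_ideal Q --> ord_at Q x = int i * ord_at Q (poly f r)"
  if x: "x : ?R" "x ~= 0" for x
 proof -
  obtain p where p: "x = poly p s" "pover (adj Fq r) p" using x(1) unfolding adj_def[of _ s] by blast
  have "coeff p i : adj Fq r" for i using p(2) by (simp add: pover_def)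
  hence "ALL i. EX a. pover Fq a & coeff p i = poly a r" unfolding adj_def by blast
  then obtain A where A: "!!i. pover Fq (A i)" "!!i. coeff p i = poly (A i) r" by metis
  show ?thesis by (rule main[of A x "degree p", OF A(1) _ x(2)]) (simp add: p(1) poly_altdef A(2))
 qed
 obtain a b where ab: "a : ?R" "b : ?R" "h = a / b" using M0_frac[OF R.subrng_axioms RR g(1)] by blast
 have ab0: "a ~= 0" "b ~= 0" using ab(3) g(2) by auto
 obtain i j :: nat where ij: "!!Q. Q : cs.nonc ==> poly f r : max_ideal Q ==> ord_at Q a = int i * ord_at Q (poly f r)"
  "!!Q. Q : cs.nonc ==> poly f r : max_ideal Q ==> ord_at Q b = int j * ord_at Q (poly f r)"
  using R1[OF ab(1) ab0(1)] R1[OF ab(2) ab0(2)] by blast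
 have "?R \<subseteq> K.Mf" by (rule adj_least[OF K.M.subrng_axioms adj_least[OF K.M.subrng_axioms FqM K.r_M] K.s_M])
 hence M: "a : K.Mf" "b : K.Mf" using ab by blast+
 have "ord_at Q h = (int i - int j) * ord_at Q (poly f r)" if "Q : cs.nonc" "poly f r : max_ideal Q" for Q
  using K.ord_facts(2)[OF nonc_facts(1)[OF that(1)] M(1) ab0(1) M(2) ab0(2)] ij(1)[OF that] ij(2)[OF that]
  by (simp add: ab(3) left_diff_distrib)
 thus ?thesis by blast
qed

text \<open>One fibre f(r) = 0 at a time: on it \<open>e\<close> is a fixed multiple of the order of
  f(r), so a power of f(r) clears the whole fibre and leaves the other places alone.\<close>

lemma vertical:
 assumes "good e" "!!P. P : cs.nonc ==> hor P ==> e P = 0"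
 shows "EX d:F.Mf. d ~= 0 & (ALL P:cs.nonc. ord_at P d = e P)"
 using assms
proof (induction "card {P : cs.nonc. e P ~= 0}" arbitrary: e rule: less_induct)
 case less
 show ?case
 proof (cases "EX P:cs.nonc. e P ~= 0")
  case False
  hence "ord_at P 1 = e P" if "P : cs.nonc" for P
   using K.ord_facts(5)[OF nonc_facts(1)[OF that], of 1] that by simp
  thus ?thesis by (intro bexI[of _ 1]) auto
 next
  case True
  then obtain P where P: "P : cs.nonc" "e P ~= 0" by blast
  hence "~ hor P" using less.prems(2) by blast
  then obtain f0 where n: "pover Fq f0" "f0 ~= 0" "poly f0 r : max_ideal P" unfolding hor_def by blast
  obtain f where f: "pover Fq f" "f ~= 0" "poly f r : max_ideal P" "degree f <= degree f0"
   "!!h. pover Fq h ==> h ~= 0 ==> poly h r : max_ideal P ==> degree f <= degree h" "degree f > 0"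
   using ex_min_poly[OF P(1) n] by metis
  have uni: "EX i. ALL Q:cs.nonc. poly f r : max_ideal Q --> ord_at Q h = i * ord_at Q (poly f r)"
   if "h : F.Mf" "h ~= 0" for h
   by (rule vertical_uniform[OF P(1) f(1,3) _ f(2,6) that]) (rule f(5); assumption)
  define u where "u = poly f r"
  have uM: "u : F.Mf" unfolding u_def by (rule F.M.poly_mem[OF pover_mono[OF f(1)] F.r_M]) (use Fq_F F_M0 in blast)
  have u0: "u ~= 0" unfolding u_def using r_trans_F f(2) pover_mono[OF f(1) Fq_F] unfolding algel_def by blast
  have uMK: "u : K.Mf" using uM M0_M by blast
  have upos: "ord_at Q u >= 1" if "Q : cs.nonc" "u : max_ideal Q" for Q
   using K.ord_facts(8)[OF nonc_facts(1)[OF that(1)] uMK u0] that(2) by blast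
  have uz: "ord_at Q u = 0" if "Q : cs.nonc" "u ~: max_ideal Q" for Q
   using dvring.ord_unit[OF K.dvring[OF nonc_facts(1)[OF that(1)]], of u] poly_Fq_P[OF that(1) f(1)] that(2)
   unfolding u_def by blast
  have Pu: "u : max_ideal P" using f(3) by (simp add: u_def)
  have hex: "EX h i. (ALL Q:cs.nonc. e Q <= ord_at Q h) & ord_at P' h = e P' & (ALL Q:cs.nonc. u : max_ideal Q --> ord_at Q h = i * ord_at Q u)"
   if P': "P' : cs.nonc" for P'
  proof -
   obtain h where h: "h : F.Mf" "h ~= 0" "ALL Q:cs.nonc. e Q <= ord_at Q h" "ord_at P' h = e P'"
    using less.prems(1) P' unfolding good_def by blast
   obtain i where "ALL Q:cs.nonc. u : max_ideal Q --> ord_at Q h = i * ord_at Q u" using uni[OF h(1,2)] unfolding u_def by blast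
   thus ?thesis using h(3,4) by blast
  qed
  obtain h i where h: "ALL Q:cs.nonc. e Q <= ord_at Q h" "ord_at P h = e P"
   "ALL Q:cs.nonc. u : max_ideal Q --> ord_at Q h = i * ord_at Q u" using hex[OF P(1)] by blast
  have eP: "e P = i * ord_at P u" using h P(1) Pu by simp
  \<comment> \<open>A function exact at Q has some multiplicity i' along the fibre. It also respects
    the bound at P, which gives i <= i', while h itself bounds e Q from above.\<close>
  have eQ: "e Q = i * ord_at Q u" if Q: "Q : cs.nonc" "u : max_ideal Q" for Q
  proof (rule antisym)
   show "e Q <= i * ord_at Q u" using h(1,3) Q by force
   obtain h' i' where h': "ALL Q:cs.nonc. e Q <= ord_at Q h'" "ord_at Q h' = e Q"
    "ALL Q:cs.nonc. u : max_ideal Q --> ord_at Q h' = i' * ord_at Q u" using hex[OF Q(1)] by blast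
   have "i * ord_at P u <= i' * ord_at P u" using h'(1,3) P(1) Pu eP by force
   hence "i <= i'" using upos[OF P(1) Pu] by simp
   hence "i * ord_at Q u <= i' * ord_at Q u" using upos[OF Q] by (intro mult_right_mono) auto
   thus "i * ord_at Q u <= e Q" using h'(2,3) Q by simp
  qed
  define d where "d = u powi i"
  have d: "d : F.Mf" "d ~= 0" unfolding d_def using uM u0 by (auto intro: F.M.powi_mem)
  have od: "ord_at Q d = i * ord_at Q u" if "Q : cs.nonc" for Q
  proof -
   note o = K.ord_facts[OF nonc_facts(1)[OF that] uMK u0]
   have iu: "inverse u : K.Mf" "inverse u ~= 0" using uMK u0 by (auto intro: K.M.inverse_mem)
   show ?thesis unfolding d_def power_int_def
    using o(3,4) K.ord_facts(4)[OF nonc_facts(1)[OF that] iu, of "nat (- i)"] by (auto simp: mult.commute)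
  qed
  define e' where "e' = (%Q. e Q - ord_at Q d)"
  have e': "good e'" unfolding e'_def by (rule good_shift[OF less.prems(1) d])
  have z1: "e' Q = 0" if "Q : cs.nonc" "u : max_ideal Q" for Q using eQ[OF that] od[OF that(1)] by (simp add: e'_def)
  have z2: "e' Q = e Q" if "Q : cs.nonc" "u ~: max_ideal Q" for Q using uz[OF that] od[OF that(1)] by (simp add: e'_def)
  have "{P : cs.nonc. e' P ~= 0} \<subset> {P : cs.nonc. e P ~= 0}"
  proof (rule psubsetI)
   show "{P : cs.nonc. e' P ~= 0} \<subseteq> {P : cs.nonc. e P ~= 0}" using z1 z2 by force
   show "{P : cs.nonc. e' P ~= 0} ~= {P : cs.nonc. e P ~= 0}" using P z1[OF P(1) Pu] by blast
  qed
  hence "card {P : cs.nonc. e' P ~= 0} < card {P : cs.nonc. e P ~= 0}"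
   using less.prems(1) unfolding good_def by (intro psubset_card_mono) blast+
  moreover have "e' Q = 0" if "Q : cs.nonc" "hor Q" for Q using z1[OF that(1)] z2[OF that(1)] less.prems(2)[OF that] by metis
  ultimately obtain d' where d': "d' : F.Mf" "d' ~= 0" "ALL P:cs.nonc. ord_at P d' = e' P" using less.hyps[OF _ e'] by blast
  have "ord_at Q (d * d') = e Q" if "Q : cs.nonc" for Q
   using K.ord_facts(1)[OF nonc_facts(1)[OF that], of d d'] d d' M0_M that by (auto simp: e'_def)
  thus ?thesis using d d' by (intro bexI[of _ "d * d'"]) (auto intro: F.M.mult_mem)
 qed
qed

lemma affine_principal:
 assumes e: "good e"
 shows "EX d:F.Mf. d ~= 0 & (ALL P:cs.nonc. ord_at P d = e P)"
proof -
 obtain d where d: "d : F.Mf" "d ~= 0" "ALL P:cs.nonc. hor P --> ord_at P d = e P" using horizontal[OF e] by blast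
 obtain d' where d': "d' : F.Mf" "d' ~= 0" "ALL P:cs.nonc. ord_at P d' = e P - ord_at P d"
  using vertical[OF good_shift[OF e d(1,2)]] d(3) by auto
 have "ord_at P (d * d') = e P" if "P : cs.nonc" for P
  using K.ord_facts(1)[OF nonc_facts(1)[OF that], of d d'] d d' M0_M that by auto
 thus ?thesis using d d' by (intro bexI[of _ "d * d'"]) (auto intro: F.M.mult_mem)
qed

end

lemma galois_lookup:
 assumes "faut l sg"
 shows "Poly_Mapping.lookup (galois_div sg A) (sg ` P) = Poly_Mapping.lookup A P"
proof -
 have inj: "sg ` B = sg ` P \<longleftrightarrow> B = P" for B using bij_is_inj[OF fautD(12)[OF assms]] by (rule inj_image_eq_iff)
 have "Poly_Mapping.lookup (galois_div sg A) (sg ` P) = (\<Sum>B\<in>Poly_Mapping.keys A. Poly_Mapping.lookup A B * (if B = P then 1 else 0))"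
  unfolding galois_div_def frag_extend_def lookup_sum
  by (rule sum.cong) (auto simp: lookup_frag_cmul lookup_frag_of inj eq_commute[of "sg ` P"])
 also have "... = Poly_Mapping.lookup A P" by (simp add: in_keys_iff if_distrib cong: if_cong)
 finally show ?thesis .
qed

lemma galois_eqI:
 assumes sg: "faut l sg" and eq: "!!P. Poly_Mapping.lookup B (sg ` P) = Poly_Mapping.lookup A P"
 shows "galois_div sg A = B"
proof (rule poly_mapping_eqI)
 fix Q
 have "sg ` inv_into UNIV sg ` Q = Q" using bij_is_surj[OF fautD(12)[OF sg]] by (rule image_f_inv_f)
 thus "Poly_Mapping.lookup (galois_div sg A) Q = Poly_Mapping.lookup B Q"
  using galois_lookup[OF sg, of A "inv_into UNIV sg ` Q"] eq[of "inv_into UNIV sg ` Q"] by simp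
qed

context t3_cusps
begin

subsection \<open>The Galois action on divisors\<close>

lemma gal_place: "faut F.Mf sg ==> sg ` P : places K K.Mf \<longleftrightarrow> P : places K K.Mf"
proof
 assume sg: "faut F.Mf sg"
 show "sg ` P : places K K.Mf" if "P : places K K.Mf" using faut_place[OF sg gal_image[OF sg] that] .
 assume "sg ` P : places K K.Mf"
 from faut_place[OF faut_inv[OF sg] gal_image[OF faut_inv[OF sg]] this]
 show "P : places K K.Mf" using bij_is_inj[OF fautD(12)[OF sg]] by (simp add: image_inv_f_f)
qed

text \<open>Each cusp is the only place with its conditions on r, s and theta, and these functions
  are fixed by the Galois group; so all four cusps are rational.\<close>

lemma gal_cusps:
 assumes sg: "faut F.Mf sg"
 shows "sg ` P1 = P1" "sg ` P2 = P2" "sg ` Q1 = Q1" "sg ` Q2 = Q2" "P : cs.nonc ==> sg ` P : cs.nonc"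
proof -
 note S = fautD[OF sg]
 have fx: "sg r = r" "sg s = s" "sg (1 + \<theta> * z) = 1 + \<theta> * z"
  using S(13)[OF F.r_M] S(13)[OF F.s_M] S(1,2,3) S(13)[OF F.th_M] S(13)[OF F.z_M] by auto
 have mem: "r : sg ` P \<longleftrightarrow> r : P" "s : sg ` P \<longleftrightarrow> s : P" "s : max_ideal (sg ` P) \<longleftrightarrow> s : max_ideal P"
  "1 + \<theta> * z : max_ideal (sg ` P) \<longleftrightarrow> 1 + \<theta> * z : max_ideal P" for P
  unfolding faut_max_ideal[OF sg]
  using faut_image_iff[OF sg, of r P] faut_image_iff[OF sg, of s P] faut_image_iff[OF sg, of s "max_ideal P"]
   faut_image_iff[OF sg, of "1 + \<theta> * z" "max_ideal P"] unfolding fx by blast+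
 have i: "sg ` P : K.P1s \<longleftrightarrow> P : K.P1s" "sg ` P : K.P2s \<longleftrightarrow> P : K.P2s" "sg ` P : K.Q1s \<longleftrightarrow> P : K.Q1s" "sg ` P : K.Q2s \<longleftrightarrow> P : K.Q2s" for P
  by (simp_all add: K.P1s_def K.P2s_def K.Q1s_def K.Q2s_def mem gal_place[OF sg])
 show "sg ` P1 = P1" by (rule K.P1s_facts(6)[OF cusp_mem(1)]) (simp add: i cusp_mem)
 show "sg ` P2 = P2" by (rule K.P2s_facts(6)[OF cusp_mem(2)]) (simp add: i cusp_mem)
 show "sg ` Q1 = Q1" by (rule K.Q1s_facts(6)[OF cusp_mem(3)]) (simp add: i cusp_mem)
 show "sg ` Q2 = Q2" by (rule K.Q2s_facts(7)[OF cusp_mem(4)]) (simp add: i cusp_mem)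
 show "P : cs.nonc ==> sg ` P : cs.nonc" by (simp add: cs.nonc_def i mem gal_place[OF sg])
qed

lemma gal_cd:
 assumes sg: "faut F.Mf sg"
 shows "K.lk (cs.cd a b c d) (sg ` P) = K.lk (cs.cd a b c d) P"
proof -
 have "sg ` P = B \<longleftrightarrow> P = B" if "sg ` B = B" for B
  using inj_image_eq_iff[OF bij_is_inj[OF fautD(12)[OF sg]], of P B] that by simp
 thus ?thesis using gal_cusps(1-4)[OF sg] by (simp add: cs.lk_cd)
qed

lemma gal_pdiv:
 assumes sg: "faut F.Mf sg" and f: "f : K.Mf" "f ~= 0"
 shows "K.lk (K.pdiv (sg f)) (sg ` P) = K.lk (K.pdiv f) P"
 using K.lk_pdiv[OF f, of P] K.lk_pdiv[OF gal_M1[OF sg f(1)], of "sg ` P"] f(2) gal_place[OF sg, of P] faut_ord[OF sg, of P f] fautD(10)[OF sg]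
 by simp

lemma cuspidal_invariant:
 assumes sg: "faut F.Mf sg"
 shows "galois_div sg ` K.cl (cs.cd a b c d) = K.cl (cs.cd a b c d)"
proof -
 have g: "galois_div \<tau> (cs.cd a b c d + K.pdiv f) = cs.cd a b c d + K.pdiv (\<tau> f)"
  if "faut F.Mf \<tau>" "f : K.Mf" "f ~= 0" for \<tau> f
  by (rule galois_eqI[OF that(1)]) (simp add: lookup_add gal_cd[OF that(1)] gal_pdiv[OF that])
 have m: "E : K.cl (cs.cd a b c d) \<longleftrightarrow> (EX f:K.Mf. f ~= 0 & E = cs.cd a b c d + K.pdiv f)" for E
  unfolding K.mem_cl K.Pr_iff by (simp add: diff_eq_eq add.commute)
 show ?thesis
 proof (intro equalityI subsetI)
  fix E assume "E : galois_div sg ` K.cl (cs.cd a b c d)"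
  then obtain E' where E': "E' : K.cl (cs.cd a b c d)" "E = galois_div sg E'" by (elim imageE)
  from E'(1)[unfolded m] obtain f where f: "f : K.Mf" "f ~= 0" "E' = cs.cd a b c d + K.pdiv f" by (elim bexE conjE)
  have "E = cs.cd a b c d + K.pdiv (sg f)" unfolding E'(2) f(3) by (rule g[OF sg f(1,2)])
  moreover have "sg f ~= 0" using f(2) fautD(10)[OF sg, of f] by simp
  ultimately show "E : K.cl (cs.cd a b c d)" unfolding m using gal_M1[OF sg f(1)] by (intro bexI[of _ "sg f"] conjI)
 next
  fix E assume "E : K.cl (cs.cd a b c d)"
  from this[unfolded m] obtain f where f: "f : K.Mf" "f ~= 0" "E = cs.cd a b c d + K.pdiv f" by (elim bexE conjE)
  define h where "h = inv_into UNIV sg f"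
  note i = faut_inv[OF sg]
  have h: "h : K.Mf" "h ~= 0" "sg h = f" unfolding h_def
   using gal_M1[OF i f(1)] fautD(10)[OF i, of f] f(2) faut_image_all[OF sg, of f] by auto
  have "E = galois_div sg (cs.cd a b c d + K.pdiv h)" unfolding g[OF sg h(1,2)] h(3) by (rule f(3))
  moreover have "cs.cd a b c d + K.pdiv h : K.cl (cs.cd a b c d)" unfolding m by (rule bexI[of _ h]) (rule conjI[OF h(2) refl], rule h(1))
  ultimately show "E : galois_div sg ` K.cl (cs.cd a b c d)" by (rule image_eqI)
 qed
qed

text \<open>Allowing just enough poles at the rational cusp \<open>Q\<^sub>1\<close> makes the Riemann--Roch space
 one-dimensional, so the effective divisor obtained from it is Galois invariant.\<close>

lemma invariant_effective:
 assumes A: "A : carrier K.DG" and inv: "!!sg. faut F.Mf sg ==> galois_div sg A - A : K.Pr"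
 obtains E n f where "K.isdiv E" "!!P. K.lk E P >= 0" "!!sg P. faut F.Mf sg ==> P : places K K.Mf ==> K.lk E (sg ` P) = K.lk E P"
  "f : K.Mf" "f ~= 0" "E = A + cs.cd 0 0 n 0 + K.pdiv f"
proof -
 have Ad: "K.isdiv A" "K.degd A = 0" using A by (simp_all add: K.carrier_DG)
 define a where "a n = A + cs.cd 0 0 n 0" for n
 have ad: "K.isdiv (a n)" "K.degd (a n) = n" for n
  using Ad cs.isdiv_cd K.isdiv_intros(2) by (simp_all add: a_def K.degd_add cs.degd_cd)
 obtain N \<gamma> where rr: "!!B. K.isdiv B ==> N <= K.degd B ==> int (K.ell B) = K.degd B - \<gamma>" using K.riemann by blast
 define n1 where "n1 = nat (max 0 (max N (\<gamma> + 1)))"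
 have "K.ell (a (int n1)) > 0"
 proof -
  have "int n1 = max 0 (max N (\<gamma> + 1))" by (simp add: n1_def)
  hence "N <= int n1" "\<gamma> + 1 <= int n1" by (simp_all add: le_max_iff_disj)
  thus ?thesis using rr[OF ad(1), of "int n1"] unfolding ad(2) by linarith
 qed
 then obtain n where n: "K.ell (a (int n)) > 0" "!!m. K.ell (a (int m)) > 0 ==> n <= m"
  using ex_has_least_nat[of "%n. K.ell (a (int n)) > 0" n1 id] by auto
 obtain f where f: "f : K.L (a (int n))" "f ~= 0" using K.ell_pos_ex[OF ad(1) n(1)] .
 have fM: "f : K.Mf" using f(1) by (simp add: K.L_def)
 have L0: "K.L (a (int n - 1)) = {0}"
 proof (cases n)
  case 0
  thus ?thesis using K.L_neg[OF ad(1)] by (simp add: ad(2))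
 next
  case (Suc m)
  hence "K.ell (a (int m)) = 0" using n(2)[of m] by linarith
  hence "K.L (a (int m)) \<subseteq> {0}" using K.ell[OF ad(1)[of "int m"]] by (intro K.k.mdim_0D) simp
  thus ?thesis using vsubD(1)[OF K.vsub_L] Suc by auto
 qed
 have "a (int n - 1) + frag_of Q1 = a (int n)"
 proof -
  have "frag_of Q1 = cs.cd 0 0 1 0" by (simp add: cs.cd_def)
  thus ?thesis by (simp add: a_def add.assoc cs.cd_simps)
 qed
 then obtain m where "m <= K.dg Q1" "mdim K (K.L (a (int n))) {0} m"
  using K.L_step[OF cs.cusp_places(3), of "a (int n - 1)"] unfolding L0 by auto
 hence m: "m <= 1" "mdim K (K.L (a (int n))) {0} m" using K.Q1s_facts(1)[OF cusp_mem(3)] by auto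
 then obtain U where U: "spans K {0} U (K.L (a (int n)))" "card U <= 1" "finite U" by (auto simp: mdim_def spans_def)
 have scal: "EX c:K. h = c * f" if h: "h : K.L (a (int n))" for h
 proof (cases "U = {}")
  case True
  hence "f = 0" using U(1) f(1) unfolding spans_def by force
  thus ?thesis using f by blast
 next
  case False
  hence "card U = 1" using U(2,3) by (simp add: le_Suc_eq)
  then obtain u where u: "U = {u}" by (auto simp: card_1_singleton_iff)
  have sp: "EX c:K. v = c * u" if "v : K.L (a (int n))" for v using U(1) that unfolding u spans_def by auto
  obtain c d where cd: "c : K" "f = c * u" "d : K" "h = d * u" using sp[OF f(1)] sp[OF h] by blast
  hence "h = (d / c) * f" using f(2) by auto
  thus ?thesis using cd K.k.divide_mem by blast
 qed
 define E where "E = a (int n) + K.pdiv f"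
 have lkE: "K.lk E P = K.lk (a (int n)) P + ord_at P f" if "P : places K K.Mf" for P
  using K.lk_pdiv[OF fM f(2)] that by (simp add: E_def lookup_add)
 have E0: "K.lk E P >= 0" for P unfolding E_def using K.L_nonzero(1)[OF ad(1) f] .
 have inv: "K.lk E (sg ` P) = K.lk E P" if sg: "faut F.Mf sg" and P: "P : places K K.Mf" for sg P
 proof -
  obtain u where u: "u : K.Mf" "u ~= 0" "galois_div sg A - A = K.pdiv u" using inv[OF sg] unfolding K.Pr_iff by blast
  have sf: "sg f : K.Mf" "sg f ~= 0" using gal_M1[OF sg fM] fautD(10)[OF sg, of f] f(2) by auto
  \<comment> \<open>Transporting the effective divisor E by sg shows that h lies in the same
    one-dimensional space as f. So h is a constant times f, and comparing the two expressions for E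
    gives its invariance.\<close>
  define h where "h = u * sg f"
  have hM: "h : K.Mf" "h ~= 0" unfolding h_def using u(1,2) sf K.M.mult_mem by auto
  have key: "K.lk E B = K.lk (a (int n)) (sg ` B) + ord_at (sg ` B) h" if B: "B : places K K.Mf" for B
  proof -
   note sB = iffD2[OF gal_place[OF sg] B]
   have "K.lk A B = K.lk A (sg ` B) + ord_at (sg ` B) u"
    using arg_cong[OF u(3), of "%D. K.lk D (sg ` B)"] K.lk_pdiv[OF u(1,2), of "sg ` B"] sB
    by (simp add: lookup_minus galois_lookup[OF sg])
   moreover have "ord_at (sg ` B) h = ord_at (sg ` B) u + ord_at B f"
    unfolding h_def using K.ord_facts(1)[OF sB u(1,2) sf] faut_ord[OF sg] by simp
   ultimately show ?thesis unfolding lkE[OF B] a_def lookup_add gal_cd[OF sg] by simp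
  qed
  have "h : K.L (a (int n))"
   unfolding K.L_def
  proof (intro CollectI conjI ballI)
   fix B' assume B': "B' : places K K.Mf"
   define B where "B = inv_into UNIV sg ` B'"
   have sB: "sg ` B = B'" unfolding B_def using bij_is_surj[OF fautD(12)[OF sg]] by (rule image_f_inv_f)
   hence "B : places K K.Mf" using gal_place[OF sg, of B] B' by simp
   from key[OF this] have "K.lk E B = K.lk (a (int n)) B' + ord_at B' h" unfolding sB .
   hence "- K.lk (a (int n)) B' <= ord_at B' h" using E0[of B] by linarith
   thus "h : K.og B' (- K.lk (a (int n)) B')" using hM by (simp add: K.og_def)
  qed (rule hM)
  then obtain c where c: "c : K" "h = c * f" using scal by blast
  hence c0: "c ~= 0" "c : K.Mf" using hM K.k_M by auto
  have sP: "sg ` P : places K K.Mf" using gal_place[OF sg] P by blast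
  have "ord_at (sg ` P) h = ord_at (sg ` P) f"
   unfolding c(2) using K.ord_facts(1)[OF sP c0(2,1) fM f(2)] K.ord_facts(6)[OF sP c0(2,1) c(1)] by simp
  thus ?thesis using key[OF P] lkE[OF sP] by simp
 qed
 have "K.isdiv E" unfolding E_def by (intro K.isdiv_intros(2) ad(1) K.isdiv_pdiv fM f(2))
 thus ?thesis using that[of E f "int n"] E0 inv fM f(2) by (simp add: E_def a_def)
qed

text \<open>With enough poles allowed at Q1, Riemann's theorem gives functions bounded by E on the
  open curve and exact at P. The space is Galois stable, so if all its members over F missed
  exactness at P, descent would make all members miss it.\<close>

lemma good_invariant:
 assumes E: "K.isdiv E" and inv: "!!sg P. faut F.Mf sg ==> P : places K K.Mf ==> K.lk E (sg ` P) = K.lk E P"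
 shows "good (K.lk E)"
 unfolding good_def
proof (intro conjI ballI)
 show "finite {P : cs.nonc. K.lk E P ~= 0}" by (rule finite_subset[of _ "Poly_Mapping.keys E"]) (auto simp: in_keys_iff)
 fix P assume P: "P : cs.nonc"
 note pl = nonc_facts(1)[OF P]
 obtain N \<gamma> where rr: "!!B. K.isdiv B ==> N <= K.degd B ==> int (K.ell B) = K.degd B - \<gamma>" using K.riemann by blast
 \<comment> \<open>Chosen so that B, and also B with the place P removed, reach the degree from
   which Riemann's formula holds.\<close>
 define n where "n = N + K.degd E + int (K.dg P)"
 define B where "B = cs.cd 0 0 n 0 - E"
 have B: "K.isdiv B" "K.degd B = n - K.degd E" using E cs.isdiv_cd K.isdiv_intros(4) by (simp_all add: B_def K.degd_diff cs.degd_cd)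
 define B' where "B' = B - frag_of P"
 have B': "K.isdiv B'" "K.degd B' = n - K.degd E - int (K.dg P)"
  using B K.isdiv_intros(4,6) pl by (simp_all add: B'_def K.degd_diff K.degd_frag_of)
 have "int (K.ell B') < int (K.ell B)" using rr[OF B(1)] rr[OF B'(1)] K.dg(2)[OF pl] unfolding B(2) B'(2) n_def by simp
 hence "~ K.L B \<subseteq> K.L B'"
 proof -
  assume lt: "int (K.ell B') < int (K.ell B)"
  show ?thesis
  proof
   assume sub: "K.L B \<subseteq> K.L B'"
   have "K.L B' \<subseteq> K.L B" by (rule K.L_mono) (simp add: B'_def lookup_minus lookup_frag_of)
   hence "K.L B = K.L B'" using sub by blast
   hence "K.ell B = K.ell B'" by (simp add: K.ell_def)
   thus False using lt by simp
  qed
 qed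
 have stable: "sg f : K.L B" if sg: "faut F.Mf sg" and f: "f : K.L B" for sg f
  unfolding K.L_def
 proof (intro CollectI conjI ballI)
  have fM: "f : K.Mf" using f by (simp add: K.L_def)
  thus sM: "sg f : K.Mf" by (rule gal_M1[OF sg])
  fix C' assume C': "C' : places K K.Mf"
  define C0 where "C0 = inv_into UNIV sg ` C'"
  have sC: "sg ` C0 = C'" unfolding C0_def using bij_is_surj[OF fautD(12)[OF sg]] by (rule image_f_inv_f)
  hence C0: "C0 : places K K.Mf" using gal_place[OF sg, of C0] C' by simp
  have "f : K.og C0 (- K.lk B C0)" using f C0 by (simp add: K.L_def)
  moreover have "K.lk B C' = K.lk B C0" unfolding B_def lookup_minus sC[symmetric] gal_cd[OF sg] inv[OF sg C0] ..
  moreover have "ord_at C' (sg f) = ord_at C0 f" unfolding sC[symmetric] by (rule faut_ord[OF sg])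
  ultimately show "sg f : K.og C' (- K.lk B C')" using sM fautD(10)[OF sg, of f] by (simp add: K.og_def)
 qed
 have "~ K.L B \<inter> F.Mf \<subseteq> K.L B'"
 proof
  assume sub: "K.L B \<inter> F.Mf \<subseteq> K.L B'"
  have "K.L B \<subseteq> K.Mf" unfolding K.L_def by blast
  hence "K.L B \<subseteq> K.L B'" by (rule descent[OF K.vsub_L _ K.vsub_L _ sub]) (rule stable)
  thus False using \<open>~ K.L B \<subseteq> K.L B'\<close> by blast
 qed
 then obtain h where h: "h : K.L B" "h : F.Mf" "h ~: K.L B'" by blast
 have h0: "h ~= 0" using h(3) vsubD(1)[OF K.vsub_L] by metis
 have hM: "h : K.Mf" using h(2) M0_M by blast
 have lkB: "K.lk B Q = - K.lk E Q" if "Q : cs.nonc" for Q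
  using cs.nonc(3)[OF that] by (simp add: B_def lookup_minus cs.lk_cd)
 have ge: "- K.lk B Q <= ord_at Q h" if "Q : places K K.Mf" for Q using h(1) that h0 by (simp add: K.L_def K.og_def)
 obtain Q where Q: "Q : places K K.Mf" "ord_at Q h < - K.lk B' Q" using h(3) hM h0 by (auto simp: K.L_def K.og_def not_le)
 have QP: "Q = P"
 proof (rule ccontr)
  assume "Q ~= P"
  hence "K.lk B' Q = K.lk B Q" by (simp add: B'_def lookup_minus lookup_frag_of)
  thus False using Q ge[OF Q(1)] by simp
 qed
 have "K.lk B' P = K.lk B P - 1" by (simp add: B'_def lookup_minus lookup_frag_of)
 hence "ord_at P h = K.lk E P" using Q(2) ge[OF pl] lkB[OF P] unfolding QP by simp
 moreover have "ALL Q:cs.nonc. K.lk E Q <= ord_at Q h" using ge nonc_facts(1) lkB by force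
 ultimately show "EX h:F.Mf. h ~= 0 & (ALL Q:cs.nonc. K.lk E Q <= ord_at Q h) & ord_at P h = K.lk E P"
  using h(2) h0 by blast
qed

text \<open>Dividing the invariant effective divisor by a function over F with the same orders on
  the open curve leaves a divisor supported on the cusps, hence a multiple of delta in the class
  group.\<close>

lemma rational_class:
 assumes A: "A : carrier K.DG" and inv: "!!sg. faut F.Mf sg ==> galois_div sg A - A : K.Pr"
 shows "EX n. K.cl A = K.cl (frag_cmul n cs.\<delta>)"
proof -
 obtain E n f where E: "K.isdiv E" "!!P. K.lk E P >= 0"
   "!!sg P. faut F.Mf sg ==> P : places K K.Mf ==> K.lk E (sg ` P) = K.lk E P"
  and f: "f : K.Mf" "f ~= 0" and EA: "E = A + cs.cd 0 0 n 0 + K.pdiv f"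
  using invariant_effective[OF A inv] by metis
 obtain d where d: "d : F.Mf" "d ~= 0" "ALL P:cs.nonc. ord_at P d = K.lk E P"
  using affine_principal[OF good_invariant[OF E(1,3)]] by blast
 have dM: "d : K.Mf" using d(1) M0_M by blast
 define a b c e where "a = K.lk E P1 - ord_at P1 d" and "b = K.lk E P2 - ord_at P2 d"
  and "c = K.lk E Q1 - ord_at Q1 d" and "e = K.lk E Q2 - ord_at Q2 d"
 have Ed: "E - K.pdiv d = cs.cd a b c e"
 proof (rule poly_mapping_eqI)
  fix P
  show "K.lk (E - K.pdiv d) P = K.lk (cs.cd a b c e) P"
  proof (cases "P : places K K.Mf")
   case True
   thus ?thesis
   proof (cases rule: cs.place_cases)
    case 5
    thus ?thesis using True cs.nonc(3)[OF 5] d(3) by (simp add: lookup_minus K.lk_pdiv[OF dM d(2)] cs.lk_cd)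
   qed (use True cs.cusps_neq in \<open>auto simp: lookup_minus K.lk_pdiv[OF dM d(2)] cs.lk_cd a_def b_def c_def e_def\<close>)
  next
   case False
   hence "K.lk E P = 0" using K.isdivD[OF E(1)] by blast
   thus ?thesis using False cs.cusp_places by (auto simp: lookup_minus K.lk_pdiv[OF dM d(2)] cs.lk_cd)
  qed
 qed
 have Acd: "A = cs.cd a b (c - n) e + K.pdiv (d / f)"
 proof -
  have "A = (E - K.pdiv d) + cs.cd 0 0 (- n) 0 + (K.pdiv d - K.pdiv f)"
  proof -
   have m: "cs.cd 0 0 (- n) 0 = - cs.cd 0 0 n 0" unfolding cs.cd_simps(3) by simp
   show ?thesis unfolding EA m by (simp add: algebra_simps)
  qed
  also have "... = cs.cd a b (c - n) e + K.pdiv (d / f)"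
   unfolding Ed cs.cd_simps K.pdiv_divide[OF dM d(2) f] by simp
  finally show ?thesis .
 qed
 have df: "d / f : K.Mf" "d / f ~= 0" using dM d(2) f by (auto intro: K.M.divide_mem)
 have "K.degd A = 0" using A by (simp add: K.carrier_DG)
 hence "a + b + (c - n) + e = 0" unfolding Acd K.degd_add K.degd_pdiv[OF df] cs.degd_cd by simp
 from cs.cd_mod_delta[OF this] obtain m h where h: "h : K.Mf" "h ~= 0" "cs.cd a b (c - n) e = frag_cmul m cs.\<delta> + K.pdiv h" by blast
 have "A - frag_cmul m cs.\<delta> = K.pdiv (h * (d / f))" unfolding Acd h(3) K.pdiv_mult[OF h(1,2) df] by simp
 moreover have "h * (d / f) : K.Mf" by (rule K.M.mult_mem[OF h(1) df(1)])
 moreover have "h * (d / f) ~= 0" using h(2) df(2) by (rule no_zero_divisors)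
 ultimately have "A - frag_cmul m cs.\<delta> : K.Pr" unfolding K.Pr_iff by (intro bexI[of _ "h * (d / f)"] conjI)
 thus ?thesis using K.cl_eq_iff[OF A K.cmul_DG[OF cs.delta_DG]] by blast
qed

subsection \<open>The main theorem\<close>

text \<open>j is the power q + 1 of -(theta + D), divided by \<open>D\<close>. It is finite where
  \<open>D\<close> is a unit. If D has order v > 0 the order of j is -v, and if v < 0 it is q v; in
  both cases j has a pole.\<close>

lemma cusps_eq: "cusps \<phi> C = {P1, P2, Q1, Q2}"
proof -
 note jf = j_field[OF K.M.subfld_axioms K.th_M K.r_M K.s_M]
 have DM: "D : K.Mf" "j_gen : K.Mf" "\<theta> + D : K.Mf" "1 + \<theta> * z : K.Mf"
  using jf K.th_M K.z_M by (auto intro: K.M.mems)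
 have Dz: "D = (1 + \<theta> * z) / z ^ q" using D_eq zz_nz by (simp add: zz_z field_simps)
 have jD: "j_gen = (- (\<theta> + D)) ^ (q + 1) / D" using j_D D_nz by (metis nonzero_eq_divide_eq)
 have oD: "ord_at P D = ord_at P (1 + \<theta> * z) - int q * ord_at P z" if P: "P : places K K.Mf" for P
  unfolding Dz using K.ord_facts(2)[OF P DM(4) K.nz(3), of "z ^ q"] K.ord_facts(4)[OF P K.z_M K.nz(2), of q] K.nz(2) K.z_M K.M.power_mem
  by simp
 have pole: "j_gen ~: P" if P: "P : places K K.Mf" and n: "ord_at P D ~= 0" for P
 proof -
  note o = K.ord_facts[OF P]
  have v: "ord_at P (\<theta> + D) = min 0 (ord_at P D) & \<theta> + D ~= 0"
  proof (cases "ord_at P D > 0")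
   case True
   thus ?thesis using o(9)[OF K.th_M th_nz, of D] K.th_unit[OF P] DM(1) by (auto simp: K.og_def)
  next
   case False
   thus ?thesis using o(9)[OF DM(1) D_nz, of \<theta>] K.th_unit[OF P] n K.th_M by (auto simp: K.og_def add.commute)
  qed
  have G: "- (\<theta> + D) : K.Mf" "- (\<theta> + D) ~= 0"
   using K.M.minus_mem[OF DM(3)] v unfolding neg_equal_0_iff_equal by blast+
  have "ord_at P (- (\<theta> + D)) = ord_at P (\<theta> + D)"
   using dvring.ord_uminus[OF K.dvring[OF P]] DM(3) v by blast
  hence "ord_at P j_gen = int (q + 1) * min 0 (ord_at P D) - ord_at P D"
   unfolding jD using o(2)[OF K.M.power_mem[OF G(1)] _ DM(1) D_nz, of "q + 1"] o(4)[OF G, of "q + 1"] G(2) v by simp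
  moreover have "int (q + 1) * min 0 (ord_at P D) - ord_at P D < 0"
  proof (cases "ord_at P D > 0")
   case False
   hence "int q * ord_at P D < 0" using n q_ge_2 by (intro mult_pos_neg) auto
   thus ?thesis using False by (simp add: algebra_simps)
  qed simp
  ultimately have "~ ord_at P j_gen >= 0" by linarith
  moreover have "(j_gen :: 'a ambient) ~= 0"
  proof
   assume "j_gen = (0 :: 'a ambient)"
   hence "(- (\<theta> + D)) ^ (q + 1) = 0" unfolding j_D by simp
   thus False using power_not_zero[OF G(2), of "q + 1"] by (rule notE[rotated])
  qed
  ultimately show ?thesis using o(7)[OF DM(2)] by blast
 qed
 have nopole: "j_gen : P" if P: "P : cs.nonc" for P
 proof -
  note pl = nonc_facts(1)[OF P]
  interpret V: vring K K.Mf P by unfold_locales (rule pl)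
  have "ord_at P D = 0" using oD[OF pl] cs.nonc_ord(3,4)[OF P] by simp
  hence "D : P - max_ideal P" using dvring.unit_iff_ord[OF K.dvring[OF pl] DM(1) D_nz] by blast
  hence "D : P" "inverse D : P" using V.unit_inverse by blast+
  thus ?thesis unfolding jD divide_inverse using K.th_unit(1)[OF pl]
   by (intro V.mult_mem V.power_mem V.minus_mem V.add_mem)
 qed
 have cusp: "j_gen ~: P" if "P : {P1, P2, Q1, Q2}" for P
 proof (rule pole)
  show pl: "P : places K K.Mf" using that cs.cusp_places by blast
  \<comment> \<open>At P1, P2, Q1, Q2 the orders of D are -q^2, 1, q - 1 and q^2 - q, all nonzero as
    q is at least 2.\<close>
  have "int q > 1" "int q * int q > int q" using q_ge_2 by simp_all
  thus "ord_at P D ~= 0" unfolding oD[OF pl] using that cs.facts by auto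
 qed
 show ?thesis
 proof (intro equalityI subsetI)
  fix P assume "P : cusps \<phi> C"
  hence P: "P : places K K.Mf" "j_gen ~: P" by (auto simp: cusps_def X0_sep_field_eq)
  from P(1) show "P : {P1, P2, Q1, Q2}" by (cases rule: cs.place_cases) (use P(2) nopole in auto)
 next
  fix P assume P: "P : {P1, P2, Q1, Q2}"
  hence "P : places K K.Mf" using cs.cusp_places by blast
  thus "P : cusps \<phi> C" using cusp[OF P] by (simp add: cusps_def X0_sep_field_eq)
 qed
qed

lemma class_pow: "A : carrier K.DG ==> K.cl A [^]\<^bsub>K.J\<^esub> (n::nat) = K.cl (frag_cmul (int n) A)"
proof (induction n)
 case 0
 thus ?case using monoid.nat_pow_0 by (simp add: K.cl_one[symmetric])
next
 case (Suc n)
 have "K.cl A [^]\<^bsub>K.J\<^esub> Suc n = K.cl A [^]\<^bsub>K.J\<^esub> n \<otimes>\<^bsub>K.J\<^esub> K.cl A" by simp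
 also have "... = K.cl (frag_cmul (int n) A + A)" unfolding Suc.IH[OF Suc.prems] by (rule K.cl_mult[OF K.cmul_DG[OF Suc.prems] Suc.prems])
 finally show ?case by (simp add: frag_cmul_distrib add.commute)
qed

lemma cuspidal_group_eq: "cuspidal_group \<phi> C = range (%n. K.cl (frag_cmul n cs.\<delta>))" (is "_ = ?H")
proof -
 let ?S = "{K.cl (frag_of P - frag_of P') | P P'. P : {P1, P2, Q1, Q2} & P' : {P1, P2, Q1, Q2}}"
 have cg: "cuspidal_group \<phi> C = generate K.J ?S"
  unfolding cuspidal_group_def J0_sep_def cusps_eq X0_sep_field_eq K.cl_def ..
 note grp = comm_group.axioms(2)[OF K.group_J]
 have H: "subgroup ?H K.J" by (rule K.cyclic_subgroup_cl[OF cs.delta_DG])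
 have sub: "?S \<subseteq> ?H"
 proof
  fix c assume "c : ?S"
  then obtain P P' where PP: "P : {P1, P2, Q1, Q2}" "P' : {P1, P2, Q1, Q2}" "c = K.cl (frag_of P - frag_of P')" by blast
  have one: "EX a1 a2 a3 a4. frag_of P = cs.cd a1 a2 a3 a4 & a1 + a2 + a3 + a4 = 1" if "P : {P1, P2, Q1, Q2}" for P
  proof -
   have "frag_of P1 = cs.cd 1 0 0 0" "frag_of P2 = cs.cd 0 1 0 0" "frag_of Q1 = cs.cd 0 0 1 0" "frag_of Q2 = cs.cd 0 0 0 1"
    by (simp_all add: cs.cd_def)
   moreover have "(1::int) + 0 + 0 + 0 = 1" "(0::int) + 1 + 0 + 0 = 1" "(0::int) + 0 + 1 + 0 = 1" "(0::int) + 0 + 0 + 1 = 1" by simp_all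
   ultimately show ?thesis using that by (elim insertE emptyE) blast+
  qed
  obtain a1 a2 a3 a4 where a: "frag_of P = cs.cd a1 a2 a3 a4" "a1 + a2 + a3 + a4 = 1" using one[OF PP(1)] by blast
  obtain b1 b2 b3 b4 where b: "frag_of P' = cs.cd b1 b2 b3 b4" "b1 + b2 + b3 + b4 = 1" using one[OF PP(2)] by blast
  have e: "frag_of P - frag_of P' = cs.cd (a1 - b1) (a2 - b2) (a3 - b3) (a4 - b4)"
   unfolding a(1) b(1) by (rule poly_mapping_eqI) (simp add: lookup_minus cs.lk_cd)
  have z0: "(a1 - b1) + (a2 - b2) + (a3 - b3) + (a4 - b4) = 0" using a(2) b(2) by linarith
  obtain n f where f: "f : K.Mf" "f ~= 0" "frag_of P - frag_of P' = frag_cmul n cs.\<delta> + K.pdiv f"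
   using cs.cd_mod_delta[OF z0] unfolding e by blast
  have "frag_of P - frag_of P' : carrier K.DG" unfolding e K.carrier_DG cs.degd_cd using cs.isdiv_cd z0 by blast
  hence "c = K.cl (frag_cmul n cs.\<delta>)"
   unfolding PP(3) using K.cl_eq_iff[OF _ K.cmul_DG[OF cs.delta_DG]] f by (auto simp: K.Pr_iff)
  thus "c : ?H" by blast
 qed
 have "generate K.J ?S \<subseteq> ?H" by (rule group.generate_subgroup_incl[OF grp sub H])
 moreover have "?H \<subseteq> generate K.J ?S"
 proof -
  have "?S \<subseteq> carrier K.J" using sub subgroup.subset[OF H] by blast
  hence gS: "subgroup (generate K.J ?S) K.J" by (rule group.generate_is_subgroup[OF grp])
  have "cs.\<delta> = frag_of Q2 - frag_of Q1" by (simp add: cs.\<delta>_def cs.cd_def)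
  hence "K.cl cs.\<delta> : ?S" by (intro CollectI) (rule exI[of _ Q2], rule exI[of _ Q1], simp)
  hence "K.cl cs.\<delta> : generate K.J ?S" by (rule generate.incl)
  thus ?thesis using K.subgroup_cl_cmul[OF cs.delta_DG gS] by blast
 qed
 ultimately show ?thesis unfolding cg by blast
qed

lemma J0_eq: "J0_sep \<phi> C = K.J"
 by (simp add: J0_sep_def X0_sep_field_eq)

text \<open>Stronger than equality with the torsion: the whole rational group is the finite cuspidal
  group. Invariance of a class as a set of divisors is turned into the statement that a
  representative changes by a principal divisor.\<close>

lemma J0_rational_eq: "J0_rational \<phi> C = cuspidal_group \<phi> C"
proof (intro equalityI subsetI)
 fix c assume "c : J0_rational \<phi> C"
 hence c: "c : carrier K.J" "!!sg. faut F.Mf sg ==> galois_div sg ` c = c"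
  by (auto simp: J0_rational_def J0_eq X0_field_eq auts_iff)
 obtain A where A: "A : carrier K.DG" "c = K.cl A" using c(1) unfolding K.carrier_J by blast
 have "A : c" unfolding A(2) K.mem_cl using subgroup.one_closed[OF K.subgroup_Pr] by simp
 hence "galois_div sg A - A : K.Pr" if "faut F.Mf sg" for sg
  using c(2)[OF that] unfolding A(2) K.mem_cl[symmetric] by blast
 thus "c : cuspidal_group \<phi> C" unfolding cuspidal_group_eq A(2) using rational_class[OF A(1)] by auto
next
 fix c assume "c : cuspidal_group \<phi> C"
 then obtain n where n: "c = K.cl (frag_cmul n cs.\<delta>)" unfolding cuspidal_group_eq by blast
 have "c : carrier K.J" unfolding n K.carrier_J using K.cmul_DG[OF cs.delta_DG] by blast
 moreover have "galois_div sg ` c = c" if "faut F.Mf sg" for sg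
  unfolding n cs.\<delta>_def cs.cd_simps by (rule cuspidal_invariant[OF that])
 ultimately show "c : J0_rational \<phi> C" by (simp add: J0_rational_def J0_eq X0_field_eq auts_iff)
qed

lemma torsion_iso:
 "J0_torsion \<phi> C = cuspidal_group \<phi> C"
 "(J0_sep \<phi> C)\<lparr>carrier := cuspidal_group \<phi> C\<rparr> \<cong> integer_mod_group (q ^ 2)"
proof -
 have "c [^]\<^bsub>K.J\<^esub> (q ^ 2) = \<one>\<^bsub>K.J\<^esub>" if c: "c : cuspidal_group \<phi> C" for c
 proof -
  obtain n where n: "c = K.cl (frag_cmul n cs.\<delta>)" using c unfolding cuspidal_group_eq by blast
  have "frag_cmul (int (q ^ 2) * n) cs.\<delta> : K.Pr" unfolding cs.delta_order by simp
  moreover have "0 : carrier K.DG" by (simp add: K.carrier_DG K.isdiv_intros)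
  ultimately show ?thesis unfolding n class_pow[OF K.cmul_DG[OF cs.delta_DG]] K.cl_one
   using K.cl_eq_iff[OF K.cmul_DG[OF cs.delta_DG], of 0 "int (q ^ 2) * n"] by simp
 qed
 moreover have "q ^ 2 > 0" using q_ge_2 by simp
 ultimately show "J0_torsion \<phi> C = cuspidal_group \<phi> C"
  unfolding J0_torsion_def J0_rational_eq J0_eq by blast
 show "(J0_sep \<phi> C)\<lparr>carrier := cuspidal_group \<phi> C\<rparr> \<cong> integer_mod_group (q ^ 2)"
  unfolding J0_eq cuspidal_group_eq by (rule K.cyclic_subgroup_iso[OF cs.delta_DG _ cs.delta_order]) (use q_ge_2 in simp)
qed

end

section \<open>Existence of the four cusps, and the conclusion\<close>

lemma (in t3_pair) ex_cusps: "EX P1 P2 Q1 Q2. t3_cusps \<phi> C x \<theta> q P1 P2 Q1 Q2"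
proof -
 have "field_Fj \<subseteq> K.Mf" using Fj_M M0_M by blast
 \<comment> \<open>The ambient field is algebraic over F(j), which lies in the function field, and
   that is algebraic over K(r). This allows the conjugation exchanging the cusps over infinity to be
   extended to the ambient field.\<close>
 have "algel (ratf K r) a" for a
 proof (rule K.R.algel_trans)
  show "algel K.Mf a" using algel_mono[OF algel_Fj \<open>field_Fj \<subseteq> K.Mf\<close>] .
  have "algel (ratf K r) s" using K.spol unfolding algel_def by blast
  thus "algel (ratf K r) b" if "b : K.Mf" for b
   using K.R.fd_algel[OF K.R.fd_adj[OF K.R.fd_self]] that unfolding K.Mf_def by blast
 qed
 then obtain P1 P2 Q1 Q2 where "P1 : K.P1s" "P2 : K.P2s" "Q1 : K.Q1s" "Q2 : K.Q2s"
  using K.ex_P1 K.ex_P2 K.ex_Q by blast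
 hence "t3_cusps \<phi> C x \<theta> q P1 P2 Q1 Q2"
  by (intro t3_cusps.intro t3_cusps_axioms.intro t3_pair_axioms)
 thus ?thesis by blast
qed

theorem theorem7p1:
  fixes \<phi> :: "'q::{finite,field} poly \<Rightarrow> 'q ambient poly"
    and C :: "'q ambient set"
    and n :: "'q poly"
  assumes "n = [:0, 1:] ^ 3"
    and "generic_pair n \<phi> C"
  shows "cuspidal_group \<phi> C \<subseteq> J0_rational \<phi> C
    \<and> J0_torsion \<phi> C = cuspidal_group \<phi> C
    \<and> (J0_sep \<phi> C)\<lparr>carrier := cuspidal_group \<phi> C\<rparr> \<cong> integer_mod_group (CARD('q) ^ 2)"
proof -
 obtain x where "t3_pair \<phi> C x (of_A [:0, 1:]) (CARD('q))" using generic_pair_t3 assms by blast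
 then obtain P1 P2 Q1 Q2 where "t3_cusps \<phi> C x (of_A [:0, 1:]) (CARD('q)) P1 P2 Q1 Q2"
  using t3_pair.ex_cusps by blast
 then interpret t3_cusps \<phi> C x "of_A [:0, 1:]" "CARD('q)" P1 P2 Q1 Q2 .
 show ?thesis using J0_rational_eq torsion_iso by simp
qed

end
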